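(* Let $T>0$, $p\in(1,\infty)$ and $\omega_0\in L^{p}(\mathbb{T}^2)$. Let $\{\omega_0^\nu\}_{\nu}\subset L^{p}(\mathbb{T}^2)$ be a sequence of smooth functions (indexed by a sequence of viscosities $\nu\to0^+$) such that $$\omega_0^\nu\to \omega_0\quad\text{strongly in }L^{p}(\mathbb{T}^2),$$ and let $(u^\nu,\omega^\nu)$ be the solution on $(0,T)\times\mathbb{T}^2$ of the Navier-Stokes equations $$\partial_t \omega^\nu+u^\nu\cdot\nabla\omega^\nu-\nu\Delta\omega^\nu=0,\qquad u^\nu=\nabla^{\perp}(-\Delta)^{-1}\omega^\nu,$$ with initial datum $\omega^\nu|_{t=0}=\omega_0^{\nu}$. Assume that there exists a Lagrangian solution $(u,\omega)$ of the two-dimensional Euler equations with initial datum $\omega_0$ such that, up to a subsequence not relabelled, $$u^\nu\stackrel{*}{\rightharpoonup} u\quad\text{weakly* in }L^{\infty}((0,T);L^{2}(\mathbb{T}^2)).$$ Then (along this subsequence) $$\omega^\nu\to \omega\quad\text{strongly in }C([0,T];L^{p}(\mathbb{T}^2)).$$ Moreover, for any $\delta>0$ there exists $C=C(\delta,\omega_0)>0$ such that for $\nu$ small enough $$\sup_{t\in(0,T)}\|\omega^\nu(t)-\omega(t)\|_{L^{p}}\leq \delta+\frac{C(\delta,\omega_0)}{\left|\ln\left(\max\{\sqrt{\nu}, \|u^\nu-u\|_{L^{1}((0,T);L^1(\mathbb{T}^2))}\}\right)\right|}+\|\omega_0^\nu-\omega_0\|_{L^{p}}.$$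
   Context: $\mathbb{T}^2$ is the two-dimensional flat torus, identified with $[0,1)^2$ with periodic boundary conditions, equipped with Lebesgue (Haar) measure; $T>0$ is finite and fixed, and constants may depend on the fixed $p$ and $T$. Biot-Savart law on the torus: $(-\Delta)^{-1}f$ is the zero-average periodic solution $\psi$ of $-\Delta\psi=f-\int_{\mathbb{T}^2}f$, and the sign of $\nabla^\perp$ is such that $u=\nabla^\perp(-\Delta)^{-1}\omega$ is divergence-free with $\operatorname{curl}u=\partial_1u_2-\partial_2u_1=\omega$ for zero-average $\omega$, i.e. $\nabla^\perp=(\partial_2,-\partial_1)$. Regular Lagrangian flow: given a vector field $u$ on $(0,T)\times\mathbb{T}^2$, a map $X\in L^\infty((0,T)\times(0,T)\times\mathbb{T}^2)$, $(t,s,x)\mapsto X_{t,s}(x)\in\mathbb{T}^2$, is a regular Lagrangian flow of $u$ if for a.e. $x\in\mathbb{T}^2$ and for any $t\in[0,T]$ the map $s\in[0,T]\mapsto X_{t,s}(x)\in\mathbb{T}^2$ is an absolutely continuous solution of $\partial_sX_{t,s}(x)=u(s,X_{t,s}(x))$ for $s\in[0,T]$, $X_{t,t}(x)=x$, and for any $t,s\in[0,T]$ the map $x\in\mathbb{T}^2\mapsto X_{t,s}(x)\in\mathbb{T}^2$ is measure-preserving. Lagrangian solution of the 2D Euler equations: for $p\in(1,\infty)$ and $\omega_0\in L^p(\mathbb{T}^2)$, the pair $(u,\omega)$ is a Lagrangian solution of the 2D Euler equations ($\partial_t\omega+u\cdot\nabla\omega=0$, $u=\nabla^\perp(-\Delta)^{-1}\omega$,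 $\omega|_{t=0}=\omega_0$) if $(u,\omega)\in L^{\infty}((0,T);W^{1,p}(\mathbb{T}^2))\times L^{\infty}((0,T);L^{p}(\mathbb{T}^2))$, there exists a regular Lagrangian flow $X$ of $u$, and for a.e. $(t,x)\in(0,T)\times\mathbb{T}^2$ $$u(t,x)=(\nabla^{\perp}(-\Delta)^{-1}\omega(t,\cdot))(x),\qquad \omega(t,x)=\omega_0(X_{t,0}(x)).$$ For smooth initial data the 2D Navier-Stokes equations on $\mathbb{T}^2$ have a unique smooth solution; this is "the solution" $(u^\nu,\omega^\nu)$. *)

theory Defs
  imports "HOL-Analysis.Analysis"
begin

(* The flat torus is identified with the cell [0,1)^2 carrying Lebesgue measure.  Functions that
   are only defined almost everywhere (Lebesgue and Sobolev functions, Euler velocity and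
   vorticity) are represented by functions on real^2 whose values outside the cell are never used;
   smooth functions are 1-periodic functions on the whole plane.  Time-dependent functions are
   curried: f t x. *)

definition torus :: "(real^2) set" where
  "torus = {x. \<forall>i. 0 \<le> x $ i \<and> x $ i < 1}"

abbreviation torus_measure :: "(real^2) measure" where
  "torus_measure \<equiv> lebesgue_on torus"

abbreviation spacetime_measure :: "real \<Rightarrow> (real \<times> (real^2)) measure" where
  "spacetime_measure T \<equiv> lebesgue_on ({0<..<T} \<times> torus)"


section \<open>Smooth periodic functions\<close>

definition periodic :: "(real^2 \<Rightarrow> 'b) \<Rightarrow> bool" where
  "periodic f \<longleftrightarrow> (\<forall>x i. f (x + axis i 1) = f x)"

(* The sets S used below are real^2 and the closed slab {0..T} x real^2; in both cases the
   derivative within S is unique, at the boundary of the slab it is one-sided in time. *)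
primrec Ck_on :: "nat \<Rightarrow> 'a::euclidean_space set \<Rightarrow> ('a \<Rightarrow> 'b::real_normed_vector) \<Rightarrow> bool" where
  "Ck_on 0 S f \<longleftrightarrow> continuous_on S f"
| "Ck_on (Suc k) S f \<longleftrightarrow>
     (\<exists>f'. (\<forall>x\<in>S. (f has_derivative f' x) (at x within S)) \<and>
           (\<forall>b\<in>Basis. Ck_on k S (\<lambda>x. f' x b)))"

definition smooth_on :: "'a::euclidean_space set \<Rightarrow> ('a \<Rightarrow> 'b::real_normed_vector) \<Rightarrow> bool" where
  "smooth_on S f \<longleftrightarrow> (\<forall>k. Ck_on k S f)"

definition torus_smooth :: "(real^2 \<Rightarrow> 'b::real_normed_vector) \<Rightarrow> bool" where
  "torus_smooth f \<longleftrightarrow> periodic f \<and> smooth_on UNIV f"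

definition spacetime_smooth :: "real \<Rightarrow> (real \<Rightarrow> real^2 \<Rightarrow> 'b::real_normed_vector) \<Rightarrow> bool" where
  "spacetime_smooth T f \<longleftrightarrow>
     (\<forall>t\<in>{0..T}. periodic (f t)) \<and> smooth_on ({0..T} \<times> UNIV) (\<lambda>(t, x). f t x)"

definition partial :: "2 \<Rightarrow> (real^2 \<Rightarrow> real) \<Rightarrow> real^2 \<Rightarrow> real" where
  "partial i f x = deriv (\<lambda>h. f (x + h *\<^sub>R axis i 1)) 0"

definition grad :: "(real^2 \<Rightarrow> real) \<Rightarrow> real^2 \<Rightarrow> real^2" where
  "grad f x = (\<chi> i. partial i f x)"

definition laplacian :: "(real^2 \<Rightarrow> real) \<Rightarrow> real^2 \<Rightarrow> real" where
  "laplacian f x = (\<Sum>i\<in>UNIV. partial i (partial i f) x)"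


section \<open>Function spaces\<close>

definition Lp :: "real \<Rightarrow> (real^2 \<Rightarrow> 'b::euclidean_space) set" where
  "Lp p = {f \<in> borel_measurable torus_measure. integrable torus_measure (\<lambda>x. norm (f x) powr p)}"

definition Lp_norm :: "real \<Rightarrow> (real^2 \<Rightarrow> 'b::euclidean_space) \<Rightarrow> real" where
  "Lp_norm p f = (LINT x|torus_measure. norm (f x) powr p) powr (1 / p)"

definition jointly_measurable :: "real \<Rightarrow> (real \<Rightarrow> real^2 \<Rightarrow> 'b::euclidean_space) \<Rightarrow> bool" where
  "jointly_measurable T f \<longleftrightarrow> (\<lambda>(t, x). f t x) \<in> borel_measurable (spacetime_measure T)"

definition Linf_Lp :: "real \<Rightarrow> real \<Rightarrow> (real \<Rightarrow> real^2 \<Rightarrow> 'b::euclidean_space) set" where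
  "Linf_Lp T p =
     {f. jointly_measurable T f \<and>
         (\<exists>K. AE t in lebesgue_on {0<..<T}. f t \<in> Lp p \<and> Lp_norm p (f t) \<le> K)}"

definition L1_Lp :: "real \<Rightarrow> real \<Rightarrow> (real \<Rightarrow> real^2 \<Rightarrow> 'b::euclidean_space) set" where
  "L1_Lp T p =
     {f. jointly_measurable T f \<and>
         (AE t in lebesgue_on {0<..<T}. f t \<in> Lp p) \<and>
         integrable (lebesgue_on {0<..<T}) (\<lambda>t. Lp_norm p (f t))}"

definition L1_Lp_norm :: "real \<Rightarrow> real \<Rightarrow> (real \<Rightarrow> real^2 \<Rightarrow> 'b::euclidean_space) \<Rightarrow> real" where
  "L1_Lp_norm T p f = (LINT t|lebesgue_on {0<..<T}. Lp_norm p (f t))"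

definition C_Lp :: "real \<Rightarrow> real \<Rightarrow> (real \<Rightarrow> real^2 \<Rightarrow> 'b::euclidean_space) set" where
  "C_Lp T p =
     {f. (\<forall>t\<in>{0..T}. f t \<in> Lp p) \<and>
         (\<forall>t\<in>{0..T}. ((\<lambda>s. Lp_norm p (\<lambda>x. f s x - f t x)) \<longlongrightarrow> 0) (at t within {0..T}))}"

definition converges_C_Lp ::
    "real \<Rightarrow> real \<Rightarrow> (nat \<Rightarrow> real \<Rightarrow> real^2 \<Rightarrow> 'b::euclidean_space) \<Rightarrow>
     (real \<Rightarrow> real^2 \<Rightarrow> 'b) \<Rightarrow> bool" where
  "converges_C_Lp T p f g \<longleftrightarrow>
     (\<forall>k. f k \<in> C_Lp T p) \<and> g \<in> C_Lp T p \<and>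
     (\<lambda>k. SUP t\<in>{0..T}. Lp_norm p (\<lambda>x. f k t x - g t x)) \<longlonglongrightarrow> 0"

definition weak_partial ::
    "2 \<Rightarrow> (real^2 \<Rightarrow> 'b::euclidean_space) \<Rightarrow> (real^2 \<Rightarrow> 'b) \<Rightarrow> bool" where
  "weak_partial i f g \<longleftrightarrow>
     integrable torus_measure f \<and> integrable torus_measure g \<and>
     (\<forall>\<phi>. torus_smooth \<phi> \<longrightarrow>
        (LINT x|torus_measure. partial i \<phi> x *\<^sub>R f x) = - (LINT x|torus_measure. \<phi> x *\<^sub>R g x))"

definition Linf_W1p :: "real \<Rightarrow> real \<Rightarrow> (real \<Rightarrow> real^2 \<Rightarrow> 'b::euclidean_space) set" where
  "Linf_W1p T p =
     {f \<in> Linf_Lp T p.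
        \<forall>i. \<exists>g \<in> Linf_Lp T p. AE t in lebesgue_on {0<..<T}. weak_partial i (f t) (g t)}"

(* Weak* convergence in L^inf((0,T); L^2), the dual space of L^1((0,T); L^2). *)
definition weakstar_Linf_L2 ::
    "real \<Rightarrow> (nat \<Rightarrow> real \<Rightarrow> real^2 \<Rightarrow> 'b::euclidean_space) \<Rightarrow>
     (real \<Rightarrow> real^2 \<Rightarrow> 'b) \<Rightarrow> bool" where
  "weakstar_Linf_L2 T f g \<longleftrightarrow>
     (\<forall>k. f k \<in> Linf_Lp T 2) \<and> g \<in> Linf_Lp T 2 \<and>
     (\<forall>\<phi> \<in> L1_Lp T 2.
        (\<lambda>k. LINT (t, x)|spacetime_measure T. f k t x \<bullet> \<phi> t x)
        \<longlonglongrightarrow> (LINT (t, x)|spacetime_measure T. g t x \<bullet> \<phi> t x))"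


section \<open>Biot-Savart law\<close>

(* psi = (-Laplace)^{-1} f: the zero-average solution of -Laplace psi = f - mean(f), understood in
   the sense of periodic distributions, which determines psi up to null sets.  The torus has
   measure one, so the mean of f is its integral. *)
definition is_inv_neg_laplacian :: "(real^2 \<Rightarrow> real) \<Rightarrow> (real^2 \<Rightarrow> real) \<Rightarrow> bool" where
  "is_inv_neg_laplacian f \<psi> \<longleftrightarrow>
     integrable torus_measure f \<and> integrable torus_measure \<psi> \<and>
     (LINT x|torus_measure. \<psi> x) = 0 \<and>
     (\<forall>\<phi>. torus_smooth \<phi> \<longrightarrow>
        (LINT x|torus_measure. \<psi> x * (- laplacian \<phi> x)) =
        (LINT x|torus_measure. (f x - (LINT y|torus_measure. f y)) * \<phi> x))"

definition is_perp_grad :: "(real^2 \<Rightarrow> real) \<Rightarrow> (real^2 \<Rightarrow> real^2) \<Rightarrow> bool" where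
  "is_perp_grad \<psi> v \<longleftrightarrow>
     weak_partial 2 \<psi> (\<lambda>x. v x $ 1) \<and> weak_partial 1 \<psi> (\<lambda>x. - (v x $ 2))"

definition biot_savart :: "(real^2 \<Rightarrow> real) \<Rightarrow> (real^2 \<Rightarrow> real^2) \<Rightarrow> bool" where
  "biot_savart \<omega> v \<longleftrightarrow> (\<exists>\<psi>. is_inv_neg_laplacian \<omega> \<psi> \<and> is_perp_grad \<psi> v)"


section \<open>Regular Lagrangian flows and Lagrangian Euler solutions\<close>

definition abs_continuous_on :: "real \<Rightarrow> real \<Rightarrow> (real \<Rightarrow> 'b::real_normed_vector) \<Rightarrow> bool" where
  "abs_continuous_on a b f \<longleftrightarrow>
     (\<forall>\<epsilon>>0. \<exists>\<delta>>0. \<forall>D S. D division_of S \<and> S \<subseteq> {a..b} \<and> (\<Sum>k\<in>D. Sup k - Inf k) < \<delta> \<longrightarrow>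
        (\<Sum>k\<in>D. norm (f (Sup k) - f (Inf k))) < \<epsilon>)"

(* The curve c takes values in the cell, hence jumps whenever the torus-valued curve it represents
   crosses the boundary of the cell; absolute continuity and the differential equation are
   therefore expressed through a lift of the curve to the plane.  As usual for absolutely
   continuous solutions, the equation holds for almost every s. *)
definition torus_ode_solution ::
    "real \<Rightarrow> (real \<Rightarrow> real^2 \<Rightarrow> real^2) \<Rightarrow> (real \<Rightarrow> real^2) \<Rightarrow> bool" where
  "torus_ode_solution T u c \<longleftrightarrow>
     (\<exists>\<gamma>. abs_continuous_on 0 T \<gamma> \<and>
        (\<forall>s\<in>{0..T}. \<forall>i. (\<gamma> s - c s) $ i \<in> \<int>) \<and>
        (AE s in lebesgue_on {0..T}. (\<gamma> has_vector_derivative u s (c s)) (at s within {0..T})))"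

definition measure_preserving_torus :: "(real^2 \<Rightarrow> real^2) \<Rightarrow> bool" where
  "measure_preserving_torus f \<longleftrightarrow>
     f \<in> measurable torus_measure torus_measure \<and>
     distr torus_measure torus_measure f = torus_measure"

(* X t s x stands for X_{t,s}(x).  Essential boundedness of X is automatic, since each X t s maps
   the cell to itself, as part of being measurable from torus_measure to torus_measure. *)
definition regular_lagrangian_flow ::
    "real \<Rightarrow> (real \<Rightarrow> real^2 \<Rightarrow> real^2) \<Rightarrow> (real \<Rightarrow> real \<Rightarrow> real^2 \<Rightarrow> real^2) \<Rightarrow> bool" where
  "regular_lagrangian_flow T u X \<longleftrightarrow>
     (\<lambda>(t, s, x). X t s x)
        \<in> borel_measurable (lebesgue_on ({0<..<T} \<times> {0<..<T} \<times> torus)) \<and>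
     (AE x in torus_measure. \<forall>t\<in>{0..T}.
        torus_ode_solution T u (\<lambda>s. X t s x) \<and> X t t x = x) \<and>
     (\<forall>t\<in>{0..T}. \<forall>s\<in>{0..T}. measure_preserving_torus (X t s))"

definition lagrangian_euler_solution ::
    "real \<Rightarrow> real \<Rightarrow> (real^2 \<Rightarrow> real) \<Rightarrow> (real \<Rightarrow> real^2 \<Rightarrow> real^2) \<Rightarrow>
     (real \<Rightarrow> real^2 \<Rightarrow> real) \<Rightarrow> bool" where
  "lagrangian_euler_solution T p \<omega>0 u \<omega> \<longleftrightarrow>
     u \<in> Linf_W1p T p \<and> \<omega> \<in> Linf_Lp T p \<and>
     (AE t in lebesgue_on {0<..<T}. biot_savart (\<omega> t) (u t)) \<and>
     (\<exists>X. regular_lagrangian_flow T u X \<and>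
          (AE (t, x) in spacetime_measure T. \<omega> t x = \<omega>0 (X t 0 x)))"


section \<open>Smooth Navier-Stokes solutions\<close>

(* Since u is required to be smooth, the Biot-Savart law, which fixes u t only up to null sets,
   determines it at every point. *)
definition navier_stokes_solution ::
    "real \<Rightarrow> real \<Rightarrow> (real^2 \<Rightarrow> real) \<Rightarrow> (real \<Rightarrow> real^2 \<Rightarrow> real^2) \<Rightarrow>
     (real \<Rightarrow> real^2 \<Rightarrow> real) \<Rightarrow> bool" where
  "navier_stokes_solution T \<nu> \<omega>0 u \<omega> \<longleftrightarrow>
     spacetime_smooth T u \<and> spacetime_smooth T \<omega> \<and>
     (\<forall>t\<in>{0<..<T}. \<forall>x.
        deriv (\<lambda>s. \<omega> s x) t + u t x \<bullet> grad (\<omega> t) x - \<nu> * laplacian (\<omega> t) x = 0) \<and>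
     (\<forall>t\<in>{0..T}. biot_savart (\<omega> t) (u t)) \<and>
     (\<forall>x. \<omega> 0 x = \<omega>0 x)"

end

theory Submission
  imports Defs
begin

text \<open>
The whole difficulty is the strong convergence of the vorticities in \<open>C([0,T]; L\<^sup>p)\<close>. The estimate with the
logarithm is then a formal consequence: the data are a fixed sequence, its error is eventually below \<open>\<delta>\<close>
uniformly in time, and only finitely many viscosities, all positive, belong to the exceptional indices; so
\<open>C = 1\<close> serves, the last two terms on the right being nonnegative.

Write \<open>w\<^sup>k\<close> for the Navier-Stokes vorticities, \<open>u\<^sup>k\<close> for their velocities, \<open>w\<close>, \<open>u\<close> for the Lagrangian
solution and \<open>w\<^sub>0\<close> for its initial datum. Two facts pull in the same direction. A convex function of \<open>w\<^sup>k\<close> has an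
integral that decreases in time, and the flow of \<open>u\<close> preserves Lebesgue measure, so at almost every time
\<open>w\<close> has the distribution of \<open>w\<^sub>0\<close>. The limit thus loses nothing of what the approximations could have lost.

\<^item> \<^emph>\<open>Convergence on space-time\<close> (\<open>vorticity_L1\<close>). Weak convergence of \<open>u\<^sup>k\<close> passes to the curl. For
\<open>B(z) = sqrt (1 + z\<^sup>2)\<close> the Bregman divergence of \<open>B\<close> between \<open>w\<^sup>k\<close> and \<open>w\<close> has an integral of which the
weak convergence removes the linear part; the rest is \<open>\<integral>B(w\<^sup>k) - \<integral>B(w)\<close>, at most \<open>\<integral>B(w\<^sup>k(0)) - \<integral>B(w\<^sub>0)\<close>
up to a factor \<open>T\<close>, and this tends to zero. Divergence zero and \<open>L\<^sup>p\<close> bounds give \<open>w\<^sup>k \<longlongrightarrow> w\<close> in \<open>L\<^sup>1((0,T) \<times> torus)\<close>.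

\<^item> \<^emph>\<open>No oscillation of \<open>w\<close> in time\<close> (\<open>uniform_smoothing\<close>). Let \<open>S\<^sub>n\<close> be convolution with a positive
trigonometric kernel and \<open>\<theta>\<close> a bounded smooth truncation of the vorticity. The energy \<open>\<integral>\<theta>(w) S\<^sub>n \<theta>(w)\<close> is a finite sum
of squares of Fourier-type coefficients. Its derivative is, up to dissipation that vanishes in the limit, the commutator
\<open>2 \<integral>\<theta>(w) u \<bullet> grad (S\<^sub>n \<theta>(w))\<close>, bounded independently of \<open>n\<close> because \<open>grad u\<close> is integrable (\<open>commutator\<close>). So the
energies are Lipschitz from below in time uniformly in \<open>n\<close> (\<open>good_energy\<close>). At a single time they tend to \<open>\<integral>\<theta>(w\<^sub>0)\<^sup>2\<close>
as \<open>n\<close> grows, hence they do so uniformly over a finite net of times and then over all times: \<open>S\<^sub>n w(s)\<close> approximates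
\<open>w(s)\<close> in \<open>L\<^sup>1\<close> uniformly in \<open>s\<close>.

\<^item> \<^emph>\<open>Uniform convergence in \<open>L\<^sup>1\<close>\<close> (\<open>uniformly_Cauchy\<close>). The distance in \<open>L\<^sup>1\<close> from \<open>w\<^sup>k(t)\<close> to a fixed smooth
function \<open>\<phi>\<close> grows at most at the rate \<open>\<integral>\<bar>u\<^sup>k\<bar> sup \<bar>grad \<phi>\<bar>\<close> (\<open>L1_stability\<close>). Taking \<open>\<phi> = S\<^sub>n w(s)\<close> at a time \<open>s\<close> slightly
before \<open>t\<close> at which \<open>w\<^sup>k(s)\<close> is close to \<open>w(s)\<close> compares all late \<open>w\<^sup>k(t)\<close> with one function.

\<^item> \<^emph>\<open>From \<open>L\<^sup>1\<close> to \<open>L\<^sup>p\<close>\<close> (\<open>uniform_Lp\<close>). The limit is equidistributed with \<open>w\<^sub>0\<close> at every time, while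
\<open>\<integral>\<bar>w\<^sup>k(t)\<bar>\<^sup>p\<close> is at most \<open>\<integral>\<bar>w\<^sup>k(0)\<bar>\<^sup>p\<close>, which converges to \<open>\<integral>\<bar>w\<^sub>0\<bar>\<^sup>p\<close>. So no mass of the \<open>p\<close>-th power escapes to large values.
\<close>

text \<open>The integrals below are mostly Bochner integrals; the hidden names belong to the gauge integral.\<close>
hide_fact (open) Henstock_Kurzweil_Integration.integral_cong Henstock_Kurzweil_Integration.integrable_bound
  Henstock_Kurzweil_Integration.integral_add Henstock_Kurzweil_Integration.integral_sum
  Henstock_Kurzweil_Integration.integral_diff Henstock_Kurzweil_Integration.integral_nonneg
  Henstock_Kurzweil_Integration.integrable_diff Henstock_Kurzweil_Integration.integrable_add
  Henstock_Kurzweil_Integration.integrable_cong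

type_synonym spacetime = "real \<times> (real^2)"

abbreviation (input) "TM \<equiv> torus_measure"

text \<open>The torus has measure one, so its integrals are averages.\<close>
abbreviation (input) avg :: "(real^2 \<Rightarrow> 'b::{banach, second_countable_topology}) \<Rightarrow> 'b" (binder "AV " 60)
  where "avg f \<equiv> integral\<^sup>L torus_measure f"

abbreviation (input) L1 :: "(real^2 \<Rightarrow> 'b::{banach, second_countable_topology}) \<Rightarrow> bool"
  where "L1 f \<equiv> integrable torus_measure f"

abbreviation (input) "Borel \<equiv> borel_measurable borel"
abbreviation (input) "TBorel \<equiv> borel_measurable torus_measure"
abbreviation (input) "time_on T \<equiv> lebesgue_on {0<..<T::real}"
abbreviation (input) "cont \<equiv> continuous_on UNIV"

abbreviation (input) LIMSEQ_ascii :: "(nat \<Rightarrow> 'a::topological_space) \<Rightarrow> 'a \<Rightarrow> bool" ("((_)/ ----> (_))" [60, 60] 60)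
  where "X ----> L \<equiv> X \<longlonglongrightarrow> L"

lemmas cont_Borel = borel_measurable_continuous_onI
lemmas integrable_measurable = borel_measurable_integrable
lemmas real_iff_vector_derivative = has_real_derivative_iff_has_vector_derivative

section \<open>Calculus of smooth periodic functions\<close>

lemma Ck_on_cong:
 assumes "!!x. x \<in> S ==> f x = g x"
 shows "Ck_on k S f \<longleftrightarrow> Ck_on k S g"
proof (cases k)
 case 0
 then show ?thesis using assms by (simp cong: continuous_on_cong)
next
 case (Suc m)
 have "!!f'. (\<forall>x\<in>S. (f has_derivative f' x) (at x within S)) = (\<forall>x\<in>S. (g has_derivative f' x) (at x within S))"
  using assms by (metis (no_types, lifting) has_derivative_transform)
 then show ?thesis using Suc by simp
qed

lemma Ck_on_Suc_D: "Ck_on (Suc k) S f ==> Ck_on k S f"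
proof (induction k arbitrary: f)
 case 0
 then show ?case by (metis Ck_on.simps has_derivative_continuous_on)
next
 case (Suc k)
 then obtain f' where "\<forall>x\<in>S. (f has_derivative f' x) (at x within S)" "\<forall>b\<in>Basis. Ck_on (Suc k) S (%x. f' x b)"
  by (metis Ck_on.simps(2))
 then show ?case using Suc.IH by (metis Ck_on.simps(2))
qed

lemma Ck_on_continuous: "Ck_on k S f ==> continuous_on S f"
proof (induction k)
 case (Suc k)
 then show ?case using Ck_on_Suc_D by blast
qed simp

lemma Ck_on_const [simp]: "Ck_on k S (%x. c)"
proof (induction k arbitrary: c)
 case (Suc k)
 show ?case unfolding Ck_on.simps by (rule exI[of _ "%x h. 0"]) (use Suc in auto)
qed simp

lemma Ck_on_add:
 assumes "Ck_on k S f" "Ck_on k S g" shows "Ck_on k S (%x. f x + g x)"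
 using assms
proof (induction k arbitrary: f g)
 case 0 then show ?case by (auto intro: continuous_intros)
next
 case (Suc k)
 obtain f' where f': "\<forall>x\<in>S. (f has_derivative f' x) (at x within S)" "\<forall>b\<in>Basis. Ck_on k S (%x. f' x b)"
  using Suc.prems by auto
 obtain g' where g': "\<forall>x\<in>S. (g has_derivative g' x) (at x within S)" "\<forall>b\<in>Basis. Ck_on k S (%x. g' x b)"
  using Suc.prems by auto
 show ?case unfolding Ck_on.simps
  by (rule exI[of _ "%x h. f' x h + g' x h"]) (use f' g' Suc.IH in "auto intro!: derivative_intros")
qed

lemma Ck_on_mult:
 fixes f g :: "_ => real"
 assumes "Ck_on k S f" "Ck_on k S g" shows "Ck_on k S (%x. f x * g x)"
 using assms
proof (induction k arbitrary: f g)
 case 0 then show ?case by (auto intro: continuous_intros)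
next
 case (Suc k)
 obtain f' where f': "\<forall>x\<in>S. (f has_derivative f' x) (at x within S)" "\<forall>b\<in>Basis. Ck_on k S (%x. f' x b)"
  using Suc.prems by auto
 obtain g' where g': "\<forall>x\<in>S. (g has_derivative g' x) (at x within S)" "\<forall>b\<in>Basis. Ck_on k S (%x. g' x b)"
  using Suc.prems by auto
 show ?case unfolding Ck_on.simps
  by (rule exI[of _ "%x h. f x * g' x h + f' x h * g x"])
    (use f' g' Suc.IH Ck_on_Suc_D[OF Suc.prems(1)] Ck_on_Suc_D[OF Suc.prems(2)]
     in "auto intro!: derivative_intros Ck_on_add")
qed

lemma Ck_on_diff:
 fixes f g :: "_ => real"
 assumes "Ck_on k S f" "Ck_on k S g" shows "Ck_on k S (%x. f x - g x)"
 using Ck_on_add[OF assms(1) Ck_on_mult[OF Ck_on_const[of _ _ "-1"] assms(2)]] by simp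

lemma Ck_on_sum:
 fixes f :: "'i => _ => real"
 assumes "!!i. i \<in> I ==> Ck_on k S (f i)" shows "Ck_on k S (%x. \<Sum>i\<in>I. f i x)"
 using assms by (induction I rule: infinite_finite_induct) (auto intro: Ck_on_add)

lemma Ck_on_linear:
 assumes "bounded_linear f" shows "Ck_on k S f"
proof (cases k)
 case 0 then show ?thesis using assms by (simp add: linear_continuous_on)
next
 case (Suc m)
 show ?thesis unfolding Suc Ck_on.simps
  by (rule exI[of _ "%x. f"]) (auto intro: bounded_linear_imp_has_derivative assms)
qed

lemma Ck_on_sin_cos:
 fixes f :: "'a::euclidean_space => real"
 assumes "Ck_on k S f" shows "Ck_on k S (%x. sin (f x)) & Ck_on k S (%x. cos (f x))"
 using assms
proof (induction k arbitrary: f)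
 case 0 then show ?case by (auto intro: continuous_intros)
next
 case (Suc k)
 obtain f' where f': "\<forall>x\<in>S. (f has_derivative f' x) (at x within S)" "\<forall>b\<in>Basis. Ck_on k S (%x. f' x b)"
  using Suc.prems by auto
 note IH = Suc.IH[OF Ck_on_Suc_D[OF Suc.prems]]
 have 1: "Ck_on (Suc k) S (%x. sin (f x))" unfolding Ck_on.simps
  by (rule exI[of _ "%x h. f' x h * cos (f x)"])
    (use f' IH in "auto intro!: derivative_eq_intros Ck_on_mult")
 have 2: "Ck_on (Suc k) S (%x. cos (f x))" unfolding Ck_on.simps
 proof (rule exI[of _ "%x h. f' x h * ((-1) * sin (f x))"], intro conjI ballI)
  fix x assume "x \<in> S"
  then show "((%x. cos (f x)) has_derivative (%h. f' x h * ((-1) * sin (f x)))) (at x within S)"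
   using f'(1) by (auto intro!: derivative_eq_intros)
 next
  fix b assume "b \<in> (Basis :: 'a set)"
  then show "Ck_on k S (%x. f' x b * ((-1) * sin (f x)))"
   using f'(2) IH by (intro Ck_on_mult Ck_on_const) auto
 qed
 show ?case using 1 2 by blast
qed

text \<open>Stated for all exponents at once because differentiation lowers the exponent by one.\<close>
lemma Ck_on_powr:
 fixes f :: "'a::euclidean_space => real"
 assumes "Ck_on k S f" "c > 0" shows "Ck_on k S (%x. (c + (f x)^2) powr q)"
 using assms
proof (induction k arbitrary: f q)
 case 0
 have "c + (f x)^2 ~= 0" for x using \<open>c > 0\<close> by (smt (verit) zero_le_power2)
 then show ?case using 0 by (auto intro!: continuous_intros)
next
 case (Suc k)
 have pos: "c + (f x)^2 > 0" for x using \<open>c > 0\<close> by (smt (verit) zero_le_power2)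
 obtain f' where f': "\<forall>x\<in>S. (f has_derivative f' x) (at x within S)" "\<forall>b\<in>Basis. Ck_on k S (%x. f' x b)"
  using Suc.prems by auto
 note fk = Ck_on_Suc_D[OF Suc.prems(1)]
 show ?case unfolding Ck_on.simps
 proof (rule exI[of _ "%x h. (c + (f x)^2) powr (q-1) * (f x * ((2*q) * f' x h))"], intro conjI ballI)
  fix x assume "x \<in> S"
  have D: "((%z. (c + z^2) powr q) has_real_derivative (c+z^2) powr (q-1) * (z * (2*q))) (at z)" for z
  proof -
   have "c + z^2 > 0" using \<open>c > 0\<close> by (smt (verit) zero_le_power2)
   then show ?thesis
    by (auto intro!: derivative_eq_intros simp: powr_diff field_simps)
  qed
  have "((%x. (c + (f x)^2) powr q) has_derivative (%h. ((c+(f x)^2) powr (q-1) * (f x * (2*q))) * f' x h)) (at x within S)"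
   by (rule has_derivative_compose[OF f'(1)[rule_format, OF \<open>x\<in>S\<close>], of "%z. (c + z^2) powr q"])
     (use D in "simp add: has_field_derivative_def")
  then show "((%x. (c + (f x)^2) powr q) has_derivative (%h. (c + (f x)^2) powr (q-1) * (f x * ((2*q) * f' x h)))) (at x within S)"
   by (simp add: mult_ac)
 next
  fix b :: 'a assume "b \<in> Basis"
  show "Ck_on k S (%x. (c + (f x)^2) powr (q - 1) * (f x * (2 * q * f' x b)))"
   using f'(2) \<open>b \<in> Basis\<close> by (intro Ck_on_mult Suc.IH fk \<open>c>0\<close> Ck_on_const) auto
 qed
qed

lemma Ck_on_translate:
 assumes "Ck_on k UNIV f" shows "Ck_on k UNIV (%x. f (x + a))"
 using assms
proof (induction k arbitrary: f)
 case 0 then show ?case by (auto intro!: continuous_intros elim!: continuous_on_compose2)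
next
 case (Suc k)
 obtain f' where f': "!!x. (f has_derivative f' x) (at x)" "\<forall>b\<in>Basis. Ck_on k UNIV (%x. f' x b)"
  using Suc.prems by auto
 have "((%x. f (x + a)) has_derivative f' (x + a)) (at x)" for x
 proof -
  have "((%x. x + a) has_derivative (%h. h)) (at x)" by (auto intro!: derivative_eq_intros)
  from has_derivative_compose[OF this f'(1)] show ?thesis by simp
 qed
 then show ?case unfolding Ck_on.simps using f'(2) Suc.IH
  by (intro exI[of _ "%x. f' (x+a)"]) auto
qed

subsection \<open>torus smooth\<close>

lemma torus_smooth_const [simp]: "torus_smooth (%x. c)"
 by (simp add: torus_smooth_def periodic_def smooth_on_def)

lemma torus_smooth_add: "torus_smooth f ==> torus_smooth g ==> torus_smooth (%x. f x + g x)"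
 by (simp add: torus_smooth_def periodic_def smooth_on_def Ck_on_add)
lemma torus_smooth_mult: "torus_smooth f ==> torus_smooth g ==> torus_smooth (%x. f x * g x :: real)"
 by (simp add: torus_smooth_def periodic_def smooth_on_def Ck_on_mult)
lemma torus_smooth_diff: "torus_smooth f ==> torus_smooth g ==> torus_smooth (%x. f x - g x :: real)"
 by (simp add: torus_smooth_def periodic_def smooth_on_def Ck_on_diff)
lemma torus_smooth_sum: "(!!i. i \<in> I ==> torus_smooth (f i)) ==> torus_smooth (%x. \<Sum>i\<in>I. f i x :: real)"
 by (simp add: torus_smooth_def periodic_def smooth_on_def Ck_on_sum)
lemma torus_smooth_powr: "torus_smooth (f :: real^2 => real) ==> c > 0 ==> torus_smooth (%x. (c + (f x)^2) powr q)"
 unfolding torus_smooth_def periodic_def smooth_on_def by (auto intro: Ck_on_powr)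
lemma torus_smooth_translate: "torus_smooth f ==> torus_smooth (%x. f (x + a))"
proof -
 assume f: "torus_smooth f"
 have "x + axis j 1 + a = (x + a) + axis j 1" for x and j by (simp add: add_ac)
 then have "periodic (%x. f (x + a))"
  using f unfolding torus_smooth_def periodic_def by metis
 then show ?thesis using f by (auto simp: torus_smooth_def smooth_on_def Ck_on_translate)
qed
lemma smooth_cont: "torus_smooth f ==> continuous_on S f"
 by (metis Ck_on_continuous continuous_on_subset smooth_on_def subset_UNIV torus_smooth_def)

text \<open>The only trigonometric function needed: \<open>cos\<close> and \<open>sin\<close> of \<open>2 \<pi> x\<^sub>i\<close> generate the kernel below.\<close>
lemma torus_smooth_trig:
 "torus_smooth (%x. sin (2 * pi * (x $ i)))" "torus_smooth (%x. cos (2 * pi * (x $ i)))"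
proof -
 have C: "Ck_on k UNIV (%x::real^2. 2 * pi * (x $ i))" for k
  by (intro Ck_on_mult Ck_on_const Ck_on_linear bounded_linear_vec_nth)
 have P: "sin (2 * pi * ((x + axis j 1) $ i)) = sin (2 * pi * (x $ i))"
    "cos (2 * pi * ((x + axis j 1) $ i)) = cos (2 * pi * (x $ i))" for x :: "real^2" and j
  by (auto simp: axis_def distrib_left sin_add cos_add)
 show "torus_smooth (%x. sin (2 * pi * (x $ i)))" "torus_smooth (%x. cos (2 * pi * (x $ i)))"
  using Ck_on_sin_cos[OF C] P unfolding torus_smooth_def periodic_def smooth_on_def by blast+
qed

lemma axis_in_Basis2: "axis i (1::real) \<in> (Basis :: (real^2) set)"
 by (simp add: axis_in_Basis_iff)

lemma has_derivative_partial:
 fixes f :: "real^2 => real"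
 assumes "(f has_derivative f') (at x)"
 shows "partial i f x = f' (axis i 1)" "((%h. f (x + h *\<^sub>R axis i 1)) has_real_derivative partial i f x) (at 0)"
proof -
 have "((%h. x + h *\<^sub>R axis i 1) has_derivative (%h. h *\<^sub>R axis i 1)) (at (0::real))"
  by (auto intro!: derivative_eq_intros)
 from has_derivative_compose[OF this, of f f'] assms
 have "((%h. f (x + h *\<^sub>R axis i 1)) has_derivative (%h. f' (h *\<^sub>R axis i 1))) (at 0)" by simp
 moreover have "f' (h *\<^sub>R axis i 1) = f' (axis i 1) * h" for h
  using linear_cmul[OF has_derivative_linear[OF assms], of h "axis i 1"] by simp
 ultimately have *: "((%h. f (x + h *\<^sub>R axis i 1)) has_real_derivative f' (axis i 1)) (at 0)"
  by (simp add: has_field_derivative_def cong: if_cong)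
 then show "partial i f x = f' (axis i 1)" unfolding partial_def by (rule DERIV_imp_deriv)
 with * show "((%h. f (x + h *\<^sub>R axis i 1)) has_real_derivative partial i f x) (at 0)" by simp
qed

lemma torus_smooth_has_derivative:
 fixes f :: "real^2 => real"
 assumes "torus_smooth f"
 shows "(f has_derivative (%h. \<Sum>i\<in>UNIV. h $ i * partial i f x)) (at x)"
proof -
 have "Ck_on (Suc 0) UNIV f" using assms unfolding torus_smooth_def smooth_on_def by blast
 then obtain f' where f': "(f has_derivative f' x) (at x)" for x by auto
 have "f' x = (%h. \<Sum>i\<in>UNIV. h $ i * partial i f x)"
 proof
  fix h :: "real^2"
  have lin: "linear (f' x)" using f' has_derivative_linear by blast
  have "f' x h = f' x (\<Sum>i\<in>UNIV. h $ i *\<^sub>R axis i 1)"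
   using basis_expansion[of h] by (simp add: scalar_mult_eq_scaleR)
  also have "... = (\<Sum>i\<in>UNIV. h $ i * f' x (axis i 1))"
   by (simp add: linear_sum[OF lin] linear_cmul[OF lin])
  finally show "f' x h = (\<Sum>i\<in>UNIV. h $ i * partial i f x)"
   using has_derivative_partial(1)[OF f'] by simp
 qed
 then show ?thesis using f'[of x] by simp
qed

lemma smooth_partial:
 fixes f :: "real^2 => real"
 assumes "torus_smooth f" shows "torus_smooth (partial i f)"
proof -
 have "Ck_on k UNIV (partial i f)" for k
 proof -
  have "Ck_on (Suc k) UNIV f" using assms unfolding torus_smooth_def smooth_on_def by blast
  then obtain f' where f': "!!x. (f has_derivative f' x) (at x)" "\<forall>b\<in>Basis. Ck_on k UNIV (%x. f' x b)" by auto
  have "partial i f = (%x. f' x (axis i 1))" using has_derivative_partial(1)[OF f'(1)] by blast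
  then show ?thesis using f'(2) axis_in_Basis2 by auto
 qed
 moreover have "periodic (partial i f)"
  unfolding periodic_def partial_def
 proof (intro allI)
  fix x :: "real^2" and j
  have "x + axis j 1 + h *\<^sub>R axis i 1 = (x + h *\<^sub>R axis i 1) + axis j 1" for h by (simp add: add_ac)
  then have "f (x + axis j 1 + h *\<^sub>R axis i 1) = f (x + h *\<^sub>R axis i 1)" for h
   using assms unfolding torus_smooth_def periodic_def by metis
  then show "deriv (%h. f (x + axis j 1 + h *\<^sub>R axis i 1)) 0 = deriv (%h. f (x + h *\<^sub>R axis i 1)) 0"
   by simp
 qed
 ultimately show ?thesis by (simp add: torus_smooth_def smooth_on_def)
qed

lemma torus_smooth_DERIV:
 fixes f :: "real^2 => real"
 assumes "torus_smooth f"
 shows "((%h. f (x + h *\<^sub>R axis i 1)) has_real_derivative partial i f (x + a *\<^sub>R axis i 1)) (at a)"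
proof -
 have "((%h. f ((x + a *\<^sub>R axis i 1) + h *\<^sub>R axis i 1)) has_real_derivative partial i f (x + a *\<^sub>R axis i 1)) (at 0)"
  by (rule has_derivative_partial(2)[OF torus_smooth_has_derivative[OF assms]])
 then show ?thesis
  using DERIV_shift[of "%h. f (x + h *\<^sub>R axis i 1)" "partial i f (x + a *\<^sub>R axis i 1)" 0 a]
  by (simp add: scaleR_add_left add_ac)
qed

lemma torus_smooth_DERIV0:
 fixes f :: "real^2 => real"
 assumes "torus_smooth f"
 shows "((%h. f (x + h *\<^sub>R axis i 1)) has_real_derivative partial i f x) (at 0)"
 using torus_smooth_DERIV[OF assms, where a=0] by simp

lemma partialI: "((%h. f (x + h *\<^sub>R axis i 1)) has_real_derivative d) (at 0) ==> partial i f x = d"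
 unfolding partial_def by (rule DERIV_imp_deriv)

lemma partial_const [simp]: "partial i (%x. c) x = 0"
 by (rule partialI) auto

lemma partial_diff:
 assumes "torus_smooth f" "torus_smooth g"
 shows "partial i (%x. f x - g x) x = partial i f x - partial i g x"
 by (rule partialI) (auto intro!: derivative_eq_intros torus_smooth_DERIV0 assms)
lemma partial_mult:
 assumes "torus_smooth f" "torus_smooth g"
 shows "partial i (%x. f x * g x) x = f x * partial i g x + partial i f x * g x"
 by (rule partialI) (auto intro!: derivative_eq_intros torus_smooth_DERIV0 assms)
lemma partial_sum:
 assumes "!!j. j \<in> J ==> torus_smooth (f j)"
 shows "partial i (%x. \<Sum>j\<in>J. f j x) x = (\<Sum>j\<in>J. partial i (f j) x)"
 by (rule partialI) (auto intro!: derivative_eq_intros torus_smooth_DERIV0 assms)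
lemma partial_cmult:
 assumes "torus_smooth f"
 shows "partial i (%x. c * f x) x = c * partial i f x"
 by (rule partialI) (auto intro!: derivative_eq_intros torus_smooth_DERIV0 assms)

lemma partial_compose:
 assumes "torus_smooth f" "(B has_real_derivative B') (at (f x))"
 shows "partial i (%x. B (f x)) x = B' * partial i f x"
proof (rule partialI)
 show "((%h. B (f (x + h *\<^sub>R axis i 1))) has_real_derivative B' * partial i f x) (at 0)"
  using DERIV_chain2[OF _ torus_smooth_DERIV0[OF assms(1), of x i], of B B'] assms(2) by simp
qed

lemma partial_translate: "partial i (%x. f (x + a)) x = partial i f (x + a)"
 by (simp add: partial_def add_ac)

lemma periodic_wrap:
 assumes "periodic f" shows "\<exists>z\<in>cbox 0 (1::real^2). f z = f x"
proof -
 have st: "f (x + of_int n *\<^sub>R axis i 1) = f x" for x i and n::int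
 proof -
  have nat: "f (x + of_nat n *\<^sub>R axis i 1) = f x" for x and n::nat
  proof (induction n)
   case (Suc n)
   have "x + of_nat (Suc n) *\<^sub>R axis i 1 = (x + of_nat n *\<^sub>R axis i 1) + axis i 1" by (simp add: algebra_simps)
   then show ?case using assms Suc unfolding periodic_def by metis
  qed simp
  show ?thesis
  proof (cases "n >= 0")
   case True then show ?thesis using nat[of x "nat n"] by simp
  next
   case False
   then show ?thesis using nat[of "x + of_int n *\<^sub>R axis i 1" "nat (-n)"] by simp
  qed
 qed
 define z where "z = x + of_int (- \<lfloor>x $ 1\<rfloor>) *\<^sub>R axis 1 1 + of_int (- \<lfloor>x $ 2\<rfloor>) *\<^sub>R axis 2 1"
 have "f z = f x" unfolding z_def by (simp only: st)
 moreover have "z $ 1 = frac (x $ 1)" "z $ 2 = frac (x $ 2)" by (simp_all add: z_def axis_def frac_def)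
 then have "z \<in> cbox 0 1"
  by (auto simp: mem_box_cart forall_2 less_imp_le[OF frac_lt_1])
 ultimately show ?thesis by blast
qed

lemma torus_smooth_bounded:
 assumes "torus_smooth f" shows "\<exists>C>0. \<forall>x. norm (f x) <= C"
proof -
 have "compact (f ` cbox 0 1)"
  by (intro compact_continuous_image smooth_cont assms compact_cbox)
 then obtain C where "C > 0" "\<forall>y\<in>f ` cbox 0 1. norm y <= C" using compact_imp_bounded bounded_pos by blast
 then show ?thesis using periodic_wrap[of f] assms unfolding torus_smooth_def by (metis image_eqI)
qed

section \<open>Integration over the torus\<close>

lemma torus_borel [measurable, simp]: "torus \<in> sets borel"
proof -
 have "torus = {x. \<forall>i\<in>UNIV. 0 <= x $ i} \<inter> {x. \<forall>i\<in>UNIV. x $ i < 1}" by (auto simp: torus_def)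
 also have "... = (\<Inter>i\<in>UNIV. {x. 0 <= x $ i}) \<inter> (\<Inter>i\<in>UNIV. {x. x $ i < 1})" by auto
 also have "... \<in> sets borel"
 proof (rule sets.Int)
  show "(\<Inter>i\<in>UNIV. {x::real^2. 0 <= x $ i}) \<in> sets borel"
   by (intro borel_closed closed_INT ballI closed_Collect_le continuous_intros)
  show "(\<Inter>i\<in>UNIV. {x::real^2. x $ i < 1}) \<in> sets borel"
   by (intro borel_open open_INT ballI open_Collect_less continuous_intros) simp
 qed
 finally show ?thesis .
qed

lemma torus_lebesgue [measurable, simp]: "torus \<in> sets lebesgue"
 using torus_borel by (simp add: sets_completionI_sets)

lemma box_torus: "box 0 1 \<subseteq> torus" "torus \<subseteq> cbox 0 1"
 by (auto simp: torus_def mem_box_cart less_imp_le)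

lemma negligible_torus_cbox: "negligible ((torus - cbox 0 1) \<union> (cbox 0 1 - torus))"
proof (rule negligible_subset)
 show "negligible (frontier (cbox 0 1 :: (real^2) set))" by (rule negligible_convex_frontier) simp
 show "(torus - cbox 0 1) \<union> (cbox 0 1 - torus) \<subseteq> frontier (cbox 0 (1::real^2))"
  using box_torus by (auto simp: frontier_def interior_cbox)
qed

lemma content_unit_cbox [simp]: "measure lborel (cbox 0 (1::real^2)) = 1"
proof -
 have "cbox 0 (1::real^2) ~= {}" by (metis empty_iff mem_box_cart(2) zero_index one_index order_refl zero_le_one)
 then show ?thesis by (subst content_cbox_cart) auto
qed

lemma measure_torus [simp]: "measure lebesgue torus = 1" "emeasure lebesgue torus = 1"
proof -
 have tl: "torus \<in> lmeasurable"
  by (rule bounded_set_imp_lmeasurable) (auto intro: bounded_subset[OF bounded_cbox box_torus(2)])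
 have "negligible (sym_diff torus (cbox 0 (1::real^2)))" using negligible_torus_cbox by simp
 then have "measure lebesgue (cbox 0 (1::real^2)) = measure lebesgue torus"
  using measure_negligible_symdiff[of torus "cbox 0 1"] tl
  by (metis Un_commute fmeasurableD)
 then show "measure lebesgue torus = 1" by simp
 with tl show "emeasure lebesgue torus = 1"
  by (simp add: emeasure_eq_measure2)
qed

interpretation torus: finite_measure TM
 by (rule finite_measure_lebesgue_on)
   (use measure_torus(2) in "auto simp: fmeasurable_def")

lemma measure_torus_space [simp]: "measure TM torus = 1" "emeasure TM torus = 1"
 by (simp_all add: measure_restrict_space emeasure_restrict_space)

lemma torus_measurable_borel: "f \<in> Borel ==> f \<in> TBorel"
 by (intro measurable_restrict_space1 measurable_completion) simp

lemma bounded_L1: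
 fixes f :: "real^2 => 'b::{banach, second_countable_topology}"
 assumes "f \<in> TBorel" "!!x. x \<in> torus ==> norm (f x) <= C"
 shows "L1 f"
 by (rule torus.integrable_const_bound[where B=C]) (use assms in auto)

lemma continuous_torus_measurable: "cont f ==> f \<in> TBorel"
 by (intro torus_measurable_borel cont_Borel)

lemma continuous_torus_integrable:
 fixes f :: "real^2 => 'b::euclidean_space"
 assumes "cont f" shows "L1 f"
proof -
 have "compact (f ` cbox 0 1)"
  by (intro compact_continuous_image continuous_on_subset[OF assms] compact_cbox) auto
 then obtain C where "\<forall>y\<in>f ` cbox 0 1. norm y <= C" using compact_imp_bounded bounded_iff by blast
 then show ?thesis using box_torus(2)
  by (intro bounded_L1[where C=C] continuous_torus_measurable assms) auto
qed

lemma torus_LINT_eq_integral: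
 fixes f :: "real^2 => 'b::euclidean_space"
 assumes "cont f" shows "avg f = integral (cbox 0 1) f"
proof -
 have "avg f = integral torus f"
  using continuous_torus_integrable[OF assms] by (intro lebesgue_integral_eq_integral) auto
 also have "... = integral (cbox 0 1) f"
  by (intro integral_spike_set negligible_subset[OF negligible_torus_cbox]) auto
 finally show ?thesis .
qed

text \<open>The library has Fubini's theorem for pairs, not for \<open>real^2\<close>; this identification transfers it.\<close>
definition vec2 :: "real \<times> real => real^2" where "vec2 = (%(a, b). \<chi> i. if i = 1 then a else b)"

lemma vec2_nth [simp]: "vec2 (a, b) $ 1 = a" "vec2 (a, b) $ 2 = b"
 by (simp_all add: vec2_def)

lemma vec2_eta: "vec2 (x $ 1, x $ 2) = x"
 by (simp add: vec_eq_iff forall_2)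

lemma continuous_vec2: "cont vec2"
proof -
 have "cont (%p::real\<times>real. \<chi> i. if i = (1::2) then fst p else snd p)"
 proof (rule continuous_on_vec_lambda[of UNIV "%i p. if i = (1::2) then fst p else snd p"])
  fix i :: 2 show "cont (%p::real\<times>real. if i = 1 then fst p else snd p)"
   by (cases "i = 1") (auto intro!: continuous_intros)
 qed
 then show ?thesis unfolding vec2_def case_prod_unfold .
qed

lemma distr_vec2: "distr (lborel \<Otimes>\<^sub>M lborel) borel vec2 = lborel"
proof (rule lborel_eqI[symmetric])
 fix l u :: "real^2" assume lu: "!!b. b \<in> Basis ==> l \<bullet> b <= u \<bullet> b"
 have meas: "vec2 \<in> borel_measurable (lborel \<Otimes>\<^sub>M lborel)"
  using cont_Borel[OF continuous_vec2] by (simp add: lborel_prod)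
 have le: "l $ i <= u $ i" for i using lu[OF axis_in_Basis2[of i]] by (simp add: inner_axis)
 have "vec2 -` box l u \<inter> space (lborel \<Otimes>\<^sub>M lborel) = box (l$1) (u$1) \<times> box (l$2) (u$2)"
  by (auto simp: space_pair_measure mem_box_cart forall_2)
 then have "emeasure (distr (lborel \<Otimes>\<^sub>M lborel) borel vec2) (box l u)
    = emeasure (lborel \<Otimes>\<^sub>M lborel) (box (l$1) (u$1) \<times> box (l$2) (u$2))"
  using meas by (simp add: emeasure_distr)
 also have "... = ennreal (u$1 - l$1) * ennreal (u$2 - l$2)"
  using le by (subst lborel.emeasure_pair_measure_Times) auto
 also have "... = ennreal ((u$1 - l$1) * (u$2 - l$2))" using le by (simp add: ennreal_mult)
 also have "(u$1 - l$1) * (u$2 - l$2) = (\<Prod>b\<in>Basis. (u - l) \<bullet> b)"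
 proof -
  have B: "(Basis :: (real^2) set) = {axis 1 1, axis 2 1}"
   by (auto simp: Basis_vec_def exhaust_2 axis_def) (metis exhaust_2)+
  have "axis 1 (1::real) ~= (axis 2 1 :: real^2)" by (auto simp: axis_eq_axis)
  then show ?thesis by (simp add: B inner_axis)
 qed
 finally show "emeasure (distr (lborel \<Otimes>\<^sub>M lborel) borel vec2) (box l u) = ennreal (\<Prod>b\<in>Basis. (u - l) \<bullet> b)" .
qed simp

lemma torus_LINT_lborel:
 assumes "f \<in> Borel"
 shows "avg f = (LINT x|lborel. indicator torus x *\<^sub>R (f x :: real))"
proof -
 have "avg f = (LINT x|lebesgue. indicator torus x *\<^sub>R f x)"
  by (subst integral_restrict_space) auto
 also have "... = (LINT x|lborel. indicator torus x *\<^sub>R f x)"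
  using assms by (subst integral_completion) auto
 finally show ?thesis .
qed

text \<open>Continuous functions are integrated by iterated one-dimensional integrals, in both orders. Translations and partial
derivatives then reduce to one variable.\<close>
lemma torus_LINT_iterated:
 fixes f :: "real^2 => real"
 assumes "cont f"
 shows "avg f = integral {0..1} (%a. integral {0..1} (%b. f (vec2 (a, b))))" (is "_ = ?A")
  and "avg f = integral {0..1} (%b. integral {0..1} (%a. f (vec2 (a, b))))" (is "_ = ?B")
proof -
 let ?g = "%p. f (vec2 p)"
 have g: "cont ?g"
  using continuous_on_compose[OF continuous_vec2 continuous_on_subset[OF assms]] by (simp add: o_def)
 have fm: "f \<in> Borel" by (rule cont_Borel[OF assms])
 have v: "vec2 \<in> borel_measurable (lborel \<Otimes>\<^sub>M lborel)"
  using cont_Borel[OF continuous_vec2] by (simp add: lborel_prod)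
 have "avg f = (LINT x|distr (lborel \<Otimes>\<^sub>M lborel) borel vec2. indicator torus x *\<^sub>R f x)"
  unfolding distr_vec2 by (rule torus_LINT_lborel[OF fm])
 also have "... = (LINT p|lborel. indicator torus (vec2 p) *\<^sub>R f (vec2 p))"
  using fm by (subst integral_distr[OF v]) (auto simp: lborel_prod)
 also have "... = (LINT p|lborel. indicator (cbox (0,0) (1,1)) p *\<^sub>R f (vec2 p))"
 proof (rule integral_cong_AE)
  show "(%p. indicator torus (vec2 p) *\<^sub>R f (vec2 p)) \<in> borel_measurable lborel"
  proof -
   have "(%x. indicator torus x *\<^sub>R f x) \<circ> vec2 \<in> Borel"
    by (rule measurable_comp[OF cont_Borel[OF continuous_vec2]]) (use fm in auto)
   then show ?thesis by (simp add: o_def)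
  qed
  have 1: "?g \<in> Borel" by (rule cont_Borel[OF g])
  then show "(%p. indicator (cbox (0,0) (1,1)) p *\<^sub>R f (vec2 p)) \<in> borel_measurable lborel"
   by auto
  have fr: "frontier (cbox (0,0) (1::real,1::real)) = cbox (0,0) (1,1) - box (0,0) (1,1)"
   by (simp only: frontier_def interior_cbox closure_closed closed_cbox)
  have "negligible (frontier (cbox (0,0) (1::real,1::real)))" by (rule negligible_convex_frontier) simp
  moreover have "frontier (cbox (0,0) (1::real,1::real)) \<in> sets borel" by (auto intro: borel_closed)
  ultimately have "emeasure lborel (frontier (cbox (0,0) (1::real,1::real))) = 0"
   by (metis negligible_iff_null_sets null_setsD1 null_sets_completion_iff sets_lborel)
  then have ae: "AE p in lborel. p \<notin> frontier (cbox (0,0) (1::real,1::real))"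
   by (intro AE_not_in) (auto simp: null_sets_def intro: borel_closed)
  show "AE p in lborel. indicator torus (vec2 p) *\<^sub>R f (vec2 p) = indicator (cbox (0,0) (1,1)) p *\<^sub>R f (vec2 p)"
  proof (rule AE_mp[OF ae], intro AE_I2 impI)
   fix p :: "real \<times> real" assume "p \<notin> frontier (cbox (0,0) (1,1))"
   then have "vec2 p \<in> torus \<longleftrightarrow> p \<in> cbox (0,0) (1,1)"
    unfolding fr by (cases p) (auto simp: torus_def forall_2 box_prod mem_box cbox_Pair_eq)
   then show "indicator torus (vec2 p) *\<^sub>R f (vec2 p) = indicator (cbox (0,0) (1,1)) p *\<^sub>R f (vec2 p)"
    by (auto simp: indicator_def)
  qed
 qed
 also have "... = integral (cbox (0,0) (1,1)) ?g"
 proof -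
  have "set_integrable lborel (cbox (0,0) (1,1)) ?g"
   unfolding set_integrable_def by (rule borel_integrable_compact) (auto intro: continuous_on_subset[OF g])
  from set_borel_integral_eq_integral(2)[OF this] show ?thesis
   by (simp add: set_lebesgue_integral_def)
 qed
 finally have eq: "avg f = integral (cbox (0,0) (1,1)) ?g" .
 have c: "continuous_on (cbox (0,0) (1,1)) (%(a, b). f (vec2 (a, b)))" by (rule continuous_on_subset[where s=UNIV]) (use g in auto)
 have c': "continuous_on (cbox (0,0) (1,1)) ?g" by (rule continuous_on_subset[OF g]) simp
 show "avg f = ?A"
  unfolding eq using integral_prod_continuous[of 0 0 1 1 "%p. f (vec2 p)"] c' by simp
 then show "avg f = ?B"
  using integral_swap_continuous[OF c] by simp
qed

lemma vec2_shift: "vec2 (a, b) + h *\<^sub>R axis 1 1 = vec2 (a + h, b)" "vec2 (a, b) + h *\<^sub>R axis 2 1 = vec2 (a, b + h)"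
 by (simp_all add: vec_eq_iff forall_2 axis_def)

lemma continuous_slice:
 fixes f :: "real^2 => real"
 assumes "cont f"
 shows "cont (%a. f (vec2 (a, b)))" "cont (%b. f (vec2 (a, b)))"
 by (rule continuous_on_compose2[OF assms], rule continuous_on_compose2[OF continuous_vec2];
   auto intro: continuous_intros)+

lemma periodic1_integral:
 fixes g :: "real => real"
 assumes g: "cont g" and per: "!!x. g (x + 1) = g x"
 shows "integral {0..1} (%s. g (s + a)) = integral {0..1} g"
  and "integral {0..1} (%s. g (- s)) = integral {0..1} g"
proof -
 define N where "N = \<bar>a\<bar> + 3"
 obtain G where G: "!!x. x \<in> {-N..N} ==> (G has_vector_derivative g x) (at x within {-N..N})"
  using antiderivative_continuous[of "-N" N g] continuous_on_subset[OF g] by auto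
 have G': "(G has_real_derivative g x) (at x)" if "x \<in> {-N<..<N}" for x
  using G[of x] that has_vector_derivative_within_open[of x "{-N<..<N}" G "g x"]
  by (simp add: real_iff_vector_derivative
    has_vector_derivative_within_subset[of G "g x" x "{-N..N}" "{-N<..<N}"] subset_eq)
 define K where "K x = G (x + 1) - G x" for x
 have K: "(K has_real_derivative 0) (at x)" if "x \<in> {-N+1<..<N-1}" for x
 proof -
  have "((%x. G (x + 1)) has_real_derivative g (x + 1)) (at x)"
   using G'[of "x+1"] that by (simp add: DERIV_shift)
  then show ?thesis unfolding K_def using G'[of x] that per[of x]
   by (auto intro!: derivative_eq_intros)
 qed
 have Kc: "K x = K 0" if "x \<in> {-N+1<..<N-1}" for x
 proof (rule has_field_derivative_zero_constant[of "{-N+1<..<N-1}" K, THEN exE])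
  show "convex {-N+1<..<N-1}" by simp
  show "(K has_real_derivative 0) (at x within {-N+1<..<N-1})" if "x \<in> {-N+1<..<N-1}" for x
   using K[OF that] by (rule has_field_derivative_at_within)
  fix c assume "\<forall>x\<in>{-N+1<..<N-1}. K x = c"
  then show "K x = K 0" using that by (auto simp: N_def)
 qed
 have I0: "integral {0..1} g = K 0"
 proof -
  have "(g has_integral (G 1 - G 0)) {0..1}"
   by (rule fundamental_theorem_of_calculus)
     (auto simp: real_iff_vector_derivative[symmetric] N_def intro!: has_field_derivative_at_within G')
  then show ?thesis by (simp add: K_def integral_unique)
 qed
 have "((%s. g (s + a)) has_integral (G (1 + a) - G (0 + a))) {0..1}"
 proof (rule fundamental_theorem_of_calculus)
  fix x :: real assume x: "x \<in> {0..1}"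
  have "x + a \<in> {-N<..<N}" using x unfolding N_def by (auto simp: abs_if)
  then have "((%s. G (s + a)) has_real_derivative g (x + a)) (at x)"
   using G'[of "x+a"] by (simp add: DERIV_shift)
  then show "((%s. G (s + a)) has_vector_derivative g (x + a)) (at x within {0..1})"
   by (simp add: real_iff_vector_derivative has_vector_derivative_at_within)
 qed simp
 note ha = this
 show "integral {0..1} (%s. g (s + a)) = integral {0..1} g"
 proof -
  have "a \<in> {-N+1<..<N-1}" unfolding N_def by (auto simp: abs_if)
  from Kc[OF this] ha show ?thesis by (simp add: I0 integral_unique K_def add_ac)
 qed
 have "((%s. g (- s)) has_integral ((- G (- 1)) - (- G (- 0)))) {0..1}"
 proof (rule fundamental_theorem_of_calculus)
  fix x :: real assume x: "x \<in> {0..1}"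
  have "- x \<in> {-N<..<N}" using x unfolding N_def by auto
  then have "((%s. G (- s)) has_real_derivative g (- x) * (- 1)) (at x)"
   by (intro DERIV_chain2[OF G']) (auto intro!: derivative_eq_intros)
  then have "((%s. - G (- s)) has_real_derivative g (- x)) (at x)"
   using DERIV_minus by fastforce
  then show "((%s. - G (- s)) has_vector_derivative g (- x)) (at x within {0..1})"
   by (simp add: real_iff_vector_derivative has_vector_derivative_at_within)
 qed simp
 note hr = this
 show "integral {0..1} (%s. g (- s)) = integral {0..1} g"
 proof -
  have "- 1 \<in> {-N+1<..<N-1}" unfolding N_def by auto
  from Kc[OF this] hr show ?thesis by (simp add: I0 integral_unique K_def)
 qed
qed

lemma continuous_translate:
 "cont f ==> cont (%x. f (x + z))" for f :: "real^2 => 'b::topological_space"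
 by (rule continuous_on_compose2[of UNIV f]) (auto intro: continuous_intros)

lemma torus_LINT_shift_axis:
 fixes f :: "real^2 => real"
 assumes f: "cont f" and per: "periodic f"
 shows "(AV x. f (x + h *\<^sub>R axis i 1)) = avg f"
proof -
 have p: "f (vec2 (a + 1, b)) = f (vec2 (a, b))" "f (vec2 (a, b + 1)) = f (vec2 (a, b))" for a b
  using per vec2_shift[of a b 1] unfolding periodic_def by (metis scaleR_one)+
 note c = continuous_translate[OF f]
 consider "i = 1" | "i = 2" using exhaust_2 by blast
 then show ?thesis
 proof cases
  case 1
  show ?thesis unfolding torus_LINT_iterated(2)[OF f] torus_LINT_iterated(2)[OF c] 1 vec2_shift
   using periodic1_integral(1)[OF continuous_slice(1)[OF f] p(1)] by simp
 next
  case 2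
  show ?thesis unfolding torus_LINT_iterated(1)[OF f] torus_LINT_iterated(1)[OF c] 2 vec2_shift
   using periodic1_integral(1)[OF continuous_slice(2)[OF f] p(2)] by simp
 qed
qed

lemma periodic_translate: "periodic f ==> periodic (%x. f (x + z))"
 unfolding periodic_def by (metis add.assoc add.commute)

lemma torus_LINT_shift:
 fixes f :: "real^2 => real"
 assumes f: "cont f" and per: "periodic f"
 shows "(AV x. f (x + z)) = avg f"
proof -
 have z: "x + z = (x + z$1 *\<^sub>R axis 1 1) + z$2 *\<^sub>R axis 2 1" for x
  by (simp add: vec_eq_iff forall_2 axis_def)
 have "(AV x. f (x + z)) = (AV x. f ((x + z$1 *\<^sub>R axis 1 1) + z$2 *\<^sub>R axis 2 1))"
  by (rule integral_cong[OF refl arg_cong[OF z]])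
 also have "... = (AV x. f (x + z$2 *\<^sub>R axis 2 1))"
  by (rule torus_LINT_shift_axis) (intro continuous_translate f periodic_translate per)+
 also have "... = avg f" by (rule torus_LINT_shift_axis[OF f per])
 finally show ?thesis .
qed

lemma vec2_uminus: "- vec2 (a, b) = vec2 (- a, - b)"
 by (simp add: vec_eq_iff forall_2)

lemma torus_LINT_reflect:
 fixes f :: "real^2 => real"
 assumes f: "cont f" and per: "periodic f"
 shows "(AV x. f (- x)) = avg f"
proof -
 have p: "f (vec2 (a + 1, b)) = f (vec2 (a, b))" "f (vec2 (a, b + 1)) = f (vec2 (a, b))" for a b
  using per vec2_shift[of a b 1] unfolding periodic_def by (metis scaleR_one)+
 have c: "cont (%x. f (- x))"
  by (rule continuous_on_compose2[OF f]) (auto intro: continuous_intros)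
 have 1: "integral {0..1} (%b. f (vec2 (- a, - b))) = integral {0..1} (%b. f (vec2 (- a, b)))" for a
  using periodic1_integral(2)[OF continuous_slice(2)[OF f] p(2)] by simp
 let ?h = "%a. integral {0..1} (%b. f (vec2 (a, b)))"
 have "cont ?h"
 proof -
  have "continuous_on (UNIV \<times> cbox 0 1) (%(a, b). f (vec2 (a, b)))"
   using continuous_on_compose2[OF f continuous_vec2]
   by (auto simp: case_prod_unfold intro: continuous_on_subset)
  from integral_continuous_on_param[OF this] show ?thesis by simp
 qed
 from periodic1_integral(2)[OF this] p(1)
 have "integral {0..1} (%a. ?h (- a)) = integral {0..1} ?h" by simp
 then show ?thesis unfolding torus_LINT_iterated(1)[OF f] torus_LINT_iterated(1)[OF c] vec2_uminus 1 .
qed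

lemma torus_LINT_partial:
 fixes f :: "real^2 => real"
 assumes "torus_smooth f"
 shows "avg (partial i f) = 0"
proof -
 have per: "periodic f" using assms by (simp add: torus_smooth_def)
 have p: "f (vec2 (1, b)) = f (vec2 (0, b))" "f (vec2 (a, 1)) = f (vec2 (a, 0))" for a b
  using per vec2_shift(1)[of 0 b 1] vec2_shift(2)[of a 0 1] unfolding periodic_def
  by (metis scaleR_one add_0)+
 have c: "cont (partial i f)" by (intro smooth_cont smooth_partial assms)
 consider "i = 1" | "i = 2" using exhaust_2 by blast
 then show ?thesis
 proof cases
  case 1
  have "((%a. partial 1 f (vec2 (a, b))) has_integral f (vec2 (1, b)) - f (vec2 (0, b))) {0..1}" for b
  proof (rule fundamental_theorem_of_calculus)
   fix a :: real
   have "((%h. f (vec2 (0, b) + h *\<^sub>R axis 1 1)) has_real_derivative partial 1 f (vec2 (0, b) + a *\<^sub>R axis 1 1)) (at a)"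
    by (rule torus_smooth_DERIV[OF assms])
   then show "((%a. f (vec2 (a, b))) has_vector_derivative partial 1 f (vec2 (a, b))) (at a within {0..1})"
    by (simp add: vec2_shift real_iff_vector_derivative has_vector_derivative_at_within)
  qed simp
  then have "integral {0..1} (%a. partial 1 f (vec2 (a, b))) = 0" for b
   using p by (simp add: integral_unique)
  then show ?thesis unfolding 1 torus_LINT_iterated(2)[OF c[unfolded 1]] by simp
 next
  case 2
  have "((%b. partial 2 f (vec2 (a, b))) has_integral f (vec2 (a, 1)) - f (vec2 (a, 0))) {0..1}" for a
  proof (rule fundamental_theorem_of_calculus)
   fix b :: real
   have "((%h. f (vec2 (a, 0) + h *\<^sub>R axis 2 1)) has_real_derivative partial 2 f (vec2 (a, 0) + b *\<^sub>R axis 2 1)) (at b)"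
    by (rule torus_smooth_DERIV[OF assms])
   then show "((%b. f (vec2 (a, b))) has_vector_derivative partial 2 f (vec2 (a, b))) (at b within {0..1})"
    by (simp add: vec2_shift real_iff_vector_derivative has_vector_derivative_at_within)
  qed simp
  then have "integral {0..1} (%b. partial 2 f (vec2 (a, b))) = 0" for a
   using p by (simp add: integral_unique)
  then show ?thesis unfolding 2 torus_LINT_iterated(1)[OF c[unfolded 2]] by simp
 qed
qed

section \<open>The Biot-Savart law tested with smooth functions\<close>

lemma integrable_bounded_mult:
 fixes f g :: "'a => real"
 assumes g: "integrable M g" and f: "f \<in> borel_measurable M" and "!!x. x \<in> space M ==> \<bar>f x\<bar> <= C"
 shows "integrable M (%x. f x * g x)"
proof (rule integrable_bound)
 show "integrable M (%x. C * g x)" using g by simp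
 show "(%x. f x * g x) \<in> borel_measurable M" using f g by auto
 show "AE x in M. norm (f x * g x) <= norm (C * g x)"
 proof (intro AE_I2)
  fix x assume "x \<in> space M"
  then have "\<bar>f x\<bar> <= \<bar>C\<bar>" using assms(3) by (smt (verit))
  then show "norm (f x * g x) <= norm (C * g x)" by (simp add: abs_mult mult_right_mono)
 qed
qed

lemma smooth_measurable: "torus_smooth f ==> f \<in> TBorel"
 by (intro continuous_torus_measurable smooth_cont)

lemma smooth_L1_mult:
 fixes \<phi> g :: "real^2 => real"
 assumes "torus_smooth \<phi>" "L1 g"
 shows "L1 (%x. \<phi> x * g x)"
proof -
 obtain C where "\<forall>x. norm (\<phi> x) <= C" using torus_smooth_bounded[OF assms(1)] by blast
 then show ?thesis by (intro integrable_bounded_mult[where C=C] assms smooth_measurable) auto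
qed

lemma smooth_L1: "torus_smooth f ==> L1 f" for f :: "real^2 => real"
 by (intro continuous_torus_integrable smooth_cont)

lemma torus_smooth_DERIV_vec2:
 fixes f :: "real^2 => real"
 assumes "torus_smooth f"
 shows "((%a. f (vec2 (a, b))) has_real_derivative partial 1 f (vec2 (a, b))) (at a)"
  "((%b. f (vec2 (a, b))) has_real_derivative partial 2 f (vec2 (a, b))) (at b)"
 using torus_smooth_DERIV[OF assms, of "vec2 (0, b)" 1 a] torus_smooth_DERIV[OF assms, of "vec2 (a, 0)" 2 b]
 by (simp_all add: vec2_shift)

lemma dist_vec2: "dist (vec2 (a, b)) (vec2 (c, d)) <= \<bar>a - c\<bar> + \<bar>b - d\<bar>"
 using norm_le_l1_cart[of "vec2 (a, b) - vec2 (c, d)"] by (simp add: dist_norm sum_2)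

text \<open>Schwarz's theorem: both mixed derivatives are limits of the same second difference quotient, evaluated by two applications
of the mean value theorem.\<close>
lemma partial_commute:
 fixes f :: "real^2 => real"
 assumes f: "torus_smooth f"
 shows "partial 1 (partial 2 f) x = partial 2 (partial 1 f) x"
proof (rule ccontr)
 assume ne: "partial 1 (partial 2 f) x ~= partial 2 (partial 1 f) x"
 define e where "e = \<bar>partial 1 (partial 2 f) x - partial 2 (partial 1 f) x\<bar> / 2"
 have e: "e > 0" using ne by (simp add: e_def)
 let ?F = "partial 1 (partial 2 f)" and ?G = "partial 2 (partial 1 f)"
 have "cont ?F" "cont ?G"
  by (intro smooth_cont smooth_partial f)+
 then obtain d1 d2 where d1: "d1 > 0" "!!y. dist y x < d1 ==> dist (?F y) (?F x) < e"
  and d2: "d2 > 0" "!!y. dist y x < d2 ==> dist (?G y) (?G x) < e"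
  using e unfolding continuous_on_iff by (metis UNIV_I)
 define h where "h = min d1 d2 / 3"
 have h: "h > 0" using d1 d2 by (simp add: h_def)
 define a b where "a = x $ 1" and "b = x $ 2"
 have x: "x = vec2 (a, b)" by (simp add: a_def b_def vec2_eta)
 let ?D = "f (vec2 (a+h, b+h)) - f (vec2 (a+h, b)) - f (vec2 (a, b+h)) + f (vec2 (a, b))"
 note D = torus_smooth_DERIV_vec2[OF f] torus_smooth_DERIV_vec2[OF smooth_partial[OF f]]
 have "\<exists>z>a. z < a + h & (f (vec2 (a+h, b+h)) - f (vec2 (a+h, b))) - (f (vec2 (a, b+h)) - f (vec2 (a, b)))
   = (a + h - a) * (partial 1 f (vec2 (z, b+h)) - partial 1 f (vec2 (z, b)))"
  using h by (intro MVT2[where f="%a. f (vec2 (a, b+h)) - f (vec2 (a, b))"]) (auto intro!: derivative_intros D)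
 then obtain z where z: "a < z" "z < a + h" "?D = h * (partial 1 f (vec2 (z, b+h)) - partial 1 f (vec2 (z, b)))" by auto
 have "\<exists>w>b. w < b + h & partial 1 f (vec2 (z, b+h)) - partial 1 f (vec2 (z, b)) = (b + h - b) * ?G (vec2 (z, w))"
  using h by (intro MVT2) (auto intro!: D)
 then obtain w where w: "b < w" "w < b + h" "?D = h * (h * ?G (vec2 (z, w)))" using z by auto
 have "\<exists>z>b. z < b + h & (f (vec2 (a+h, b+h)) - f (vec2 (a, b+h))) - (f (vec2 (a+h, b)) - f (vec2 (a, b)))
   = (b + h - b) * (partial 2 f (vec2 (a+h, z)) - partial 2 f (vec2 (a, z)))"
  using h by (intro MVT2[where f="%b. f (vec2 (a+h, b)) - f (vec2 (a, b))"]) (auto intro!: derivative_intros D)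
 then obtain z' where z': "b < z'" "z' < b + h" "?D = h * (partial 2 f (vec2 (a+h, z')) - partial 2 f (vec2 (a, z')))" by auto
 have "\<exists>w>a. w < a + h & partial 2 f (vec2 (a+h, z')) - partial 2 f (vec2 (a, z')) = (a + h - a) * ?F (vec2 (w, z'))"
  using h by (intro MVT2) (auto intro!: D)
 then obtain w' where w': "a < w'" "w' < a + h" "?D = h * (h * ?F (vec2 (w', z')))" using z' by auto
 have eq: "?F (vec2 (w', z')) = ?G (vec2 (z, w))" using w w' h by auto
 have "dist (vec2 (w', z')) x < d1" "dist (vec2 (z, w)) x < d2"
  using dist_vec2[of w' z' a b] dist_vec2[of z w a b] z z' w w' d1 d2 unfolding x h_def by (auto simp: min_def split: if_splits)
 from d1(2)[OF this(1)] d2(2)[OF this(2)] eq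
 have "\<bar>?G (vec2 (z, w)) - ?F x\<bar> < e" "\<bar>?G (vec2 (z, w)) - ?G x\<bar> < e" by (simp_all add: dist_real_def)
 moreover have "\<bar>?F x - ?G x\<bar> = 2 * e" by (simp add: e_def)
 ultimately show False by linarith
qed

text \<open>What the argument uses of the Biot-Savart law: tested with a stream function \<open>\<psi>\<close>, the velocity is divergence-free
and its curl is \<open>f\<close> minus its mean. For the first identity the mixed partial derivatives of \<open>\<phi>\<close> cancel.\<close>
lemma biot_savart_divfree:
 assumes "biot_savart f v" "torus_smooth \<phi>"
 shows "(AV x. v x \<bullet> grad \<phi> x) = 0"
  and "(AV x. v x $ 1 * partial 2 \<phi> x - v x $ 2 * partial 1 \<phi> x)
     = (AV x. (f x - avg f) * \<phi> x)"
  and "L1 f"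
  and "L1 (%x. v x $ 1)" and "L1 (%x. v x $ 2)"
proof -
 obtain \<psi> where \<psi>: "is_inv_neg_laplacian f \<psi>" "is_perp_grad \<psi> v" using assms(1) unfolding biot_savart_def by blast
 show "L1 f" using \<psi> by (simp add: is_inv_neg_laplacian_def)
 have I\<psi>: "L1 \<psi>" using \<psi> by (simp add: is_inv_neg_laplacian_def)
 have w2: "(AV x. partial 2 \<phi> x * \<psi> x) = - (AV x. \<phi> x * v x $ 1)"
  and w1: "(AV x. partial 1 \<phi> x * \<psi> x) = (AV x. \<phi> x * v x $ 2)"
  if "torus_smooth \<phi>" for \<phi>
  using \<psi>(2) that unfolding is_perp_grad_def weak_partial_def by auto
 have "L1 (%x. - (v x $ 2))" and i1: "L1 (%x. v x $ 1)"
  using \<psi>(2) unfolding is_perp_grad_def weak_partial_def by auto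
 then have i2: "L1 (%x. v x $ 2)" using integrable_minus by fastforce
 show "L1 (%x. v x $ 1)" "L1 (%x. v x $ 2)" by (fact i1 i2)+
 note sm = smooth_partial[OF assms(2)] smooth_partial[OF smooth_partial[OF assms(2)]]
 note im = smooth_L1_mult
 have "(AV x. v x \<bullet> grad \<phi> x)
   = (AV x. partial 1 \<phi> x * v x $ 1 + partial 2 \<phi> x * v x $ 2)"
  by (simp add: inner_vec_def sum_2 grad_def mult.commute)
 also have "... = - (AV x. partial 2 (partial 1 \<phi>) x * \<psi> x) + (AV x. partial 1 (partial 2 \<phi>) x * \<psi> x)"
  using w2[OF sm(1)[of 1]] w1[OF sm(1)[of 2]] im[OF sm(1) i1] im[OF sm(1) i2] by simp
 also have "... = 0" using partial_commute[OF assms(2)] by simp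
 finally show "(AV x. v x \<bullet> grad \<phi> x) = 0" .
 have "(AV x. v x $ 1 * partial 2 \<phi> x - v x $ 2 * partial 1 \<phi> x)
  = (AV x. partial 2 \<phi> x * v x $ 1 - partial 1 \<phi> x * v x $ 2)" by (simp add: mult.commute)
 also have "... = - (AV x. partial 2 (partial 2 \<phi>) x * \<psi> x) - (AV x. partial 1 (partial 1 \<phi>) x * \<psi> x)"
  using w2[OF sm(1)[of 2]] w1[OF sm(1)[of 1]] im[OF sm(1) i1] im[OF sm(1) i2] by simp
 also have "... = (AV x. - (partial 2 (partial 2 \<phi>) x * \<psi> x) - partial 1 (partial 1 \<phi>) x * \<psi> x)"
  using im[OF sm(2) I\<psi>] by simp
 also have "... = (AV x. \<psi> x * (- laplacian \<phi> x))"
  by (rule integral_cong[OF refl]) (simp add: laplacian_def sum_2 algebra_simps)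
 also have "... = (AV x. (f x - avg f) * \<phi> x)"
  using \<psi>(1) assms(2) by (simp add: is_inv_neg_laplacian_def)
 finally show "(AV x. v x $ 1 * partial 2 \<phi> x - v x $ 2 * partial 1 \<phi> x)
     = (AV x. (f x - avg f) * \<phi> x)" .
qed

subsection \<open>slab\<close>

lemma Ck_on_slice:
 assumes "t \<in> I" "Ck_on k (I \<times> UNIV) F"
 shows "Ck_on k UNIV (%x. F (t, x))"
 using assms(2)
proof (induction k arbitrary: F)
 case 0
 then show ?case using assms(1)
  by (auto intro!: continuous_on_compose2[of "I \<times> UNIV" F UNIV "%x. (t, x)"] continuous_intros)
next
 case (Suc k)
 then obtain F' where F': "!!p. p \<in> I \<times> UNIV ==> (F has_derivative F' p) (at p within I \<times> UNIV)"
  "\<forall>b\<in>Basis. Ck_on k (I \<times> UNIV) (%p. F' p b)" by auto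
 have "((%x. F (t, x)) has_derivative (%h. F' (t, x) (0, h))) (at x)" for x
 proof -
  have "((%x. (t, x)) has_derivative (%h. (0, h))) (at x)"
   by (intro has_derivative_Pair has_derivative_const has_derivative_ident)
  from has_derivative_in_compose[OF this, of F "F' (t, x)"]
   has_derivative_subset[OF F'(1)[of "(t, x)"], of "range (Pair t)"] assms(1)
  show ?thesis by auto
 qed
 moreover have "Ck_on k UNIV (%x. F' (t, x) (0, b))" if "b \<in> Basis" for b
  using that F'(2) by (intro Suc.IH) (auto simp: Basis_prod_def)
 ultimately show ?case unfolding Ck_on.simps by (intro exI[of _ "%x h. F' (t, x) (0, h)"]) auto
qed

lemma spacetime_smooth_slice:
 "spacetime_smooth T f ==> t \<in> {0..T} ==> torus_smooth (f t)"
 using Ck_on_slice[of t "{0..T}" _ "%(t, x). f t x"]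
 by (auto simp: spacetime_smooth_def torus_smooth_def smooth_on_def)

lemma spacetime_smooth_continuous:
 "spacetime_smooth T f ==> continuous_on ({0..T} \<times> UNIV) (%(t, x). f t x)"
 unfolding spacetime_smooth_def smooth_on_def using Ck_on.simps(1) by blast

lemma spacetime_smooth_partial:
 fixes f :: "real => real^2 => real"
 assumes f: "spacetime_smooth T f"
 shows "spacetime_smooth T (%t. partial i (f t))"
 unfolding spacetime_smooth_def
proof (intro conjI ballI)
 fix t assume "t \<in> {0..T}"
 then show "periodic (partial i (f t))"
  using smooth_partial[OF spacetime_smooth_slice[OF f]] by (simp add: torus_smooth_def)
next
 let ?S = "{0..T} \<times> (UNIV :: (real^2) set)"
 have "Ck_on k ?S (%(t, x). partial i (f t) x)" for k
 proof -
  have "Ck_on (Suc k) ?S (%(t, x). f t x)" using f unfolding spacetime_smooth_def smooth_on_def by blast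
  then obtain F' where F': "!!p. p \<in> ?S ==> ((%(t, x). f t x) has_derivative F' p) (at p within ?S)"
   "\<forall>b\<in>Basis. Ck_on k ?S (%p. F' p b)" by auto
  have "F' p (0, axis i 1) = (%(t, x). partial i (f t) x) p" if "p \<in> ?S" for p
  proof -
   obtain t x where "p = (t, x)" by (cases p)
   with that have p: "p = (t, x)" "t \<in> {0..T}" by auto
   have d: "((%x. (t, x)) has_derivative (%h. (0, h))) (at x)"
    by (intro has_derivative_Pair has_derivative_const has_derivative_ident)
   have sub: "range (Pair t) \<subseteq> {0..T} \<times> UNIV" using p by auto
   from has_derivative_in_compose[OF d, of "%(t, x). f t x" "F' (t, x)"]
    has_derivative_subset[OF F'(1)[of "(t, x)"], of "range (Pair t)"] p sub
   have "(f t has_derivative (%h. F' (t, x) (0, h))) (at x)"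
    by auto
   from has_derivative_partial(1)[OF this] show ?thesis by (simp add: p)
  qed
  moreover have "Ck_on k ?S (%p. F' p (0, axis i 1))"
  proof -
   have "(0::real, axis i 1 :: real^2) \<in> Basis" unfolding Basis_prod_def using axis_in_Basis2 by blast
   then show ?thesis using F'(2) by blast
  qed
  ultimately show ?thesis using Ck_on_cong[of ?S "%p. F' p (0, axis i 1)" "%(t, x). partial i (f t) x" k] by blast
 qed
 then show "smooth_on ?S (%(t, x). partial i (f t) x)" by (simp add: smooth_on_def)
qed

lemma spacetime_smooth_time_derivative:
 fixes f :: "real => real^2 => real"
 assumes f: "spacetime_smooth T f"
 obtains ft where "continuous_on ({0..T} \<times> UNIV) (%(t, x). ft t x)"
  and "!!t x. t \<in> {0..T} ==> ((%s. f s x) has_vector_derivative ft t x) (at t within {0..T})"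
proof -
 let ?S = "{0..T} \<times> (UNIV :: (real^2) set)"
 have "Ck_on (Suc 0) ?S (%(t, x). f t x)" using f unfolding spacetime_smooth_def smooth_on_def by blast
 then obtain F' where F': "!!p. p \<in> ?S ==> ((%(t, x). f t x) has_derivative F' p) (at p within ?S)"
  "\<forall>b\<in>Basis. continuous_on ?S (%p. F' p b)" by auto
 show ?thesis
 proof (rule that[of "%t x. F' (t, x) (1, 0)"])
  have "(1::real, 0::real^2) \<in> Basis" by (auto simp: Basis_prod_def)
  then show "continuous_on ?S (%(t, x). F' (t, x) (1, 0))" using F'(2) by (auto simp: case_prod_unfold)
  fix t and x :: "real^2" assume t: "t \<in> {0..T}"
  have "((%s. (s, x)) has_derivative (%h. (h, 0))) (at t within {0..T})"
   by (intro has_derivative_Pair has_derivative_const has_derivative_ident)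
  from has_derivative_in_compose[OF this, of "%(t, x). f t x" "F' (t, x)"]
   has_derivative_subset[OF F'(1)[of "(t, x)"], of "(%s. (s, x)) ` {0..T}"] t
  have "((%s. f s x) has_derivative (%h. F' (t, x) (h, 0))) (at t within {0..T})"
   by auto
  moreover have "F' (t, x) (h, 0) = h *\<^sub>R F' (t, x) (1, 0)" for h
   using linear_cmul[OF has_derivative_linear[OF F'(1)[of "(t, x)"]], of h "(1, 0)"] t by simp
  then have "(%h. F' (t, x) (h, 0)) = (%h. h *\<^sub>R F' (t, x) (1, 0))" by blast
  ultimately show "((%s. f s x) has_vector_derivative F' (t, x) (1, 0)) (at t within {0..T})"
   unfolding has_vector_derivative_def by metis
 qed
qed

section \<open>Balance laws for Navier-Stokes solutions\<close>

lemma cont_L1: "cont f ==> L1 f" for f :: "real^2 => real"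
 by (rule continuous_torus_integrable)

lemma continuous_grad: "torus_smooth f ==> continuous_on S (grad f)"
 unfolding grad_def by (intro continuous_intros smooth_cont smooth_partial)

lemma torus_smooth_laplacian: "torus_smooth f ==> torus_smooth (laplacian f)"
 unfolding laplacian_def by (intro torus_smooth_sum smooth_partial)

lemma cont_compose:
 "cont B ==> continuous_on S f ==> continuous_on S (%x. B (f x))"
 by (rule continuous_on_compose2[of UNIV B]) auto

text \<open>Entropies must preserve \<open>torus_smooth\<close> under composition, so that every product below can be integrated by parts. A
function of class \<open>C\<^sup>2\<close> would not do; the concrete entropies are powers of \<open>c + z\<^sup>2\<close>.\<close>
locale C2_fun =
 fixes B B' B'' :: "real => real"
 assumes B: "!!z. (B has_real_derivative B' z) (at z)"
  and B': "!!z. (B' has_real_derivative B'' z) (at z)"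
  and B'': "cont B''"
  and smooth: "!!f. torus_smooth f ==> torus_smooth (%x. B (f x))"
   "!!f. torus_smooth f ==> torus_smooth (%x. B' (f x))"
begin

lemma continuous_B: "cont B" "cont B'"
 using B B' by (meson DERIV_isCont continuous_at_imp_continuous_on)+

text \<open>Integration by parts for a renormalised vorticity relative to a smooth function \<open>\<phi>\<close>, with weight \<open>e\<close>: the transport
term becomes a flux because \<open>v\<close> is divergence-free, the diffusion term produces the dissipation with \<open>B''\<close>.\<close>
lemma spatial_identity:
 fixes v :: "real^2 => real^2"
 assumes v: "cont v"
  and divfree: "!!\<phi>. torus_smooth \<phi> ==> (AV x. v x \<bullet> grad \<phi> x) = 0"
  and g: "torus_smooth g" and \<phi>: "torus_smooth \<phi>" and e: "torus_smooth e"
 defines "f \<equiv> %x. g x - \<phi> x"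
 shows "(AV x. B' (f x) * e x * (\<nu> * laplacian g x - v x \<bullet> grad g x))
  = (AV x. B (f x) * (v x \<bullet> grad e x)) - (AV x. e x * B' (f x) * (v x \<bullet> grad \<phi> x))
  + \<nu> * (AV x. B (f x) * laplacian e x + B' (f x) * e x * laplacian \<phi> x)
  - \<nu> * (AV x. e x * B'' (f x) * (norm (grad f x))^2)"
proof -
 have f: "torus_smooth f" unfolding f_def by (intro torus_smooth_diff g \<phi>)
 note c = smooth_cont[OF f] smooth_cont[OF g] smooth_cont[OF \<phi>] smooth_cont[OF e]
  smooth_cont[OF smooth(1)[OF f]] smooth_cont[OF smooth(2)[OF f]]
  cont_compose[OF B'' smooth_cont[OF f]] v
  continuous_grad[OF f] continuous_grad[OF g] continuous_grad[OF \<phi>] continuous_grad[OF e]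
  smooth_cont[OF torus_smooth_laplacian[OF f]] smooth_cont[OF torus_smooth_laplacian[OF g]]
  smooth_cont[OF torus_smooth_laplacian[OF \<phi>]] smooth_cont[OF torus_smooth_laplacian[OF e]]
  continuous_on_inner continuous_on_mult continuous_on_add continuous_on_diff continuous_on_norm continuous_on_power continuous_on_const
 have pf: "partial i f x = partial i g x - partial i \<phi> x" for i x unfolding f_def by (rule partial_diff[OF g \<phi>])
 have gf: "grad g x = grad f x + grad \<phi> x" for x by (simp add: grad_def vec_eq_iff pf)
 have pfe: "partial i f = (%x. partial i g x - partial i \<phi> x)" for i using pf by blast
 have lf: "laplacian g x = laplacian f x + laplacian \<phi> x" for x
  by (simp add: laplacian_def sum_2 pfe partial_diff smooth_partial g \<phi>)
 have gBe: "grad (%x. B (f x) * e x) x = (e x * B' (f x)) *\<^sub>R grad f x + B (f x) *\<^sub>R grad e x" for x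
  by (simp add: grad_def vec_eq_iff partial_mult[OF smooth(1)[OF f] e] partial_compose[OF f B])
 have "0 = (AV x. e x * B' (f x) * (v x \<bullet> grad f x) + B (f x) * (v x \<bullet> grad e x))"
  using divfree[OF torus_smooth_mult[OF smooth(1)[OF f] e]] unfolding gBe by (simp add: inner_add_right)
 also have "... = (AV x. e x * B' (f x) * (v x \<bullet> grad f x)) + (AV x. B (f x) * (v x \<bullet> grad e x))"
  by (intro integral_add cont_L1 c)
 finally have T: "(AV x. e x * B' (f x) * (v x \<bullet> grad f x)) = - (AV x. B (f x) * (v x \<bullet> grad e x))" by simp
 have ng: "(norm (grad f x))^2 = (partial 1 f x)^2 + (partial 2 f x)^2" for x
  unfolding power2_norm_eq_inner inner_vec_def by (simp add: grad_def sum_2 power2_eq_square)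
 have "0 = (AV x. partial i (%x. B' (f x) * e x * partial i f x - B (f x) * partial i e x) x)" for i
  using torus_LINT_partial[of "%x. B' (f x) * e x * partial i f x - B (f x) * partial i e x" i]
  by (simp add: torus_smooth_diff torus_smooth_mult smooth f e smooth_partial)
 moreover have "partial i (%x. B' (f x) * e x * partial i f x - B (f x) * partial i e x) x
   = e x * B'' (f x) * (partial i f x)^2 + B' (f x) * e x * partial i (partial i f) x - B (f x) * partial i (partial i e) x" for i x
  by (simp add: partial_diff partial_mult torus_smooth_mult smooth f e smooth_partial
    partial_compose[OF f B] partial_compose[OF f B'] algebra_simps power2_eq_square)
 ultimately have "0 = (AV x. e x * B'' (f x) * (partial i f x)^2 + B' (f x) * e x * partial i (partial i f) x - B (f x) * partial i (partial i e) x)" for i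
  by simp
 then have "0 = (\<Sum>i\<in>UNIV. (AV x. e x * B'' (f x) * (partial i f x)^2 + B' (f x) * e x * partial i (partial i f) x - B (f x) * partial i (partial i e) x))"
  by simp
 also have "... = (AV x. (\<Sum>i\<in>UNIV. e x * B'' (f x) * (partial i f x)^2 + B' (f x) * e x * partial i (partial i f) x - B (f x) * partial i (partial i e) x))"
  by (intro integral_sum[symmetric] cont_L1 c
    smooth_cont[OF smooth_partial[OF f]]
    smooth_cont[OF smooth_partial[OF smooth_partial[OF f]]]
    smooth_cont[OF smooth_partial[OF smooth_partial[OF e]]])
 also have "... = (AV x. e x * B'' (f x) * (norm (grad f x))^2 + B' (f x) * e x * laplacian f x - B (f x) * laplacian e x)"
  by (rule integral_cong[OF refl])
    (simp add: laplacian_def sum_2 ng algebra_simps)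
 also have "... = (AV x. e x * B'' (f x) * (norm (grad f x))^2) + (AV x. B' (f x) * e x * laplacian f x) - (AV x. B (f x) * laplacian e x)"
  by (subst integral_diff, (intro cont_L1 c)+,
    subst integral_add, (intro cont_L1 c)+, rule refl)
 finally have D: "(AV x. B' (f x) * e x * laplacian f x) = (AV x. B (f x) * laplacian e x) - (AV x. e x * B'' (f x) * (norm (grad f x))^2)" by simp
 have "(AV x. B' (f x) * e x * (\<nu> * laplacian g x - v x \<bullet> grad g x))
  = (AV x. \<nu> * (B' (f x) * e x * laplacian f x) + \<nu> * (B' (f x) * e x * laplacian \<phi> x)
     - e x * B' (f x) * (v x \<bullet> grad f x) - e x * B' (f x) * (v x \<bullet> grad \<phi> x))"
  by (rule integral_cong[OF refl]) (simp add: gf lf inner_add_right algebra_simps)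
 also have "... = (AV x. \<nu> * (B' (f x) * e x * laplacian f x)) + (AV x. \<nu> * (B' (f x) * e x * laplacian \<phi> x))
     - (AV x. e x * B' (f x) * (v x \<bullet> grad f x)) - (AV x. e x * B' (f x) * (v x \<bullet> grad \<phi> x))"
  by (subst integral_diff, (intro cont_L1 c)+,
    subst integral_diff, (intro cont_L1 c)+,
    subst integral_add, (intro cont_L1 c)+, rule refl)
 finally have S: "(AV x. B' (f x) * e x * (\<nu> * laplacian g x - v x \<bullet> grad g x))
  = (AV x. \<nu> * (B' (f x) * e x * laplacian f x)) + (AV x. \<nu> * (B' (f x) * e x * laplacian \<phi> x))
     - (AV x. e x * B' (f x) * (v x \<bullet> grad f x)) - (AV x. e x * B' (f x) * (v x \<bullet> grad \<phi> x))" .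
 have V: "(AV x. B (f x) * laplacian e x + B' (f x) * e x * laplacian \<phi> x)
  = (AV x. B (f x) * laplacian e x) + (AV x. B' (f x) * e x * laplacian \<phi> x)"
  by (intro integral_add cont_L1 c)
 show ?thesis unfolding S V T integral_mult_right_zero D
  by (simp add: distrib_left right_diff_distrib)
qed

end

lemma grad_diff: "torus_smooth f ==> torus_smooth g ==> grad (%x. f x - g x) x = grad f x - grad g x"
 by (simp add: grad_def vec_eq_iff partial_diff)

lemma slab_slice_continuous:
 assumes "continuous_on ({0..T} \<times> UNIV) (%p. F (fst p) (snd p))" "t \<in> {0..T}"
 shows "cont (F t)"
proof -
 have "cont (%x. (t, x))" by (intro continuous_intros)
 moreover have "range (%x. (t, x)) \<subseteq> {0..T} \<times> UNIV" using assms(2) by auto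
 ultimately show ?thesis using continuous_on_compose2[OF assms(1), of UNIV "%x. (t, x)"] by simp
qed

lemma slab_LINT_continuous:
 fixes F :: "real => real^2 => real"
 assumes c: "continuous_on ({0..T} \<times> UNIV) (%p. F (fst p) (snd p))"
 shows "continuous_on {0..T} (%t. AV x. F t x)"
proof -
 have "continuous_on {0..T} (%t. integral (cbox 0 1) (F t))"
  by (rule integral_continuous_on_param) (auto simp: case_prod_unfold intro: continuous_on_subset[OF c])
 then show ?thesis
  by (rule continuous_on_cong[THEN iffD1, rotated 2])
    (auto simp: torus_LINT_eq_integral[OF slab_slice_continuous[OF c]])
qed

lemma slab_LINT_derivative:
 fixes F F' :: "real => real^2 => real"
 assumes c: "continuous_on ({0..T} \<times> UNIV) (%p. F (fst p) (snd p))"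
  and c': "continuous_on ({0..T} \<times> UNIV) (%p. F' (fst p) (snd p))"
  and D: "!!t x. t \<in> {0..T} ==> ((%s. F s x) has_vector_derivative F' t x) (at t within {0..T})"
  and t: "t \<in> {0..T}"
 shows "((%t. AV x. F t x) has_vector_derivative (AV x. F' t x)) (at t within {0..T})"
proof -
 have "((%t. integral (cbox 0 1) (F t)) has_vector_derivative integral (cbox 0 1) (F' t)) (at t within {0..T})"
 proof (rule leibniz_rule_vector_derivative[where U="{0..T}"])
  show "F s integrable_on cbox 0 1" if "s \<in> {0..T}" for s
   by (rule integrable_continuous) (rule continuous_on_subset[OF slab_slice_continuous[OF c that]], simp)
  show "continuous_on ({0..T} \<times> cbox 0 1) (%(x, t). F' x t)"
   by (auto simp: case_prod_unfold intro: continuous_on_subset[OF c'])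
 qed (use D t in auto)
 then show ?thesis
  using t by (subst torus_LINT_eq_integral[OF slab_slice_continuous[OF c']])
    (auto simp: torus_LINT_eq_integral[OF slab_slice_continuous[OF c]] elim!: has_vector_derivative_transform[rotated 2])
qed

locale ns_solution =
 fixes T \<nu> :: real and wi :: "real^2 => real" and u :: "real => real^2 => real^2" and w :: "real => real^2 => real"
 assumes ns: "navier_stokes_solution T \<nu> wi u w"
  and T: "T > 0" and \<nu>: "\<nu> > 0"
begin

lemma u_continuous: "continuous_on ({0..T} \<times> UNIV) (%p. u (fst p) (snd p))"
 using ns spacetime_smooth_continuous[of T u] by (simp add: navier_stokes_solution_def case_prod_unfold)

lemma w_spacetime_smooth: "spacetime_smooth T w"
 using ns by (simp add: navier_stokes_solution_def)

lemma w_continuous: "continuous_on ({0..T} \<times> UNIV) (%p. w (fst p) (snd p))"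
 using spacetime_smooth_continuous[OF w_spacetime_smooth] by (simp add: case_prod_unfold)

lemma w_smooth: "t \<in> {0..T} ==> torus_smooth (w t)"
 by (rule spacetime_smooth_slice[OF w_spacetime_smooth])

lemma biot_savart: "t \<in> {0..T} ==> biot_savart (w t) (u t)"
 using ns by (simp add: navier_stokes_solution_def)

lemma divfree: "t \<in> {0..T} ==> torus_smooth \<phi> ==> (AV x. u t x \<bullet> grad \<phi> x) = 0"
 by (rule biot_savart_divfree(1)[OF biot_savart])

lemma grad_continuous: "continuous_on ({0..T} \<times> UNIV) (%p. grad (w (fst p)) (snd p))"
 unfolding grad_def
 using spacetime_smooth_continuous[OF spacetime_smooth_partial[OF w_spacetime_smooth]]
 by (intro continuous_on_vec_lambda) (simp add: case_prod_unfold)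

lemma continuous_snd_slab: "cont \<phi> ==> continuous_on ({0..T} \<times> UNIV) (%p. \<phi> (snd p))"
 by (rule continuous_on_compose2[of UNIV \<phi>]) (auto intro: continuous_intros)

context
 fixes B B' B'' :: "real => real" and \<phi> e :: "real^2 => real"
 assumes C2: "C2_fun B B' B''" and \<phi>: "torus_smooth \<phi>" and e: "torus_smooth e"
begin

interpretation C2_fun B B' B'' by (rule C2)

definition "conv_flux \<tau> = (AV x. B (w \<tau> x - \<phi> x) * (u \<tau> x \<bullet> grad e x))"
definition "conv_source \<tau> = (AV x. e x * B' (w \<tau> x - \<phi> x) * (u \<tau> x \<bullet> grad \<phi> x))"
definition "visc_term \<tau> = (AV x. B (w \<tau> x - \<phi> x) * laplacian e x + B' (w \<tau> x - \<phi> x) * e x * laplacian \<phi> x)"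
definition "dissip \<tau> = (AV x. e x * B'' (w \<tau> x - \<phi> x) * (norm (grad (%x. w \<tau> x - \<phi> x) x))^2)"

lemma slab_continuous:
 "continuous_on ({0..T} \<times> UNIV) (%p. B (w (fst p) (snd p) - \<phi> (snd p)))"
 "continuous_on ({0..T} \<times> UNIV) (%p. B' (w (fst p) (snd p) - \<phi> (snd p)))"
 "continuous_on ({0..T} \<times> UNIV) (%p. B'' (w (fst p) (snd p) - \<phi> (snd p)))"
 by (intro cont_compose[OF continuous_B(1)] cont_compose[OF continuous_B(2)] cont_compose[OF B'']
   continuous_on_diff w_continuous continuous_snd_slab smooth_cont \<phi>)+

lemma evolution_continuous:
 "continuous_on {0..T} conv_flux" "continuous_on {0..T} conv_source" "continuous_on {0..T} visc_term" "continuous_on {0..T} dissip"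
proof -
 note c = slab_continuous u_continuous continuous_snd_slab[OF continuous_grad[OF e]] continuous_snd_slab[OF continuous_grad[OF \<phi>]]
   continuous_snd_slab[OF smooth_cont[OF e]]
   continuous_snd_slab[OF smooth_cont[OF torus_smooth_laplacian[OF e]]]
   continuous_snd_slab[OF smooth_cont[OF torus_smooth_laplacian[OF \<phi>]]]
  continuous_on_inner continuous_on_mult continuous_on_add continuous_on_diff continuous_on_norm continuous_on_power continuous_on_const
 show "continuous_on {0..T} conv_flux" unfolding conv_flux_def by (intro slab_LINT_continuous c)
 show "continuous_on {0..T} conv_source" unfolding conv_source_def by (intro slab_LINT_continuous c)
 show "continuous_on {0..T} visc_term" unfolding visc_term_def by (intro slab_LINT_continuous c)
 have "continuous_on {0..T} (%\<tau>. AV x. e x * B'' (w \<tau> x - \<phi> x) * (norm (grad (w \<tau>) x - grad \<phi> x))^2)"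
  by (intro slab_LINT_continuous c grad_continuous)
 then show "continuous_on {0..T} dissip"
  by (rule continuous_on_cong[THEN iffD1, rotated 2]) (auto simp: dissip_def grad_diff w_smooth \<phi>)
qed

lemma evolution_derivative:
 shows "continuous_on {0..T} (%\<tau>. AV x. B (w \<tau> x - \<phi> x) * e x)"
  and "\<tau> \<in> {0<..<T} ==> ((%\<tau>. AV x. B (w \<tau> x - \<phi> x) * e x) has_real_derivative
   (conv_flux \<tau> - conv_source \<tau> + \<nu> * visc_term \<tau> - \<nu> * dissip \<tau>)) (at \<tau>)"
proof -
 obtain wt where wtc: "continuous_on ({0..T} \<times> UNIV) (%(t, x). wt t x)"
  and wt: "!!t x. t \<in> {0..T} ==> ((%s. w s x) has_vector_derivative wt t x) (at t within {0..T})"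
  using spacetime_smooth_time_derivative[OF w_spacetime_smooth] by blast
 let ?J = "%\<tau>. AV x. B (w \<tau> x - \<phi> x) * e x"
 have D: "(?J has_vector_derivative (AV x. B' (w \<tau> x - \<phi> x) * e x * wt \<tau> x)) (at \<tau> within {0..T})"
  if "\<tau> \<in> {0..T}" for \<tau>
 proof (rule slab_LINT_derivative[OF _ _ _ that])
  show "continuous_on ({0..T} \<times> UNIV) (%p. B (w (fst p) (snd p) - \<phi> (snd p)) * e (snd p))"
   by (intro continuous_on_mult slab_continuous continuous_snd_slab smooth_cont e)
  show "continuous_on ({0..T} \<times> UNIV) (%p. B' (w (fst p) (snd p) - \<phi> (snd p)) * e (snd p) * wt (fst p) (snd p))"
   using wtc by (intro continuous_on_mult slab_continuous continuous_snd_slab smooth_cont e) (simp add: case_prod_unfold)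
  fix \<tau> x assume "\<tau> \<in> {0..T}"
  from wt[OF this, of x]
  have 1: "((%s. w s x - \<phi> x) has_real_derivative wt \<tau> x) (at \<tau> within {0..T})"
   unfolding real_iff_vector_derivative by (auto intro!: derivative_eq_intros)
  have "((%s. B (w s x - \<phi> x)) has_real_derivative B' (w \<tau> x - \<phi> x) * wt \<tau> x) (at \<tau> within {0..T})"
   by (rule DERIV_chain2[OF B 1])
  then have "((%s. B (w s x - \<phi> x) * e x) has_real_derivative B' (w \<tau> x - \<phi> x) * e x * wt \<tau> x) (at \<tau> within {0..T})"
   by (auto intro!: derivative_eq_intros)
  then show "((%s. B (w s x - \<phi> x) * e x) has_vector_derivative B' (w \<tau> x - \<phi> x) * e x * wt \<tau> x) (at \<tau> within {0..T})"
   by (simp add: real_iff_vector_derivative)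
 qed
 show "continuous_on {0..T} ?J"
  using D has_vector_derivative_continuous unfolding continuous_on_eq_continuous_within by blast
 show "(?J has_real_derivative (conv_flux \<tau> - conv_source \<tau> + \<nu> * visc_term \<tau> - \<nu> * dissip \<tau>)) (at \<tau>)"
  if \<tau>: "\<tau> \<in> {0<..<T}"
 proof -
  have \<tau>T: "\<tau> \<in> {0..T}" and \<tau>T': "\<tau> \<in> {0<..<T}" using \<tau> by auto
  have at: "at \<tau> within {0..T} = at \<tau>" by (rule at_within_interior) (use \<tau>T' in auto)
  have pde: "wt \<tau> x = \<nu> * laplacian (w \<tau>) x - u \<tau> x \<bullet> grad (w \<tau>) x" for x
  proof -
   have "deriv (%s. w s x) \<tau> = wt \<tau> x"
    using wt[OF \<tau>T, of x] unfolding at by (intro DERIV_imp_deriv) (simp add: real_iff_vector_derivative)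
   moreover have "deriv (%s. w s x) \<tau> + u \<tau> x \<bullet> grad (w \<tau>) x - \<nu> * laplacian (w \<tau>) x = 0"
    using ns \<tau>T' by (simp add: navier_stokes_solution_def)
   ultimately show ?thesis by simp
  qed
  have "(AV x. B' (w \<tau> x - \<phi> x) * e x * wt \<tau> x) = conv_flux \<tau> - conv_source \<tau> + \<nu> * visc_term \<tau> - \<nu> * dissip \<tau>"
   unfolding pde conv_flux_def conv_source_def visc_term_def dissip_def
   by (rule spatial_identity[OF slab_slice_continuous[OF u_continuous \<tau>T] divfree[OF \<tau>T] w_smooth[OF \<tau>T] \<phi> e])
  then show ?thesis
   using D[OF \<tau>T] unfolding at by (simp add: real_iff_vector_derivative)
 qed
qed

text \<open>Fluxes, sources and dissipation are continuous in time up to the boundary, so the balance law is integrated by the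
fundamental theorem of calculus although the equation holds only inside the time interval.\<close>
lemma evolution:
 assumes "0 <= s" "s <= t" "t <= T"
 shows "((%\<tau>. conv_flux \<tau> - conv_source \<tau> + \<nu> * visc_term \<tau> - \<nu> * dissip \<tau>) has_integral
   ((AV x. B (w t x - \<phi> x) * e x) - (AV x. B (w s x - \<phi> x) * e x))) {s..t}"
 by (rule fundamental_theorem_of_calculus_interior[OF assms(2)])
   (use evolution_derivative assms in \<open>auto simp: real_iff_vector_derivative[symmetric]
    intro: continuous_on_subset\<close>)

text \<open>The squares of the modes of \<open>B(w)\<close> are what the energy of the smoothed vorticity consists of.\<close>
lemma evolution_square:
 assumes "0 <= s" "s <= t" "t <= T"
 defines "a \<equiv> %\<tau>. AV x. B (w \<tau> x - \<phi> x) * e x"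
 shows "((%\<tau>. 2 * a \<tau> * (conv_flux \<tau> - conv_source \<tau> + \<nu> * visc_term \<tau> - \<nu> * dissip \<tau>)) has_integral
   ((a t)^2 - (a s)^2)) {s..t}"
proof (rule fundamental_theorem_of_calculus_interior[OF assms(2)])
 have c: "continuous_on {0..T} a" unfolding a_def by (rule evolution_derivative)
 then show "continuous_on {s..t} (%t. (a t)^2)"
  using assms by (auto intro!: continuous_intros intro: continuous_on_subset)
 fix \<tau> assume "\<tau> \<in> {s<..<t}"
 then have "(a has_real_derivative (conv_flux \<tau> - conv_source \<tau> + \<nu> * visc_term \<tau> - \<nu> * dissip \<tau>)) (at \<tau>)"
  using assms unfolding a_def by (intro evolution_derivative(2)) auto
 then show "((%t. (a t)^2) has_vector_derivative 2 * a \<tau> * (conv_flux \<tau> - conv_source \<tau> + \<nu> * visc_term \<tau> - \<nu> * dissip \<tau>)) (at \<tau>)"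
  unfolding real_iff_vector_derivative[symmetric]
  by (auto intro!: derivative_eq_intros)
qed

end

end

section \<open>Entropies and their dissipation\<close>

lemma sq_pos: "c > 0 ==> c + z^2 > (0::real)"
 by (smt (verit) zero_le_power2)

lemma powr_C2_fun:
 assumes c: "c > 0"
 shows "C2_fun (%z. (c + z^2) powr q) (%z. 2 * q * z * (c + z^2) powr (q - 1))
   (%z. 2 * q * (c + z^2) powr (q - 1) + 4 * q * (q - 1) * z^2 * (c + z^2) powr (q - 2))"
proof
 have D: "((%z. (c + z^2) powr q) has_real_derivative 2 * q * z * (c + z^2) powr (q - 1)) (at z)" for z q
  using sq_pos[OF c, of z] by (auto intro!: derivative_eq_intros simp: powr_diff field_simps)
 show "((%z. (c + z^2) powr q) has_real_derivative 2 * q * z * (c + z^2) powr (q - 1)) (at z)" for z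
  by (rule D)
 show "((%z. 2 * q * z * (c + z^2) powr (q - 1)) has_real_derivative
   2 * q * (c + z^2) powr (q - 1) + 4 * q * (q - 1) * z^2 * (c + z^2) powr (q - 2)) (at z)" for z
 proof -
  have "((%z. 2 * q * z) has_real_derivative 2 * q) (at z)" by (auto intro!: derivative_eq_intros)
  from DERIV_mult[OF this D[of "q - 1" z]] show ?thesis by (simp add: algebra_simps power2_eq_square)
 qed
 have "c + z^2 ~= 0" for z using sq_pos[OF c, of z] by simp
 then show "cont (%z. 2 * q * (c + z^2) powr (q - 1) + 4 * q * (q - 1) * z^2 * (c + z^2) powr (q - 2))"
  by (auto intro!: continuous_intros)
 fix f :: "real^2 => real" assume f: "torus_smooth f"
 show "torus_smooth (%x. (c + (f x)^2) powr q)" by (intro torus_smooth_powr f c)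
 show "torus_smooth (%x. 2 * q * f x * (c + (f x)^2) powr (q - 1))"
  by (intro torus_smooth_mult torus_smooth_const torus_smooth_powr f c)
qed

lemma sq_powr_half: "(z^2) powr (p / 2) = \<bar>z\<bar> powr (p::real)" for z :: real
proof (cases "z = 0")
 case False
 then have "z^2 = \<bar>z\<bar> powr 2" by simp
 then show ?thesis by (simp only: powr_powr) simp
qed simp

text \<open>A smooth substitute for \<open>\<bar>z\<bar>\<close>; \<open>ent1\<close>, \<open>ent2\<close>, \<open>ent3\<close> are its derivatives. For large \<open>c\<close>, \<open>sqrt c * ent1 c\<close> is a smooth
truncation of the identity at height \<open>sqrt c\<close>.\<close>
definition ent :: "real => real => real" where "ent c z = (c + z^2) powr (1/2)"
definition ent1 :: "real => real => real" where "ent1 c z = z * (c + z^2) powr (-1/2)"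
definition ent2 :: "real => real => real" where "ent2 c z = c * (c + z^2) powr (-3/2)"
definition ent3 :: "real => real => real" where "ent3 c z = - 3 * c * z * (c + z^2) powr (-5/2)"

lemma ent_deriv:
 assumes c: "c > 0"
 shows "(ent c has_real_derivative ent1 c z) (at z)"
  "(ent1 c has_real_derivative ent2 c z) (at z)"
  "(ent2 c has_real_derivative ent3 c z) (at z)"
proof -
 have D: "((%z. (c + z^2) powr q) has_real_derivative 2 * q * z * (c + z^2) powr (q - 1)) (at z)" for z q
  using C2_fun.B[OF powr_C2_fun[OF c, of q]] .
 show "(ent c has_real_derivative ent1 c z) (at z)"
  using D[of "1/2" z] unfolding ent_def ent1_def by simp
 have w: "(c + z^2) powr (-1/2) = (c + z^2) * (c + z^2) powr (-3/2)"
  using sq_pos[OF c, of z] by (simp add: powr_mult_base)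
 have "((%z. z * (c + z^2) powr (-1/2)) has_real_derivative (c + z^2) powr (-1/2) + z * (2 * (-1/2) * z * (c + z^2) powr (-1/2 - 1))) (at z)"
  using DERIV_mult[OF DERIV_ident D[of "-1/2" z]] by (simp add: add.commute mult.commute)
 then show "(ent1 c has_real_derivative ent2 c z) (at z)"
  unfolding ent1_def ent2_def w by (simp add: algebra_simps power2_eq_square)
 show "(ent2 c has_real_derivative ent3 c z) (at z)"
  unfolding ent2_def[abs_def] ent3_def
  using DERIV_cmult[OF D[of "-3/2" z], of c] by (simp add: mult_ac)
qed

lemma ent_C2_fun:
 assumes c: "c > 0"
 shows "C2_fun (ent c) (ent1 c) (ent2 c)"
  "C2_fun (%z. sqrt c * ent1 c z) (%z. sqrt c * ent2 c z) (%z. sqrt c * ent3 c z)"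
proof -
 have nz: "c + z^2 ~= 0" for z using sq_pos[OF c, of z] by simp
 have sm: "torus_smooth (%x. ent c (f x))" "torus_smooth (%x. ent1 c (f x))" "torus_smooth (%x. ent2 c (f x))"
  if f: "torus_smooth f" for f :: "real^2 => real"
  unfolding ent_def ent1_def ent2_def by (intro torus_smooth_mult torus_smooth_const torus_smooth_powr f c)+
 have ct: "cont (ent2 c)" "cont (ent3 c)"
  unfolding ent2_def ent3_def using nz by (auto intro!: continuous_intros)
 show "C2_fun (ent c) (ent1 c) (ent2 c)"
  by standard (use ent_deriv[OF c] ct sm in auto)
 show "C2_fun (%z. sqrt c * ent1 c z) (%z. sqrt c * ent2 c z) (%z. sqrt c * ent3 c z)"
  by standard (use ent_deriv[OF c] ct sm in "auto intro!: DERIV_cmult continuous_intros torus_smooth_mult")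
qed

lemma ent_eq_sqrt: "c > 0 ==> ent c z = sqrt (c + z^2)"
 using sq_pos[of c z] by (simp add: ent_def powr_half_sqrt)

lemma ent1_eq: "c > 0 ==> ent1 c z = z / sqrt (c + z^2)"
 using sq_pos[of c z] by (simp add: ent1_def powr_minus powr_half_sqrt field_simps)

text \<open>The bound on \<open>ent3\<close> lets the dissipation of \<open>ent c\<close> control the error made in the equation for \<open>sqrt c * ent1 c (w)\<close>.\<close>
lemma ent_bounds:
 assumes c: "c > 0"
 shows "\<bar>z\<bar> <= ent c z" "ent c z <= sqrt c + \<bar>z\<bar>" "\<bar>ent1 c z\<bar> <= 1" "0 < ent2 c z"
  "\<bar>sqrt c * ent3 c z\<bar> <= 3 / 2 * ent2 c z" "sqrt c * ent2 c z <= 1"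
proof -
 note p = sq_pos[OF c, of z]
 have z: "\<bar>z\<bar> <= sqrt (c + z^2)" using c by (intro real_le_rsqrt) auto
 then show "\<bar>z\<bar> <= ent c z" by (simp add: ent_eq_sqrt c)
 show "ent c z <= sqrt c + \<bar>z\<bar>" using sqrt_add_le_add_sqrt[of c "z^2"] c by (simp add: ent_eq_sqrt)
 show "\<bar>ent1 c z\<bar> <= 1" using z p by (simp add: ent1_eq c abs_div divide_le_eq)
 show "0 < ent2 c z" using p c by (simp add: ent2_def)
 have "2 * (sqrt c * \<bar>z\<bar>) <= c + z^2"
  using sum_squares_bound[of "sqrt c" "\<bar>z\<bar>"] c by simp
 moreover have w: "(c + z^2) powr (-3/2) = (c + z^2) * (c + z^2) powr (-5/2)"
  using p by (simp add: powr_mult_base)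
 ultimately have "2 * (sqrt c * \<bar>z\<bar>) * (c + z^2) powr (-5/2) <= (c + z^2) powr (-3/2)"
  unfolding w by (intro mult_right_mono) auto
 then have "3 / 2 * c * (2 * (sqrt c * \<bar>z\<bar>) * (c + z^2) powr (-5/2)) <= 3 / 2 * c * (c + z^2) powr (-3/2)"
  using c by (intro mult_left_mono) auto
 then show "\<bar>sqrt c * ent3 c z\<bar> <= 3 / 2 * ent2 c z"
  using c by (simp add: ent3_def ent2_def abs_mult algebra_simps)
 have "(c + z^2) powr (-3/2) <= c powr (-3/2)" using c by (intro powr_mono2') auto
 then have "sqrt c * ent2 c z <= sqrt c * (c * c powr (-3/2))" using c unfolding ent2_def by (intro mult_left_mono) auto
 also have "... = c powr (1/2) * c powr (1 + (-3/2))" using c by (simp add: powr_half_sqrt powr_mult_base)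
 also have "... = 1" using c by (simp flip: powr_add)
 finally show "sqrt c * ent2 c z <= 1" .
qed

lemma grad_const [simp]: "grad (%x. c) x = 0" "laplacian (%x. c) x = 0"
proof -
 have "partial i (%x. c) = (%x. 0)" for i by auto
 then show "grad (%x. c) x = 0" "laplacian (%x. c) x = 0" by (simp_all add: grad_def laplacian_def vec_eq_iff)
qed

lemma torus_LINT_bound:
 fixes f :: "real^2 => real"
 assumes "!!x. x \<in> torus ==> \<bar>f x\<bar> <= C" "0 <= C"
 shows "\<bar>avg f\<bar> <= C"
proof (cases "L1 f")
 case True
 have "\<bar>avg f\<bar> <= (AV x. \<bar>f x\<bar>)" by (rule integral_abs_bound)
 also have "... <= (AV x. C)"
  using True assms by (intro integral_mono) auto
 also have "... = C" by simp
 finally show ?thesis .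
qed (use assms in "simp add: not_integrable_integral_eq")

context ns_solution
begin

text \<open>The balance law with weight one: only the dissipation survives.\<close>
lemma entropy_dissipation:
 assumes C2: "C2_fun B B' B''" and st: "0 <= s" "s <= t" "t <= T"
 shows "((%\<tau>. \<nu> * (AV x. B'' (w \<tau> x) * (norm (grad (w \<tau>) x))^2)) has_integral
   (AV x. B (w s x)) - (AV x. B (w t x))) {s..t}"
 using has_integral_neg[OF evolution[OF C2 torus_smooth_const[of 0] torus_smooth_const[of 1] st]]
 by (simp add: conv_flux_def[OF C2 torus_smooth_const[of 0] torus_smooth_const[of 1]]
   conv_source_def[OF C2 torus_smooth_const[of 0] torus_smooth_const[of 1]]
   visc_term_def[OF C2 torus_smooth_const[of 0] torus_smooth_const[of 1]]
   dissip_def[OF C2 torus_smooth_const[of 0] torus_smooth_const[of 1]])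

lemma entropy_decreasing:
 assumes C2: "C2_fun B B' B''" and convex: "!!z. B'' z >= 0" and st: "0 <= s" "s <= t" "t <= T"
 shows "(AV x. B (w t x)) <= (AV x. B (w s x))"
proof -
 have "0 <= (AV x. B (w s x)) - (AV x. B (w t x))"
  by (rule has_integral_nonneg[OF entropy_dissipation[OF C2 st]])
    (use \<nu> convex in "auto intro!: mult_nonneg_nonneg integral_nonneg")
 then show ?thesis by simp
qed

lemma initial: "w 0 x = wi x"
 using ns by (simp add: navier_stokes_solution_def)

text \<open>The entropies \<open>(c + z\<^sup>2) powr (p/2)\<close> are convex and decrease to \<open>\<bar>z\<bar> powr p\<close> as \<open>c\<close> tends to zero.\<close>
lemma Lp_contraction:
 assumes p: "p >= 1" and t: "t \<in> {0..T}"
 shows "(AV x. \<bar>w t x\<bar> powr p) <= (AV x. \<bar>wi x\<bar> powr p)"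
proof -
 let ?q = "p / 2"
 have cv: "0 <= 2 * ?q * (c + z^2) powr (?q - 1) + 4 * ?q * (?q - 1) * z^2 * (c + z^2) powr (?q - 2)" if c: "c > 0" for c z :: real
 proof -
  have w: "(c + z^2) powr (?q - 1) = (c + z^2) * (c + z^2) powr (?q - 2)"
   using sq_pos[OF c, of z] by (simp add: powr_mult_base)
  have "2 * ?q * (c + z^2) powr (?q - 1) + 4 * ?q * (?q - 1) * z^2 * (c + z^2) powr (?q - 2)
   = (c + z^2) powr (?q - 2) * (p * (c + (p - 1) * z^2))" unfolding w by (simp add: algebra_simps)
  also have "... >= 0" using p c by (intro mult_nonneg_nonneg add_nonneg_nonneg) auto
  finally show ?thesis by simp
 qed
 let ?c = "%n. 1 / real (Suc n)"
 have le: "(AV x. \<bar>w t x\<bar> powr p) <= (AV x. (?c n + (wi x)^2) powr ?q)" for n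
 proof -
  have c: "?c n > 0" by simp
  have w: "torus_smooth (w t)" by (rule w_smooth[OF t])
  have "(AV x. \<bar>w t x\<bar> powr p) <= (AV x. (?c n + (w t x)^2) powr ?q)"
  proof (rule integral_mono)
   have "cont (%x. \<bar>w t x\<bar> powr p)"
    using smooth_cont[OF w] p by (intro continuous_on_powr' continuous_intros) auto
   then show "L1 (%x. \<bar>w t x\<bar> powr p)" by (rule cont_L1)
   show "L1 (%x. (?c n + (w t x)^2) powr ?q)"
    by (intro smooth_L1 torus_smooth_powr w c)
   fix x
   have "\<bar>w t x\<bar> powr p = ((w t x)^2) powr ?q"
    by (simp only: sq_powr_half)
   also have "... <= (?c n + (w t x)^2) powr ?q" using p by (intro powr_mono2) auto
   finally show "\<bar>w t x\<bar> powr p <= (?c n + (w t x)^2) powr ?q" .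
  qed
  also have "... <= (AV x. (?c n + (w 0 x)^2) powr ?q)"
   by (rule entropy_decreasing[OF powr_C2_fun[OF c] cv[OF c]]) (use t in auto)
  finally show ?thesis by (simp add: initial)
 qed
 have w: "torus_smooth wi" using w_smooth[of 0] T ext[of "w 0" wi, OF initial] by simp
 obtain K where K: "!!x. \<bar>wi x\<bar> <= K" using torus_smooth_bounded[OF w] by (auto)
 have "(%n. AV x. (?c n + (wi x)^2) powr ?q) ----> (AV x. \<bar>wi x\<bar> powr p)"
 proof (rule integral_dominated_convergence[where w="%x. (1 + K^2) powr ?q"])
  show "(%x. (?c n + (wi x)^2) powr ?q) \<in> TBorel" for n
   by (intro smooth_measurable torus_smooth_powr w) simp
  show "(%x. \<bar>wi x\<bar> powr p) \<in> TBorel"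
   using smooth_measurable[OF w] by measurable
  show "AE x in TM. (%n. (?c n + (wi x)^2) powr ?q) ----> \<bar>wi x\<bar> powr p"
  proof (rule AE_I2)
   fix x
   have "(%n. (?c n + (wi x)^2) powr ?q) ----> (0 + (wi x)^2) powr ?q"
    using p by (intro tendsto_powr' tendsto_intros LIMSEQ_Suc[OF lim_1_over_n]) auto
   moreover have "(0 + (wi x)^2) powr ?q = \<bar>wi x\<bar> powr p"
    by (simp add: sq_powr_half)
   ultimately show "(%n. (?c n + (wi x)^2) powr ?q) ----> \<bar>wi x\<bar> powr p" by simp
  qed
  show "AE x in TM. norm ((?c n + (wi x)^2) powr ?q) <= (1 + K^2) powr ?q" for n
  proof (rule AE_I2)
   fix x
   have "(wi x)^2 <= K^2" using K[of x] by (metis abs_ge_zero power2_abs power_mono)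
   then have "(?c n + (wi x)^2) powr ?q <= (1 + K^2) powr ?q"
    using p by (intro powr_mono2 add_mono) (auto simp: divide_le_eq)
   then show "norm ((?c n + (wi x)^2) powr ?q) <= (1 + K^2) powr ?q" by simp
  qed
 qed simp
 then show ?thesis by (rule LIMSEQ_le_const) (use le in auto)
qed

definition speed :: "real => real" where "speed \<tau> = (AV x. norm (u \<tau> x))"

lemma speed_continuous: "continuous_on {0..T} speed"
 unfolding speed_def by (intro slab_LINT_continuous continuous_on_norm u_continuous)

text \<open>The substitute for continuity in time: along the flow the \<open>L\<^sup>1\<close> distance to a fixed smooth function grows at most by the
transport and the diffusion of that function. The proof uses the entropy \<open>ent c\<close> with \<open>c\<close> tending to zero, so that no power of the velocity beyond the first appears.\<close>
lemma L1_stability: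
 assumes \<phi>: "torus_smooth \<phi>" and L: "!!x. norm (grad \<phi> x) <= L" "!!x. \<bar>laplacian \<phi> x\<bar> <= L"
  and st: "0 <= s" "s <= t" "t <= T"
 shows "(AV x. \<bar>w t x - \<phi> x\<bar>) <= (AV x. \<bar>w s x - \<phi> x\<bar>)
  + L * integral {s..t} speed + \<nu> * L * (t - s)"
proof -
 have L0: "L >= 0" using L(1) norm_ge_zero order_trans by blast
 have sp: "speed integrable_on {s..t}"
  by (rule integrable_continuous_real) (rule continuous_on_subset[OF speed_continuous], use st in auto)
 have st': "s \<in> {0..T}" "t \<in> {0..T}" using st by auto
 have main: "(AV x. \<bar>w t x - \<phi> x\<bar>) <= sqrt c + (AV x. \<bar>w s x - \<phi> x\<bar>)
  + L * integral {s..t} speed + \<nu> * L * (t - s)" if c: "c > 0" for c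
 proof -
  note E = ent_C2_fun(1)[OF c] \<phi> torus_smooth_const[of 1]
  have f: "torus_smooth (%x. w \<tau> x - \<phi> x)" if "\<tau> \<in> {0..T}" for \<tau> by (intro torus_smooth_diff w_smooth that \<phi>)
  have "(AV x. ent c (w t x - \<phi> x) * 1) - (AV x. ent c (w s x - \<phi> x) * 1)
    <= L * integral {s..t} speed + \<nu> * L * (t - s)"
  proof (rule has_integral_le[OF evolution[OF E st]])
   show "((%\<tau>. L * speed \<tau> + \<nu> * L) has_integral L * integral {s..t} speed + \<nu> * L * (t - s)) {s..t}"
    using has_integral_const_real[of "\<nu> * L" s t] st
    by (intro has_integral_add has_integral_mult_right integrable_integral sp) (simp add: mult.commute)
   fix \<tau> assume "\<tau> \<in> {s..t}"
   then have \<tau>: "\<tau> \<in> {0..T}" using st by auto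
   have 1: "conv_flux (ent c) \<phi> (%x. 1) \<tau> = 0" by (simp add: conv_flux_def[OF E])
   have 2: "0 <= dissip (ent2 c) \<phi> (%x. 1) \<tau>" unfolding dissip_def[OF E]
    using ent_bounds(4)[OF c] by (intro integral_nonneg) (simp add: less_imp_le)
   have 3: "visc_term (ent c) (ent1 c) \<phi> (%x. 1) \<tau> <= L"
   proof -
    have "\<bar>visc_term (ent c) (ent1 c) \<phi> (%x. 1) \<tau>\<bar> <= L" unfolding visc_term_def[OF E]
    proof (rule torus_LINT_bound[OF _ L0])
     fix x have "\<bar>ent1 c (w \<tau> x - \<phi> x)\<bar> * \<bar>laplacian \<phi> x\<bar> <= 1 * L"
      using L ent_bounds(3)[OF c] by (intro mult_mono) auto
     then show "\<bar>ent c (w \<tau> x - \<phi> x) * laplacian (%x. 1) x + ent1 c (w \<tau> x - \<phi> x) * 1 * laplacian \<phi> x\<bar> <= L"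
      by (simp add: abs_mult)
    qed
    then show ?thesis by simp
   qed
   have 4: "- conv_source (ent1 c) \<phi> (%x. 1) \<tau> <= L * speed \<tau>"
   proof -
    note uc = slab_slice_continuous[OF u_continuous \<tau>]
    have "\<bar>conv_source (ent1 c) \<phi> (%x. 1) \<tau>\<bar> <= (AV x. L * norm (u \<tau> x))"
     unfolding conv_source_def[OF E]
    proof (rule order_trans[OF integral_abs_bound], rule integral_mono)
     show "L1 (%x. L * norm (u \<tau> x))"
      by (intro cont_L1 continuous_intros uc)
     show "L1 (%x. \<bar>1 * ent1 c (w \<tau> x - \<phi> x) * (u \<tau> x \<bullet> grad \<phi> x)\<bar>)"
      by (intro cont_L1 continuous_intros uc continuous_grad \<phi>
        smooth_cont[OF C2_fun.smooth(2)[OF E(1) f[OF \<tau>]]])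
     fix x
     have "\<bar>u \<tau> x \<bullet> grad \<phi> x\<bar> <= norm (u \<tau> x) * L"
      using Cauchy_Schwarz_ineq2[of "u \<tau> x" "grad \<phi> x"] mult_left_mono[OF L(1)[of x], of "norm (u \<tau> x)"] by simp
     then have "\<bar>ent1 c (w \<tau> x - \<phi> x)\<bar> * \<bar>u \<tau> x \<bullet> grad \<phi> x\<bar> <= 1 * (norm (u \<tau> x) * L)"
      using ent_bounds(3)[OF c] by (intro mult_mono) auto
     then show "\<bar>1 * ent1 c (w \<tau> x - \<phi> x) * (u \<tau> x \<bullet> grad \<phi> x)\<bar> <= L * norm (u \<tau> x)"
      by (simp add: abs_mult mult.commute)
    qed
    then show ?thesis by (simp add: speed_def)
   qed
   have "\<nu> * visc_term (ent c) (ent1 c) \<phi> (%x. 1) \<tau> <= \<nu> * L" "0 <= \<nu> * dissip (ent2 c) \<phi> (%x. 1) \<tau>"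
    using 2 3 \<nu> by auto
   with 1 4 show "conv_flux (ent c) \<phi> (%x. 1) \<tau> - conv_source (ent1 c) \<phi> (%x. 1) \<tau>
     + \<nu> * visc_term (ent c) (ent1 c) \<phi> (%x. 1) \<tau> - \<nu> * dissip (ent2 c) \<phi> (%x. 1) \<tau> <= L * speed \<tau> + \<nu> * L" by linarith
  qed
  moreover have "(AV x. \<bar>w t x - \<phi> x\<bar>) <= (AV x. ent c (w t x - \<phi> x))"
  proof (rule integral_mono)
   show "L1 (%x. \<bar>w t x - \<phi> x\<bar>)"
    by (intro cont_L1 continuous_on_rabs smooth_cont f st')
  qed (use ent_bounds(1)[OF c] in "auto intro!: smooth_L1 C2_fun.smooth(1)[OF E(1)] f st'")
  moreover have "(AV x. ent c (w s x - \<phi> x)) <= (AV x. sqrt c + \<bar>w s x - \<phi> x\<bar>)"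
  proof (rule integral_mono)
   show "L1 (%x. sqrt c + \<bar>w s x - \<phi> x\<bar>)"
    by (intro cont_L1 continuous_on_add continuous_on_const continuous_on_rabs smooth_cont f st')
  qed (use ent_bounds(2)[OF c] in "auto intro!: smooth_L1 C2_fun.smooth(1)[OF E(1)] f st'")
  moreover have "(AV x. sqrt c + \<bar>w s x - \<phi> x\<bar>) = sqrt c + (AV x. \<bar>w s x - \<phi> x\<bar>)"
  proof -
   have "L1 (%x. \<bar>w s x - \<phi> x\<bar>)"
    by (intro cont_L1 continuous_on_rabs smooth_cont f st')
   then show ?thesis by (subst integral_add) auto
  qed
  ultimately show ?thesis by simp
 qed
 show ?thesis
 proof (rule field_le_epsilon)
  fix e :: real assume "e > 0"
  then show "(AV x. \<bar>w t x - \<phi> x\<bar>) <= (AV x. \<bar>w s x - \<phi> x\<bar>)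
  + L * integral {s..t} speed + \<nu> * L * (t - s) + e" using main[of "e^2"] by simp
 qed
qed

text \<open>Along Navier-Stokes the truncated vorticity solves a transport equation up to an error controlled by the entropy that is
lost between \<open>s\<close> and \<open>t\<close>. This loss, unlike a viscosity times a norm of the gradient, is known to vanish in the limit.\<close>
lemma truncated_mode_evolution:
 assumes c: "c > 0" and e: "torus_smooth e" and E: "!!x. \<bar>e x\<bar> <= E" "!!x. \<bar>laplacian e x\<bar> <= E"
  and st: "0 <= s" "s <= t" "t <= T"
 defines "\<theta> \<equiv> %\<tau> x. sqrt c * ent1 c (w \<tau> x)"
 defines "a \<equiv> %\<tau>. AV x. \<theta> \<tau> x * e x"
 defines "b \<equiv> %\<tau>. AV x. \<theta> \<tau> x * (u \<tau> x \<bullet> grad e x)"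
 shows "\<bar>(a t)^2 - (a s)^2 - integral {s..t} (%\<tau>. 2 * a \<tau> * b \<tau>)\<bar>
  <= 2 * sqrt c * E * (\<nu> * (sqrt c * E) * (t - s)
    + 3 / 2 * E * ((AV x. ent c (w s x)) - (AV x. ent c (w t x))))"
  and "continuous_on {0..T} a" and "continuous_on {0..T} b"
  and "!!\<tau>. \<bar>a \<tau>\<bar> <= sqrt c * E"
proof -
 note C = ent_C2_fun(2)[OF c] torus_smooth_const[of 0] e
 have E0: "E >= 0" using E(1) abs_ge_zero order_trans by blast
 have th: "\<bar>\<theta> \<tau> x\<bar> <= sqrt c" for \<tau> x
  unfolding \<theta>_def using ent_bounds(3)[OF c] c by (simp add: abs_mult mult_left_le)
 let ?V = "visc_term (%z. sqrt c * ent1 c z) (%z. sqrt c * ent2 c z) (%x. 0) e"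
 let ?D = "dissip (%z. sqrt c * ent3 c z) (%x. 0) e"
 have fl: "conv_flux (%z. sqrt c * ent1 c z) (%x. 0) e \<tau> = b \<tau>" for \<tau>
  by (simp add: conv_flux_def[OF C] b_def \<theta>_def)
 have so: "conv_source (%z. sqrt c * ent2 c z) (%x. 0) e \<tau> = 0" for \<tau>
  by (simp add: conv_source_def[OF C])
 show ac: "continuous_on {0..T} a" using evolution_derivative(1)[OF C] by (simp add: a_def \<theta>_def)
 show bc: "continuous_on {0..T} b" using evolution_continuous(1)[OF C] unfolding fl[abs_def] .
 have ab: "\<bar>a \<tau>\<bar> <= sqrt c * E" for \<tau>
  unfolding a_def using th E E0 c by (intro torus_LINT_bound) (auto simp: abs_mult intro!: mult_mono)
 then show "!!\<tau>. \<bar>a \<tau>\<bar> <= sqrt c * E" .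
 have I1: "((%\<tau>. 2 * a \<tau> * (b \<tau> + \<nu> * ?V \<tau> - \<nu> * ?D \<tau>)) has_integral ((a t)^2 - (a s)^2)) {s..t}"
  using evolution_square[OF C st] unfolding fl so a_def \<theta>_def by simp
 have I2: "((%\<tau>. 2 * a \<tau> * b \<tau>) has_integral integral {s..t} (%\<tau>. 2 * a \<tau> * b \<tau>)) {s..t}"
  by (intro integrable_integral integrable_continuous_real continuous_intros)
    (use ac bc st in "auto intro: continuous_on_subset")
 let ?S = "%\<tau>. AV x. ent2 c (w \<tau> x) * (norm (grad (w \<tau>) x))^2"
 have I4: "((%\<tau>. 2 * sqrt c * E * (\<nu> * (sqrt c * E)) + 2 * sqrt c * E * (3 / 2 * E) * (\<nu> * ?S \<tau>)) has_integral
   (2 * sqrt c * E * (\<nu> * (sqrt c * E)) * (t - s) + 2 * sqrt c * E * (3 / 2 * E) *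
    ((AV x. ent c (w s x)) - (AV x. ent c (w t x))))) {s..t}"
  using has_integral_const_real[of "2 * sqrt c * E * (\<nu> * (sqrt c * E))" s t] st
  by (intro has_integral_add has_integral_mult_right entropy_dissipation[OF ent_C2_fun(1)[OF c]]) (simp_all add: mult.commute)
 have "norm (((a t)^2 - (a s)^2) - integral {s..t} (%\<tau>. 2 * a \<tau> * b \<tau>)) <=
   (2 * sqrt c * E * (\<nu> * (sqrt c * E)) * (t - s) + 2 * sqrt c * E * (3 / 2 * E) *
    ((AV x. ent c (w s x)) - (AV x. ent c (w t x))))"
  unfolding integral_unique[OF has_integral_diff[OF I1 I2], symmetric] integral_unique[OF I4, symmetric]
 proof (rule integral_norm_bound_integral)
  show "(%\<tau>. 2 * a \<tau> * (b \<tau> + \<nu> * ?V \<tau> - \<nu> * ?D \<tau>) - 2 * a \<tau> * b \<tau>) integrable_on {s..t}"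
   using has_integral_diff[OF I1 I2] by blast
  show "(%\<tau>. 2 * sqrt c * E * (\<nu> * (sqrt c * E)) + 2 * sqrt c * E * (3 / 2 * E) * (\<nu> * ?S \<tau>)) integrable_on {s..t}"
   using I4 by blast
  fix \<tau> assume "\<tau> \<in> {s..t}"
  then have \<tau>: "\<tau> \<in> {0..T}" using st by auto
  have V: "\<bar>?V \<tau>\<bar> <= sqrt c * E" unfolding visc_term_def[OF C]
  proof (rule torus_LINT_bound)
   fix x
   have "\<bar>\<theta> \<tau> x\<bar> * \<bar>laplacian e x\<bar> <= sqrt c * E" using th E c by (intro mult_mono) auto
   then show "\<bar>sqrt c * ent1 c (w \<tau> x - 0) * laplacian e x + sqrt c * ent2 c (w \<tau> x - 0) * e x * laplacian (%x. 0) x\<bar> <= sqrt c * E"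
    by (simp add: \<theta>_def abs_mult)
  qed (use c E0 in simp)
  have gc: "cont (grad (w \<tau>))" by (intro continuous_grad w_smooth \<tau>)
  have D: "\<bar>?D \<tau>\<bar> <= 3 / 2 * E * ?S \<tau>"
  proof -
   have "\<bar>?D \<tau>\<bar> <= (AV x. (3 / 2 * E) * (ent2 c (w \<tau> x) * (norm (grad (w \<tau>) x))^2))"
    unfolding dissip_def[OF C]
   proof (rule order_trans[OF integral_abs_bound], rule integral_mono)
    have 1: "cont (%x. sqrt c * ent3 c (w \<tau> x))"
     by (intro cont_compose[OF C2_fun.B''[OF C(1)]] smooth_cont w_smooth \<tau>)
    show "L1 (%x. \<bar>e x * (sqrt c * ent3 c (w \<tau> x - 0)) * (norm (grad (%x. w \<tau> x - 0) x))^2\<bar>)"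
     using gc smooth_cont[OF e, of UNIV] 1 by (intro cont_L1) (auto intro!: continuous_intros)
    have 2: "cont (%x. ent2 c (w \<tau> x))"
     by (intro cont_compose[OF C2_fun.B''[OF ent_C2_fun(1)[OF c]]] smooth_cont w_smooth \<tau>)
    show "L1 (%x. (3 / 2 * E) * (ent2 c (w \<tau> x) * (norm (grad (w \<tau>) x))^2))"
     using gc 2 by (intro cont_L1) (auto intro!: continuous_intros)
    fix x
    have "\<bar>e x\<bar> * \<bar>sqrt c * ent3 c (w \<tau> x)\<bar> <= E * (3 / 2 * ent2 c (w \<tau> x))"
     using E(1) E0 ent_bounds(5)[OF c] by (intro mult_mono) auto
    from mult_right_mono[OF this, of "(norm (grad (w \<tau>) x))^2"]
    show "\<bar>e x * (sqrt c * ent3 c (w \<tau> x - 0)) * (norm (grad (%x. w \<tau> x - 0) x))^2\<bar>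
     <= (3 / 2 * E) * (ent2 c (w \<tau> x) * (norm (grad (w \<tau>) x))^2)"
     by (simp add: abs_mult mult_ac)
   qed
   then show ?thesis by simp
  qed
  have "\<bar>\<nu> * ?V \<tau> - \<nu> * ?D \<tau>\<bar> <= \<nu> * (sqrt c * E) + 3 / 2 * E * (\<nu> * ?S \<tau>)"
  proof -
   have "\<nu> * \<bar>?V \<tau>\<bar> <= \<nu> * (sqrt c * E)" "\<nu> * \<bar>?D \<tau>\<bar> <= \<nu> * (3 / 2 * E * ?S \<tau>)"
    using mult_left_mono[OF V, of \<nu>] mult_left_mono[OF D, of \<nu>] \<nu> by auto
   moreover have "\<bar>\<nu> * ?V \<tau> - \<nu> * ?D \<tau>\<bar> <= \<nu> * \<bar>?V \<tau>\<bar> + \<nu> * \<bar>?D \<tau>\<bar>"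
    using abs_triangle_ineq4[of "\<nu> * ?V \<tau>" "\<nu> * ?D \<tau>"] \<nu> by (simp add: abs_mult)
   moreover have "\<nu> * (3 / 2 * E * ?S \<tau>) = 3 / 2 * E * (\<nu> * ?S \<tau>)" by simp
   ultimately show ?thesis by linarith
  qed
  then have "\<bar>2 * a \<tau>\<bar> * \<bar>\<nu> * ?V \<tau> - \<nu> * ?D \<tau>\<bar> <= (2 * (sqrt c * E)) * (\<nu> * (sqrt c * E) + 3 / 2 * E * (\<nu> * ?S \<tau>))"
   using ab[of \<tau>] E0 c by (intro mult_mono) auto
  moreover have eq: "2 * a \<tau> * (b \<tau> + \<nu> * ?V \<tau> - \<nu> * ?D \<tau>) - 2 * a \<tau> * b \<tau> = (2 * a \<tau>) * (\<nu> * ?V \<tau> - \<nu> * ?D \<tau>)"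
   by (simp add: algebra_simps)
  moreover have "(2 * (sqrt c * E)) * (\<nu> * (sqrt c * E) + 3 / 2 * E * (\<nu> * ?S \<tau>))
    = 2 * sqrt c * E * (\<nu> * (sqrt c * E)) + 2 * sqrt c * E * (3 / 2 * E) * (\<nu> * ?S \<tau>)"
   by (simp add: algebra_simps)
  ultimately show "norm (2 * a \<tau> * (b \<tau> + \<nu> * ?V \<tau> - \<nu> * ?D \<tau>) - 2 * a \<tau> * b \<tau>)
   <= 2 * sqrt c * E * (\<nu> * (sqrt c * E)) + 2 * sqrt c * E * (3 / 2 * E) * (\<nu> * ?S \<tau>)"
   unfolding eq real_norm_def abs_mult[of "2 * a \<tau>"] by (simp only:)
 qed
 then show "\<bar>(a t)^2 - (a s)^2 - integral {s..t} (%\<tau>. 2 * a \<tau> * b \<tau>)\<bar>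
  <= 2 * sqrt c * E * (\<nu> * (sqrt c * E) * (t - s)
    + 3 / 2 * E * ((AV x. ent c (w s x)) - (AV x. ent c (w t x))))"
  by (simp add: algebra_simps)
qed

end

section \<open>A positive trigonometric kernel\<close>

text \<open>Normalisation of the kernel \<open>cos (\<pi> s) ^ (2 n)\<close>. This kernel is chosen because it is positive, concentrates at the
integers, is a finite sum of products of modes, and has moments that follow from the recursion for the Wallis integrals.\<close>
definition wallis :: "nat => real" where "wallis n = integral {0..1} (%s. cos (pi * s) ^ (2 * n))"

lemma cos_pow_int [simp]: "(%s. cos (pi * s) ^ m) integrable_on {0..1::real}"
 by (intro integrable_continuous_real continuous_intros)

lemma wallis_rec: "(2 * real n + 2) * wallis (Suc n) = (2 * real n + 1) * wallis n"
proof -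
 have "((%s. pi * ((2 * real n + 2) * cos (pi * s) ^ (2 * Suc n) - (2 * real n + 1) * cos (pi * s) ^ (2 * n))) has_integral
   (sin (pi * 1) * cos (pi * 1) ^ (2 * n + 1) - sin (pi * 0) * cos (pi * 0) ^ (2 * n + 1))) {0..1}"
 proof (rule fundamental_theorem_of_calculus)
  fix s :: real
  have S: "((%s. sin (pi * s)) has_real_derivative cos (pi * s) * pi) (at s)"
   and C: "((%s. cos (pi * s)) has_real_derivative - sin (pi * s) * pi) (at s)"
   by (auto intro!: derivative_eq_intros)
  have sq: "sin (pi * s) * sin (pi * s) = 1 - cos (pi * s) * cos (pi * s)"
   using sin_cos_squared_add[of "pi * s"] by (simp add: power2_eq_square)
  have "cos (pi * s) * pi * cos (pi * s) ^ (2 * n + 1)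
    + real (2 * n + 1) * (- sin (pi * s) * pi * cos (pi * s) ^ (2 * n + 1 - Suc 0)) * sin (pi * s)
   = cos (pi * s) * pi * cos (pi * s) ^ (2 * n + 1)
    - real (2 * n + 1) * pi * cos (pi * s) ^ (2 * n) * (sin (pi * s) * sin (pi * s))" by simp
  also have "... = pi * ((2 * real n + 2) * cos (pi * s) ^ (2 * Suc n) - (2 * real n + 1) * cos (pi * s) ^ (2 * n))"
   unfolding sq by (simp add: algebra_simps)
  finally have "((%s. sin (pi * s) * cos (pi * s) ^ (2 * n + 1)) has_real_derivative
    pi * ((2 * real n + 2) * cos (pi * s) ^ (2 * Suc n) - (2 * real n + 1) * cos (pi * s) ^ (2 * n))) (at s)"
   by (rule DERIV_cong[OF DERIV_mult[OF S DERIV_power[OF C]]])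
  then show "((%s. sin (pi * s) * cos (pi * s) ^ (2 * n + 1)) has_vector_derivative
    pi * ((2 * real n + 2) * cos (pi * s) ^ (2 * Suc n) - (2 * real n + 1) * cos (pi * s) ^ (2 * n))) (at s within {0..1})"
   by (simp add: real_iff_vector_derivative has_vector_derivative_at_within)
 qed simp
 then have "((%s. pi * ((2 * real n + 2) * cos (pi * s) ^ (2 * Suc n) - (2 * real n + 1) * cos (pi * s) ^ (2 * n))) has_integral 0) {0..1}"
  by simp
 from integral_unique[OF this]
 have "(2 * real n + 2) * wallis (Suc n) - (2 * real n + 1) * wallis n = 0"
 proof -
  let ?f = "%s. (2 * real n + 2) * cos (pi * s) ^ (2 * Suc n)" and ?g = "%s. (2 * real n + 1) * cos (pi * s) ^ (2 * n)"
  assume "integral {0..1} (%s. pi * (?f s - ?g s)) = 0"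
  then have "integral {0..1} (%s. ?f s - ?g s) = 0" by (simp only: integral_mult_right mult_eq_0_iff pi_neq_zero simp_thms)
  moreover have "integral {0..1} (%s. ?f s - ?g s) = integral {0..1} ?f - integral {0..1} ?g"
   by (intro Henstock_Kurzweil_Integration.integral_diff integrable_continuous_real continuous_intros)
  ultimately show ?thesis unfolding wallis_def by (simp only: integral_mult_right)
 qed
 then show ?thesis by simp
qed

lemma wallis_pos: "wallis n > 0"
proof (induction n)
 case 0 show ?case by (simp add: wallis_def)
next
 case (Suc n)
 then have "(2 * real n + 2) * wallis (Suc n) > 0" unfolding wallis_rec by simp
 then show ?case by (simp add: zero_less_mult_iff)
qed

definition kap :: "nat => real => real" where "kap n s = cos (pi * s) ^ (2 * n) / wallis n"
definition kap' :: "nat => real => real"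
 where "kap' n s = - (2 * real n * pi) * cos (pi * s) ^ (2 * n - 1) * sin (pi * s) / wallis n"

lemma kap_nonneg: "kap n s >= 0"
 using wallis_pos[of n] by (simp add: kap_def power_mult)

lemma kap_DERIV: "(kap n has_real_derivative kap' n s) (at s)"
proof -
 have C: "((%s. cos (pi * s)) has_real_derivative - sin (pi * s) * pi) (at s)"
  by (auto intro!: derivative_eq_intros)
 show ?thesis unfolding kap_def[abs_def] kap'_def
  by (rule DERIV_cong[OF DERIV_cdivide[OF DERIV_power[OF C]]]) simp
qed

lemma kap_continuous [continuous_intros]:
 "continuous_on S f ==> continuous_on S (%x. kap n (f x))" "continuous_on S f ==> continuous_on S (%x. kap' n (f x))"
proof -
 have "cont (kap n)" using kap_DERIV by (meson DERIV_isCont continuous_at_imp_continuous_on)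
 then show "continuous_on S f ==> continuous_on S (%x. kap n (f x))" by (rule cont_compose)
 have "cont (%s. (- (2 * real n * pi) * cos (pi * s) ^ (2 * n - 1) * sin (pi * s)) * (1 / wallis n))"
  by (intro continuous_intros)
 then have "cont (kap' n)" unfolding kap'_def[abs_def] by simp
 then show "continuous_on S f ==> continuous_on S (%x. kap' n (f x))" by (rule cont_compose)
qed

lemma cos_sin2: "cos t ^ (2 * n) * (sin t)^2 = cos t ^ (2 * n) - cos t ^ (2 * Suc n)" for t :: real
 by (simp add: sin_squared_eq right_diff_distrib flip: power_add)

lemma kap_integral: "integral {0..1} (kap n) = 1"
 using wallis_pos[of n] unfolding kap_def[abs_def] by (simp add: wallis_def)

lemma kap_sin2: "integral {0..1} (%s. kap n s * (sin (pi * s))^2) = 1 / (2 * real n + 2)"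
proof -
 have "integral {0..1} (%s. kap n s * (sin (pi * s))^2) = integral {0..1} (%s. cos (pi * s) ^ (2 * n) / wallis n - cos (pi * s) ^ (2 * Suc n) / wallis n)"
  by (rule Henstock_Kurzweil_Integration.integral_cong)
    (simp only: kap_def times_divide_eq_left cos_sin2 diff_divide_distrib)
 also have "... = (wallis n - wallis (Suc n)) / wallis n"
  unfolding wallis_def by (subst Henstock_Kurzweil_Integration.integral_diff) (auto simp: diff_divide_distrib intro: integrable_on_divide simp del: mult_Suc_right power_Suc)
 also have "... = 1 / (2 * real n + 2)"
  using wallis_rec[of n] wallis_pos[of n] by (simp add: field_simps)
 finally show ?thesis .
qed

lemma weighted_am_gm: "2 * r * (a * b) <= a^2 + r^2 * b^2" for a b r :: real
 using sum_squares_bound[of a "r * b"] by (simp add: power_mult_distrib mult_ac)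

lemma kap_sin:
 assumes n: "n >= 1" shows "integral {0..1} (%s. kap n s * \<bar>sin (pi * s)\<bar>) <= 1 / sqrt n"
proof -
 have sn: "sqrt n > 0" using n by simp
 have *: "(1 + r^2 * b) / (2 * r) = 1 / (2 * r) + (r / 2) * b" if "r > 0" for r b :: real
  using that by (simp add: field_simps power2_eq_square)
 have "integral {0..1} (%s. kap n s * \<bar>sin (pi * s)\<bar>) <= integral {0..1} (%s. (1 / (2 * sqrt n)) * kap n s + (sqrt n / 2) * (kap n s * (sin (pi * s))^2))"
 proof (rule integral_le)
  fix s :: real
  have "2 * sqrt n * (1 * \<bar>sin (pi * s)\<bar>) <= 1^2 + (sqrt n)^2 * \<bar>sin (pi * s)\<bar>^2" by (rule weighted_am_gm)
  then have "(2 * sqrt n * \<bar>sin (pi * s)\<bar>) / (2 * sqrt n) <= (1 + (sqrt n)^2 * (sin (pi * s))^2) / (2 * sqrt n)"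
   using sn by (intro divide_right_mono) auto
  also have "... = 1 / (2 * sqrt n) + (sqrt n / 2) * (sin (pi * s))^2"
   by (rule *[OF sn])
  finally have "\<bar>sin (pi * s)\<bar> <= 1 / (2 * sqrt n) + (sqrt n / 2) * (sin (pi * s))^2" using sn by simp
  from mult_left_mono[OF this kap_nonneg[of n s]]
  show "kap n s * \<bar>sin (pi * s)\<bar> <= (1 / (2 * sqrt n)) * kap n s + (sqrt n / 2) * (kap n s * (sin (pi * s))^2)"
   by (simp add: algebra_simps)
 qed (intro integrable_continuous_real continuous_intros)+
 also have "... = 1 / (2 * sqrt n) + (sqrt n / 2) * (1 / (2 * real n + 2))"
  by (subst Henstock_Kurzweil_Integration.integral_add, (intro integrable_continuous_real continuous_intros)+)
    (simp only: integral_mult_right kap_integral kap_sin2 mult_1_right)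
 also have "(sqrt n / 2) * (1 / (2 * real n + 2)) <= (sqrt n / 2) * (1 / real n)"
  using n by (intro mult_left_mono) (auto simp: field_simps)
 also have "(sqrt n / 2) * (1 / real n) = 1 / (2 * sqrt n)" using n by (simp add: field_simps real_sqrt_mult_self flip: power2_eq_square)
 finally show ?thesis by simp
qed

lemma cos_sin2_int:
 assumes n: "n >= 1"
 shows "integral {0..1} (%s. cos (pi * s) ^ (2 * (n - 1)) * (sin (pi * s))^2) = wallis n / (2 * real n - 1)"
proof -
 obtain m where m: "n = Suc m" using n by (cases n) auto
 have "integral {0..1} (%s. cos (pi * s) ^ (2 * (n - 1)) * (sin (pi * s))^2) = integral {0..1} (%s. cos (pi * s) ^ (2 * m) - cos (pi * s) ^ (2 * Suc m))"
 proof (rule Henstock_Kurzweil_Integration.integral_cong)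
  fix s :: real
  have "2 * (n - 1) = 2 * m" by (simp add: m)
  then show "cos (pi * s) ^ (2 * (n - 1)) * (sin (pi * s))^2 = cos (pi * s) ^ (2 * m) - cos (pi * s) ^ (2 * Suc m)"
   by (simp only: cos_sin2)
 qed
 also have "... = wallis m - wallis (Suc m)"
  unfolding wallis_def by (subst Henstock_Kurzweil_Integration.integral_diff) (auto simp del: mult_Suc_right power_Suc)
 also have "... = wallis n / (2 * real n - 1)"
  using wallis_rec[of m] wallis_pos[of m] by (simp add: m field_simps)
 finally show ?thesis .
qed

lemma kap'_abs:
 assumes n: "n >= 1"
 shows "\<bar>kap' n s\<bar> = 2 * real n * pi / wallis n * (\<bar>cos (pi * s)\<bar> ^ n * (\<bar>cos (pi * s)\<bar> ^ (n - 1) * \<bar>sin (pi * s)\<bar>))"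
proof -
 have "2 * n - 1 = n + (n - 1)" using n by simp
 then have e: "\<bar>cos (pi * s)\<bar> ^ (2 * n - 1) = \<bar>cos (pi * s)\<bar> ^ n * \<bar>cos (pi * s)\<bar> ^ (n - 1)" by (simp only: power_add)
 have "\<bar>wallis n\<bar> = wallis n" "\<bar>pi\<bar> = pi" using wallis_pos[of n] by simp_all
 then show ?thesis
  unfolding kap'_def abs_mult abs_divide abs_minus_cancel power_abs e by simp
qed

lemma cos_pow_n2: "(\<bar>cos t\<bar> ^ m)^2 = cos t ^ (2 * m)" for t :: real
 by (metis power2_abs power_mult power_even_eq power_abs mult.commute)

lemma kap'_int:
 assumes n: "n >= 1" shows "integral {0..1} (%s. \<bar>kap' n s\<bar>) <= 2 * pi * sqrt n"
proof -
 have sn: "sqrt n > 0" "sqrt n * sqrt n = n" using n by simp_all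
 let ?k = "2 * real n * pi / wallis n"
 have k: "?k >= 0" using wallis_pos[of n] by simp
 have "integral {0..1} (%s. \<bar>kap' n s\<bar>) <= integral {0..1} (%s. ?k / (2 * sqrt n) * cos (pi * s) ^ (2 * n) + (?k * sqrt n / 2) * (cos (pi * s) ^ (2 * (n - 1)) * (sin (pi * s))^2))"
 proof (rule integral_le)
  fix s :: real
  let ?a = "\<bar>cos (pi * s)\<bar> ^ n" and ?b = "\<bar>cos (pi * s)\<bar> ^ (n - 1) * \<bar>sin (pi * s)\<bar>"
  have "2 * sqrt n * (?a * ?b) <= ?a^2 + (sqrt n)^2 * ?b^2" by (rule weighted_am_gm)
  moreover have "(sqrt n)^2 = n" by simp
  ultimately have "2 * sqrt n * (?a * ?b) <= ?a^2 + n * ?b^2" by (simp only:)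
  then have "?k / (2 * sqrt n) * (2 * sqrt n * (?a * ?b)) <= ?k / (2 * sqrt n) * (?a^2 + n * ?b^2)"
   by (rule mult_left_mono) (intro divide_nonneg_nonneg k, simp)
  also have "?k / (2 * sqrt n) * (?a^2 + n * ?b^2) = ?k / (2 * sqrt n) * ?a^2 + (?k * (n / sqrt n) / 2) * ?b^2"
   by (simp add: distrib_left)
  also have "n / sqrt n = sqrt n" by (rule real_div_sqrt) simp
  finally have F: "?k / (2 * sqrt n) * (2 * sqrt n * (?a * ?b)) <= ?k / (2 * sqrt n) * ?a^2 + (?k * sqrt n / 2) * ?b^2" .
  have L: "?k / (2 * sqrt n) * (2 * sqrt n * t) = ?k * t" for t using sn(1) by simp
  from F show "\<bar>kap' n s\<bar> <= ?k / (2 * sqrt n) * cos (pi * s) ^ (2 * n) + (?k * sqrt n / 2) * (cos (pi * s) ^ (2 * (n - 1)) * (sin (pi * s))^2)"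
   unfolding L by (simp only: kap'_abs[OF n] power_mult_distrib cos_pow_n2 power2_abs)
 qed (intro integrable_continuous_real continuous_intros)+
 also have "... = ?k / (2 * sqrt n) * wallis n + (?k * sqrt n / 2) * (wallis n / (2 * real n - 1))"
  by (subst Henstock_Kurzweil_Integration.integral_add, (intro integrable_continuous_real continuous_intros)+)
    (simp only: integral_mult_right wallis_def cos_sin2_int[OF n])
 also have "... <= ?k / (2 * sqrt n) * wallis n + (?k * sqrt n / 2) * (wallis n / real n)"
  using n k wallis_pos[of n] sn by (intro add_left_mono mult_left_mono divide_left_mono) auto
 also have "... = 2 * pi * sqrt n"
  using sn wallis_pos[of n] n by (simp add: field_simps)
 finally show ?thesis .
qed

text \<open>The derivative of the kernel has size \<open>sqrt n\<close> on the scale \<open>1 / sqrt n\<close>; against \<open>\<bar>sin\<bar>\<close>, which measures the distance to the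
integers, it is bounded. By Cauchy-Schwarz in the weighted form this follows from two Wallis integrals.\<close>
lemma kap'_sin_int:
 assumes n: "n >= 1" shows "integral {0..1} (%s. \<bar>kap' n s\<bar> * \<bar>sin (pi * s)\<bar>) <= 2 * pi"
proof -
 let ?k = "2 * real n * pi / wallis n"
 have k: "?k >= 0" using wallis_pos[of n] by simp
 have "integral {0..1} (%s. \<bar>kap' n s\<bar> * \<bar>sin (pi * s)\<bar>) <= integral {0..1} (%s. real n * pi * (kap n s * (sin (pi * s))^2) + (?k / 2) * (cos (pi * s) ^ (2 * (n - 1)) * (sin (pi * s))^2))"
 proof (rule integral_le)
  fix s :: real
  let ?a = "\<bar>cos (pi * s)\<bar> ^ n * \<bar>sin (pi * s)\<bar>" and ?b = "\<bar>cos (pi * s)\<bar> ^ (n - 1) * \<bar>sin (pi * s)\<bar>"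
  have "?a * ?b <= ?a^2 / 2 + ?b^2 / 2" using sum_squares_bound[of ?a ?b] by linarith
  then have "?k * (?a * ?b) <= ?k * (?a^2 / 2 + ?b^2 / 2)" using k by (intro mult_left_mono)
  moreover have "\<bar>kap' n s\<bar> * \<bar>sin (pi * s)\<bar> = ?k * (?a * ?b)"
   by (simp only: kap'_abs[OF n] mult_ac)
  moreover have "?a^2 = cos (pi * s) ^ (2 * n) * (sin (pi * s))^2" "?b^2 = cos (pi * s) ^ (2 * (n - 1)) * (sin (pi * s))^2"
   by (simp_all only: power_mult_distrib cos_pow_n2 power2_abs)
  moreover have "?k * (a * b / 2 + c / 2) = real n * pi * (a / wallis n * b) + ?k / 2 * c" for a b c
   by (simp add: distrib_left)
  ultimately show "\<bar>kap' n s\<bar> * \<bar>sin (pi * s)\<bar> <= real n * pi * (kap n s * (sin (pi * s))^2) + (?k / 2) * (cos (pi * s) ^ (2 * (n - 1)) * (sin (pi * s))^2)"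
   unfolding kap_def by (simp only:)
 qed (intro integrable_continuous_real continuous_intros)+
 also have "... = real n * pi * (1 / (2 * real n + 2)) + (?k / 2) * (wallis n / (2 * real n - 1))"
  by (subst Henstock_Kurzweil_Integration.integral_add, (intro integrable_continuous_real continuous_intros)+)
    (simp only: integral_mult_right kap_sin2 cos_sin2_int[OF n])
 also have "... = pi * (real n / (2 * real n + 2) + real n / (2 * real n - 1))"
  using wallis_pos[of n] n by (simp add: field_simps)
 also have "... <= pi * (1 + 1)" using n by (intro mult_left_mono add_mono) (auto simp: field_simps)
 finally show ?thesis by simp
qed

subsection \<open>kernel on torus\<close>

definition ker :: "nat => real^2 => real" where "ker n z = kap n (z $ 1) * kap n (z $ 2)"

lemma torus_LINT_prod:
 fixes f g :: "real => real"
 assumes "cont f" "cont g"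
 shows "(AV z. f (z $ 1) * g (z $ 2)) = integral {0..1} f * integral {0..1} g"
proof -
 have "cont (%z::real^2. f (z $ 1) * g (z $ 2))"
  by (intro continuous_on_mult continuous_on_compose2[OF assms(1)] continuous_on_compose2[OF assms(2)] continuous_intros) auto
 from torus_LINT_iterated(1)[OF this] show ?thesis by simp
qed

lemma ker_nonneg: "ker n z >= 0" by (simp add: ker_def kap_nonneg)

lemma ker_LINT: "avg (ker n) = 1"
 unfolding ker_def[abs_def] by (subst torus_LINT_prod) (auto intro!: continuous_intros simp: kap_integral)

lemma ker_trig: "ker n z = ((1 + cos (2 * pi * (z $ 1))) / 2 * ((1 + cos (2 * pi * (z $ 2))) / 2)) ^ n * (1 / (wallis n)^2)"
proof -
 have "cos (pi * s) ^ (2 * n) = ((1 + cos (2 * pi * s)) / 2) ^ n" for s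
  using cos_double_cos[of "pi * s"] by (simp add: power_mult mult.assoc)
 then show ?thesis unfolding ker_def kap_def power_mult_distrib by (simp add: power2_eq_square)
qed

lemma torus_smooth_power: "torus_smooth f ==> torus_smooth (%x. f x ^ n :: real)"
 by (induction n) (auto intro: torus_smooth_mult)

lemma ker_smooth: "torus_smooth (ker n)"
proof -
 have "torus_smooth (%z. ((1 + cos (2 * pi * (z $ 1))) * (1/2) * ((1 + cos (2 * pi * (z $ 2))) * (1/2))) ^ n * (1 / (wallis n)^2))"
  by (intro torus_smooth_mult torus_smooth_power torus_smooth_add torus_smooth_const torus_smooth_trig)
 then show ?thesis by (simp add: ker_trig[abs_def])
qed

text \<open>Positive definiteness with finitely many explicit features; it passes to products and so from one factor to the kernel.\<close>
definition separable :: "(real^2 => real) => bool" where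
 "separable K \<longleftrightarrow> (\<exists>es. (\<forall>e\<in>set es. torus_smooth e) & (\<forall>x y. K (x - y) = (\<Sum>e\<leftarrow>es. e x * e y)))"

lemma sum_list_features:
 "(\<Sum>h\<leftarrow>concat (map (%f. map (%g z. f z * g z) fs) es). h x * h y) = (\<Sum>e\<leftarrow>es. e x * e y) * (\<Sum>e\<leftarrow>fs. e x * e y)"
 for x y :: "real^2" and es fs :: "(real^2 => real) list"
proof -
 have "(\<Sum>h\<leftarrow>map (%g z. f z * g z) fs. h x * h y) = f x * f y * (\<Sum>e\<leftarrow>fs. e x * e y)" for f :: "real^2 => real"
  by (induction fs) (auto simp: algebra_simps)
 then show ?thesis by (induction es) (auto simp: algebra_simps o_def)
qed

lemma separable_mult: "separable K ==> separable L ==> separable (%z. K z * L z)"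
 unfolding separable_def
proof (elim exE conjE)
 fix es fs assume *: "\<forall>e\<in>set es. torus_smooth e" "\<forall>x y. K (x - y) = (\<Sum>e\<leftarrow>es. e x * e y)"
  "\<forall>e\<in>set fs. torus_smooth e" "\<forall>x y. L (x - y) = (\<Sum>e\<leftarrow>fs. e x * e y)"
 show "\<exists>es. (\<forall>e\<in>set es. torus_smooth e) & (\<forall>x y. K (x - y) * L (x - y) = (\<Sum>e\<leftarrow>es. e x * e y))"
  by (rule exI[of _ "concat (map (%f. map (%g z. f z * g z) fs) es)"])
    (use * in "auto simp: sum_list_features intro: torus_smooth_mult")
qed

lemma separable_const: "c >= 0 ==> separable (%z. c)"
 unfolding separable_def by (rule exI[of _ "[%x. sqrt c]"]) auto

lemma separable_cos: "separable (%z. (1 + cos (2 * pi * (z $ i))) / 2)"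
 unfolding separable_def
proof (intro exI[of _ "[%x. sqrt (1/2), %x. sqrt (1/2) * cos (2 * pi * (x $ i)), %x. sqrt (1/2) * sin (2 * pi * (x $ i))]"] conjI allI)
 show "\<forall>e\<in>set [%x. sqrt (1/2), %x. sqrt (1/2) * cos (2 * pi * (x $ i)), %x. sqrt (1/2) * sin (2 * pi * (x $ i))]. torus_smooth e"
  by (auto intro!: torus_smooth_mult torus_smooth_trig)
 fix x y :: "real^2"
 have s: "sqrt (1/2) * sqrt (1/2) = 1/2" by simp
 have s': "(sqrt (1/2) * a) * (sqrt (1/2) * b) = a * b / 2" for a b :: real
  by (metis (no_types, opaque_lifting) s mult.assoc mult.left_commute mult_1 times_divide_eq_left)
 have "cos (2 * pi * ((x - y) $ i)) = cos (2 * pi * (x $ i)) * cos (2 * pi * (y $ i)) + sin (2 * pi * (x $ i)) * sin (2 * pi * (y $ i))"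
  by (simp add: right_diff_distrib cos_diff)
 then show "(1 + cos (2 * pi * ((x - y) $ i))) / 2 = (\<Sum>e\<leftarrow>[%x. sqrt (1/2), %x. sqrt (1/2) * cos (2 * pi * (x $ i)), %x. sqrt (1/2) * sin (2 * pi * (x $ i))]. e x * e y)"
  by (simp add: s s' add_divide_distrib del: real_sqrt_divide)
qed

lemma separable_ker: "separable (ker n)"
proof -
 have "separable (%z. ((1 + cos (2 * pi * (z $ 1))) / 2 * ((1 + cos (2 * pi * (z $ 2))) / 2)) ^ m)" for m
 proof (induction m)
  case (Suc m)
  show ?case using separable_mult[OF separable_mult[OF separable_cos[of 1] separable_cos[of 2]] Suc] by simp
 qed (simp add: separable_const)
 then have 1: "separable (%z. ((1 + cos (2 * pi * (z $ 1))) / 2 * ((1 + cos (2 * pi * (z $ 2))) / 2)) ^ n)" by blast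
 have 2: "ker n = (%z. ((1 + cos (2 * pi * (z $ 1))) / 2 * ((1 + cos (2 * pi * (z $ 2))) / 2)) ^ n * (1 / (wallis n)^2))"
  by (rule ext) (rule ker_trig)
 show ?thesis unfolding 2 by (rule separable_mult[OF 1 separable_const]) simp
qed

text \<open>Only the existence of the features matters, so they are chosen once for each \<open>n\<close>.\<close>
definition modes :: "nat => (real^2 => real) list" where
 "modes n = (SOME es. (\<forall>e\<in>set es. torus_smooth e) & (\<forall>x y. ker n (x - y) = (\<Sum>e\<leftarrow>es. e x * e y)))"
definition mode :: "nat => nat => real^2 => real" where "mode n j = modes n ! j"
definition nmodes :: "nat => nat" where "nmodes n = length (modes n)"

lemma modes_prop: "(\<forall>e\<in>set (modes n). torus_smooth e) & (\<forall>x y. ker n (x - y) = (\<Sum>e\<leftarrow>modes n. e x * e y))"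
 unfolding modes_def by (rule someI_ex) (use separable_ker[of n] in "simp add: separable_def")

lemma mode_smooth: "j < nmodes n ==> torus_smooth (mode n j)"
 using modes_prop[of n] nth_mem[of j "modes n"] unfolding mode_def nmodes_def by blast

lemma ker_modes: "ker n (x - y) = (\<Sum>j<nmodes n. mode n j x * mode n j y)"
 using modes_prop[of n] by (simp add: mode_def nmodes_def sum_list_sum_nth atLeast0LessThan)

lemma ker_even: "ker n (- z) = ker n z" by (simp add: ker_def kap_def)

lemma ker_diff_LINT: "(AV y. ker n (x - y)) = 1"
proof -
 have "ker n (x - y) = ker n (y + (- x))" for y using ker_even[of n "x - y"] by (simp add: add.commute)
 then have "(AV y. ker n (x - y)) = (AV y. ker n (y + (- x)))" by simp
 also have "... = 1"
  using torus_LINT_shift[OF smooth_cont[OF ker_smooth[of n]], of "-x"] ker_smooth[of n] ker_LINT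
  by (simp add: torus_smooth_def)
 finally show ?thesis .
qed

lemma sin_axis_LINT: "(AV z. ker n z * (sin (pi * (z $ i)))^2) = 1 / (2 * real n + 2)"
proof -
 consider "i = 1" | "i = 2" using exhaust_2 by blast
 then show ?thesis
 proof cases
  case 1
  have "(AV z. ker n z * (sin (pi * (z $ i)))^2) = (AV z. (kap n (z $ 1) * (sin (pi * (z $ 1)))^2) * kap n (z $ 2))"
   by (simp add: ker_def 1 mult_ac)
  also have "... = 1 / (2 * real n + 2)"
   by (subst torus_LINT_prod) (auto intro!: continuous_intros simp: kap_integral kap_sin2)
  finally show ?thesis .
 next
  case 2
  have "(AV z. ker n z * (sin (pi * (z $ i)))^2) = (AV z. kap n (z $ 1) * (kap n (z $ 2) * (sin (pi * (z $ 2)))^2))"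
   by (simp add: ker_def 2 mult_ac)
  also have "... = 1 / (2 * real n + 2)"
   by (subst torus_LINT_prod) (auto intro!: continuous_intros simp: kap_integral kap_sin2)
  finally show ?thesis .
 qed
qed

lemma ker_partial: "partial 1 (ker n) z = kap' n (z $ 1) * kap n (z $ 2)" "partial 2 (ker n) z = kap n (z $ 1) * kap' n (z $ 2)"
proof -
 have 1: "((%h. kap n (a + h)) has_real_derivative kap' n a) (at 0)" for a
  using DERIV_shift[of "kap n" "kap' n a" 0 a] kap_DERIV[of n a] by (simp add: add.commute)
 show "partial 1 (ker n) z = kap' n (z $ 1) * kap n (z $ 2)" "partial 2 (ker n) z = kap n (z $ 1) * kap' n (z $ 2)"
  by (rule partialI, auto simp: ker_def axis_def intro!: derivative_eq_intros 1)+
qed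

text \<open>Independent of \<open>n\<close>: this is where the commutator gets its uniform bound.\<close>
lemma ker_partial_moment:
 assumes n: "n >= 1"
 shows "(AV z. \<bar>partial i (ker n) z\<bar> * \<bar>sin (pi * (z $ l))\<bar>) <= 2 * pi"
proof -
 have cross: "integral {0..1} (%s. \<bar>kap' n s\<bar>) * integral {0..1} (%s. kap n s * \<bar>sin (pi * s)\<bar>) <= 2 * pi"
 proof -
  have "integral {0..1} (%s. \<bar>kap' n s\<bar>) * integral {0..1} (%s. kap n s * \<bar>sin (pi * s)\<bar>) <= (2 * pi * sqrt n) * (1 / sqrt n)"
   by (intro mult_mono kap'_int kap_sin n Henstock_Kurzweil_Integration.integral_nonneg integrable_continuous_real continuous_intros)
     (auto simp: kap_nonneg)
  also have "... = 2 * pi" using n by simp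
  finally show ?thesis .
 qed
 have c: "cont (%s. \<bar>kap' n s\<bar>)" "cont (kap n)" "cont (%s. \<bar>kap' n s\<bar> * \<bar>sin (pi * s)\<bar>)"
   "cont (%s. kap n s * \<bar>sin (pi * s)\<bar>)"
  by (intro continuous_intros)+
 have k: "\<bar>kap n s\<bar> = kap n s" for s using kap_nonneg[of n s] by simp
 consider "i = 1" "l = 1" | "i = 1" "l = 2" | "i = 2" "l = 1" | "i = 2" "l = 2" using exhaust_2 by blast
 then show ?thesis
 proof cases
  case 1
  have "(AV z. \<bar>partial i (ker n) z\<bar> * \<bar>sin (pi * (z $ l))\<bar>) = (AV z. (\<bar>kap' n (z $ 1)\<bar> * \<bar>sin (pi * (z $ 1))\<bar>) * kap n (z $ 2))"
   by (simp add: 1 ker_partial abs_mult k mult_ac)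
  then show ?thesis unfolding torus_LINT_prod[OF c(3,2)] using kap'_sin_int[OF n] by (simp add: kap_integral)
 next
  case 2
  have "(AV z. \<bar>partial i (ker n) z\<bar> * \<bar>sin (pi * (z $ l))\<bar>) = (AV z. \<bar>kap' n (z $ 1)\<bar> * (kap n (z $ 2) * \<bar>sin (pi * (z $ 2))\<bar>))"
   by (simp add: 2 ker_partial abs_mult k mult_ac)
  then show ?thesis unfolding torus_LINT_prod[OF c(1,4)] using cross by simp
 next
  case 3
  have "(AV z. \<bar>partial i (ker n) z\<bar> * \<bar>sin (pi * (z $ l))\<bar>) = (AV z. (kap n (z $ 1) * \<bar>sin (pi * (z $ 1))\<bar>) * \<bar>kap' n (z $ 2)\<bar>)"
   by (simp add: 3 ker_partial abs_mult k mult_ac)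
  then show ?thesis unfolding torus_LINT_prod[OF c(4,1)] using cross by (simp add: mult.commute)
 next
  case 4
  have "(AV z. \<bar>partial i (ker n) z\<bar> * \<bar>sin (pi * (z $ l))\<bar>) = (AV z. kap n (z $ 1) * (\<bar>kap' n (z $ 2)\<bar> * \<bar>sin (pi * (z $ 2))\<bar>))"
   by (simp add: 4 ker_partial abs_mult k mult_ac)
  then show ?thesis unfolding torus_LINT_prod[OF c(2,3)] using kap'_sin_int[OF n] by (simp add: kap_integral)
 qed
qed

section \<open>Smoothing by the kernel\<close>

definition coef :: "nat => (real^2 => real) => nat => real" where
 "coef n f j = (AV y. f y * mode n j y)"
text \<open>Convolution with the kernel, written through the modes so that it makes sense as a smooth function for every \<open>f\<close>. The quadratic
form \<open>energy\<close> below is \<open>\<integral>f * smoothing n f\<close>.\<close>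
definition smoothing :: "nat => (real^2 => real) => real^2 => real" where
 "smoothing n f x = (\<Sum>j<nmodes n. coef n f j * mode n j x)"
definition energy :: "nat => (real^2 => real) => real" where
 "energy n f = (\<Sum>j<nmodes n. (coef n f j)^2)"

lemma integrable_mode:
 assumes "L1 f" "j < nmodes n"
 shows "L1 (%y. mode n j y * f y)" "L1 (%y. f y * mode n j y)"
 using smooth_L1_mult[OF mode_smooth[OF assms(2)] assms(1)] by (simp_all add: mult.commute)

lemma smoothing_eq:
 assumes f: "L1 f"
 shows "smoothing n f x = (AV y. ker n (x - y) * f y)"
proof -
 have "(AV y. ker n (x - y) * f y) = (AV y. (\<Sum>j<nmodes n. mode n j x * (mode n j y * f y)))"
  by (simp add: ker_modes sum_distrib_right mult.assoc)
 also have "... = (\<Sum>j<nmodes n. (AV y. mode n j x * (mode n j y * f y)))"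
  by (rule integral_sum) (use integrable_mode(1)[OF f] in auto)
 also have "... = smoothing n f x" by (simp add: smoothing_def coef_def mult.commute)
 finally show ?thesis by simp
qed

lemma smoothing_smooth: "torus_smooth (smoothing n f)"
 unfolding smoothing_def[abs_def]
 by (intro torus_smooth_sum torus_smooth_mult torus_smooth_const mode_smooth) simp

lemma ker_diff_continuous: "cont (%y. ker n (x - y))"
 by (rule continuous_on_compose2[OF smooth_cont[OF ker_smooth]]) (auto intro: continuous_intros)

lemma ker_diff_integrable_mult:
 assumes "L1 f" shows "L1 (%y. ker n (x - y) * f y)"
proof -
 obtain C where "\<forall>z. norm (ker n z) <= C" using torus_smooth_bounded[OF ker_smooth] by blast
 then show ?thesis
  by (intro integrable_bounded_mult[where C=C] assms continuous_torus_measurable ker_diff_continuous) auto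
qed

lemma smoothing_bounded:
 assumes f: "f \<in> TBorel" and C: "!!x. x \<in> torus ==> \<bar>f x\<bar> <= C"
 shows "\<bar>smoothing n f x\<bar> <= C"
proof -
 have fi: "L1 f" by (rule bounded_L1[OF f]) (use C in auto)
 have "\<bar>smoothing n f x\<bar> <= (AV y. \<bar>ker n (x - y) * f y\<bar>)"
  unfolding smoothing_eq[OF fi] by (rule integral_abs_bound)
 also have "... <= (AV y. ker n (x - y) * C)"
 proof (rule integral_mono)
  show "L1 (%y. \<bar>ker n (x - y) * f y\<bar>)" using ker_diff_integrable_mult[OF fi] by simp
  show "L1 (%y. ker n (x - y) * C)" by (rule ker_diff_integrable_mult) simp
  fix y assume "y \<in> space TM"
  then show "\<bar>ker n (x - y) * f y\<bar> <= ker n (x - y) * C"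
   using C[of y] ker_nonneg[of n "x - y"] by (simp add: abs_mult mult_left_mono)
 qed
 also have "... = C" by (simp add: ker_diff_LINT)
 finally show ?thesis .
qed

lemma LINT_smoothing:
 assumes f: "L1 f" and g: "L1 g"
 shows "(AV x. g x * smoothing n f x) = (\<Sum>j<nmodes n. coef n f j * coef n g j)"
proof -
 have "(AV x. g x * smoothing n f x) = (AV x. (\<Sum>j<nmodes n. coef n f j * (g x * mode n j x)))"
  by (simp add: smoothing_def sum_distrib_left mult_ac)
 also have "... = (\<Sum>j<nmodes n. (AV x. coef n f j * (g x * mode n j x)))"
  by (rule integral_sum) (use integrable_mode(2)[OF g] in auto)
 finally show ?thesis by (simp add: coef_def)
qed

lemma smoothing_symmetric:
 assumes f: "L1 f" and g: "L1 g"
 shows "(AV x. g x * smoothing n f x) = (AV x. f x * smoothing n g x)"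
 unfolding LINT_smoothing[OF f g] LINT_smoothing[OF g f] by (simp add: mult.commute)

lemma smoothing_integrable: "L1 (smoothing n f)"
 by (rule smooth_L1[OF smoothing_smooth])

lemma smoothing_L1:
 assumes f: "L1 f"
 shows "(AV x. \<bar>smoothing n f x\<bar>) <= (AV x. \<bar>f x\<bar>)"
proof -
 let ?s = "%x. sgn (smoothing n f x)"
 have sm: "?s \<in> TBorel"
  using smooth_measurable[OF smoothing_smooth[of n f]] by measurable
 have si: "L1 ?s" by (rule bounded_L1[OF sm, of 1]) (simp add: sgn_real_def)
 have b: "\<bar>smoothing n ?s x\<bar> <= 1" for x by (rule smoothing_bounded[OF sm]) (simp add: sgn_real_def)
 have "(AV x. \<bar>smoothing n f x\<bar>) = (AV x. ?s x * smoothing n f x)"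
  by (rule integral_cong) (simp_all add: sgn_real_def)
 also have "... = (AV x. f x * smoothing n ?s x)" by (rule smoothing_symmetric[OF f si])
 also have "... <= (AV x. \<bar>f x\<bar>)"
 proof (rule integral_mono)
  show "L1 (%x. f x * smoothing n ?s x)"
   using smooth_L1_mult[OF smoothing_smooth f] by (simp add: mult.commute)
  fix x show "f x * smoothing n ?s x <= \<bar>f x\<bar>"
   using mult_left_mono[OF b[of x], of "\<bar>f x\<bar>"] abs_le_D1[of "f x * smoothing n ?s x"] by (simp add: abs_mult)
 qed (use f in auto)
 finally show ?thesis .
qed

lemma coef_bound:
 assumes f: "L1 f" and j: "j < nmodes n" and C: "!!x. \<bar>mode n j x\<bar> <= C"
 shows "\<bar>coef n f j\<bar> <= C * (AV x. \<bar>f x\<bar>)"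
proof -
 have "\<bar>coef n f j\<bar> <= (AV x. \<bar>f x * mode n j x\<bar>)" unfolding coef_def by (rule integral_abs_bound)
 also have "... <= (AV x. C * \<bar>f x\<bar>)"
 proof (rule integral_mono)
  show "L1 (%x. \<bar>f x * mode n j x\<bar>)" using integrable_mode(2)[OF f j] by simp
  show "\<bar>f x * mode n j x\<bar> <= C * \<bar>f x\<bar>" for x
   using mult_right_mono[OF C[of x], of "\<bar>f x\<bar>"] by (simp add: abs_mult mult.commute)
 qed (use f in simp)
 finally show ?thesis by simp
qed

lemma torus_smooth_uniform_bound:
 assumes "finite J" "!!j. j \<in> J ==> torus_smooth (f j :: real^2 => real)"
 obtains C where "C > 0" "!!j x. j \<in> J ==> \<bar>f j x\<bar> <= C"
proof -
 have "\<exists>C>0. \<forall>j\<in>J. \<forall>x. \<bar>f j x\<bar> <= C" using assms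
 proof (induction J rule: finite_induct)
  case empty show ?case by (auto intro: exI[of _ 1])
 next
  case (insert j J)
  obtain C where "C > 0" "\<forall>j\<in>J. \<forall>x. \<bar>f j x\<bar> <= C" using insert by auto
  moreover obtain D where "\<forall>x. norm (f j x) <= D" using torus_smooth_bounded insert.prems by blast
  ultimately show ?case by (intro exI[of _ "max C D"]) (auto simp: le_max_iff_disj)
 qed
 then show ?thesis using that by blast
qed

lemma norm_grad_le: "norm (grad f x) <= \<bar>partial 1 f x\<bar> + \<bar>partial 2 f x\<bar>"
 using norm_le_l1_cart[of "grad f x"] by (simp add: sum_2 grad_def)

lemma mode_bounds:
 obtains E where "E > 0" "!!j x. j < nmodes n ==> \<bar>mode n j x\<bar> <= E"
  "!!j x i. j < nmodes n ==> \<bar>partial i (mode n j) x\<bar> <= E"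
  "!!j x. j < nmodes n ==> norm (grad (mode n j) x) <= E" "!!j x. j < nmodes n ==> \<bar>laplacian (mode n j) x\<bar> <= E"
proof -
 obtain C0 where C0: "C0 > 0" "!!j x. j \<in> {..<nmodes n} ==> \<bar>mode n j x\<bar> <= C0"
  by (rule torus_smooth_uniform_bound[of "{..<nmodes n}" "mode n"]) (auto intro: mode_smooth)
 obtain C1 where C1: "C1 > 0" "!!j x. j \<in> {..<nmodes n} ==> \<bar>partial 1 (mode n j) x\<bar> <= C1"
  by (rule torus_smooth_uniform_bound[of "{..<nmodes n}" "%j. partial 1 (mode n j)"]) (auto intro: mode_smooth smooth_partial)
 obtain C2 where C2: "C2 > 0" "!!j x. j \<in> {..<nmodes n} ==> \<bar>partial 2 (mode n j) x\<bar> <= C2"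
  by (rule torus_smooth_uniform_bound[of "{..<nmodes n}" "%j. partial 2 (mode n j)"]) (auto intro: mode_smooth smooth_partial)
 obtain C3 where C3: "C3 > 0" "!!j x. j \<in> {..<nmodes n} ==> \<bar>laplacian (mode n j) x\<bar> <= C3"
  by (rule torus_smooth_uniform_bound[of "{..<nmodes n}" "%j. laplacian (mode n j)"]) (auto intro: mode_smooth torus_smooth_laplacian)
 show ?thesis
 proof (rule that[of "C0 + C1 + C2 + C3"])
  show "\<bar>mode n j x\<bar> <= C0 + C1 + C2 + C3" if "j < nmodes n" for j x
   using C0(1) C1(1) C2(1) C3(1) C0(2)[of j x] that by simp
  show "\<bar>laplacian (mode n j) x\<bar> <= C0 + C1 + C2 + C3" if "j < nmodes n" for j x
   using C0(1) C1(1) C2(1) C3(1) C3(2)[of j x] that by simp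
  show "norm (grad (mode n j) x) <= C0 + C1 + C2 + C3" if "j < nmodes n" for j x
   using C0(1) C1(1) C2(1) C3(1) C1(2)[of j x] C2(2)[of j x] that norm_grad_le[of "mode n j" x] by simp
  show "\<bar>partial i (mode n j) x\<bar> <= C0 + C1 + C2 + C3" if "j < nmodes n" for j x i
   using C0(1) C1(1) C2(1) C3(1) C1(2)[of j x] C2(2)[of j x] that exhaust_2[of i] by auto
 qed (use C0 C1 C2 C3 in auto)
qed

lemma partial_smoothing: "partial i (smoothing n f) x = (\<Sum>j<nmodes n. coef n f j * partial i (mode n j) x)"
 unfolding smoothing_def[abs_def]
 by (subst partial_sum) (auto intro!: torus_smooth_mult mode_smooth sum.cong partial_cmult)

lemma laplacian_smoothing: "laplacian (smoothing n f) x = (\<Sum>j<nmodes n. coef n f j * laplacian (mode n j) x)"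
proof -
 have "partial i (partial i (smoothing n f)) x = (\<Sum>j<nmodes n. coef n f j * partial i (partial i (mode n j)) x)" for i
  unfolding partial_smoothing[abs_def]
  by (subst partial_sum) (auto intro!: torus_smooth_mult smooth_partial mode_smooth sum.cong partial_cmult)
 then show ?thesis unfolding laplacian_def by (simp add: sum_2 distrib_left sum.distrib)
qed

lemma smoothing_derivative_bounds:
 obtains L where "L > 0"
  "!!f x. L1 f ==> norm (grad (smoothing n f) x) <= L * (AV x. \<bar>f x\<bar>)"
  "!!f x. L1 f ==> \<bar>laplacian (smoothing n f) x\<bar> <= L * (AV x. \<bar>f x\<bar>)"
proof -
 obtain E where E: "E > 0" "!!j x. j < nmodes n ==> \<bar>mode n j x\<bar> <= E"
  "!!j x i. j < nmodes n ==> \<bar>partial i (mode n j) x\<bar> <= E"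
  "!!j x. j < nmodes n ==> \<bar>laplacian (mode n j) x\<bar> <= E"
  using mode_bounds[of n] by metis
 let ?N = "real (nmodes n)"
 have S: "\<bar>\<Sum>j<nmodes n. coef n f j * h j\<bar> <= ?N * (E * E) * (AV x. \<bar>f x\<bar>)"
  if f: "L1 f" and h: "!!j. j < nmodes n ==> \<bar>h j\<bar> <= E" for f and h :: "nat => real"
 proof -
  have "\<bar>\<Sum>j<nmodes n. coef n f j * h j\<bar> <= (\<Sum>j<nmodes n. \<bar>coef n f j\<bar> * \<bar>h j\<bar>)"
   using sum_abs[of "%j. coef n f j * h j" "{..<nmodes n}"] by (simp add: abs_mult)
  also have "... <= (\<Sum>j<nmodes n. (E * (AV x. \<bar>f x\<bar>)) * E)"
   using E(1) h by (intro sum_mono mult_mono coef_bound[OF f] E(2)) auto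
  finally show ?thesis by (simp add: mult_ac)
 qed
 show ?thesis
 proof (rule that[of "2 * ?N * (E * E) + 1"])
  have nn: "0 <= (AV x. \<bar>f x\<bar>)" for f :: "real^2 => real" by simp
  show "\<bar>laplacian (smoothing n f) x\<bar> <= (2 * ?N * (E * E) + 1) * (AV x. \<bar>f x\<bar>)"
   if "L1 f" for f x
  proof -
   have "\<bar>laplacian (smoothing n f) x\<bar> <= ?N * (E * E) * (AV x. \<bar>f x\<bar>)"
    unfolding laplacian_smoothing by (rule S[OF that E(4)])
   also have "... <= (2 * ?N * (E * E) + 1) * (AV x. \<bar>f x\<bar>)"
     using nn E(1) by (intro mult_right_mono) (auto simp: mult_ac)
   finally show ?thesis .
  qed
  show "norm (grad (smoothing n f) x) <= (2 * ?N * (E * E) + 1) * (AV x. \<bar>f x\<bar>)"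
   if "L1 f" for f x
  proof -
   have "norm (grad (smoothing n f) x) <= \<bar>partial 1 (smoothing n f) x\<bar> + \<bar>partial 2 (smoothing n f) x\<bar>" by (rule norm_grad_le)
   also have "... <= ?N * (E * E) * (AV x. \<bar>f x\<bar>) + ?N * (E * E) * (AV x. \<bar>f x\<bar>)"
    unfolding partial_smoothing by (intro add_mono S[OF that] E(3))
   also have "... <= (2 * ?N * (E * E) + 1) * (AV x. \<bar>f x\<bar>)"
    using nn[of f] by (simp add: algebra_simps)
   finally show ?thesis .
  qed
  show "2 * ?N * (E * E) + 1 > 0" using E(1) by (intro add_nonneg_pos mult_nonneg_nonneg) auto
 qed
qed

lemma smoothing_const1: "smoothing n (%x. 1) x = 1"
 by (subst smoothing_eq) (auto simp: ker_diff_LINT)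

text \<open>Since the kernel is positive with integral one, Jensen's inequality gives \<open>\<integral>(smoothing n f)\<^sup>2 \<le> \<integral>f\<^sup>2\<close>; expanding the square
bounds the defect by the missing energy. Closeness to the smoothed function is thus a lower bound for one scalar.\<close>
lemma smoothing_defect:
 assumes f: "f \<in> TBorel" and C: "!!x. x \<in> torus ==> \<bar>f x\<bar> <= C"
 shows "(AV x. (f x - smoothing n f x)^2) <= 2 * ((AV x. (f x)^2) - energy n f)"
proof -
 have fi: "L1 f" by (rule bounded_L1[OF f]) (use C in auto)
 have f2: "L1 (%x. (f x)^2)"
 proof (rule bounded_L1[where C="C^2"])
  fix x assume "x \<in> torus"
  then show "norm ((f x)^2) <= C^2" using C[of x] by (simp add: abs_le_square_iff[symmetric])
 qed (use f in measurable)
 let ?S = "smoothing n f"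
 have jensen: "(?S x)^2 <= smoothing n (%x. (f x)^2) x" for x
 proof -
  let ?a = "?S x"
  have "0 <= (AV y. ker n (x - y) * (f y - ?a)^2)"
   by (intro integral_nonneg) (simp add: ker_nonneg)
  also have "... = (AV y. ker n (x - y) * (f y)^2 - (2 * ?a) * (ker n (x - y) * f y) + ?a^2 * ker n (x - y))"
   by (simp add: power2_diff algebra_simps)
  also have "... = smoothing n (%x. (f x)^2) x - (2 * ?a) * ?a + ?a^2 * 1"
   unfolding smoothing_eq[OF f2] ker_diff_LINT[of n x, symmetric]
   using ker_diff_integrable_mult[OF fi, of n x] ker_diff_integrable_mult[OF f2, of n x]
    cont_L1[OF ker_diff_continuous[of n x]]
   by (simp add: smoothing_eq[OF fi])
  finally show ?thesis by (simp add: power2_eq_square)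
 qed
 have fS: "L1 (%x. f x * ?S x)"
  using smooth_L1_mult[OF smoothing_smooth fi] by (simp add: mult.commute)
 have S2: "L1 (%x. (?S x)^2)"
  by (intro smooth_L1 torus_smooth_power smoothing_smooth)
 have "(AV x. (f x - ?S x)^2) = (AV x. (f x)^2 - 2 * (f x * ?S x) + (?S x)^2)"
  by (simp add: power2_diff algebra_simps)
 also have "... = (AV x. (f x)^2) - 2 * energy n f + (AV x. (?S x)^2)"
  using fS S2 f2 LINT_smoothing[OF fi fi, of n] by (simp add: energy_def power2_eq_square)
 also have "(AV x. (?S x)^2) <= (AV x. 1 * smoothing n (%x. (f x)^2) x)"
  using jensen S2 by (intro integral_mono) (auto intro: smoothing_integrable)
 also have "... = (AV x. (f x)^2 * smoothing n (%x. 1) x)"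
  by (rule smoothing_symmetric[OF f2]) simp
 finally show ?thesis by (simp add: smoothing_const1)
qed

lemma smoothing_diff:
 assumes "L1 f" "L1 g"
 shows "smoothing n (%x. f x - g x) x = smoothing n f x - smoothing n g x"
 using ker_diff_integrable_mult[OF assms(1), of n x] ker_diff_integrable_mult[OF assms(2), of n x]
 by (simp add: smoothing_eq assms right_diff_distrib)

subsection \<open>approximation\<close>

lemma torus_LINT_reflect_shift:
 fixes f :: "real^2 => real"
 assumes f: "cont f" and per: "periodic f"
 shows "(AV y. f (x - y)) = avg f"
proof -
 let ?g = "%y. f (x + y)"
 have "cont ?g" "periodic ?g"
  using continuous_translate[OF f, of x] periodic_translate[OF per, of x] by (simp_all add: add.commute)
 from torus_LINT_reflect[OF this] show ?thesis
  using torus_LINT_shift[OF f per, of x] by (simp add: add.commute)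
qed

lemma ker_sin2: "(AV y. ker n (x - y) * (sin (pi * (x $ i - y $ i)))^2) = 1 / (2 * real n + 2)"
proof -
 let ?F = "%z. ker n z * (sin (pi * (z $ i)))^2"
 have "(sin (pi * ((z + axis k 1) $ i)))^2 = (sin (pi * (z $ i)))^2" for z :: "real^2" and k
  by (auto simp: axis_def distrib_left sin_add power_mult_distrib)
 then have per: "periodic ?F" using ker_smooth[of n] by (simp add: torus_smooth_def periodic_def)
 have c: "cont ?F"
  by (intro continuous_intros smooth_cont ker_smooth)
 from torus_LINT_reflect_shift[OF c per, of x] show ?thesis by (simp add: sin_axis_LINT)
qed

text \<open>On the open cell the zeros of both \<open>sin (\<pi> (x\<^sub>i - y\<^sub>i))\<close> force \<open>y = x\<close>, so the second moment of the kernel controls the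
contribution of points away from \<open>x\<close>.\<close>
lemma smoothing_pointwise:
 fixes g :: "real^2 => real"
 assumes g: "cont g" and C: "!!x. \<bar>g x\<bar> <= C" and x: "x \<in> box 0 1"
 shows "(%n. smoothing n g x) ----> g x"
proof (rule LIMSEQ_I)
 fix e :: real assume e: "e > 0"
 have C0: "C >= 0" using C[of 0] by simp
 obtain d where d: "d > 0" "!!y. dist y x < d ==> \<bar>g y - g x\<bar> < e / 2"
  using g e unfolding continuous_on_iff dist_real_def by (metis UNIV_I half_gt_zero)
 let ?s = "%y::real^2. (sin (pi * (x $ 1 - y $ 1)))^2 + (sin (pi * (x $ 2 - y $ 2)))^2"
 let ?A = "cbox 0 1 \<inter> {y. d <= dist y x}"
 have "\<exists>m>0. \<forall>y\<in>?A. m <= ?s y"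
 proof (cases "?A = {}")
  case True then show ?thesis by (auto intro: exI[of _ 1])
 next
  case False
  have "compact ?A" by (intro compact_Int_closed compact_cbox closed_Collect_le continuous_intros)
  moreover have "continuous_on ?A ?s" by (intro continuous_intros)
  ultimately obtain y where y: "y \<in> ?A" "\<forall>z\<in>?A. ?s y <= ?s z" using continuous_attains_inf[OF _ False] by blast
  have "?s y ~= 0"
  proof
   assume "?s y = 0"
   then have "sin (pi * (x $ i - y $ i)) = 0" for i using exhaust_2[of i] by (auto simp: sum_power2_eq_zero_iff)
   then have "sin (pi * (x $ i - y $ i)) = 0" "\<bar>x $ i - y $ i\<bar> < 1" for i
   proof -
    fix i
    show "sin (pi * (x $ i - y $ i)) = 0" by fact
    have "0 < x $ i" "x $ i < 1" "0 <= y $ i" "y $ i <= 1" using x y(1) by (auto simp: mem_box_cart)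
    then show "\<bar>x $ i - y $ i\<bar> < 1" by linarith
   qed
   then have "x $ i = y $ i" for i
   proof -
    have "\<exists>k::int. pi * (x $ i - y $ i) = of_int k * pi"
     using \<open>!!i. sin (pi * (x $ i - y $ i)) = 0\<close>[of i] sin_zero_iff_int2 by blast
    then obtain k :: int where "x $ i - y $ i = of_int k" by (auto simp: mult.commute)
    moreover have "k = 0"
    proof -
     have "\<bar>real_of_int k\<bar> < 1" using \<open>!!i. \<bar>x $ i - y $ i\<bar> < 1\<close>[of i] calculation by simp
     then show ?thesis by linarith
    qed
    ultimately show ?thesis by simp
   qed
   then have "x = y" by (simp add: vec_eq_iff)
   then show False using y(1) d by simp
  qed
  moreover have "?s y >= 0" by simp
  ultimately have "?s y > 0" by linarith
  then show ?thesis using y(2) by blast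
 qed
 then obtain m where m: "m > 0" "!!y. y \<in> ?A ==> m <= ?s y" by blast
 let ?M = "2 * C / m"
 have M0: "?M >= 0" using C0 m by simp
 have pt: "\<bar>g y - g x\<bar> <= e / 2 + ?M * ?s y" if "y \<in> torus" for y
 proof (cases "dist y x < d")
  case True
  have "0 <= ?M * ?s y" using M0 by (intro mult_nonneg_nonneg) auto
  then show ?thesis using d(2)[OF True] by linarith
 next
  case False
  then have "m <= ?s y" using that box_torus(2) by (intro m) auto
  then have "?M * m <= ?M * ?s y" using M0 by (intro mult_left_mono)
  moreover have "?M * m = 2 * C" using m by simp
  moreover have "\<bar>g y - g x\<bar> <= 2 * C" using C[of x] C[of y] by linarith
  ultimately show ?thesis using e by linarith
 qed
 have gi: "L1 g" by (rule cont_L1[OF g])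
 have bound: "\<bar>smoothing n g x - g x\<bar> <= e / 2 + ?M * (2 / (2 * real n + 2))" for n
 proof -
  have c: "L1 (%y. ker n (x - y) * h y)" if "cont h" for h
   by (rule ker_diff_integrable_mult[OF cont_L1[OF that]])
  have s1: "L1 (%y. ker n (x - y) * (sin (pi * (x $ 1 - y $ 1)))^2)"
   and s2: "L1 (%y. ker n (x - y) * (sin (pi * (x $ 2 - y $ 2)))^2)"
   by (intro c continuous_intros)+
  have k: "L1 (%y. ker n (x - y))" by (rule cont_L1[OF ker_diff_continuous])
  have "smoothing n g x - g x = (AV y. ker n (x - y) * g y) - g x * (AV y. ker n (x - y))"
   by (simp add: smoothing_eq[OF gi] ker_diff_LINT)
  also have "... = (AV y. ker n (x - y) * (g y - g x))"
   using c[OF g] k by (simp add: right_diff_distrib mult.commute[of "g x"])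
  finally have "\<bar>smoothing n g x - g x\<bar> <= (AV y. \<bar>ker n (x - y) * (g y - g x)\<bar>)" by (simp add: integral_abs_bound)
  also have "... <= (AV y. (e / 2) * ker n (x - y) + ?M * (ker n (x - y) * (sin (pi * (x $ 1 - y $ 1)))^2)
    + ?M * (ker n (x - y) * (sin (pi * (x $ 2 - y $ 2)))^2))"
  proof (rule integral_mono)
   show "L1 (%y. \<bar>ker n (x - y) * (g y - g x)\<bar>)"
    by (intro integrable_abs c continuous_intros g)
   fix y assume "y \<in> space TM"
   then have "ker n (x - y) * \<bar>g y - g x\<bar> <= ker n (x - y) * (e / 2 + ?M * ?s y)"
    using pt by (intro mult_left_mono ker_nonneg) auto
   then show "\<bar>ker n (x - y) * (g y - g x)\<bar> <= (e / 2) * ker n (x - y) + ?M * (ker n (x - y) * (sin (pi * (x $ 1 - y $ 1)))^2)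
    + ?M * (ker n (x - y) * (sin (pi * (x $ 2 - y $ 2)))^2)"
    using ker_nonneg[of n "x - y"] by (simp add: abs_mult distrib_left mult_ac)
  qed (use k s1 s2 in auto)
  also have "... = (e / 2) * 1 + ?M * (1 / (2 * real n + 2)) + ?M * (1 / (2 * real n + 2))"
   using k s1 s2 by (simp add: ker_diff_LINT ker_sin2)
  finally show ?thesis by (simp add: algebra_simps)
 qed
 have "(%n. ?M * inverse (real (Suc n))) ----> ?M * 0"
  by (intro tendsto_intros LIMSEQ_inverse_real_of_nat)
 moreover have "inverse (real (Suc n)) = 2 / (2 * real n + 2)" for n by (simp add: field_simps)
 ultimately have "(%n. ?M * (2 / (2 * real n + 2))) ----> ?M * 0" by (simp only:)
 then obtain N where N: "!!n. n >= N ==> \<bar>?M * (2 / (2 * real n + 2))\<bar> < e / 2"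
  using e LIMSEQ_D[of "%n. ?M * (2 / (2 * real n + 2))" 0 "e / 2"] by auto
 show "\<exists>N. \<forall>n\<ge>N. norm (smoothing n g x - g x) < e"
  using bound N by (intro exI[of _ N]) (smt (verit) field_sum_of_halves real_norm_def)
qed

section \<open>Convergence of the smoothing\<close>

lemma AE_torus_interior: "AE x in TM. x \<in> box 0 1"
proof -
 have "negligible (torus - box 0 (1::real^2))"
 proof (rule negligible_subset)
  show "negligible (frontier (cbox 0 (1::real^2)))" by (rule negligible_convex_frontier) simp
  have "frontier (cbox 0 (1::real^2)) = cbox 0 1 - box 0 1"
   by (simp only: frontier_def interior_cbox closure_closed closed_cbox)
  then show "torus - box 0 1 \<subseteq> frontier (cbox 0 (1::real^2))" using box_torus(2) by auto
 qed
 then have "AE x in lebesgue. x \<notin> torus - box 0 (1::real^2)"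
  by (intro AE_not_in) (simp add: negligible_iff_null_sets)
 then have "AE x in lebesgue. x \<in> torus --> x \<in> box 0 1" by (rule AE_mp) (auto intro!: AE_I2)
 then show ?thesis by (subst AE_restrict_space_iff) auto
qed

lemma smoothing_L1_tendsto_continuous:
 fixes g :: "real^2 => real"
 assumes g: "cont g" and C: "!!x. \<bar>g x\<bar> <= C"
 shows "(%n. AV x. \<bar>g x - smoothing n g x\<bar>) ----> 0"
proof -
 have "(%n. AV x. \<bar>g x - smoothing n g x\<bar>) ----> (AV x. 0)"
 proof (rule integral_dominated_convergence[where w="%x. 2 * C"])
  show "(%x. \<bar>g x - smoothing n g x\<bar>) \<in> TBorel" for n
   by (intro continuous_torus_measurable continuous_intros g smooth_cont smoothing_smooth)
  show "AE x in TM. (%n. \<bar>g x - smoothing n g x\<bar>) ----> 0"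
   using AE_torus_interior
  proof (rule AE_mp, intro AE_I2 impI)
   fix x assume "x \<in> box 0 (1::real^2)"
   from tendsto_diff[OF tendsto_const[of "g x"] smoothing_pointwise[OF g C this]]
   show "(%n. \<bar>g x - smoothing n g x\<bar>) ----> 0" by (simp add: tendsto_rabs_zero_iff)
  qed
  show "AE x in TM. norm \<bar>g x - smoothing n g x\<bar> <= 2 * C" for n
  proof (intro AE_I2)
   fix x
   have "\<bar>smoothing n g x\<bar> <= C" by (rule smoothing_bounded[OF continuous_torus_measurable[OF g] C])
   then show "norm \<bar>g x - smoothing n g x\<bar> <= 2 * C" using C[of x] by (simp; linarith)
  qed
 qed auto
 then show ?thesis by simp
qed

lemma continuous_approx_bounded:
 fixes f :: "real^2 => real"
 assumes f: "f \<in> TBorel" and C: "!!x. x \<in> torus ==> \<bar>f x\<bar> <= C" and C0: "C >= 0" and e: "e > 0"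
 obtains g where "cont g" "!!x. \<bar>g x\<bar> <= C" "(AV x. \<bar>f x - g x\<bar>) < e"
proof -
 have "f measurable_on torus" using f measurable_on_iff_borel_measurable[of torus f] by simp
 then obtain N g where N: "negligible N" and g: "!!n. cont (g n)"
  and lim: "!!x. x \<notin> N ==> (%n. g n x) ----> (if x \<in> torus then f x else 0)"
  unfolding measurable_on_def by blast
 let ?h = "%n x. max (- C) (min C (g n x))"
 have h: "cont (?h n)" for n by (intro continuous_intros g)
 have hb: "\<bar>?h n x\<bar> <= C" for n x using C0 by auto
 have "(%n. AV x. \<bar>f x - ?h n x\<bar>) ----> (AV x. 0)"
 proof (rule integral_dominated_convergence[where w="%x. 2 * C"])
  show "(%x. \<bar>f x - ?h n x\<bar>) \<in> TBorel" for n
   using f continuous_torus_measurable[OF h[of n]] by measurable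
  have "AE x in lebesgue. x \<notin> N" using N by (intro AE_not_in) (simp add: negligible_iff_null_sets)
  then have "AE x in TM. x \<notin> N" by (subst AE_restrict_space_iff) (auto elim: AE_mp)
  then show "AE x in TM. (%n. \<bar>f x - ?h n x\<bar>) ----> 0"
  proof (rule AE_mp, intro AE_I2 impI)
   fix x assume x: "x \<in> space TM" "x \<notin> N"
   then have "(%n. g n x) ----> f x" using lim[of x] by simp
   then have "(%n. ?h n x) ----> max (- C) (min C (f x))" by (intro tendsto_intros)
   moreover have "max (- C) (min C (f x)) = f x" using C[of x] x by (auto simp: abs_le_iff)
   ultimately have "(%n. f x - ?h n x) ----> f x - f x" by (intro tendsto_diff tendsto_const) simp
   then show "(%n. \<bar>f x - ?h n x\<bar>) ----> 0" by (simp add: tendsto_rabs_zero_iff)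
  qed
  show "AE x in TM. norm \<bar>f x - ?h n x\<bar> <= 2 * C" for n
  proof (intro AE_I2)
   fix x assume "x \<in> space TM"
   then show "norm \<bar>f x - ?h n x\<bar> <= 2 * C" using C[of x] hb[of n x] by (simp; linarith)
  qed
 qed auto
 then have "(%n. AV x. \<bar>f x - ?h n x\<bar>) ----> 0" by simp
 from order_tendstoD(2)[OF this e] obtain n where "(AV x. \<bar>f x - ?h n x\<bar>) < e"
  by (auto simp: eventually_sequentially)
 then show ?thesis using that[OF h hb] by blast
qed

lemma truncation_approx:
 fixes f :: "'a => real"
 assumes f: "integrable M f"
 shows "(%n. LINT x|M. \<bar>f x - max (- real n) (min (real n) (f x))\<bar>) ----> 0"
proof -
 have "(%n. LINT x|M. \<bar>f x - max (- real n) (min (real n) (f x))\<bar>) ----> (LINT x|M. 0)"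
 proof (rule integral_dominated_convergence[where w="%x. \<bar>f x\<bar>"])
  show "AE x in M. (%n. \<bar>f x - max (- real n) (min (real n) (f x))\<bar>) ----> 0"
  proof (intro AE_I2 tendsto_eventually)
   fix x
   obtain N :: nat where "\<bar>f x\<bar> <= real N" using real_arch_simple by blast
   then show "\<forall>\<^sub>F n in sequentially. \<bar>f x - max (- real n) (min (real n) (f x))\<bar> = 0"
    by (intro eventually_sequentiallyI[of N]) (auto simp: abs_le_iff)
  qed
  show "AE x in M. norm \<bar>f x - max (- real n) (min (real n) (f x))\<bar> <= \<bar>f x\<bar>" for n
   by (intro AE_I2) (auto simp: max_def min_def)
 qed (use f in auto)
 then show ?thesis by simp
qed

lemma L1_triangle:
 assumes "integrable M f" "integrable M g" "integrable M h"
 shows "(LINT x|M. \<bar>f x - h x\<bar>) <= (LINT x|M. \<bar>f x - g x\<bar>) + (LINT x|M. \<bar>g x - h x :: real\<bar>)"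
proof -
 have "(LINT x|M. \<bar>f x - h x\<bar>) <= (LINT x|M. \<bar>f x - g x\<bar> + \<bar>g x - h x\<bar>)"
  using assms by (intro integral_mono) auto
 also have "... = (LINT x|M. \<bar>f x - g x\<bar>) + (LINT x|M. \<bar>g x - h x\<bar>)"
  using assms by (intro integral_add) auto
 finally show ?thesis .
qed

lemma smoothing_L1_tendsto:
 fixes f :: "real^2 => real"
 assumes f: "L1 f"
 shows "(%n. AV x. \<bar>f x - smoothing n f x\<bar>) ----> 0"
proof (rule LIMSEQ_I)
 fix e :: real assume e: "e > 0"
 obtain N :: nat where N: "(AV x. \<bar>f x - max (- real N) (min (real N) (f x))\<bar>) < e / 5"
  using order_tendstoD(2)[OF truncation_approx[OF f], of "e / 5"] e by (auto simp: eventually_sequentially)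
 let ?t = "%x. max (- real N) (min (real N) (f x))"
 have tm: "?t \<in> TBorel" using f by measurable
 obtain g where g: "cont g" "!!x. \<bar>g x\<bar> <= real N" "(AV x. \<bar>?t x - g x\<bar>) < e / 5"
  by (rule continuous_approx_bounded[OF tm, of "real N" "e / 5"]) (use e in "auto simp: abs_le_iff")
 have ti: "L1 ?t" by (rule bounded_L1[OF tm, of "real N"]) auto
 have gi: "L1 g" by (rule cont_L1[OF g(1)])
 have fg: "(AV x. \<bar>f x - g x\<bar>) < 2 * e / 5"
  using L1_triangle[OF f ti gi] N g(3) by simp
 obtain n0 where n0: "!!n. n >= n0 ==> (AV x. \<bar>g x - smoothing n g x\<bar>) < e / 5"
  using order_tendstoD(2)[OF smoothing_L1_tendsto_continuous[OF g(1,2)], of "e / 5"] e by (auto simp: eventually_sequentially)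
 have "\<bar>AV x. \<bar>f x - smoothing n f x\<bar>\<bar> < e" if "n >= n0" for n
 proof -
  have "(AV x. \<bar>smoothing n g x - smoothing n f x\<bar>) = (AV x. \<bar>smoothing n (%x. f x - g x) x\<bar>)"
   by (simp add: smoothing_diff[OF f gi] abs_minus_commute)
  also have "... <= (AV x. \<bar>f x - g x\<bar>)" by (rule smoothing_L1) (use f gi in simp)
  finally have 1: "(AV x. \<bar>smoothing n g x - smoothing n f x\<bar>) < 2 * e / 5" using fg by simp
  have "(AV x. \<bar>f x - smoothing n f x\<bar>) < e"
   using L1_triangle[OF f gi smoothing_integrable[of n f]] L1_triangle[OF gi smoothing_integrable[of n g] smoothing_integrable[of n f]]
    1 fg n0[OF that] by linarith
  then show ?thesis by simp
 qed
 then show "\<exists>no. \<forall>n\<ge>no. norm ((AV x. \<bar>f x - smoothing n f x\<bar>) - 0) < e"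
  by (intro exI[of _ n0]) simp
qed

lemma LINT_abs_le:
 assumes g: "integrable M g" and le: "!!x. x \<in> space M ==> \<bar>f x\<bar> <= (g x :: real)"
 shows "\<bar>LINT x|M. f x\<bar> <= (LINT x|M. g x)"
proof (cases "integrable M f")
 case True
 have "\<bar>LINT x|M. f x\<bar> <= (LINT x|M. \<bar>f x\<bar>)" by (rule integral_abs_bound)
 also have "... <= (LINT x|M. g x)" using True g le by (intro integral_mono) auto
 finally show ?thesis .
next
 case False
 have "0 <= (LINT x|M. g x)" using le by (intro integral_nonneg) (meson abs_ge_zero order_trans)
 then show ?thesis using False by (simp add: not_integrable_integral_eq)
qed

lemma energy_tendsto:
 assumes f: "f \<in> TBorel" and C: "!!x. x \<in> torus ==> \<bar>f x\<bar> <= C"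
 shows "(%n. energy n f) ----> (AV x. (f x)^2)"
proof -
 have fi: "L1 f" by (rule bounded_L1[OF f]) (use C in auto)
 have f2: "L1 (%x. (f x)^2)"
 proof (rule bounded_L1[where C="C^2"])
  fix x assume "x \<in> torus"
  then show "norm ((f x)^2) <= C^2" using C[of x] by (simp add: abs_le_square_iff[symmetric])
 qed (use f in measurable)
 have "(%n. energy n f - (AV x. (f x)^2)) ----> 0"
 proof (rule Lim_null_comparison)
  show "\<forall>\<^sub>F n in sequentially. norm (energy n f - (AV x. (f x)^2)) <= C * (AV x. \<bar>f x - smoothing n f x\<bar>)"
  proof (intro always_eventually allI)
   fix n
   have fS: "L1 (%x. f x * smoothing n f x)"
    using smooth_L1_mult[OF smoothing_smooth fi] by (simp add: mult.commute)
   have "(AV x. (f x)^2) - energy n f = (AV x. f x * (f x - smoothing n f x))"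
    using fS f2 LINT_smoothing[OF fi fi, of n] by (simp add: energy_def power2_eq_square right_diff_distrib)
   also have "\<bar>...\<bar> <= (AV x. C * \<bar>f x - smoothing n f x\<bar>)"
   proof (rule LINT_abs_le)
    show "L1 (%x. C * \<bar>f x - smoothing n f x\<bar>)" using fi smoothing_integrable[of n f] by simp
    fix x assume "x \<in> space TM"
    then show "\<bar>f x * (f x - smoothing n f x)\<bar> <= C * \<bar>f x - smoothing n f x\<bar>"
     using C[of x] by (simp add: abs_mult mult_right_mono)
   qed
   finally show "norm (energy n f - (AV x. (f x)^2)) <= C * (AV x. \<bar>f x - smoothing n f x\<bar>)"
    by (simp add: abs_minus_commute)
  qed
  show "(%n. C * (AV x. \<bar>f x - smoothing n f x\<bar>)) ----> 0"
   using tendsto_mult_right_zero[OF smoothing_L1_tendsto[OF fi], of C] by simp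
 qed
 then show ?thesis by (rule LIM_zero_cancel)
qed

subsection \<open>commutator\<close>

section \<open>The commutator estimate\<close>

text \<open>A velocity whose distributional gradient is a finite measure of mass at most \<open>G\<close> in each component, in the only form in which it is
used: tested against bounded smooth functions.\<close>
definition W11_bounded :: "real => (real^2 => real^2) => bool" where
 "W11_bounded G u \<longleftrightarrow> G >= 0 & (\<forall>i. L1 (%x. u x $ i)) &
  (\<forall>i l \<phi> R. torus_smooth \<phi> --> (\<forall>x. \<bar>\<phi> x\<bar> <= R) --> \<bar>AV x. partial l \<phi> x * u x $ i\<bar> <= G * R)"

lemma torus_smooth_bound:
 assumes "torus_smooth (f :: real^2 => real)"
 obtains C where "C > 0" "!!x. \<bar>f x\<bar> <= C"
 using torus_smooth_bounded[OF assms] by auto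

lemma line_lipschitz:
 fixes g :: "real^2 => real"
 assumes g: "torus_smooth g" and C: "!!x. \<bar>partial l g x\<bar> <= C"
 shows "\<bar>g (y + s *\<^sub>R axis l 1) - g y\<bar> <= C * \<bar>s\<bar>"
 using field_differentiable_bound[of UNIV "%h. g (y + h *\<^sub>R axis l 1)" "%h. partial l g (y + h *\<^sub>R axis l 1)" C s 0]
  torus_smooth_DERIV[OF g] C by simp

lemma line_taylor:
 fixes h :: "real^2 => real"
 assumes h: "torus_smooth h" and C: "!!x. \<bar>partial l (partial l h) x\<bar> <= C"
 shows "\<bar>h (y + s *\<^sub>R axis l 1) - h y - s * partial l h y\<bar> <= C * s^2"
proof -
 have C0: "C >= 0" using C[of 0] by simp
 have "norm ((%t. h (y + t *\<^sub>R axis l 1) - t * partial l h y) s - (%t. h (y + t *\<^sub>R axis l 1) - t * partial l h y) 0) <= (C * \<bar>s\<bar>) * norm (s - 0)"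
 proof (rule field_differentiable_bound[of "{-\<bar>s\<bar>..\<bar>s\<bar>}" _ "%t. partial l h (y + t *\<^sub>R axis l 1) - partial l h y"])
  fix t assume t: "t \<in> {-\<bar>s\<bar>..\<bar>s\<bar>}"
  show "((%t. h (y + t *\<^sub>R axis l 1) - t * partial l h y) has_field_derivative partial l h (y + t *\<^sub>R axis l 1) - partial l h y) (at t within {-\<bar>s\<bar>..\<bar>s\<bar>})"
   by (rule has_field_derivative_at_within) (auto intro!: derivative_eq_intros torus_smooth_DERIV[OF h])
  have "\<bar>partial l h (y + t *\<^sub>R axis l 1) - partial l h y\<bar> <= C * \<bar>t\<bar>"
   by (rule line_lipschitz[OF smooth_partial[OF h] C])
  also have "... <= C * \<bar>s\<bar>" using t C0 by (intro mult_left_mono) auto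
  finally show "norm (partial l h (y + t *\<^sub>R axis l 1) - partial l h y) <= C * \<bar>s\<bar>" by simp
 qed auto
 then show ?thesis by (simp add: power2_eq_square algebra_simps abs_mult_self_eq)
qed

lemma DERIV_quadratic:
 fixes f :: "real => real"
 assumes "!!s. \<bar>f (a + s) - f a - s * d\<bar> <= M * s^2"
 shows "(f has_real_derivative d) (at a)"
 unfolding DERIV_def
proof (rule LIM_zero_cancel, rule Lim_null_comparison)
 show "\<forall>\<^sub>F h in at 0. norm ((f (a + h) - f a) / h - d) <= M * \<bar>h\<bar>"
  unfolding eventually_at
 proof (intro exI[of _ 1] conjI ballI impI)
  fix h :: real assume h: "h ~= 0 & dist h 0 < 1"
  have "(f (a + h) - f a) / h - d = (f (a + h) - f a - h * d) / h" using h by (simp add: diff_divide_distrib)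
  then have "\<bar>(f (a + h) - f a) / h - d\<bar> <= (M * h^2) / \<bar>h\<bar>"
   using assms[of h] by (simp add: abs_divide divide_right_mono)
  also have "... = M * \<bar>h\<bar>" using h by (simp add: power2_eq_square field_simps abs_mult_self_eq)
  finally show "norm ((f (a + h) - f a) / h - d) <= M * \<bar>h\<bar>" by simp
 qed simp
 show "((%h. M * \<bar>h\<bar>) \<longlongrightarrow> 0) (at 0)"
  by (rule tendsto_eq_intros refl | simp)+
qed

lemma W11_shift_axis:
 assumes u: "W11_bounded G u" and h: "torus_smooth h" and R: "!!x. \<bar>h x\<bar> <= R"
 shows "\<bar>AV x. (h (x + a *\<^sub>R axis l 1) - h x) * u x $ i\<bar> <= G * R * \<bar>a\<bar>"
proof -
 have ui: "L1 (%x. u x $ i)" using u by (simp add: W11_bounded_def)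
 obtain C where C: "C > 0" "!!x. \<bar>partial l (partial l h) x\<bar> <= C"
  by (rule torus_smooth_bound[of "partial l (partial l h)"]) (auto intro: smooth_partial h)
 let ?h = "%a x. h (x + a *\<^sub>R axis l 1)"
 have hs: "torus_smooth (?h a)" for a by (rule torus_smooth_translate[OF h])
 have hi: "L1 (%x. ?h a x * u x $ i)" for a by (rule smooth_L1_mult[OF hs ui])
 have pi: "L1 (%x. partial l (?h a) x * u x $ i)" for a
  by (rule smooth_L1_mult[OF smooth_partial[OF hs] ui])
 let ?D = "%a. AV x. ?h a x * u x $ i"
 let ?D' = "%a. AV x. partial l (?h a) x * u x $ i"
 have D: "(?D has_real_derivative ?D' a) (at a)" for a
 proof (rule DERIV_quadratic[where M="C * (AV x. \<bar>u x $ i\<bar>)"])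
  fix s
  have "?D (a + s) - ?D a - s * ?D' a = (AV x. (?h (a + s) x - ?h a x - s * partial l (?h a) x) * u x $ i)"
  proof -
   have "?D (a + s) - ?D a - s * ?D' a = (AV x. ?h (a + s) x * u x $ i - ?h a x * u x $ i - s * (partial l (?h a) x * u x $ i))"
    using hi[of "a + s"] hi[of a] pi[of a] by simp
   then show ?thesis by (simp add: algebra_simps)
  qed
  also have "\<bar>...\<bar> <= (AV x. (C * s^2) * \<bar>u x $ i\<bar>)"
  proof (rule LINT_abs_le)
   fix x
   have "\<bar>h ((x + a *\<^sub>R axis l 1) + s *\<^sub>R axis l 1) - h (x + a *\<^sub>R axis l 1) - s * partial l h (x + a *\<^sub>R axis l 1)\<bar> <= C * s^2"
    by (rule line_taylor[OF h C(2)])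
   then have "\<bar>?h (a + s) x - ?h a x - s * partial l (?h a) x\<bar> <= C * s^2"
    by (simp add: partial_translate scaleR_add_left add.assoc)
   then show "\<bar>(?h (a + s) x - ?h a x - s * partial l (?h a) x) * u x $ i\<bar> <= (C * s^2) * \<bar>u x $ i\<bar>"
    by (simp add: abs_mult mult_right_mono)
  qed (use ui in simp)
  finally show "\<bar>?D (a + s) - ?D a - s * ?D' a\<bar> <= C * (AV x. \<bar>u x $ i\<bar>) * s^2"
   by (simp add: mult_ac)
 qed
 have "norm (?D a - ?D 0) <= (G * R) * norm (a - 0)"
 proof (rule field_differentiable_bound[of UNIV ?D ?D'])
  show "norm (?D' z) <= G * R" for z
   using u hs[of z] R unfolding W11_bounded_def by simp
 qed (use D in auto)
 moreover have "?D a - ?D 0 = (AV x. (h (x + a *\<^sub>R axis l 1) - h x) * u x $ i)"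
  using hi[of a] hi[of 0] by (simp add: left_diff_distrib)
 ultimately show ?thesis by simp
qed

lemma periodic_int:
 assumes "periodic f" shows "f (x + of_int n *\<^sub>R axis i 1) = f x"
proof -
 have nat: "f (x + of_nat n *\<^sub>R axis i 1) = f x" for x and n::nat
 proof (induction n)
  case (Suc n)
  have "x + of_nat (Suc n) *\<^sub>R axis i 1 = (x + of_nat n *\<^sub>R axis i 1) + axis i 1" by (simp add: algebra_simps)
  then show ?case using assms Suc unfolding periodic_def by metis
 qed simp
 show ?thesis
 proof (cases "n >= 0")
  case True then show ?thesis using nat[of x "nat n"] by simp
 next
  case False
  then show ?thesis using nat[of "x + of_int n *\<^sub>R axis i 1" "nat (-n)"] by simp
 qed
qed

lemma sin_lower:
 assumes "\<bar>t\<bar> <= 1 / 2" shows "\<bar>t\<bar> <= \<bar>sin (pi * t)\<bar>"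
proof -
 have pos: "t <= sin (pi * t)" if t: "0 <= t" "t <= 1 / 2" for t
 proof (cases "t <= 1 / 3")
  case True
  have "(1 / 2 * pi - 1) * t >= 0" using pi_ge_two t by (intro mult_nonneg_nonneg) auto
  moreover have "sin (pi * 0) - (1 / 2 * pi) * 0 <= sin (pi * t) - (1 / 2 * pi) * t"
  proof (rule DERIV_nonneg_imp_nondecreasing[OF t(1)])
   fix x assume x: "0 <= x" "x <= t"
   have "cos (pi / 3) <= cos (pi * x)" using x True by (intro cos_monotone_0_pi_le) (auto simp: field_simps)
   then have "1 / 2 * pi <= cos (pi * x) * pi" by (intro mult_right_mono) (auto simp: cos_60)
   moreover have "((%x. sin (pi * x) - (1 / 2 * pi) * x) has_real_derivative cos (pi * x) * pi - 1 / 2 * pi) (at x)"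
    by (auto intro!: derivative_eq_intros)
   ultimately show "\<exists>y. ((%x. sin (pi * x) - (1 / 2 * pi) * x) has_real_derivative y) (at x) & 0 <= y" by auto
  qed
  ultimately show ?thesis by (simp add: algebra_simps)
 next
  case False
  have "sin (pi / 6) <= sin (pi * t)" using False t by (intro sin_monotone_2pi_le) (auto simp: field_simps)
  then show ?thesis using t by (simp add: sin_30)
 qed
 show ?thesis
 proof (cases "t >= 0")
  case True then show ?thesis using pos[of t] assms by auto
 next
  case False then show ?thesis using pos[of "-t"] assms by auto
 qed
qed

text \<open>Shifting by \<open>z\<close> costs \<open>G\<close> times the distance of \<open>z\<close> to the lattice, after reduction of the shift by integer
periods; the distance is replaced by \<open>\<bar>sin (\<pi> z\<^sub>i)\<bar>\<close>, which the moments of the kernel can absorb.\<close>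
lemma W11_shift:
 assumes u: "W11_bounded G u" and h: "torus_smooth h" and R: "!!x. \<bar>h x\<bar> <= R"
 shows "\<bar>AV x. (h x - h (x + z)) * u x $ i\<bar> <= G * R * (\<bar>sin (pi * (z $ 1))\<bar> + \<bar>sin (pi * (z $ 2))\<bar>)"
proof -
 have ui: "L1 (%x. u x $ i)" using u by (simp add: W11_bounded_def)
 have R0: "R >= 0" using R[of 0] by simp
 have G0: "G >= 0" using u by (simp add: W11_bounded_def)
 let ?a = "%l. z $ l - of_int (round (z $ l))"
 have a: "\<bar>?a l\<bar> <= \<bar>sin (pi * (z $ l))\<bar>" for l
 proof -
  have "\<bar>?a l\<bar> <= 1 / 2" using of_int_round_abs_le[of "z $ l"] by (simp add: abs_minus_commute)
  from sin_lower[OF this] have "\<bar>?a l\<bar> <= \<bar>sin (pi * ?a l)\<bar>" .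
  also have "\<bar>sin (pi * ?a l)\<bar> = \<bar>sin (pi * (z $ l))\<bar>"
  proof -
   have "sin (pi * ?a l) = sin (pi * z $ l) * cos (pi * of_int (round (z $ l)))"
    by (simp add: right_diff_distrib sin_diff sin_int_times_real mult.commute)
   moreover have "\<bar>cos (pi * of_int (round (z $ l)))\<bar> = 1"
    using cos_int_times_real[of "round (z $ l)"] by (simp add: mult.commute power_int_def)
   ultimately show ?thesis by (simp add: abs_mult)
  qed
  finally show ?thesis .
 qed
 have per: "periodic h" using h by (simp add: torus_smooth_def)
 have hz: "h (x + z) = h ((x + ?a 1 *\<^sub>R axis 1 1) + ?a 2 *\<^sub>R axis 2 1)" for x
 proof -
  have "(x + z) = ((x + ?a 1 *\<^sub>R axis 1 1) + ?a 2 *\<^sub>R axis 2 1) + of_int (round (z $ 1)) *\<^sub>R axis 1 1 + of_int (round (z $ 2)) *\<^sub>R axis 2 1"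
   by (simp add: vec_eq_iff forall_2 axis_def)
  then show ?thesis by (simp only: periodic_int[OF per])
 qed
 let ?h = "%x. h (x + ?a 1 *\<^sub>R axis 1 1)" and ?k = "%x. h ((x + ?a 1 *\<^sub>R axis 1 1) + ?a 2 *\<^sub>R axis 2 1)"
 let ?h2 = "%x. h (x + ?a 2 *\<^sub>R axis 2 1)"
 have h2: "torus_smooth ?h2" by (rule torus_smooth_translate[OF h])
 have i1: "L1 (%x. (?h2 (x + ?a 1 *\<^sub>R axis 1 1) - ?h2 x) * u x $ i)"
  by (intro smooth_L1_mult ui torus_smooth_diff torus_smooth_translate h2)
 have i2: "L1 (%x. (?h2 x - h x) * u x $ i)"
  by (intro smooth_L1_mult ui torus_smooth_diff h h2)
 have "(AV x. (h x - h (x + z)) * u x $ i)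
   = (AV x. - ((?h2 (x + ?a 1 *\<^sub>R axis 1 1) - ?h2 x) * u x $ i + (?h2 x - h x) * u x $ i))"
  by (rule integral_cong[OF refl]) (simp add: hz left_diff_distrib)
 also have "... = - ((AV x. (?h2 (x + ?a 1 *\<^sub>R axis 1 1) - ?h2 x) * u x $ i) + (AV x. (?h2 x - h x) * u x $ i))"
  by (simp only: Bochner_Integration.integral_minus integral_add[OF i1 i2])
 finally have eq: "(AV x. (h x - h (x + z)) * u x $ i)
  = - ((AV x. (?h2 (x + ?a 1 *\<^sub>R axis 1 1) - ?h2 x) * u x $ i) + (AV x. (?h2 x - h x) * u x $ i))" .
 have A: "\<bar>AV x. (?h2 (x + ?a 1 *\<^sub>R axis 1 1) - ?h2 x) * u x $ i\<bar> <= G * R * \<bar>?a 1\<bar>"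
  by (rule W11_shift_axis[OF u h2]) (rule R)
 have B: "\<bar>AV x. (?h2 x - h x) * u x $ i\<bar> <= G * R * \<bar>?a 2\<bar>"
  by (rule W11_shift_axis[OF u h]) (rule R)
 have "\<bar>AV x. (h x - h (x + z)) * u x $ i\<bar> <= \<bar>AV x. (?h2 (x + ?a 1 *\<^sub>R axis 1 1) - ?h2 x) * u x $ i\<bar> + \<bar>AV x. (?h2 x - h x) * u x $ i\<bar>"
  unfolding eq by linarith
 also have "... <= G * R * \<bar>?a 1\<bar> + G * R * \<bar>?a 2\<bar>"
  by (rule add_mono[OF A B])
 also have "... <= G * R * \<bar>sin (pi * (z $ 1))\<bar> + G * R * \<bar>sin (pi * (z $ 2))\<bar>"
  using G0 R0 a by (intro add_mono mult_left_mono) auto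
 finally show ?thesis by (simp add: distrib_left)
qed

interpretation torus2: pair_sigma_finite TM TM ..

lemma ker_partial_odd: "partial i (ker n) (- z) = - partial i (ker n) z"
proof -
 have "partial i (%x. ker n (- x)) z = - partial i (ker n) (- z)"
 proof (rule partialI)
  have "((%h. ker n (- z + (- h) *\<^sub>R axis i 1)) has_real_derivative partial i (ker n) (- z) * (- 1)) (at 0)"
  proof (rule DERIV_chain2[where f="%h. ker n (- z + h *\<^sub>R axis i 1)" and g="%h. - h"])
   show "((%h. ker n (- z + h *\<^sub>R axis i 1)) has_real_derivative partial i (ker n) (- z)) (at (- 0))"
    unfolding minus_zero by (rule torus_smooth_DERIV0[OF ker_smooth])
  qed (auto intro!: derivative_eq_intros)
  then show "((%h. ker n (- (z + h *\<^sub>R axis i 1))) has_real_derivative - partial i (ker n) (- z)) (at 0)"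
   by (simp only: minus_add_distrib scaleR_minus_left mult_minus1_right)
 qed
 moreover have "(%x. ker n (- x)) = ker n" by (simp add: ker_even)
 ultimately show ?thesis by simp
qed

lemma partial_ker_modes: "partial i (ker n) (x - y) = (\<Sum>j<nmodes n. partial i (mode n j) x * mode n j y)"
proof -
 have "partial i (ker n) (x - y) = partial i (%x. ker n (x + (- y))) x" by (simp only: partial_translate diff_conv_add_uminus)
 also have "(%x. ker n (x + (- y))) = (%x. \<Sum>j<nmodes n. mode n j y * mode n j x)"
  by (simp add: ker_modes mult.commute flip: diff_conv_add_uminus)
 also have "partial i ... x = (\<Sum>j<nmodes n. mode n j y * partial i (mode n j) x)"
  by (subst partial_sum) (auto intro!: torus_smooth_mult mode_smooth sum.cong partial_cmult)
 finally show ?thesis by (simp add: mult.commute)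
qed

text \<open>The derivative of an even kernel is odd, so the convolution may be antisymmetrised.\<close>
lemma partial_smoothing_eq:
 assumes \<theta>: "torus_smooth \<theta>"
 shows "partial i (smoothing n \<theta>) x = (AV z. partial i (ker n) z * (\<theta> (x - z) - \<theta> (x + z))) / 2"
proof -
 have ti: "L1 \<theta>" by (rule smooth_L1[OF \<theta>])
 have per: "periodic \<theta>" "periodic (partial i (ker n))"
  using \<theta> smooth_partial[OF ker_smooth] by (simp_all add: torus_smooth_def)
 have pm: "\<theta> (x - (z + axis k 1)) = \<theta> (x - z)" for z k
  using periodic_int[OF per(1), of "x - z" "-1" k] by (simp add: algebra_simps)
 have ct: "cont (%z. \<theta> (x - z))" "cont (%z. \<theta> (x + z))"
  by (rule continuous_on_compose2[OF smooth_cont[OF \<theta>]]; auto intro: continuous_intros)+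
 have ck: "cont (partial i (ker n))" by (intro smooth_cont smooth_partial ker_smooth)
 have c: "cont (%z. partial i (ker n) z * \<theta> (x - z))" "cont (%z. partial i (ker n) z * \<theta> (x + z))"
  by (intro continuous_on_mult ck ct)+
 have p: "periodic (%z. partial i (ker n) z * \<theta> (x - z))"
  using per(2) pm unfolding periodic_def by simp
 have "partial i (smoothing n \<theta>) x = (AV y. (\<Sum>j<nmodes n. partial i (mode n j) x * (\<theta> y * mode n j y)))"
  unfolding partial_smoothing coef_def
  by (subst integral_sum) (use integrable_mode(2)[OF ti] in "auto simp: mult.commute")
 also have "... = (AV y. partial i (ker n) (x - y) * \<theta> (x - (x - y)))"
  by (simp add: partial_ker_modes sum_distrib_left mult_ac)
 also have "... = (AV z. partial i (ker n) z * \<theta> (x - z))"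
  by (rule torus_LINT_reflect_shift[OF c(1) p])
 finally have 1: "partial i (smoothing n \<theta>) x = (AV z. partial i (ker n) z * \<theta> (x - z))" .
 have "(AV z. partial i (ker n) z * \<theta> (x - z)) = (AV z. partial i (ker n) (- z) * \<theta> (x - (- z)))"
  by (rule torus_LINT_reflect[OF c(1) p, symmetric])
 also have "... = - (AV z. partial i (ker n) z * \<theta> (x + z))" by (simp add: ker_partial_odd)
 finally have 2: "(AV z. partial i (ker n) z * \<theta> (x - z)) = - (AV z. partial i (ker n) z * \<theta> (x + z))" .
 have "(AV z. partial i (ker n) z * (\<theta> (x - z) - \<theta> (x + z)))
  = (AV z. partial i (ker n) z * \<theta> (x - z)) - (AV z. partial i (ker n) z * \<theta> (x + z))"
  unfolding right_diff_distrib by (intro integral_diff cont_L1 c)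
 then show ?thesis unfolding 1 using 2 by simp
qed

text \<open>After antisymmetrisation the integrand is \<open>h(x) - h(x + z)\<close> with \<open>h(x) = \<theta>(x) \<theta>(x - z)\<close>, so for each \<open>z\<close> only a difference
of translates of one bounded function is tested with \<open>u\<close>. The kernel derivative is paired with the distance of \<open>z\<close> to the lattice, whence no dependence on \<open>n\<close>.\<close>
lemma commutator_axis:
 assumes u: "W11_bounded G u" and \<theta>: "torus_smooth \<theta>" and R: "!!x. \<bar>\<theta> x\<bar> <= R" and n: "n >= 1"
 shows "\<bar>AV x. \<theta> x * u x $ i * partial i (smoothing n \<theta>) x\<bar> <= 2 * pi * G * R^2"
proof -
 have R0: "R >= 0" using R[of 0] by simp
 have G0: "G >= 0" using u by (simp add: W11_bounded_def)
 have ui: "L1 (%x. u x $ i)" using u by (simp add: W11_bounded_def)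
 let ?k = "partial i (ker n)"
 let ?F = "%x z. (\<theta> x * (\<theta> (x - z) - \<theta> (x + z)) * ?k z) * u x $ i"
 have ck: "cont ?k" by (intro smooth_cont smooth_partial ker_smooth)
 obtain K where K: "K > 0" "!!x. \<bar>?k x\<bar> <= K"
  by (rule torus_smooth_bound[of ?k]) (auto intro: smooth_partial ker_smooth)
 have c\<theta>: "cont \<theta>" by (rule smooth_cont[OF \<theta>])
 have RR: "\<bar>\<theta> x * (\<theta> y - \<theta> w) * ?k z\<bar> <= R * (2 * R) * K" for x y w z
 proof -
  have "\<bar>\<theta> y - \<theta> w\<bar> <= 2 * R" using R[of y] R[of w] by linarith
  then show ?thesis unfolding abs_mult using R K R0 by (intro mult_mono) auto
 qed
 have int: "integrable (TM \<Otimes>\<^sub>M TM) (%p. ?F (fst p) (snd p))"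
 proof (rule torus2.Fubini_integrable)
  have m1: "(%p. u (fst p) $ i) \<in> borel_measurable (TM \<Otimes>\<^sub>M TM)"
   by (rule measurable_compose[OF measurable_fst integrable_measurable[OF ui]])
  have id: "(%x. x) \<in> TBorel" by (rule torus_measurable_borel) simp
  have f: "fst \<in> borel_measurable (TM \<Otimes>\<^sub>M TM)" "snd \<in> borel_measurable (TM \<Otimes>\<^sub>M TM)"
   by (rule measurable_compose[OF measurable_fst id], rule measurable_compose[OF measurable_snd id])
  have t: "\<theta> \<in> Borel" "?k \<in> Borel"
   by (intro cont_Borel c\<theta> ck)+
  have "(%p. \<theta> (fst p)) \<in> borel_measurable (TM \<Otimes>\<^sub>M TM)"
   "(%p. \<theta> (fst p - snd p)) \<in> borel_measurable (TM \<Otimes>\<^sub>M TM)"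
   "(%p. \<theta> (fst p + snd p)) \<in> borel_measurable (TM \<Otimes>\<^sub>M TM)"
   "(%p. ?k (snd p)) \<in> borel_measurable (TM \<Otimes>\<^sub>M TM)"
   using measurable_compose[OF f(1) t(1)] measurable_compose[OF borel_measurable_diff[OF f] t(1)]
    measurable_compose[OF borel_measurable_add[OF f] t(1)] measurable_compose[OF f(2) t(2)] by simp_all
  then show "(%p. ?F (fst p) (snd p)) \<in> borel_measurable (TM \<Otimes>\<^sub>M TM)"
   using m1 by (intro borel_measurable_times borel_measurable_diff)
  have cz: "cont (%z. ?F x z)" for x
   by (intro continuous_intros ck continuous_on_compose2[OF c\<theta>]) auto
  show "AE x in TM. L1 (%y. ?F (fst (x, y)) (snd (x, y)))"
   using cont_L1[OF cz] by simp
  show "L1 (%x. AV y. norm (?F (fst (x, y)) (snd (x, y))))"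
  proof (rule integrable_bound)
   show "L1 (%x. (R * (2 * R) * K) * \<bar>u x $ i\<bar>)" using ui by simp
   show "(%x. AV y. norm (?F (fst (x, y)) (snd (x, y)))) \<in> TBorel"
    using \<open>(%p. ?F (fst p) (snd p)) \<in> borel_measurable (TM \<Otimes>\<^sub>M TM)\<close>
    by (intro torus.borel_measurable_lebesgue_integral) (simp add: case_prod_unfold)
   show "AE x in TM. norm (AV y. norm (?F (fst (x, y)) (snd (x, y)))) <= norm ((R * (2 * R) * K) * \<bar>u x $ i\<bar>)"
   proof (intro AE_I2)
    fix x
    have "\<bar>AV y. norm (?F (fst (x, y)) (snd (x, y)))\<bar> <= (R * (2 * R) * K) * \<bar>u x $ i\<bar>"
    proof (rule torus_LINT_bound)
     fix z
     have "\<bar>?F x z\<bar> <= (R * (2 * R) * K) * \<bar>u x $ i\<bar>"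
      unfolding abs_mult[of _ "u x $ i"] by (intro mult_right_mono RR) simp
     then show "\<bar>norm (?F (fst (x, z)) (snd (x, z)))\<bar> <= (R * (2 * R) * K) * \<bar>u x $ i\<bar>" by simp
    qed (use R0 K in simp)
    then show "norm (AV y. norm (?F (fst (x, y)) (snd (x, y)))) <= norm ((R * (2 * R) * K) * \<bar>u x $ i\<bar>)"
     using R0 K by simp
   qed
  qed
 qed
 have "(AV x. \<theta> x * u x $ i * partial i (smoothing n \<theta>) x)
   = (AV x. (AV z. ?F x z)) / 2"
 proof -
  have E: "\<theta> x * u x $ i * partial i (smoothing n \<theta>) x = (AV z. ?F x z) / 2" for x
  proof -
   have "(AV z. ?F x z) = (AV z. (\<theta> x * u x $ i) * (?k z * (\<theta> (x - z) - \<theta> (x + z))))"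
    by (simp add: mult_ac)
   also have "... = (\<theta> x * u x $ i) * (AV z. ?k z * (\<theta> (x - z) - \<theta> (x + z)))"
    by (rule integral_mult_right_zero)
   finally show ?thesis unfolding partial_smoothing_eq[OF \<theta>] by (simp only: times_divide_eq_right)
  qed
  show ?thesis unfolding E by (rule Bochner_Integration.integral_divide_zero)
 qed
 also have "(AV x. (AV z. ?F x z)) = (AV z. (AV x. ?F x z))"
  by (rule torus2.Fubini_integral[symmetric]) (use int in "simp add: case_prod_unfold")
 finally have eq: "(AV x. \<theta> x * u x $ i * partial i (smoothing n \<theta>) x) = (AV z. (AV x. ?F x z)) / 2" .
 have "\<bar>AV z. (AV x. ?F x z)\<bar>
   <= (AV z. G * R^2 * (\<bar>?k z\<bar> * \<bar>sin (pi * (z $ 1))\<bar>) + G * R^2 * (\<bar>?k z\<bar> * \<bar>sin (pi * (z $ 2))\<bar>))"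
 proof (rule LINT_abs_le)
  show "L1 (%z. G * R^2 * (\<bar>?k z\<bar> * \<bar>sin (pi * (z $ 1))\<bar>) + G * R^2 * (\<bar>?k z\<bar> * \<bar>sin (pi * (z $ 2))\<bar>))"
   by (intro cont_L1 continuous_intros ck)
  fix z
  let ?h = "%x. \<theta> x * \<theta> (x - z)"
  have hs: "torus_smooth ?h"
   using torus_smooth_mult[OF \<theta> torus_smooth_translate[OF \<theta>, of "- z"]] by simp
  have hR: "\<bar>?h x\<bar> <= R^2" for x
   using R[of x] R[of "x - z"] R0 unfolding abs_mult power2_eq_square by (intro mult_mono) auto
  have "(AV x. ?F x z) = ?k z * (AV x. (?h x - ?h (x + z)) * u x $ i)"
  proof -
   have "(AV x. ?F x z) = (AV x. ?k z * ((?h x - ?h (x + z)) * u x $ i))"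
    by (simp add: algebra_simps)
   then show ?thesis by simp
  qed
  then have "\<bar>AV x. ?F x z\<bar> <= \<bar>?k z\<bar> * (G * R^2 * (\<bar>sin (pi * (z $ 1))\<bar> + \<bar>sin (pi * (z $ 2))\<bar>))"
   using W11_shift[OF u hs hR, of z i] by (simp add: abs_mult mult_left_mono)
  then show "\<bar>AV x. ?F x z\<bar> <= G * R^2 * (\<bar>?k z\<bar> * \<bar>sin (pi * (z $ 1))\<bar>) + G * R^2 * (\<bar>?k z\<bar> * \<bar>sin (pi * (z $ 2))\<bar>)"
   by (simp add: algebra_simps)
 qed
 also have "... = G * R^2 * (AV z. \<bar>?k z\<bar> * \<bar>sin (pi * (z $ 1))\<bar>) + G * R^2 * (AV z. \<bar>?k z\<bar> * \<bar>sin (pi * (z $ 2))\<bar>)"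
  by (subst integral_add, (intro cont_L1 continuous_intros ck)+, simp)
 also have "... <= G * R^2 * (2 * pi) + G * R^2 * (2 * pi)"
  using G0 by (intro add_mono mult_left_mono ker_partial_moment n) auto
 finally show ?thesis unfolding eq by (simp add: mult_ac)
qed

lemma commutator:
 assumes u: "W11_bounded G u" and \<theta>: "torus_smooth \<theta>" and R: "!!x. \<bar>\<theta> x\<bar> <= R" and n: "n >= 1"
 shows "\<bar>AV x. \<theta> x * (u x \<bullet> grad (smoothing n \<theta>) x)\<bar> <= 4 * pi * G * R^2"
proof -
 have i: "L1 (%x. \<theta> x * u x $ i * partial i (smoothing n \<theta>) x)" for i
 proof -
  have "L1 (%x. (\<theta> x * partial i (smoothing n \<theta>) x) * u x $ i)"
   using u by (intro smooth_L1_mult torus_smooth_mult smooth_partial smoothing_smooth \<theta>) (simp add: W11_bounded_def)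
  then show ?thesis by (simp add: mult_ac)
 qed
 have "(AV x. \<theta> x * (u x \<bullet> grad (smoothing n \<theta>) x))
  = (AV x. \<theta> x * u x $ 1 * partial 1 (smoothing n \<theta>) x + \<theta> x * u x $ 2 * partial 2 (smoothing n \<theta>) x)"
  by (simp add: inner_vec_def sum_2 grad_def algebra_simps)
 also have "... = (AV x. \<theta> x * u x $ 1 * partial 1 (smoothing n \<theta>) x) + (AV x. \<theta> x * u x $ 2 * partial 2 (smoothing n \<theta>) x)"
  by (rule integral_add[OF i i])
 finally show ?thesis
  using commutator_axis[OF u \<theta> R n, of 1] commutator_axis[OF u \<theta> R n, of 2] by linarith
qed

section \<open>Weakly bounded sequences are bounded\<close>

lemma AE_summable_of_integrals:
 fixes f :: "nat => 'a => real"
 assumes f: "!!i. integrable M (f i)" and nn: "!!i x. 0 <= f i x" and s: "summable (%i. LINT x|M. f i x)"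
 shows "AE x in M. summable (%i. f i x)"
proof -
 have [measurable]: "f i \<in> borel_measurable M" for i using f by auto
 have "(\<integral>\<^sup>+x. (\<Sum>i. ennreal (f i x)) \<partial>M) = (\<Sum>i. \<integral>\<^sup>+x. ennreal (f i x) \<partial>M)" by (rule nn_integral_suminf) simp
 also have "... = (\<Sum>i. ennreal (LINT x|M. f i x))" by (simp add: nn_integral_eq_integral f nn)
 also have "... = ennreal (\<Sum>i. LINT x|M. f i x)" by (intro suminf_ennreal2 s integral_nonneg nn)
 finally have "(\<integral>\<^sup>+x. (\<Sum>i. ennreal (f i x)) \<partial>M) ~= \<infinity>" by simp
 then have "AE x in M. (\<Sum>i. ennreal (f i x)) ~= \<infinity>" by (intro nn_integral_noteq_infinite) auto
 then show ?thesis by (rule AE_mp) (auto intro!: AE_I2 summable_suminf_not_top nn)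
qed

lemma integrable_inner_L2:
 fixes f g :: "'a => 'b::euclidean_space"
 assumes f: "f \<in> borel_measurable M" "integrable M (%x. (norm (f x))^2)"
  and g: "g \<in> borel_measurable M" "integrable M (%x. (norm (g x))^2)"
 shows "integrable M (%x. norm (f x) * norm (g x))" "integrable M (%x. f x \<bullet> g x)"
  and "r > 0 ==> (LINT x|M. norm (f x) * norm (g x)) <= (r * (LINT x|M. (norm (f x))^2) + (LINT x|M. (norm (g x))^2) / r) / 2"
proof -
 have le: "norm (f x) * norm (g x) <= (norm (f x))^2 + (norm (g x))^2" for x
  using sum_squares_bound[of "norm (f x)" "norm (g x)"] mult_nonneg_nonneg[OF norm_ge_zero[of "f x"] norm_ge_zero[of "g x"]] by linarith
 have dom: "integrable M (%x. (norm (f x))^2 + (norm (g x))^2)" using f g by simp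
 show i: "integrable M (%x. norm (f x) * norm (g x))"
  by (rule integrable_bound[OF dom])
    (use f g le in "auto intro!: AE_I2")
 show "integrable M (%x. f x \<bullet> g x)"
  by (rule integrable_bound[OF i])
    (use f g Cauchy_Schwarz_ineq2 in "auto intro!: AE_I2")
 assume r: "r > 0"
 have "(LINT x|M. norm (f x) * norm (g x)) <= (LINT x|M. (r / 2) * (norm (f x))^2 + (1 / (2 * r)) * (norm (g x))^2)"
 proof (rule integral_mono[OF i])
  show "integrable M (%x. (r / 2) * (norm (f x))^2 + (1 / (2 * r)) * (norm (g x))^2)" using f g by simp
  fix x
  have "0 <= (r * norm (f x) - norm (g x))^2" by simp
  then have "2 * r * (norm (f x) * norm (g x)) <= r^2 * (norm (f x))^2 + (norm (g x))^2"
   by (simp add: power2_diff power_mult_distrib mult_ac)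
  then have "(2 * r * (norm (f x) * norm (g x))) / (2 * r) <= (r^2 * (norm (f x))^2 + (norm (g x))^2) / (2 * r)"
   using r by (intro divide_right_mono) auto
  also have "... = (r / 2) * (norm (f x))^2 + (1 / (2 * r)) * (norm (g x))^2"
   using r by (simp add: add_divide_distrib power2_eq_square[of r])
  finally show "norm (f x) * norm (g x) <= (r / 2) * (norm (f x))^2 + (1 / (2 * r)) * (norm (g x))^2" using r by simp
 qed
 also have "... = (r / 2) * (LINT x|M. (norm (f x))^2) + (1 / (2 * r)) * (LINT x|M. (norm (g x))^2)"
  using f g by simp
 finally show "(LINT x|M. norm (f x) * norm (g x)) <= (r * (LINT x|M. (norm (f x))^2) + (LINT x|M. (norm (g x))^2) / r) / 2"
  using r by (simp add: field_simps)
qed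

text \<open>The uniform boundedness principle in \<open>L\<^sup>2\<close>, by a gliding hump: if the norms exceeded \<open>4\<^sup>n\<close> along a subsequence,
the signed sum of the normalised functions with weights \<open>3\<^sup>-\<^sup>n\<close> would be a test function with unbounded pairings.\<close>
lemma weakly_bounded_imp_L2_bounded:
 fixes f :: "nat => 'a => 'b::euclidean_space"
 assumes fm: "!!k. f k \<in> borel_measurable M" and f2: "!!k. integrable M (%x. (norm (f k x))^2)"
  and weak: "!!\<phi>. \<phi> \<in> borel_measurable M ==> integrable M (%x. (norm (\<phi> x))^2) ==> \<exists>B. \<forall>k. \<bar>LINT x|M. f k x \<bullet> \<phi> x\<bar> <= B"
 shows "\<exists>K. \<forall>k. (LINT x|M. (norm (f k x))^2) <= K"
proof (rule ccontr)
 assume "~ (\<exists>K. \<forall>k. (LINT x|M. (norm (f k x))^2) <= K)"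
 then have "\<exists>k. (LINT x|M. (norm (f k x))^2) > K" for K by (meson not_le)
 then have "\<exists>k. \<forall>n. (LINT x|M. (norm (f (k n) x))^2) > (4 ^ n)^2" by (intro choice allI)
 then obtain k where k: "!!n::nat. (LINT x|M. (norm (f (k n) x))^2) > (4 ^ n)^2" by blast
 define N where "N n = sqrt (LINT x|M. (norm (f (k n) x))^2)" for n
 have N: "N n > 4 ^ n" for n unfolding N_def using k[of n] by (rule real_less_rsqrt)
 have Npos: "N n > 0" for n using N[of n] by (meson dual_order.strict_trans zero_less_numeral zero_less_power)
 have N2: "(LINT x|M. (norm (f (k n) x))^2) = (N n)^2" for n unfolding N_def using Npos[of n] by (simp add: N_def)
 define h where "h n x = (1 / N n) *\<^sub>R f (k n) x" for n x
 have hm: "h n \<in> borel_measurable M" for n unfolding h_def using fm by measurable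
 have h2e: "(norm (h n x))^2 = (1 / N n)^2 * (norm (f (k n) x))^2" for n x
  unfolding h_def norm_scaleR power_mult_distrib using Npos[of n] by simp
 have h2: "integrable M (%x. (norm (h n x))^2)" and h1: "(LINT x|M. (norm (h n x))^2) = 1" for n
  unfolding h2e using f2[of "k n"] N2[of n] Npos[of n] by (simp_all add: field_simps)
 define A where "A n m = (LINT x|M. f (k n) x \<bullet> h m x)" for n m
 have Ann: "A n n = N n" for n
 proof -
  have "A n n = (LINT x|M. (1 / N n) * (norm (f (k n) x))^2)" unfolding A_def h_def by (simp add: power2_norm_eq_inner)
  then show ?thesis using N2[of n] Npos[of n] by (simp add: power2_eq_square)
 qed
 have nfh: "(LINT x|M. norm (f (k n) x) * norm (h m x)) <= N n" for n m
 proof -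
  have "(LINT x|M. norm (f (k n) x) * norm (h m x))
    <= (1 / N n * (LINT x|M. (norm (f (k n) x))^2) + (LINT x|M. (norm (h m x))^2) / (1 / N n)) / 2"
   by (rule integrable_inner_L2(3)[OF fm f2 hm h2]) (use Npos[of n] in simp)
  also have "... = N n" unfolding N2 h1 using Npos[of n] by (simp add: power2_eq_square)
  finally show ?thesis .
 qed
 have Abd: "\<bar>A n m\<bar> <= N n" for n m
 proof -
  have "\<bar>A n m\<bar> <= (LINT x|M. norm (f (k n) x) * norm (h m x))" unfolding A_def
   by (rule LINT_abs_le[OF integrable_inner_L2(1)[OF fm f2 hm h2]]) (rule Cauchy_Schwarz_ineq2)
  then show ?thesis using nfh[of n m] by linarith
 qed
 let ?w = "%m. (1 / 3 :: real) ^ m"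
 let ?P = "%s n r. \<bar>r\<bar> = 1 & ?w n * N n <= \<bar>(\<Sum>m<n. s m * ?w m * A n m) + r * ?w n * N n\<bar>"
 \<comment> \<open>each sign is chosen so that the new hump does not cancel against the previous ones\<close>
 have "\<exists>s::nat => real. \<forall>n. ?P s n (s n)"
 proof (rule dependent_wellorder_choice)
  fix r :: real and s s' :: "nat => real" and n assume "!!m. m < n ==> s m = s' m"
  then have "(\<Sum>m<n. s m * ?w m * A n m) = (\<Sum>m<n. s' m * ?w m * A n m)" by (intro sum.cong) auto
  then show "?P s n r = ?P s' n r" by simp
 next
  fix n :: nat and s :: "nat => real"
  let ?S = "\<Sum>m<n. s m * ?w m * A n m"
  have p: "0 <= ?w n * N n" using Npos[of n] by simp
  show "\<exists>r. ?P s n r"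
  proof (cases "?S >= 0")
   case True then show ?thesis using p by (intro exI[of _ 1]) (simp del: power_one_over)
  next
   case False then show ?thesis using p by (intro exI[of _ "-1"]) (simp del: power_one_over)
  qed
 qed
 then obtain s :: "nat => real" where s: "!!n. \<bar>s n\<bar> = 1"
  and big: "!!n. ?w n * N n <= \<bar>(\<Sum>m<n. s m * ?w m * A n m) + s n * ?w n * N n\<bar>" by blast
 define H where "H x = (\<Sum>m. ?w m * (norm (h m x))^2)" for x
 have wsum: "summable ?w" by simp
 have Hint: "integrable M (%x. ?w m * (norm (h m x))^2)" "(LINT x|M. ?w m * (norm (h m x))^2) = ?w m" for m
  using h2[of m] h1[of m] by simp_all
 have AEH: "AE x in M. summable (%m. ?w m * (norm (h m x))^2)"
  by (rule AE_summable_of_integrals) (use Hint wsum in auto)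
 have HI: "integrable M H" unfolding H_def
  by (rule integrable_suminf) (use Hint wsum AEH in auto)
 have Gb: "(\<Sum>m<n. ?w m * norm (h m x))^2 <= 3 / 2 * H x" if "summable (%m. ?w m * (norm (h m x))^2)" for x n
 proof -
  let ?r = "%m. sqrt (?w m)"
  have rr: "?r m * ?r m = ?w m" for m by simp
  have "(\<Sum>m<n. ?w m * norm (h m x)) = (\<Sum>m<n. ?r m * (?r m * norm (h m x)))"
   by (simp only: mult.assoc[symmetric] rr)
  then have "(\<Sum>m<n. ?w m * norm (h m x))^2 <= (\<Sum>m<n. (?r m)^2) * (\<Sum>m<n. (?r m * norm (h m x))^2)"
   using Cauchy_Schwarz_ineq_sum[of ?r "%m. ?r m * norm (h m x)" "{..<n}"] by (simp only:)
  also have "... = (\<Sum>m<n. ?w m) * (\<Sum>m<n. ?w m * (norm (h m x))^2)" by (simp add: power_mult_distrib)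
  also have "... <= (3 / 2) * H x"
  proof (rule mult_mono)
   have "(\<Sum>m<n. ?w m) <= (\<Sum>m. ?w m)" by (rule sum_le_suminf[OF wsum]) auto
   also have "... = 3 / 2" by (subst suminf_geometric) auto
   finally show "(\<Sum>m<n. ?w m) <= 3 / 2" .
   show "(\<Sum>m<n. ?w m * (norm (h m x))^2) <= H x" unfolding H_def by (rule sum_le_suminf[OF that]) auto
  qed (auto intro!: sum_nonneg)
  finally show ?thesis .
 qed
 have H0: "H x >= 0" if "summable (%m. ?w m * (norm (h m x))^2)" for x
  unfolding H_def using that by (intro suminf_nonneg) auto
 have Gs: "summable (%m. ?w m * norm (h m x))" if sm: "summable (%m. ?w m * (norm (h m x))^2)" for x
 proof (rule summableI_nonneg_bounded)
  fix n show "(\<Sum>m<n. ?w m * norm (h m x)) <= sqrt (3 / 2 * H x)" using Gb[OF sm] by (intro real_le_rsqrt)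
 qed simp
 let ?t = "%m x. (s m * ?w m) *\<^sub>R h m x"
 define \<phi> where "\<phi> x = (\<Sum>m. ?t m x)" for x
 have nt: "norm (?t m x) = ?w m * norm (h m x)" for m x using s[of m] by (simp add: abs_mult)
 have \<phi>m: "\<phi> \<in> borel_measurable M" unfolding \<phi>_def using hm by (intro borel_measurable_suminf) measurable
 have \<phi>b: "(norm (\<phi> x))^2 <= 3 / 2 * H x" if sm: "summable (%m. ?w m * (norm (h m x))^2)" for x
 proof -
  have "summable (%m. norm (?t m x))" unfolding nt by (rule Gs[OF sm])
  then have "summable (%m. ?t m x)" by (rule summable_norm_cancel)
  then have "(%n. (norm (\<Sum>m<n. ?t m x))^2) ----> (norm (\<phi> x))^2"
   unfolding \<phi>_def by (intro tendsto_intros summable_LIMSEQ)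
  moreover have "(norm (\<Sum>m<n. ?t m x))^2 <= 3 / 2 * H x" for n
  proof -
   have "norm (\<Sum>m<n. ?t m x) <= (\<Sum>m<n. ?w m * norm (h m x))" using norm_sum[of "%m. ?t m x" "{..<n}"] unfolding nt .
   then have "(norm (\<Sum>m<n. ?t m x))^2 <= (\<Sum>m<n. ?w m * norm (h m x))^2" by (intro power_mono) auto
   then show ?thesis using Gb[OF sm, of n] by linarith
  qed
  ultimately show ?thesis by (intro LIMSEQ_le_const2) auto
 qed
 have \<phi>2: "integrable M (%x. (norm (\<phi> x))^2)"
 proof (rule integrable_bound)
  show "integrable M (%x. 3 / 2 * H x)" using HI by simp
  show "AE x in M. norm ((norm (\<phi> x))^2) <= norm (3 / 2 * H x)"
   using AEH by (rule AE_mp) (use \<phi>b H0 in "auto intro!: AE_I2")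
 qed (use \<phi>m in measurable)
 obtain B where B: "!!j. \<bar>LINT x|M. f j x \<bullet> \<phi> x\<bar> <= B" using weak[OF \<phi>m \<phi>2] by blast
 have big2: "1 / 2 * ?w n * N n <= B" for n
 proof -
  let ?F = "%m x. f (k n) x \<bullet> ?t m x"
  have Fi: "integrable M (?F m)" for m using integrable_inner_L2(2)[OF fm f2 hm h2] by simp
  have Fn: "norm (?F m x) <= ?w m * (norm (f (k n) x) * norm (h m x))" for m x
   using Cauchy_Schwarz_ineq2[of "f (k n) x" "?t m x"] unfolding nt by (simp add: mult_ac)
  have FI: "(LINT x|M. norm (?F m x)) <= ?w m * N n" for m
  proof -
   have "(LINT x|M. norm (?F m x)) <= (LINT x|M. ?w m * (norm (f (k n) x) * norm (h m x)))"
    using Fi[of m] Fn integrable_inner_L2(1)[OF fm f2 hm h2, of "k n" m] by (intro integral_mono) auto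
   also have "... = ?w m * (LINT x|M. norm (f (k n) x) * norm (h m x))" by simp
   also have "... <= ?w m * N n" using nfh by (intro mult_left_mono) auto
   finally show ?thesis .
  qed
  have AEF: "AE x in M. summable (%m. norm (?F m x))"
   using AEH
  proof (rule AE_mp, intro AE_I2 impI)
   fix x assume "summable (%m. ?w m * (norm (h m x))^2)"
   from summable_mult[OF Gs[OF this], of "norm (f (k n) x)"]
   show "summable (%m. norm (?F m x))"
    by (rule summable_comparison_test'[where N=0]) (use Fn in "simp add: mult_ac")
  qed
  have SF: "summable (%m. LINT x|M. norm (?F m x))"
  proof (rule summable_comparison_test'[where N=0])
   show "summable (%m. ?w m * N n)" by (intro summable_mult2 wsum)
  qed (use FI in simp)
  have Ae: "(LINT x|M. ?F m x) = s m * ?w m * A n m" for m unfolding A_def by simp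
  have "(%m. s m * ?w m * A n m) sums (LINT x|M. (\<Sum>m. ?F m x))"
   using sums_integral[OF Fi AEF SF] unfolding Ae .
  moreover have "(LINT x|M. (\<Sum>m. ?F m x)) = (LINT x|M. f (k n) x \<bullet> \<phi> x)"
  proof (rule integral_cong_AE)
   show "(%x. \<Sum>m. ?F m x) \<in> borel_measurable M"
    by (intro borel_measurable_suminf integrable_measurable[OF Fi])
   show "(%x. f (k n) x \<bullet> \<phi> x) \<in> borel_measurable M" using fm \<phi>m by measurable
   show "AE x in M. (\<Sum>m. ?F m x) = f (k n) x \<bullet> \<phi> x"
    using AEH
   proof (rule AE_mp, intro AE_I2 impI)
    fix x assume "summable (%m. ?w m * (norm (h m x))^2)"
    then have "summable (%m. norm (?t m x))" unfolding nt by (rule Gs)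
    then have "summable (%m. ?t m x)" by (rule summable_norm_cancel)
    from bounded_linear.suminf[OF bounded_linear_inner_right this, of "f (k n) x"]
    show "(\<Sum>m. ?F m x) = f (k n) x \<bullet> \<phi> x" unfolding \<phi>_def by simp
   qed
  qed
  ultimately have S: "(%m. s m * ?w m * A n m) sums (LINT x|M. f (k n) x \<bullet> \<phi> x)" by simp
  have sm: "summable (%m. s m * ?w m * A n m)" using S by (rule sums_summable)
  have ab: "\<bar>s m * ?w m * A n m\<bar> <= ?w m * N n" for m
   using Abd[of n m] s[of m] by (simp add: abs_mult mult_left_mono)
  have "(LINT x|M. f (k n) x \<bullet> \<phi> x) = (\<Sum>m<Suc n. s m * ?w m * A n m) + (\<Sum>m. s (m + Suc n) * ?w (m + Suc n) * A n (m + Suc n))"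
   using suminf_split_initial_segment[OF sm, of "Suc n"] S by (simp add: sums_iff)
  moreover have "\<bar>\<Sum>m. s (m + Suc n) * ?w (m + Suc n) * A n (m + Suc n)\<bar> <= 1 / 2 * ?w n * N n"
  proof -
   have sg: "summable (%m. ?w (m + Suc n) * N n)" by (intro summable_mult2 summable_ignore_initial_segment wsum)
   have ab': "norm \<bar>s (m + Suc n) * ?w (m + Suc n) * A n (m + Suc n)\<bar> <= ?w (m + Suc n) * N n" for m
    using ab[of "m + Suc n"] by (simp only: real_norm_def abs_idempotent)
   have sa: "summable (%m. \<bar>s (m + Suc n) * ?w (m + Suc n) * A n (m + Suc n)\<bar>)"
    by (rule summable_comparison_test'[OF sg, of 0]) (rule ab')
   have "\<bar>\<Sum>m. s (m + Suc n) * ?w (m + Suc n) * A n (m + Suc n)\<bar> <= (\<Sum>m. \<bar>s (m + Suc n) * ?w (m + Suc n) * A n (m + Suc n)\<bar>)"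
    by (rule summable_rabs[OF sa])
   also have "... <= (\<Sum>m. ?w (m + Suc n) * N n)"
    by (rule suminf_le[OF ab sa sg])
   also have "(%m. ?w (m + Suc n) * N n) = (%m. ?w m * (?w n * N n / 3))" by (rule ext) (simp add: power_add mult_ac)
   also have "(\<Sum>m. ?w m * (?w n * N n / 3)) = (\<Sum>m. ?w m) * (?w n * N n / 3)" by (rule suminf_mult2[OF wsum, symmetric])
   also have "(\<Sum>m. ?w m) = 3 / 2" by (subst suminf_geometric) auto
   also have "3 / 2 * (?w n * N n / 3) = 1 / 2 * ?w n * N n" by simp
    finally show ?thesis .
  qed
  moreover have "?w n * N n <= \<bar>\<Sum>m<Suc n. s m * ?w m * A n m\<bar>" using big[of n] by (simp add: Ann del: power_one_over)
  moreover have "\<bar>LINT x|M. f (k n) x \<bullet> \<phi> x\<bar> <= B" by (rule B)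
  ultimately show ?thesis by linarith
 qed
 obtain n :: nat where n: "2 * B < (4 / 3) ^ n" using real_arch_pow[of "4 / 3" "2 * B"] by auto
 have "(4 / 3) ^ n = ?w n * 4 ^ n" by (simp add: power_divide)
 also have "... <= ?w n * N n" using N[of n] by (intro mult_left_mono) auto
 finally show False using n big2[of n] by linarith
qed

section \<open>Space-time integrals\<close>

text \<open>Space-time as a product, for Fubini's theorem. Completed Lebesgue measure on the strip differs from it only by null sets; Borel
functions have the same integrals for both (\<open>spacetime_LINT\<close>).\<close>
definition stm :: "real => (spacetime) measure" where
 "stm T = time_on T \<Otimes>\<^sub>M TM"

lemma finite_time: "finite_measure (lebesgue_on {0<..<T::real})"
 by (rule finite_measure_lebesgue_on) (auto simp: lmeasurable_interval)

lemma stm_pair: "pair_sigma_finite (lebesgue_on {0<..<T::real}) TM"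
 using finite_time[of T] torus.finite_measure_axioms
 by (simp add: pair_sigma_finite_def finite_measure.axioms(1))

lemma space_stm: "space (stm T) = {0<..<T} \<times> torus"
 by (simp add: stm_def space_pair_measure)

lemma finite_stm: "finite_measure (stm T)"
proof -
 have "emeasure (stm T) (space (stm T)) = emeasure (time_on T) {0<..<T} * emeasure TM torus"
  unfolding space_stm unfolding stm_def by (rule torus.emeasure_pair_measure_Times) auto
 also have "... < \<infinity>"
  using finite_measure.emeasure_finite[OF finite_time[of T], of "{0<..<T}"] by (simp add: less_top)
 finally show ?thesis by (intro finite_measureI) simp
qed

lemma id_stm: "(%p. p) \<in> borel_measurable (stm T)"
proof -
 have t: "(%x. x) \<in> borel_measurable (time_on T)" "(%x. x) \<in> TBorel"
  using id_borel_measurable_lebesgue_on[of "{0<..<T}"] id_borel_measurable_lebesgue_on[of torus] by (simp_all add: id_def)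
 have "(%p. (fst p, snd p)) \<in> stm T \<rightarrow>\<^sub>M borel \<Otimes>\<^sub>M borel" unfolding stm_def
  by (rule measurable_Pair[OF measurable_compose[OF measurable_fst t(1)] measurable_compose[OF measurable_snd t(2)]])
 then show ?thesis by (simp add: borel_prod)
qed

lemma stm_borel: "f \<in> Borel ==> f \<in> borel_measurable (stm T)"
 using measurable_compose[OF id_stm] by blast

lemma spacetime_borel: "f \<in> Borel ==> f \<in> borel_measurable (spacetime_measure T)"
 by (intro measurable_restrict_space1 measurable_completion) simp

lemma spacetime_set [measurable, simp]: "{0<..<T::real} \<times> torus \<in> sets borel"
 by (intro borel_Times) auto

lemma spacetime_set_lebesgue [simp]: "{0<..<T::real} \<times> torus \<in> sets lebesgue"
 using spacetime_set[of T] by (simp add: sets_completionI_sets)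

lemma spacetime_distr: "distr (spacetime_measure T) borel (%p. p) = distr (stm T) borel (%p. p)"
proof (rule measure_eqI)
 fix A :: "(spacetime) set" assume "A \<in> sets (distr (spacetime_measure T) borel (%p. p))"
 then have A: "A \<in> sets borel" by simp
 let ?S = "{0<..<T} \<times> torus"
 let ?B = "A \<inter> ?S"
 have B: "?B \<in> sets borel" using A by (intro sets.Int) auto
 have B2: "?B \<in> sets (borel \<Otimes>\<^sub>M borel)" using B by (simp only: borel_prod)
 have B3: "?B \<in> sets (borel \<Otimes>\<^sub>M lborel)"
  using B2 sets_pair_measure_cong[of borel borel lborel borel] by simp
 have B4: "?B \<in> sets (lborel \<Otimes>\<^sub>M lborel)"
  using B2 sets_pair_measure_cong[of lborel borel lborel borel] by simp
 have Bx: "Pair x -` ?B \<in> sets borel" for x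
  by (rule sets_Pair1[OF B2])
 have id: "(%p. p) \<in> borel_measurable (spacetime_measure T)"
  using id_borel_measurable_lebesgue_on[of ?S] by (simp add: id_def)
 have g: "(%x. emeasure lborel (Pair x -` ?B)) \<in> Borel"
  by (rule lborel.measurable_emeasure_Pair[OF B3])
 have "emeasure (distr (spacetime_measure T) borel (%p. p)) A = emeasure (spacetime_measure T) ?B"
  by (subst emeasure_distr[OF id A]) simp
 also have "... = emeasure lebesgue ?B" by (rule emeasure_restrict_space) auto
 also have "... = emeasure (lborel \<Otimes>\<^sub>M lborel) ?B" using B by (simp add: lborel_prod)
 also have "... = (\<integral>\<^sup>+x. emeasure lborel (Pair x -` ?B) \<partial>lborel)"
  by (rule lborel.emeasure_pair_measure_alt[OF B4])
 also have "... = (\<integral>\<^sup>+x. emeasure lborel (Pair x -` ?B) * indicator {0<..<T} x \<partial>lborel)"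
  by (rule nn_integral_cong) (auto simp: indicator_def)
 also have "... = (\<integral>\<^sup>+x. emeasure lborel (Pair x -` ?B) * indicator {0<..<T} x \<partial>lebesgue)"
  by (rule nn_integral_completion[symmetric])
 also have "... = (\<integral>\<^sup>+x. emeasure lborel (Pair x -` ?B) \<partial>time_on T)"
  by (rule nn_integral_restrict_space[symmetric]) auto
 also have "... = (\<integral>\<^sup>+x. emeasure TM (Pair x -` ?B) \<partial>time_on T)"
 proof (rule nn_integral_cong)
  fix x
  have "emeasure TM (Pair x -` ?B) = emeasure lebesgue (Pair x -` ?B)" by (rule emeasure_restrict_space) auto
  then show "emeasure lborel (Pair x -` ?B) = emeasure TM (Pair x -` ?B)" using Bx[of x] by simp
 qed
 also have "... = emeasure (stm T) ?B"
 proof -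
  have "?B \<in> sets (stm T)" using measurable_sets[OF id_stm A, of T] by (simp add: space_stm)
  then show ?thesis unfolding stm_def by (rule torus.emeasure_pair_measure_alt[symmetric])
 qed
 also have "... = emeasure (distr (stm T) borel (%p. p)) A"
  by (subst emeasure_distr[OF id_stm A]) (simp add: space_stm)
 finally show "emeasure (distr (spacetime_measure T) borel (%p. p)) A = emeasure (distr (stm T) borel (%p. p)) A" .
qed simp

lemma spacetime_LINT:
 fixes f :: "spacetime => 'b::{banach, second_countable_topology}"
 assumes f: "f \<in> Borel"
 shows "integral\<^sup>L (spacetime_measure T) f = integral\<^sup>L (stm T) f"
proof -
 have id: "(%p. p) \<in> borel_measurable (spacetime_measure T)"
  using id_borel_measurable_lebesgue_on[of "{0<..<T} \<times> torus"] by (simp add: id_def)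
 show ?thesis using integral_distr[OF id f] integral_distr[OF id_stm[of T] f] spacetime_distr[of T] by simp
qed

lemma spacetime_AE:
 assumes "AE p in spacetime_measure T. Q p"
 shows "AE t in time_on T. AE x in TM. Q (t, x)"
proof -
 have "AE p in lebesgue. p \<in> {0<..<T} \<times> torus --> Q p" using assms by (simp add: AE_restrict_space_iff)
 then have "AE p in lborel. p \<in> {0<..<T} \<times> torus --> Q p" by (simp add: AE_completion_iff)
 then have "AE p in lborel \<Otimes>\<^sub>M lborel. p \<in> {0<..<T} \<times> torus --> Q p" by (subst lborel_prod)
 from lborel_pair.AE_pair[OF this]
 have "AE t in lborel. AE x in lborel. t \<in> {0<..<T} --> x \<in> torus --> Q (t, x)"
  by (simp only: mem_Times_iff fst_conv snd_conv imp_conjL)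
 then have "AE t in lebesgue. AE x in lborel. t \<in> {0<..<T} --> x \<in> torus --> Q (t, x)" by (rule AE_completion)
 moreover have "(AE x in lborel. t \<in> {0<..<T} --> x \<in> torus --> Q (t, x)) -->
   t \<in> {0<..<T} --> (AE x in TM. Q (t, x))" for t
 proof (rule impI, rule impI)
  assume *: "AE x in lborel. t \<in> {0<..<T} --> x \<in> torus --> Q (t, x)" "t \<in> {0<..<T}"
  then have "AE x in lborel. x \<in> torus --> Q (t, x)" by simp
  then have "AE x in lebesgue. x \<in> torus --> Q (t, x)" by (rule AE_completion)
  then show "AE x in TM. Q (t, x)" by (simp add: AE_restrict_space_iff)
 qed
 ultimately have "AE t in lebesgue. t \<in> {0<..<T} --> (AE x in TM. Q (t, x))"
  by (rule AE_mp[OF _ AE_I2])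
 then show ?thesis by (simp add: AE_restrict_space_iff)
qed

lemma borel_version_real:
 fixes f :: "'a::euclidean_space => real"
 assumes f: "f \<in> borel_measurable (lebesgue_on S)" and S: "S \<in> sets lebesgue"
 obtains g where "g \<in> Borel" "AE x in lebesgue_on S. f x = g x"
proof -
 have "(%x. if x \<in> S then f x else 0) \<in> borel_measurable lebesgue" using f S by (simp add: borel_measurable_if)
 from completion_ex_borel_measurable_real[OF this]
 obtain g where g: "g \<in> borel_measurable lborel" "AE x in lborel. (if x \<in> S then f x else 0) = g x" by blast
 have "AE x in lebesgue. (if x \<in> S then f x else 0) = g x" using g(2) by (rule AE_completion)
 then have "AE x in lebesgue. x \<in> S --> f x = g x" by (rule AE_mp) (auto intro!: AE_I2)
 then have "AE x in lebesgue_on S. f x = g x" using S by (simp add: AE_restrict_space_iff)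
 then show ?thesis using that g(1) by simp
qed

lemma borel_version_vec:
 fixes f :: "'a::euclidean_space => real^2"
 assumes f: "f \<in> borel_measurable (lebesgue_on S)" and S: "S \<in> sets lebesgue"
 obtains g where "g \<in> Borel" "AE x in lebesgue_on S. f x = g x"
proof -
 have fi: "(%x. f x $ i) \<in> borel_measurable (lebesgue_on S)" for i
  using measurable_compose[OF f cont_Borel[of "%v. v $ i"]] by (simp add: continuous_on_component)
 obtain g1 where g1: "g1 \<in> Borel" "AE x in lebesgue_on S. f x $ 1 = g1 x" by (rule borel_version_real[OF fi S])
 obtain g2 where g2: "g2 \<in> Borel" "AE x in lebesgue_on S. f x $ 2 = g2 x" by (rule borel_version_real[OF fi S])
 let ?g = "%x. vec2 (g1 x, g2 x)"
 have "(%x. (g1 x, g2 x)) \<in> Borel" using measurable_Pair[OF g1(1) g2(1)] by (simp add: borel_prod)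
 from measurable_compose[OF this cont_Borel[OF continuous_vec2]]
 have "?g \<in> Borel" .
 moreover have "AE x in lebesgue_on S. f x = ?g x"
  using g1(2) g2(2) by eventually_elim (simp add: vec_eq_iff forall_2)
 ultimately show ?thesis using that by blast
qed

lemma borel_section: "(f :: spacetime => 'b::topological_space) \<in> Borel ==> (%x. f (t, x)) \<in> Borel"
proof -
 assume f: "f \<in> Borel"
 have "cont (%x::real^2. (t, x))" by (intro continuous_intros)
 from measurable_compose[OF cont_Borel[OF this] f] show ?thesis .
qed

lemma borel_curry: "f \<in> Borel ==> (%t. AV x. f (t, x)) \<in> borel_measurable (time_on T)"
 for f :: "spacetime => real"
proof -
 assume "f \<in> Borel"
 then have "f \<in> borel_measurable (time_on T \<Otimes>\<^sub>M TM)"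
  unfolding stm_def[symmetric] by (rule stm_borel)
 then have "(%(t, x). f (t, x)) \<in> borel_measurable (time_on T \<Otimes>\<^sub>M TM)" by (simp only: case_prod_eta)
 then show ?thesis by (rule torus.borel_measurable_lebesgue_integral)
qed

lemma L2_test_in_L1_Lp:
 fixes \<phi> :: "spacetime => 'b::euclidean_space"
 assumes \<phi>: "\<phi> \<in> Borel" and \<phi>2: "integrable (stm T) (%p. (norm (\<phi> p))^2)"
 shows "(%t x. \<phi> (t, x)) \<in> L1_Lp T 2"
proof -
 interpret pair_sigma_finite "time_on T" TM by (rule stm_pair)
 have sec: "(%x. \<phi> (t, x)) \<in> TBorel" for t
  by (intro torus_measurable_borel borel_section \<phi>)
 have ae: "AE t in time_on T. L1 (%x. (norm (\<phi> (t, x)))^2)"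
  using AE_integrable_fst'[OF \<phi>2[unfolded stm_def]] by simp
 have I: "integrable (time_on T) (%t. AV x. (norm (\<phi> (t, x)))^2)"
  using integrable_fst'[OF \<phi>2[unfolded stm_def]] by simp
 have norm2: "(%p. (norm (\<phi> p))^2) \<in> Borel"
  by (rule borel_measurable_power, rule measurable_compose[OF \<phi> borel_measurable_norm])
 show ?thesis unfolding L1_Lp_def jointly_measurable_def
 proof (intro CollectI conjI)
  show "(%(t, x). \<phi> (t, x)) \<in> borel_measurable (spacetime_measure T)" using spacetime_borel[OF \<phi>] by simp
  show "AE t in time_on T. (%x. \<phi> (t, x)) \<in> Lp 2"
   using ae by (rule AE_mp) (auto intro!: AE_I2 simp: Lp_def sec)
  show "integrable (time_on T) (%t. Lp_norm 2 (%x. \<phi> (t, x)))"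
  proof (rule integrable_bound)
   show "integrable (time_on T) (%t. 1 + (AV x. (norm (\<phi> (t, x)))^2))"
    using I finite_measure.integrable_const[OF finite_time[of T], of "1::real"] by simp
   have m: "(%t. AV x. (norm (\<phi> (t, x)))^2) \<in> borel_measurable (time_on T)"
    by (rule borel_curry[OF norm2])
   have e: "Lp_norm 2 (%x. \<phi> (t, x)) = sqrt (AV x. (norm (\<phi> (t, x)))^2)" for t
    by (simp add: Lp_norm_def powr_half_sqrt)
   show "(%t. Lp_norm 2 (%x. \<phi> (t, x))) \<in> borel_measurable (time_on T)"
    unfolding e by (rule measurable_compose[OF m borel_measurable_sqrt])
   show "AE t in time_on T. norm (Lp_norm 2 (%x. \<phi> (t, x))) <= norm (1 + (AV x. (norm (\<phi> (t, x)))^2))"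
   proof (intro AE_I2)
    fix t
    have "sqrt a <= 1 + a" if "a >= 0" for a :: real
     using that by (intro real_le_lsqrt) (auto simp: power2_eq_square algebra_simps)
    then show "norm (Lp_norm 2 (%x. \<phi> (t, x))) <= norm (1 + (AV x. (norm (\<phi> (t, x)))^2))"
     unfolding e by simp
   qed
  qed
 qed
qed

text \<open>Restriction of a field given on the closed slab; continuous fields become Borel functions on all of space-time.\<close>
definition cut :: "real => (real => real^2 => 'b::real_normed_vector) => spacetime => 'b" where
 "cut T F p = indicator ({0..T} \<times> UNIV) p *\<^sub>R F (fst p) (snd p)"

lemma cut_eq: "t \<in> {0..T} ==> cut T F (t, x) = F t x" by (simp add: cut_def)

lemma cut_borel:
 assumes "continuous_on ({0..T} \<times> UNIV) (%p. F (fst p) (snd p))"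
 shows "(cut T F :: spacetime => 'b::euclidean_space) \<in> Borel"
 unfolding cut_def by (rule borel_measurable_continuous_on_indicator[OF _ assms], rule borel_Times) simp_all

lemma slab_bounded:
 fixes F :: "real => real^2 => 'b::euclidean_space"
 assumes "continuous_on ({0..T} \<times> UNIV) (%p. F (fst p) (snd p))"
 obtains C where "C >= 0" "!!t x. t \<in> {0..T} ==> x \<in> torus ==> norm (F t x) <= C"
proof -
 have "compact ({0..T} \<times> cbox 0 (1::real^2))" by (intro compact_Times) auto
 moreover have "continuous_on ({0..T} \<times> cbox 0 1) (%p. F (fst p) (snd p))"
  by (rule continuous_on_subset[OF assms]) auto
 ultimately have "bounded ((%p. F (fst p) (snd p)) ` ({0..T} \<times> cbox 0 1))"
  using compact_continuous_image compact_imp_bounded by blast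
 then obtain C where "\<forall>y\<in>(%p. F (fst p) (snd p)) ` ({0..T} \<times> cbox 0 1). norm y <= C" unfolding bounded_iff by blast
 then have C: "norm (F (fst p) (snd p)) <= C" if "p \<in> {0..T} \<times> cbox 0 1" for p using that by blast
 show ?thesis
 proof (rule that[of "max 0 C"])
  fix t and x :: "real^2" assume "t \<in> {0..T}" "x \<in> torus"
  then show "norm (F t x) <= max 0 C" using C[of "(t, x)"] box_torus(2) by (auto simp: le_max_iff_disj)
 qed simp
qed

lemma stm_bounded_integrable:
 fixes f :: "spacetime => 'b::{banach, second_countable_topology}"
 assumes "f \<in> borel_measurable (stm T)" "!!t x. t \<in> {0<..<T} ==> x \<in> torus ==> norm (f (t, x)) <= C"
 shows "integrable (stm T) f"
 by (rule finite_measure.integrable_const_bound[OF finite_stm, where B=C]) (use assms in "auto simp: space_stm")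

lemma stm_iterated:
 fixes f :: "spacetime => real"
 assumes "integrable (stm T) f"
 shows "integral\<^sup>L (stm T) f = (LINT t|time_on T. AV x. f (t, x))"
  and "AE t in time_on T. L1 (%x. f (t, x))"
  and "integrable (time_on T) (%t. AV x. f (t, x))"
 using pair_sigma_finite.integral_fst'[OF stm_pair assms[unfolded stm_def]]
  pair_sigma_finite.AE_integrable_fst'[OF stm_pair assms[unfolded stm_def]]
  pair_sigma_finite.integrable_fst'[OF stm_pair assms[unfolded stm_def]]
 unfolding stm_def by simp_all

text \<open>Brings the hypothesis of weak* convergence into the language of Borel fields and of the product measure.\<close>
lemma weakstar_test:
 fixes f :: "nat => real => real^2 => real^2"
 assumes ws: "weakstar_Linf_L2 T f g"
  and fc: "!!k. continuous_on ({0..T} \<times> UNIV) (%p. f k (fst p) (snd p))"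
  and g': "g' \<in> Borel" "AE p in spacetime_measure T. g (fst p) (snd p) = g' p"
  and \<phi>: "\<phi> \<in> Borel" and \<phi>2: "integrable (stm T) (%p. (norm (\<phi> p))^2)"
 shows "(%k. LINT p|stm T. cut T (f k) p \<bullet> \<phi> p) ----> (LINT p|stm T. g' p \<bullet> \<phi> p)"
proof -
 have fe: "(LINT (t, x)|spacetime_measure T. f k t x \<bullet> \<phi> (t, x)) = (LINT p|stm T. cut T (f k) p \<bullet> \<phi> p)" for k
 proof -
  have "(LINT (t, x)|spacetime_measure T. f k t x \<bullet> \<phi> (t, x)) = (LINT p|spacetime_measure T. cut T (f k) p \<bullet> \<phi> p)"
   by (rule integral_cong) (auto simp: cut_def)
  also have "... = (LINT p|stm T. cut T (f k) p \<bullet> \<phi> p)"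
   by (rule spacetime_LINT[OF borel_measurable_inner[OF cut_borel[OF fc] \<phi>]])
  finally show ?thesis .
 qed
 have gm: "(%(t, x). g t x) \<in> borel_measurable (spacetime_measure T)"
  using ws by (simp add: weakstar_Linf_L2_def Linf_Lp_def jointly_measurable_def)
 have ge: "(LINT (t, x)|spacetime_measure T. g t x \<bullet> \<phi> (t, x)) = (LINT p|stm T. g' p \<bullet> \<phi> p)"
 proof -
  have "(LINT (t, x)|spacetime_measure T. g t x \<bullet> \<phi> (t, x)) = (LINT p|spacetime_measure T. g' p \<bullet> \<phi> p)"
  proof (rule integral_cong_AE)
   show "(%(t, x). g t x \<bullet> \<phi> (t, x)) \<in> borel_measurable (spacetime_measure T)"
    using borel_measurable_inner[OF gm spacetime_borel[OF \<phi>]] by (simp add: case_prod_unfold)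
   show "(%p. g' p \<bullet> \<phi> p) \<in> borel_measurable (spacetime_measure T)"
    by (rule borel_measurable_inner[OF spacetime_borel[OF g'(1)] spacetime_borel[OF \<phi>]])
   show "AE p in spacetime_measure T. (case p of (t, x) => g t x \<bullet> \<phi> (t, x)) = g' p \<bullet> \<phi> p"
    using g'(2) by (rule AE_mp) (auto intro!: AE_I2)
  qed
  also have "... = (LINT p|stm T. g' p \<bullet> \<phi> p)" by (rule spacetime_LINT[OF borel_measurable_inner[OF g'(1) \<phi>]])
  finally show ?thesis .
 qed
 show ?thesis using ws L2_test_in_L1_Lp[OF \<phi> \<phi>2] unfolding weakstar_Linf_L2_def fe[symmetric] ge[symmetric] by auto
qed

section \<open>Fields built from modes, and weak times strong convergence\<close>

lemma time_LINT:
 fixes g :: "real => real"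
 assumes g: "continuous_on {0..T} g" and st: "0 <= s" "t <= T"
 shows "(LINT \<tau>|time_on T. indicator {s..t} \<tau> * g \<tau>) = integral {s..t} g"
  and "integrable (time_on T) (%\<tau>. indicator {s..t} \<tau> * g \<tau>)"
proof -
 obtain C where C: "!!\<tau>. \<tau> \<in> {0..T} ==> norm (g \<tau>) <= C"
  using compact_imp_bounded[OF compact_continuous_image[OF g compact_Icc]] unfolding bounded_iff by blast
 have gm: "g \<in> borel_measurable (time_on T)"
  by (rule continuous_imp_measurable_on_sets_lebesgue[OF continuous_on_subset[OF g]]) auto
 have im: "(indicator {s..t} :: real => real) \<in> borel_measurable (time_on T)"
  by (intro measurable_restrict_space1 measurable_completion) simp
 show i: "integrable (time_on T) (%\<tau>. indicator {s..t} \<tau> * g \<tau>)"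
 proof (rule finite_measure.integrable_const_bound[OF finite_time, where B="max 0 C"])
  show "AE \<tau> in time_on T. norm (indicator {s..t} \<tau> * g \<tau>) <= max 0 C"
  proof (rule AE_I2)
   fix \<tau> assume "\<tau> \<in> space (time_on T)"
   then have "norm (g \<tau>) <= C" by (intro C) simp
   then show "norm (indicator {s..t} \<tau> * g \<tau>) <= max 0 C" by (auto simp: indicator_def)
  qed
 qed (rule borel_measurable_times[OF im gm])
 have "(LINT \<tau>|time_on T. indicator {s..t} \<tau> * g \<tau>) = integral {0<..<T} (%\<tau>. indicator {s..t} \<tau> * g \<tau>)"
  by (rule lebesgue_integral_eq_integral[OF i]) simp
 also have "... = integral {0..T} (%\<tau>. indicator {s..t} \<tau> * g \<tau>)" by (rule integral_open_interval_real[symmetric])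
 also have "... = integral {0..T} (%\<tau>. if \<tau> \<in> {s..t} then g \<tau> else 0)"
  by (rule Henstock_Kurzweil_Integration.integral_cong) (simp add: indicator_def)
 also have "... = integral {s..t} g"
  using Henstock_Kurzweil_Integration.integral_restrict_Int[of "{0..T}" "{s..t}" g] st by (simp add: Int_absorb2)
 finally show "(LINT \<tau>|time_on T. indicator {s..t} \<tau> * g \<tau>) = integral {s..t} g" .
qed

text \<open>Needed on the whole line and for Borel measurability, so that coefficients depending on time yield admissible test fields.\<close>
lemma torus_curry_borel:
 fixes f :: "spacetime => real"
 assumes f: "f \<in> Borel"
 shows "(%t. AV x. f (t, x)) \<in> Borel"
proof -
 have e: "(AV x. f (t, x)) = (LINT x|lborel. indicator torus x *\<^sub>R f (t, x))" for t
  by (rule torus_LINT_lborel[OF borel_section[OF f]])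
 have "sets (borel \<Otimes>\<^sub>M (lborel :: (real^2) measure)) = sets ((borel :: real measure) \<Otimes>\<^sub>M (borel :: (real^2) measure))"
  by (rule sets_pair_measure_cong) simp_all
 then have s: "sets (borel \<Otimes>\<^sub>M lborel) = sets (borel :: (spacetime) measure)" by (simp only: borel_prod)
 have "(%p::spacetime. indicator torus (snd p) *\<^sub>R f p) \<in> Borel"
  by (rule borel_measurable_scaleR[OF measurable_compose[OF cont_Borel[OF continuous_on_snd[OF continuous_on_id]]] f]) simp
 then have "(%(t, x). indicator torus x *\<^sub>R f (t, x)) \<in> borel_measurable (borel \<Otimes>\<^sub>M lborel)"
  by (simp add: case_prod_unfold measurable_cong_sets[OF s refl])
 from lborel.borel_measurable_lebesgue_integral[OF this] show ?thesis unfolding e .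
qed

lemma fst_snd_borel:
 "g \<in> Borel ==> (%p::spacetime. g (fst p) :: real) \<in> Borel"
 "e \<in> Borel ==> (%p::spacetime. e (snd p) :: real) \<in> Borel"
proof -
 have c: "cont (fst :: spacetime => real)" "cont (snd :: spacetime => real^2)"
  by (intro continuous_intros)+
 show "g \<in> Borel ==> (%p::spacetime. g (fst p) :: real) \<in> Borel"
  using measurable_compose[OF cont_Borel[OF c(1)]] .
 show "e \<in> Borel ==> (%p::spacetime. e (snd p) :: real) \<in> Borel"
  using measurable_compose[OF cont_Borel[OF c(2)]] .
qed

lemma coef_borel:
 fixes h :: "spacetime => real"
 assumes h: "h \<in> Borel" and j: "j < nmodes n"
 shows "(%t. coef n (%x. h (t, x)) j) \<in> Borel"
proof -
 have "mode n j \<in> Borel"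
  by (rule cont_Borel[OF smooth_cont[OF mode_smooth[OF j]]])
 from torus_curry_borel[OF borel_measurable_times[OF h fst_snd_borel(2)[OF this]]] show ?thesis by (simp add: coef_def)
qed

lemma smoothing_borel:
 fixes h :: "spacetime => real"
 assumes h: "h \<in> Borel"
 shows "(%p. smoothing n (%x. h (fst p, x)) (snd p)) \<in> Borel"
  and "(%p. partial i (smoothing n (%x. h (fst p, x))) (snd p)) \<in> Borel"
proof -
 have *: "(%p. \<Sum>j<nmodes n. coef n (%x. h (fst p, x)) j * e j (snd p)) \<in> Borel"
  if e: "!!j. j < nmodes n ==> torus_smooth (e j)" for e
 proof (rule borel_measurable_sum)
  fix j assume "j \<in> {..<nmodes n}"
  then have j: "j < nmodes n" by simp
  have "e j \<in> Borel" by (rule cont_Borel[OF smooth_cont[OF e[OF j]]])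
  from borel_measurable_times[OF fst_snd_borel(1)[OF coef_borel[OF h j]] fst_snd_borel(2)[OF this]]
  show "(%p. coef n (%x. h (fst p, x)) j * e j (snd p)) \<in> Borel" .
 qed
 show "(%p. smoothing n (%x. h (fst p, x)) (snd p)) \<in> Borel"
  unfolding smoothing_def by (rule *[OF mode_smooth])
 show "(%p. partial i (smoothing n (%x. h (fst p, x))) (snd p)) \<in> Borel"
  unfolding partial_smoothing by (rule *[OF smooth_partial[OF mode_smooth]])
qed

lemma vec2_borel:
 fixes f g :: "'a => real"
 assumes "f \<in> borel_measurable M" "g \<in> borel_measurable M"
 shows "(%p. vec2 (f p, g p)) \<in> borel_measurable M"
proof -
 have "(%p. (f p, g p)) \<in> borel_measurable M" using measurable_Pair[OF assms] by (simp add: borel_prod)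
 from measurable_compose[OF this cont_Borel[OF continuous_vec2]] show ?thesis .
qed

lemma norm_vec2_le: "norm (vec2 (a, b)) <= \<bar>a\<bar> + \<bar>b\<bar>"
proof -
 have "vec2 (0, 0) = 0" by (simp add: vec_eq_iff forall_2)
 then show ?thesis using dist_vec2[of a b 0 0] by (simp add: dist_norm)
qed

lemma inner_vec2: "v \<bullet> vec2 (a, b) = v $ 1 * a + v $ 2 * b" by (simp add: inner_vec_def sum_2)

lemma grad_vec2: "grad f x = vec2 (partial 1 f x, partial 2 f x)"
 by (simp add: grad_def vec_eq_iff forall_2)

text \<open>The field \<open>h * grad (smoothing n h)\<close>, which multiplies the velocity in the derivative of the energy.\<close>
definition mfield :: "nat => (spacetime => real) => spacetime => real^2" where
 "mfield n h p = h p *\<^sub>R grad (smoothing n (%x. h (fst p, x))) (snd p)"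

lemma mfield_borel: "h \<in> Borel ==> mfield n h \<in> Borel"
 unfolding mfield_def[abs_def] grad_vec2
 by (rule borel_measurable_scaleR, assumption, rule vec2_borel; rule smoothing_borel)

lemma bounded_section:
 fixes h :: "spacetime => real"
 assumes h: "h \<in> Borel" and R: "!!p. \<bar>h p\<bar> <= R"
 shows "L1 (%x. h (t, x))" "(AV x. \<bar>h (t, x)\<bar>) <= R"
proof -
 have R0: "0 <= R" using R[of "(0,0)"] by linarith
 show "L1 (%x. h (t, x))"
  by (rule bounded_L1[OF torus_measurable_borel[OF borel_section[OF h]], where C=R]) (simp add: R)
 show "(AV x. \<bar>h (t, x)\<bar>) <= R"
  using torus_LINT_bound[of "%x. \<bar>h (t, x)\<bar>" R] R R0 by simp
qed

lemma mfield_diff: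
 fixes h h' :: "spacetime => real"
 assumes h: "h \<in> Borel" "!!p. \<bar>h p\<bar> <= R" and h': "h' \<in> Borel" "!!p. \<bar>h' p\<bar> <= R"
  and L: "!!f x. L1 f ==> norm (grad (smoothing n f) x) <= L * (AV x. \<bar>f x\<bar>)" "L > 0"
 shows "norm (mfield n h p) <= L * R^2"
  and "norm (mfield n h p - mfield n h' p) <= L * R * (\<bar>h p - h' p\<bar> + (AV x. \<bar>h (fst p, x) - h' (fst p, x)\<bar>))"
proof -
 have R0: "0 <= R" using h(2)[of "(0,0)"] by linarith
 let ?g = "grad (smoothing n (%x. h (fst p, x))) (snd p)" and ?g' = "grad (smoothing n (%x. h' (fst p, x))) (snd p)"
 let ?I = "AV x. \<bar>h (fst p, x) - h' (fst p, x)\<bar>"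
 note i = bounded_section(1)[OF h] bounded_section(1)[OF h']
 have g: "norm ?g <= L * R"
  using L(1)[OF i(1)[of "fst p"], of "snd p"] mult_left_mono[OF bounded_section(2)[OF h, of "fst p"], of L] L(2) by linarith
 have "norm (mfield n h p) = \<bar>h p\<bar> * norm ?g" by (simp add: mfield_def)
 also have "... <= R * (L * R)" by (rule mult_mono[OF h(2) g R0]) simp
 finally show "norm (mfield n h p) <= L * R^2" by (simp add: power2_eq_square mult.commute mult.left_commute)
 have d: "?g - ?g' = grad (smoothing n (%x. h (fst p, x) - h' (fst p, x))) (snd p)"
  using grad_diff[OF smoothing_smooth smoothing_smooth, of n "%x. h (fst p, x)" n "%x. h' (fst p, x)" "snd p"]
  by (simp add: smoothing_diff[OF i, abs_def])
 have d2: "norm (?g - ?g') <= L * ?I"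
  unfolding d by (rule L(1)) (rule integrable_diff[OF i])
 have I0: "0 <= ?I" by (rule integral_nonneg_AE) simp
 have "mfield n h p - mfield n h' p = (h p - h' p) *\<^sub>R ?g + h' p *\<^sub>R (?g - ?g')"
  by (simp add: mfield_def scaleR_diff_left scaleR_diff_right)
 then have "norm (mfield n h p - mfield n h' p) <= \<bar>h p - h' p\<bar> * norm ?g + \<bar>h' p\<bar> * norm (?g - ?g')"
  by (metis norm_scaleR norm_triangle_ineq)
 also have "... <= \<bar>h p - h' p\<bar> * (L * R) + R * (L * ?I)"
  by (intro add_mono mult_left_mono mult_mono g d2 h'(2) R0) auto
 finally show "norm (mfield n h p - mfield n h' p) <= L * R * (\<bar>h p - h' p\<bar> + ?I)" by (simp add: algebra_simps)
qed

text \<open>Bounded in \<open>h\<close> and Lipschitz from \<open>L\<^sup>1\<close>, hence convergence of \<open>h\<close> in \<open>L\<^sup>1\<close> alone gives convergence of the field in \<open>L\<^sup>2\<close>.\<close>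
lemma mfield_L2:
 fixes h h' :: "spacetime => real"
 assumes h: "h \<in> Borel" "!!p. \<bar>h p\<bar> <= R" and h': "h' \<in> Borel" "!!p. \<bar>h' p\<bar> <= R"
  and L: "!!f x. L1 f ==> norm (grad (smoothing n f) x) <= L * (AV x. \<bar>f x\<bar>)" "L > 0"
 shows "(LINT p|stm T. (norm (mfield n h p - mfield n h' p))^2) <= 4 * L^2 * R^3 * (LINT p|stm T. \<bar>h p - h' p\<bar>)"
proof -
 have R0: "0 <= R" using h(2)[of "(0,0)"] by linarith
 let ?D = "%p. \<bar>h p - h' p\<bar>"
 let ?J = "%t. AV x. \<bar>h (t, x) - h' (t, x)\<bar>"
 have Dm: "?D \<in> Borel" by (intro borel_measurable_abs borel_measurable_diff h h')
 have D2: "?D p <= 2 * R" for p using h(2)[of p] h'(2)[of p] by linarith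
 have Di: "integrable (stm T) ?D"
  by (rule stm_bounded_integrable[OF stm_borel[OF Dm], of _ "2 * R"]) (use D2 in simp)
 have Jb: "?J \<in> Borel" by (rule torus_curry_borel[OF Dm])
 have J0: "0 <= ?J t" for t by (rule integral_nonneg_AE) simp
 have J2: "?J t <= 2 * R" for t
  using bounded_section(2)[OF Dm, of "2 * R" t] D2 by simp
 have Ji: "integrable (stm T) (%p. ?J (fst p))"
  by (rule stm_bounded_integrable[OF stm_borel[OF fst_snd_borel(1)[OF Jb]], of _ "2 * R"]) (use J2 J0 in simp)
 have JI: "(LINT p|stm T. ?J (fst p)) = (LINT p|stm T. ?D p)"
 proof -
  have "(LINT p|stm T. ?J (fst p)) = (LINT t|time_on T. AV x. ?J t)"
   using stm_iterated(1)[OF Ji] by simp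
  also have "... = (LINT t|time_on T. ?J t)" by simp
  also have "... = (LINT p|stm T. ?D p)" using stm_iterated(1)[OF Di] by simp
  finally show ?thesis .
 qed
 have pt: "(norm (mfield n h p - mfield n h' p))^2 <= (2 * L^2 * R^3) * (?D p + ?J (fst p))" for p
 proof -
  let ?N = "norm (mfield n h p - mfield n h' p)"
  have a: "?N <= 2 * (L * R^2)"
   using norm_triangle_ineq4[of "mfield n h p" "mfield n h' p"] mfield_diff(1)[OF h h' L, of p] mfield_diff(1)[OF h' h L, of p] by linarith
  have b: "?N <= L * R * (?D p + ?J (fst p))" by (rule mfield_diff(2)[OF h h' L])
  have "?N * ?N <= (2 * (L * R^2)) * (L * R * (?D p + ?J (fst p)))"
   by (rule mult_mono[OF a b]) (use L R0 in auto)
  also have "... = (2 * L^2 * R^3) * (?D p + ?J (fst p))" by (simp add: power2_eq_square power3_eq_cube)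
  finally show ?thesis by (simp add: power2_eq_square)
 qed
 have "(LINT p|stm T. (norm (mfield n h p - mfield n h' p))^2) <= (LINT p|stm T. (2 * L^2 * R^3) * (?D p + ?J (fst p)))"
  using L R0 by (intro integral_mono_AE' AE_I2 pt integrable_mult_right integrable_add Di Ji) (auto intro!: mult_nonneg_nonneg add_nonneg_nonneg J0)
 also have "... = (2 * L^2 * R^3) * ((LINT p|stm T. ?D p) + (LINT p|stm T. ?J (fst p)))"
  by (simp only: integral_mult_right_zero integral_add[OF Di Ji])
 finally show ?thesis unfolding JI by (simp add: algebra_simps)
qed

lemma weak_strong:
 fixes f \<phi> :: "nat => 'a => 'b::euclidean_space"
 assumes f: "!!k. f k \<in> borel_measurable M" "!!k. integrable M (%x. (norm (f k x))^2)" and K: "!!k. (LINT x|M. (norm (f k x))^2) <= K"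
  and \<phi>: "!!k. \<phi> k \<in> borel_measurable M" "!!k. integrable M (%x. (norm (\<phi> k x))^2)"
  and \<phi>': "\<phi>' \<in> borel_measurable M" "integrable M (%x. (norm (\<phi>' x))^2)"
  and d: "!!k. integrable M (%x. (norm (\<phi> k x - \<phi>' x))^2)" "(%k. LINT x|M. (norm (\<phi> k x - \<phi>' x))^2) ----> 0"
  and weak: "(%k. LINT x|M. f k x \<bullet> \<phi>' x) ----> 0"
 shows "(%k. LINT x|M. f k x \<bullet> \<phi> k x) ----> 0"
proof -
 have dm: "(%x. \<phi> k x - \<phi>' x) \<in> borel_measurable M" for k by (rule borel_measurable_diff[OF \<phi>(1) \<phi>'(1)])
 have K0: "K >= 0" using order_trans[OF integral_nonneg K[of 0]] by simp
 have split: "(LINT x|M. f k x \<bullet> \<phi> k x) = (LINT x|M. f k x \<bullet> \<phi>' x) + (LINT x|M. f k x \<bullet> (\<phi> k x - \<phi>' x))" for k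
  using integral_add[OF integrable_inner_L2(2)[OF f(1) f(2) \<phi>'] integrable_inner_L2(2)[OF f(1) f(2) dm d(1)], of k k]
  by (simp add: inner_add_right[symmetric])
 have "(%k. LINT x|M. f k x \<bullet> (\<phi> k x - \<phi>' x)) ----> 0"
 proof (rule LIMSEQ_I)
  fix e :: real assume e: "e > 0"
  define r where "r = e / (K + 1)"
  have r: "r > 0" using e K0 by (simp add: r_def)
  have "\<forall>\<^sub>F k in sequentially. (LINT x|M. (norm (\<phi> k x - \<phi>' x))^2) < e * r"
   using order_tendstoD(2)[OF d(2), of "e * r"] e r by simp
  then obtain k0 where k0: "!!k. k >= k0 ==> (LINT x|M. (norm (\<phi> k x - \<phi>' x))^2) < e * r"
   unfolding eventually_sequentially by blast
  show "\<exists>no. \<forall>k\<ge>no. norm ((LINT x|M. f k x \<bullet> (\<phi> k x - \<phi>' x)) - 0) < e"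
  proof (intro exI[of _ k0] allI impI)
   fix k assume k: "k >= k0"
   have "\<bar>LINT x|M. f k x \<bullet> (\<phi> k x - \<phi>' x)\<bar> <= (LINT x|M. norm (f k x) * norm (\<phi> k x - \<phi>' x))"
    by (rule LINT_abs_le[OF integrable_inner_L2(1)[OF f(1) f(2) dm d(1)]]) (rule Cauchy_Schwarz_ineq2)
   also have "... <= (r * (LINT x|M. (norm (f k x))^2) + (LINT x|M. (norm (\<phi> k x - \<phi>' x))^2) / r) / 2"
    by (rule integrable_inner_L2(3)[OF f(1) f(2) dm d(1) r])
   also have "... < (e + e) / 2"
   proof -
    have "r * (LINT x|M. (norm (f k x))^2) <= r * K" using K r by simp
    also have "... <= e" using K0 e by (simp add: r_def field_simps)
    finally have 1: "r * (LINT x|M. (norm (f k x))^2) <= e" .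
    have "(LINT x|M. (norm (\<phi> k x - \<phi>' x))^2) / r < e" using k0[OF k] r by (simp add: pos_divide_less_eq)
    with 1 show ?thesis by simp
   qed
   finally show "norm ((LINT x|M. f k x \<bullet> (\<phi> k x - \<phi>' x)) - 0) < e" by simp
  qed
 qed
 from tendsto_add[OF weak this] show ?thesis unfolding split by simp
qed

section \<open>The Bregman divergence\<close>

text \<open>The Bregman divergence of \<open>ent 1\<close>.\<close>
definition breg :: "real => real => real" where "breg b a = ent 1 b - ent 1 a - ent1 1 a * (b - a)"

text \<open>With \<open>S = sqrt (1 + a\<^sup>2)\<close> and \<open>U = sqrt (1 + b\<^sup>2)\<close> one has \<open>(U * S)\<^sup>2 - (1 + a * b)\<^sup>2 = (b - a)\<^sup>2\<close>.\<close>
lemma breg_identity: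
 shows "breg b a >= 0" and "(b - a)^2 = breg b a * (sqrt (1 + a^2) * (sqrt (1 + b^2) * sqrt (1 + a^2) + 1 + a * b))"
proof -
 define S U where "S = sqrt (1 + a^2)" and "U = sqrt (1 + b^2)"
 have S: "S > 0" "S^2 = 1 + a^2" and U: "U > 0" "U^2 = 1 + b^2"
  unfolding S_def U_def by (simp_all add: add_pos_nonneg)
 have "breg b a * S = (U - S - a / S * (b - a)) * S" unfolding breg_def by (simp add: ent_eq_sqrt ent1_eq S_def U_def)
 also have "... = U * S - S^2 - a * (b - a)" using S(1) by (simp add: field_simps power2_eq_square)
 also have "... = U * S - 1 - a * b" unfolding S(2) by (simp add: algebra_simps power2_eq_square)
 finally have e: "breg b a * S = U * S - 1 - a * b" .
 have "(U * S)^2 = (1 + a * b)^2 + (b - a)^2" unfolding power_mult_distrib S(2) U(2) by (simp add: algebra_simps power2_eq_square)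
 then have q: "(U * S - 1 - a * b) * (U * S + 1 + a * b) = (b - a)^2" by (simp add: algebra_simps power2_eq_square)
 have "(1 + a * b)^2 <= (U * S)^2" using \<open>(U * S)^2 = _\<close> by simp
 then have "\<bar>1 + a * b\<bar> <= \<bar>U * S\<bar>" by (simp add: abs_le_square_iff)
 then have "1 + a * b <= U * S" using S(1) U(1) by (simp add: abs_mult)
 then have "0 <= breg b a * S" using e by simp
 then show "breg b a >= 0" using S(1) by (simp add: zero_le_mult_iff)
 show "(b - a)^2 = breg b a * (sqrt (1 + a^2) * (sqrt (1 + b^2) * sqrt (1 + a^2) + 1 + a * b))"
  unfolding S_def[symmetric] U_def[symmetric] q[symmetric] e[symmetric] by (simp add: algebra_simps)
qed

lemma breg_lower:
 assumes R: "\<bar>a\<bar> <= R" "\<bar>b\<bar> <= R"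
 shows "(b - a)^2 <= 2 * (1 + R^2)^2 * breg b a"
proof -
 have a2: "a^2 <= R^2" "b^2 <= R^2" using R abs_le_square_iff[of a R] abs_le_square_iff[of b R] by auto
 define Q where "Q = sqrt (1 + R^2)"
 have Q: "Q >= 1" "Q^2 = 1 + R^2" unfolding Q_def by simp_all
 have S: "sqrt (1 + a^2) <= Q" "sqrt (1 + b^2) <= Q" using a2 unfolding Q_def by simp_all
 have ab: "a * b <= R^2" using mult_mono[OF R] R by (metis abs_ge_self abs_ge_zero abs_mult order_trans power2_eq_square)
 have "sqrt (1 + b^2) * sqrt (1 + a^2) <= Q * Q" by (rule mult_mono[OF S(2) S(1)]) (use Q in auto)
 then have "sqrt (1 + b^2) * sqrt (1 + a^2) + 1 + a * b <= 2 * Q^2"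
  using ab Q(2) by (simp add: power2_eq_square)
 moreover have "sqrt (1 + a^2) <= Q^2"
 proof -
  have "Q <= Q^2" using mult_left_mono[OF Q(1), of Q] Q(1) by (simp add: power2_eq_square)
  then show ?thesis using S(1) by linarith
 qed
 ultimately have "sqrt (1 + a^2) * (sqrt (1 + b^2) * sqrt (1 + a^2) + 1 + a * b) <= sqrt (1 + a^2) * (2 * Q^2)"
  by (intro mult_left_mono) auto
 also have "... <= Q^2 * (2 * Q^2)" using \<open>sqrt (1 + a^2) <= Q^2\<close> by (intro mult_right_mono) auto
 finally have "sqrt (1 + a^2) * (sqrt (1 + b^2) * sqrt (1 + a^2) + 1 + a * b) <= 2 * (1 + R^2)^2"
  unfolding Q(2) by (simp only: power2_eq_square mult.left_commute)
 from mult_left_mono[OF this breg_identity(1)] show ?thesis unfolding breg_identity(2)[of b a] by (simp add: mult.commute)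
qed

lemma powr_tail:
 fixes z :: real
 assumes p: "p > 1" and R: "R > 0"
 shows "R < \<bar>z\<bar> ==> \<bar>z\<bar> <= R powr (1 - p) * \<bar>z\<bar> powr p" and "\<bar>z\<bar> <= R + R powr (1 - p) * \<bar>z\<bar> powr p"
proof -
 show *: "\<bar>z\<bar> <= R powr (1 - p) * \<bar>z\<bar> powr p" if "R < \<bar>z\<bar>"
 proof -
  have "\<bar>z\<bar> powr (1 - p) <= R powr (1 - p)" by (rule powr_mono2') (use p R that in auto)
  from mult_right_mono[OF this, of "\<bar>z\<bar> powr p"]
  have "\<bar>z\<bar> powr (1 - p) * \<bar>z\<bar> powr p <= R powr (1 - p) * \<bar>z\<bar> powr p" by simp
  then show ?thesis using that R by (simp add: powr_add[symmetric])
 qed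
 show "\<bar>z\<bar> <= R + R powr (1 - p) * \<bar>z\<bar> powr p"
 proof (cases "R < \<bar>z\<bar>")
  case True then show ?thesis using * R by linarith
 next
  case False then show ?thesis by (metis add_increasing2 linorder_not_less mult_nonneg_nonneg powr_ge_zero)
 qed
qed

text \<open>Strict convexity degenerates at infinity; where one argument exceeds \<open>R\<close> the \<open>p\<close>-th powers take over.\<close>
lemma breg_controls_abs:
 assumes p: "p > 1" and R: "R > 0" and \<epsilon>: "\<epsilon> > 0"
 shows "\<bar>b - a\<bar> <= \<epsilon> + 2 * (1 + R^2)^2 / \<epsilon> * breg b a + 2 * R powr (1 - p) * (\<bar>a\<bar> powr p + \<bar>b\<bar> powr p)"
proof -
 have nn: "0 <= 2 * (1 + R^2)^2 / \<epsilon> * breg b a" using breg_identity(1)[of b a] \<epsilon> by simp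
 have nn2: "0 <= R powr (1 - p) * \<bar>a\<bar> powr p" "0 <= R powr (1 - p) * \<bar>b\<bar> powr p" by simp_all
 have e: "2 * R powr (1 - p) * (\<bar>a\<bar> powr p + \<bar>b\<bar> powr p) = 2 * (R powr (1 - p) * \<bar>a\<bar> powr p) + 2 * (R powr (1 - p) * \<bar>b\<bar> powr p)"
  by (simp add: distrib_left)
 consider "\<bar>a\<bar> <= R" "\<bar>b\<bar> <= R" | "R < \<bar>a\<bar>" "\<bar>b\<bar> <= \<bar>a\<bar>" | "R < \<bar>b\<bar>" "\<bar>a\<bar> <= \<bar>b\<bar>" by linarith
 then show ?thesis
 proof cases
  case 1
  have "\<bar>b - a\<bar> <= \<epsilon> + (b - a)^2 / \<epsilon>"
  proof (cases "\<bar>b - a\<bar> <= \<epsilon>")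
   case False
   then have "\<bar>b - a\<bar> * \<epsilon> <= \<bar>b - a\<bar> * \<bar>b - a\<bar>" by (intro mult_left_mono) auto
   then have "\<bar>b - a\<bar> <= (b - a)^2 / \<epsilon>" using \<epsilon> by (simp add: pos_le_divide_eq power2_eq_square)
   then show ?thesis using \<epsilon> by linarith
  qed (use \<epsilon> in "simp add: add_increasing2")
  moreover have "(b - a)^2 / \<epsilon> <= 2 * (1 + R^2)^2 / \<epsilon> * breg b a"
   using divide_right_mono[OF breg_lower[OF 1], of \<epsilon>] \<epsilon> by simp
  moreover have "2 * R powr (1 - p) * (\<bar>a\<bar> powr p + \<bar>b\<bar> powr p) >= 0" by simp
  ultimately show ?thesis by linarith
 next
  case 2
  have "\<bar>b - a\<bar> <= 2 * \<bar>a\<bar>" using 2 by linarith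
  then show ?thesis using powr_tail(1)[OF p R 2(1)] nn nn2 \<epsilon> unfolding e by linarith
 next
  case 3
  have "\<bar>b - a\<bar> <= 2 * \<bar>b\<bar>" using 3 by linarith
  then show ?thesis using powr_tail(1)[OF p R 3(1)] nn nn2 \<epsilon> unfolding e by linarith
 qed
qed

lemma lipschitz_of_deriv:
 fixes f :: "real => real"
 assumes "!!z. (f has_real_derivative f' z) (at z)" "!!z. \<bar>f' z\<bar> <= C"
 shows "\<bar>f a - f b\<bar> <= C * \<bar>a - b\<bar>"
 using field_differentiable_bound[of UNIV f f' C a b] assms by simp

lemma ent_lipschitz: "\<bar>ent 1 a - ent 1 b\<bar> <= \<bar>a - b\<bar>"
 using lipschitz_of_deriv[of "ent 1" "ent1 1" 1 a b] ent_deriv(1) ent_bounds(3) by simp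

lemma trunc_lipschitz: "c > 0 ==> \<bar>sqrt c * ent1 c a - sqrt c * ent1 c b\<bar> <= \<bar>a - b\<bar>"
proof -
 assume c: "c > 0"
 have "((%z. sqrt c * ent1 c z) has_real_derivative sqrt c * ent2 c z) (at z)" for z
  by (rule DERIV_cmult[OF ent_deriv(2)[OF c]])
 moreover have "\<bar>sqrt c * ent2 c z\<bar> <= 1" for z using ent_bounds(4,6)[OF c, of z] c by (simp add: abs_mult)
 ultimately show ?thesis using lipschitz_of_deriv[of "%z. sqrt c * ent1 c z" "%z. sqrt c * ent2 c z" 1 a b] by simp
qed

lemma ent_continuous: "c > 0 ==> cont (ent c)" "c > 0 ==> cont (ent1 c)"
 by (rule C2_fun.continuous_B[OF ent_C2_fun(1)], assumption)+

lemma stm_const: "T > 0 ==> (LINT q|stm T. c) = T * (c::real)"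
proof -
 assume T: "T > 0"
 have i: "integrable (stm T) (%q. c)" using finite_measure.integrable_const[OF finite_stm] by blast
 have m: "measure (time_on T) {0<..<T} = T" using T by (simp add: measure_restrict_space)
 show ?thesis using stm_iterated(1)[OF i] m by simp
qed

lemma stm_integrable_curry:
 fixes f :: "spacetime => real"
 assumes f: "f \<in> Borel" and ae: "AE t in time_on T. L1 (%x. f (t, x)) & (AV x. \<bar>f (t, x)\<bar>) <= C"
 shows "integrable (stm T) f"
proof -
 interpret pair_sigma_finite "time_on T" TM by (rule stm_pair)
 have fm: "f \<in> borel_measurable (time_on T \<Otimes>\<^sub>M TM)" using stm_borel[OF f, of T] by (simp add: stm_def)
 have m: "(%t. AV x. \<bar>f (t, x)\<bar>) \<in> borel_measurable (time_on T)"
  by (rule borel_curry[OF borel_measurable_abs[OF f]])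
 have i: "integrable (time_on T) (%t. AV x. \<bar>f (t, x)\<bar>)"
 proof (rule finite_measure.integrable_const_bound[OF finite_time _ m])
  show "AE t in time_on T. norm (AV x. \<bar>f (t, x)\<bar>) <= C" using ae
  proof eventually_elim
   fix t assume "L1 (%x. f (t, x)) & (AV x. \<bar>f (t, x)\<bar>) <= C"
   moreover have "0 <= (AV x. \<bar>f (t, x)\<bar>)" by (rule integral_nonneg) simp
   ultimately show "norm (AV x. \<bar>f (t, x)\<bar>) <= C" by (simp only: real_norm_def abs_of_nonneg)
  qed
 qed
 have a: "AE t in time_on T. L1 (%x. f (t, x))" using ae by eventually_elim (rule conjunct1)
 show ?thesis unfolding stm_def
  by (rule Fubini_integrable[OF fm _ a]) (simp only: real_norm_def i)
qed

lemma equidistributed_LINT: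
 fixes f g :: "real^2 => real" and B :: "real => real"
 assumes d: "distr TM borel f = distr TM borel g"
  and f: "f \<in> TBorel" and g: "g \<in> TBorel" and B: "B \<in> Borel"
 shows "(AV x. B (f x)) = (AV x. B (g x))"
  and "L1 (%x. B (f x)) \<longleftrightarrow> L1 (%x. B (g x))"
 by (simp_all only: integral_distr[OF f B, symmetric] integral_distr[OF g B, symmetric] integrable_distr_eq[OF f B, symmetric] integrable_distr_eq[OF g B, symmetric] d)

section \<open>The setting of the inviscid limit\<close>

text \<open>The limit enters only through Borel versions \<open>u\<close>, \<open>w\<close> of the velocity and the vorticity, through three properties at almost every time (its
curl, its distribution and its Sobolev bound) and through the weak convergence of the velocities.\<close>
locale inviscid =
 fixes T p Kp G :: real and wi :: "real^2 => real" and \<nu> :: "nat => real" and w0 :: "nat => real^2 => real"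
  and un :: "nat => real => real^2 => real^2" and wn :: "nat => real => real^2 => real"
  and u :: "spacetime => real^2" and w :: "spacetime => real"
 assumes T: "T > 0" and p: "p > 1" and ns: "!!k. ns_solution T (\<nu> k) (w0 k) (un k) (wn k)"
  and \<nu>0: "\<nu> ----> 0" and wi_measurable: "wi \<in> TBorel"
  and wi_p: "L1 (%x. \<bar>wi x\<bar> powr p)" "(AV x. \<bar>wi x\<bar> powr p) <= Kp"
  and w0_p: "!!k. (AV x. \<bar>w0 k x\<bar> powr p) <= Kp"
  and w0_L1: "(%k. AV x. \<bar>w0 k x - wi x\<bar>) ----> 0"
  and u_borel: "u \<in> Borel" and w_borel: "w \<in> Borel"
  and u_L2: "integrable (stm T) (%q. (norm (u q))^2)"
  and weak: "!!\<phi>. \<phi> \<in> Borel ==> integrable (stm T) (%q. (norm (\<phi> q))^2) ==>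
   (%k. LINT q|stm T. cut T (un k) q \<bullet> \<phi> q) ----> (LINT q|stm T. u q \<bullet> \<phi> q)"
  and curl: "AE t in time_on T. \<forall>\<phi>. torus_smooth \<phi> -->
   (AV x. u (t, x) $ 1 * partial 2 \<phi> x - u (t, x) $ 2 * partial 1 \<phi> x)
   = (AV x. (w (t, x) - avg wi) * \<phi> x)"
  and equi: "AE t in time_on T. distr TM borel (%x. w (t, x)) = distr TM borel wi"
  and sob: "AE t in time_on T. W11_bounded G (%x. u (t, x))"
begin

sublocale NS: ns_solution T "\<nu> k" "w0 k" "un k" "wn k" for k by (rule ns)

abbreviation "WK k \<equiv> cut T (wn k)"
abbreviation "UK k \<equiv> cut T (un k)"

lemma WK_borel: "WK k \<in> Borel" by (rule cut_borel[OF NS.w_continuous])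
lemma UK_borel: "UK k \<in> Borel" by (rule cut_borel[OF NS.u_continuous])

lemma w0_smooth: "torus_smooth (w0 k)"
proof -
 have "wn k 0 = w0 k" by (rule ext) (rule NS.initial)
 then show ?thesis using NS.w_smooth[of 0 k] T by simp
qed

lemma w_section: "(%x. w (t, x)) \<in> TBorel"
 by (rule torus_measurable_borel[OF borel_section[OF w_borel]])

lemma wi_integrable: "L1 wi"
proof (rule integrable_bound[OF _ wi_measurable])
 show "L1 (%x. 1 + \<bar>wi x\<bar> powr p)" using wi_p(1) by simp
 show "AE x in TM. norm (wi x) <= norm (1 + \<bar>wi x\<bar> powr p)"
  by (rule AE_I2) (use powr_tail(2)[OF p, of 1] in simp)
qed

lemma mass:
 assumes t: "t \<in> {0..T}" shows "avg (wn k t) = avg (w0 k)"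
proof -
 have C2: "C2_fun (%z. z) (%z. 1) (%z. 0)" by standard (auto intro!: derivative_eq_intros torus_smooth_const)
 have "((%\<tau>. 0) has_integral (AV x. wn k 0 x) - (AV x. wn k t x)) {0..t}"
  using NS.entropy_dissipation[OF C2, of 0 t k] t by simp
 then show ?thesis using has_integral_unique[OF _ has_integral_0] by (fastforce simp: NS.initial)
qed

lemma UK_L2: "integrable (stm T) (%q. (norm (UK k q))^2)"
proof -
 obtain C where C: "C >= 0" "!!t x. t \<in> {0..T} ==> x \<in> torus ==> norm (un k t x) <= C" using slab_bounded[OF NS.u_continuous[of k]] by blast
 show ?thesis
 proof (rule stm_bounded_integrable[where C="C^2"])
  show "(%q. (norm (UK k q))^2) \<in> borel_measurable (stm T)"
   by (rule stm_borel, rule borel_measurable_power, rule measurable_compose[OF UK_borel borel_measurable_norm])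
  fix t and x :: "real^2" assume "t \<in> {0<..<T}" "x \<in> torus"
  then show "norm ((norm (UK k (t, x)))^2) <= C^2" using C by (simp add: cut_eq power_mono)
 qed
qed

lemma WK_integrable:
 assumes B: "cont (B :: real => real)"
 shows "integrable (stm T) (%q. B (WK k q))"
  and "(LINT q|stm T. B (WK k q)) = (LINT t|time_on T. AV x. B (wn k t x))"
  and "integrable (time_on T) (%t. AV x. B (wn k t x))"
proof -
 have "continuous_on ({0..T} \<times> UNIV) (%q. B (wn k (fst q) (snd q)))" by (rule cont_compose[OF B NS.w_continuous])
 then obtain C where C: "C >= 0" "!!t x. t \<in> {0..T} ==> x \<in> torus ==> norm (B (wn k t x)) <= C"
  using slab_bounded[of T "%t x. B (wn k t x)"] by blast
 show i: "integrable (stm T) (%q. B (WK k q))"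
 proof (rule stm_bounded_integrable[where C="C"])
  show "(%q. B (WK k q)) \<in> borel_measurable (stm T)"
   by (rule stm_borel, rule measurable_compose[OF WK_borel cont_Borel[OF B]])
 qed (use C in "auto simp: cut_eq")
 have e: "(AV x. B (WK k (t, x))) = (AV x. B (wn k t x))" if "t \<in> space (time_on T)" for t
  using that by (simp add: cut_eq)
 show "(LINT q|stm T. B (WK k q)) = (LINT t|time_on T. AV x. B (wn k t x))"
  unfolding stm_iterated(1)[OF i] by (rule integral_cong[OF refl e])
 show "integrable (time_on T) (%t. AV x. B (wn k t x))"
 proof -
  have "integrable (time_on T) (%t. AV x. B (WK k (t, x))) = integrable (time_on T) (%t. AV x. B (wn k t x))"
   by (rule integrable_cong[OF refl e])
  then show ?thesis using stm_iterated(3)[OF i] by simp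
 qed
qed

lemma WK_decreasing:
 assumes B: "cont (B :: real => real)" and le: "!!t. t \<in> {0..T} ==> (AV x. B (wn k t x)) <= C"
 shows "(LINT q|stm T. B (WK k q)) <= T * C"
proof -
 have m: "measure (time_on T) {0<..<T} = T" using T by (simp add: measure_restrict_space)
 have "(LINT t|time_on T. AV x. B (wn k t x)) <= (LINT t|time_on T. C)"
  by (rule integral_mono[OF WK_integrable(3)[OF B] finite_measure.integrable_const[OF finite_time]]) (use le in simp)
 also have "... = T * C" using m by simp
 finally show ?thesis unfolding WK_integrable(2)[OF B] .
qed

text \<open>Functions of \<open>w\<close> have a constant integral in time, because the distribution is constant.\<close>
lemma w_integrable:
 assumes B: "B \<in> Borel" and i: "L1 (%x. B (wi x) :: real)"
 shows "integrable (stm T) (%q. B (w q))" and "(LINT q|stm T. B (w q)) = T * (AV x. B (wi x))"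
proof -
 have m: "measure (time_on T) {0<..<T} = T" using T by (simp add: measure_restrict_space)
 have ae: "AE t in time_on T. L1 (%x. B (w (t, x))) &
   (AV x. \<bar>B (w (t, x))\<bar>) = (AV x. \<bar>B (wi x)\<bar>) &
   (AV x. B (w (t, x))) = (AV x. B (wi x))"
  using equi
 proof eventually_elim
  fix t assume d: "distr TM borel (%x. w (t, x)) = distr TM borel wi"
  note e = equidistributed_LINT[OF d w_section wi_measurable]
  show "L1 (%x. B (w (t, x))) &
   (AV x. \<bar>B (w (t, x))\<bar>) = (AV x. \<bar>B (wi x)\<bar>) &
   (AV x. B (w (t, x))) = (AV x. B (wi x))"
   using e(1)[OF B] e(2)[OF B] i e(1)[OF borel_measurable_abs[OF B]] by simp
 qed
 show s: "integrable (stm T) (%q. B (w q))"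
 proof (rule stm_integrable_curry)
  show "(%q. B (w q)) \<in> Borel" by (rule measurable_compose[OF w_borel B])
  show "AE t in time_on T. L1 (%x. B (w (t, x))) & (AV x. \<bar>B (w (t, x))\<bar>) <= (AV x. \<bar>B (wi x)\<bar>)"
   using ae by eventually_elim simp
 qed
 have "(LINT q|stm T. B (w q)) = (LINT t|time_on T. AV x. B (w (t, x)))" by (rule stm_iterated(1)[OF s])
 also have "... = (LINT t|time_on T. AV x. B (wi x))"
  by (rule integral_cong_AE) (use ae borel_curry[OF measurable_compose[OF w_borel B]] in auto)
 also have "... = T * (AV x. B (wi x))" using m by simp
 finally show "(LINT q|stm T. B (w q)) = T * (AV x. B (wi x))" .
qed

lemma w_stm: "integrable (stm T) w" using w_integrable(1)[of "%z. z"] wi_integrable by simp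

lemma WK_stm: "integrable (stm T) (WK k)" using WK_integrable(1)[of "%z. z" k] by simp

lemmas WKw_stm = integrable_diff[OF WK_stm w_stm]
lemmas WKw_abs_stm = integrable_abs[OF WKw_stm]

text \<open>Applied on the distribution of space-time on the Borel sets, since the weak convergence is tested with Borel fields only.\<close>
lemma velocity_bound: "\<exists>K. \<forall>k. (LINT q|stm T. (norm (UK k q))^2) <= K"
proof -
 let ?M = "distr (stm T) borel (%q. q)"
 have n2: "(%q. (norm (f q))^2) \<in> Borel" if "f \<in> Borel" for f :: "spacetime => real^2"
  by (rule borel_measurable_power, rule measurable_compose[OF that borel_measurable_norm])
 have "\<exists>K. \<forall>k. (LINT q|?M. (norm (UK k q))^2) <= K"
 proof (rule weakly_bounded_imp_L2_bounded)
  show "UK k \<in> borel_measurable ?M" for k using UK_borel by simp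
  show "integrable ?M (%q. (norm (UK k q))^2)" for k
   using UK_L2 integrable_distr_eq[OF id_stm n2[OF UK_borel]] by blast
  fix \<phi> :: "spacetime => real^2" assume "\<phi> \<in> borel_measurable ?M" and i: "integrable ?M (%q. (norm (\<phi> q))^2)"
  then have \<phi>: "\<phi> \<in> Borel" by simp
  have "integrable (stm T) (%q. (norm (\<phi> q))^2)" using i integrable_distr_eq[OF id_stm n2[OF \<phi>]] by blast
  from weak[OF \<phi> this] have "Bseq (%k. LINT q|stm T. UK k q \<bullet> \<phi> q)" by (intro convergent_imp_Bseq convergentI)
  then obtain B where "\<forall>k. \<bar>LINT q|stm T. UK k q \<bullet> \<phi> q\<bar> <= B" unfolding Bseq_def by auto
  moreover have "(LINT q|?M. UK k q \<bullet> \<phi> q) = (LINT q|stm T. UK k q \<bullet> \<phi> q)" for k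
   by (rule integral_distr[OF id_stm borel_measurable_inner[OF UK_borel \<phi>]])
  ultimately show "\<exists>B. \<forall>k. \<bar>LINT q|?M. UK k q \<bullet> \<phi> q\<bar> <= B" by auto
 qed
 moreover have "(LINT q|?M. (norm (UK k q))^2) = (LINT q|stm T. (norm (UK k q))^2)" for k
  by (rule integral_distr[OF id_stm n2[OF UK_borel]])
 ultimately show ?thesis by simp
qed

end

section \<open>Strong convergence on space-time\<close>

lemma small_tail:
 assumes p: "p > 1" and e: "e > 0"
 obtains R where "R > 0" "C * R powr (1 - p) < (e::real)"
proof -
 have "((%R. C * R powr (1 - p)) \<longlongrightarrow> C * 0) at_top"
  by (intro tendsto_intros tendsto_neg_powr filterlim_ident) (use p in auto)
 then have "\<forall>\<^sub>F R in at_top. C * R powr (1 - p) < e" using e by (intro order_tendstoD(2)) auto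
 from eventually_conj[OF eventually_gt_at_top[of 0] this]
 obtain R where "R > 0 & C * R powr (1 - p) < e" using eventually_happens'[OF trivial_limit_at_top_linorder] by blast
 then show ?thesis using that by blast
qed

context inviscid
begin

text \<open>The perpendicular gradient of a smoothed function tests the velocity; by the Biot-Savart law this is a test of the
vorticity minus its mean. The means are conserved and converge.\<close>
lemma smoothing_weak:
 assumes h: "h \<in> Borel" "!!q. \<bar>h q\<bar> <= R"
 shows "(%k. LINT q|stm T. smoothing n (%x. h (fst q, x)) (snd q) * (WK k q - w q)) ----> 0"
proof -
 let ?S = "%q. smoothing n (%x. h (fst q, x)) (snd q)"
 let ?P = "%i q. partial i (smoothing n (%x. h (fst q, x))) (snd q)"
 let ?\<phi> = "%q. vec2 (?P 2 q, - ?P 1 q)"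
 let ?m = "avg wi" and ?mk = "%k. avg (w0 k)"
 obtain L where L: "L > 0" "!!f x. L1 f ==> norm (grad (smoothing n f) x) <= L * (AV x. \<bar>f x\<bar>)"
  by (rule smoothing_derivative_bounds[of n]) (rule that)
 have Sb: "?S \<in> Borel" by (rule smoothing_borel(1)[OF h(1)])
 have \<phi>b: "?\<phi> \<in> Borel"
  by (rule vec2_borel[OF smoothing_borel(2)[OF h(1)] borel_measurable_uminus[OF smoothing_borel(2)[OF h(1)]]])
 have SR: "\<bar>?S q\<bar> <= R" for q
  by (rule smoothing_bounded[OF torus_measurable_borel[OF borel_section[OF h(1)]] h(2)])
 have P: "\<bar>?P i q\<bar> <= L * R" for i q
 proof -
  have "\<bar>?P i q\<bar> <= norm (grad (smoothing n (%x. h (fst q, x))) (snd q))"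
   using component_le_norm_cart[of "grad (smoothing n (%x. h (fst q, x))) (snd q)" i] by (simp add: grad_def)
  also have "... <= L * R"
   using L(2)[OF bounded_section(1)[OF h], of "fst q" "snd q"] mult_left_mono[OF bounded_section(2)[OF h, of "fst q"], of L] L(1) by linarith
  finally show ?thesis .
 qed
 have \<phi>n: "norm (?\<phi> q) <= 2 * (L * R)" for q
  using norm_vec2_le[of "?P 2 q" "- ?P 1 q"] P[of 2 q] P[of 1 q] by simp
 have n2: "(%q. (norm (?\<phi> q))^2) \<in> Borel"
  by (rule borel_measurable_power, rule measurable_compose[OF \<phi>b borel_measurable_norm])
 have \<phi>2: "integrable (stm T) (%q. (norm (?\<phi> q))^2)"
  by (rule stm_bounded_integrable[OF stm_borel[OF n2], where C="(2 * (L * R))^2"]) (simp only: real_norm_def abs_power2, rule power_mono[OF \<phi>n norm_ge_zero])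
 have um: "u \<in> borel_measurable (stm T)" and UKm: "UK k \<in> borel_measurable (stm T)" and \<phi>m: "?\<phi> \<in> borel_measurable (stm T)" for k
  by (rule stm_borel, rule u_borel UK_borel \<phi>b)+
 have Si: "integrable (stm T) ?S" by (rule stm_bounded_integrable[OF stm_borel[OF Sb], where C=R]) (simp only: real_norm_def SR)
 have ci: "integrable (stm T) (%q. c)" for c :: real by (rule finite_measure.integrable_const[OF finite_stm])
 have mi: "integrable (stm T) (%q. ?S q * (g q - c))" if "integrable (stm T) g" for g c
  by (rule integrable_bounded_mult[OF integrable_diff[OF that ci] stm_borel[OF Sb], where C=R]) (rule SR)
 have smooth: "torus_smooth (smoothing n (%x. h (t, x)))" for t by (rule smoothing_smooth)
 have 1: "(LINT q|stm T. UK k q \<bullet> ?\<phi> q) = (LINT q|stm T. ?S q * (WK k q - ?mk k))" for k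
 proof -
  have i: "integrable (stm T) (%q. UK k q \<bullet> ?\<phi> q)" by (rule integrable_inner_L2(2)[OF UKm UK_L2 \<phi>m \<phi>2])
  show ?thesis unfolding stm_iterated(1)[OF i] stm_iterated(1)[OF mi[OF WK_stm]]
  proof (rule integral_cong[OF refl])
   fix t assume "t \<in> space (time_on T)"
   then have t: "t \<in> {0..T}" by simp
   show "(AV x. UK k (t, x) \<bullet> ?\<phi> (t, x)) = (AV x. ?S (t, x) * (WK k (t, x) - ?mk k))"
    using biot_savart_divfree(2)[OF NS.biot_savart[OF t] smooth] mass[OF t]
    by (simp add: cut_eq[OF t] inner_vec2 mult.commute)
  qed
 qed
 have 2: "(LINT q|stm T. u q \<bullet> ?\<phi> q) = (LINT q|stm T. ?S q * (w q - ?m))"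
 proof -
  have i: "integrable (stm T) (%q. u q \<bullet> ?\<phi> q)" by (rule integrable_inner_L2(2)[OF um u_L2 \<phi>m \<phi>2])
  show ?thesis unfolding stm_iterated(1)[OF i] stm_iterated(1)[OF mi[OF w_stm]]
  proof (rule integral_cong_AE)
   show "(%t. AV x. u (t, x) \<bullet> ?\<phi> (t, x)) \<in> borel_measurable (time_on T)"
    by (rule integrable_measurable[OF stm_iterated(3)[OF i]])
   show "(%t. AV x. ?S (t, x) * (w (t, x) - ?m)) \<in> borel_measurable (time_on T)"
    by (rule integrable_measurable[OF stm_iterated(3)[OF mi[OF w_stm]]])
   show "AE t in time_on T. (AV x. u (t, x) \<bullet> ?\<phi> (t, x)) = (AV x. ?S (t, x) * (w (t, x) - ?m))"
    using curl
   proof eventually_elim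
    fix t assume c: "\<forall>\<phi>. torus_smooth \<phi> --> (AV x. u (t, x) $ 1 * partial 2 \<phi> x - u (t, x) $ 2 * partial 1 \<phi> x)
      = (AV x. (w (t, x) - avg wi) * \<phi> x)"
    show "(AV x. u (t, x) \<bullet> ?\<phi> (t, x)) = (AV x. ?S (t, x) * (w (t, x) - ?m))"
     using c[rule_format, OF smooth[of t]] by (simp add: inner_vec2 mult.commute)
   qed
  qed
 qed
 have mk: "?mk ----> ?m"
 proof (rule LIM_zero_cancel, rule Lim_null_comparison[OF _ w0_L1], rule always_eventually, rule allI)
  fix k
  show "norm (?mk k - ?m) <= (AV x. \<bar>w0 k x - wi x\<bar>)"
   using LINT_abs_le[OF integrable_abs[OF integrable_diff[OF smooth_L1[OF w0_smooth] wi_integrable]], of "%x. w0 k x - wi x"]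
   by (simp add: integral_diff[OF smooth_L1[OF w0_smooth] wi_integrable])
 qed
 have eq: "(LINT q|stm T. ?S q * (WK k q - w q)) = (LINT q|stm T. UK k q \<bullet> ?\<phi> q) - (LINT q|stm T. u q \<bullet> ?\<phi> q) + (?mk k - ?m) * (LINT q|stm T. ?S q)" for k
 proof -
  have "(LINT q|stm T. ?S q * (WK k q - ?mk k)) - (LINT q|stm T. ?S q * (w q - ?m)) + (LINT q|stm T. (?mk k - ?m) * ?S q)
    = (LINT q|stm T. ?S q * (WK k q - ?mk k) - ?S q * (w q - ?m) + (?mk k - ?m) * ?S q)"
   using mi[OF WK_stm, of k "?mk k"] mi[OF w_stm, of ?m] integrable_mult_right[OF Si, of "?mk k - ?m"]
   by (subst integral_add; (intro integrable_diff)?; simp?)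
  also have "... = (LINT q|stm T. ?S q * (WK k q - w q))"
   by (rule integral_cong) (simp_all add: algebra_simps)
  finally show ?thesis unfolding 1 2 by simp
 qed
 have "(%k. (LINT q|stm T. UK k q \<bullet> ?\<phi> q) - (LINT q|stm T. u q \<bullet> ?\<phi> q) + (?mk k - ?m) * (LINT q|stm T. ?S q)) ---->
   (LINT q|stm T. u q \<bullet> ?\<phi> q) - (LINT q|stm T. u q \<bullet> ?\<phi> q) + (?m - ?m) * (LINT q|stm T. ?S q)"
  by (intro tendsto_intros weak[OF \<phi>b \<phi>2] mk)
 then show ?thesis unfolding eq by simp
qed

text \<open>Dominates the parts of \<open>w\<close> and of its approximation that lie above a large level.\<close>
definition tails :: "nat => spacetime => real" where "tails k q = \<bar>w q\<bar> powr p + \<bar>WK k q\<bar> powr p"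

lemma powr_p_continuous: "cont (%z::real. \<bar>z\<bar> powr p)"
 using p by (intro continuous_intros continuous_on_powr') auto

lemma tails_integral: "integrable (stm T) (tails k)" "(LINT q|stm T. tails k q) <= 2 * T * Kp"
proof -
 note i1 = w_integrable[OF cont_Borel[OF powr_p_continuous] wi_p(1)]
 note i2 = WK_integrable(1)[OF powr_p_continuous, of k]
 show "integrable (stm T) (tails k)" unfolding tails_def[abs_def] by (rule integrable_add[OF i1(1) i2])
 have "(AV x. \<bar>wn k t x\<bar> powr p) <= Kp" if "t \<in> {0..T}" for t
  using NS.Lp_contraction[of p t k] w0_p[of k] p that by simp
 then have "(LINT q|stm T. \<bar>WK k q\<bar> powr p) <= T * Kp" by (rule WK_decreasing[OF powr_p_continuous])
 moreover have "(LINT q|stm T. \<bar>w q\<bar> powr p) <= T * Kp" using i1(2) wi_p(2) T by simp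
 ultimately show "(LINT q|stm T. tails k q) <= 2 * T * Kp"
  unfolding tails_def[abs_def] integral_add[OF i1(1) i2] by simp
qed

lemma stm_smoothing_tendsto:
 assumes h: "h \<in> Borel" "!!q. \<bar>h q\<bar> <= R"
 shows "(%n. LINT q|stm T. \<bar>h q - smoothing n (%x. h (fst q, x)) (snd q)\<bar>) ----> 0"
proof -
 have R0: "0 <= R" using h(2)[of "(0,0)"] by linarith
 let ?d = "%n q. \<bar>h q - smoothing n (%x. h (fst q, x)) (snd q)\<bar>"
 have SR: "\<bar>smoothing n (%x. h (fst q, x)) (snd q)\<bar> <= R" for n q
  by (rule smoothing_bounded[OF torus_measurable_borel[OF borel_section[OF h(1)]] h(2)])
 have db: "?d n \<in> Borel" for n by (rule borel_measurable_abs[OF borel_measurable_diff[OF h(1) smoothing_borel(1)[OF h(1)]]])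
 have d2: "\<bar>?d n q\<bar> <= 2 * R" for n q using h(2)[of q] SR[of n q] by linarith
 have di: "integrable (stm T) (?d n)" for n
  by (rule stm_bounded_integrable[OF stm_borel[OF db]]) (simp only: real_norm_def, rule d2)
 have "(%n. LINT t|time_on T. AV x. ?d n (t, x)) ----> (LINT t|time_on T. 0)"
 proof (rule integral_dominated_convergence[where w="%t. 2 * R"])
  show "(%t. AV x. ?d n (t, x)) \<in> borel_measurable (time_on T)" for n
   by (rule integrable_measurable[OF stm_iterated(3)[OF di]])
  show "integrable (time_on T) (%t. 2 * R)" by (rule finite_measure.integrable_const[OF finite_time])
  show "AE t in time_on T. (%n. AV x. ?d n (t, x)) ----> 0"
   using smoothing_L1_tendsto[OF bounded_section(1)[OF h]] by simp
  show "AE t in time_on T. norm (AV x. ?d n (t, x)) <= 2 * R" for n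
   using R0 d2 by (intro AE_I2, simp only: real_norm_def, intro torus_LINT_bound) auto
 qed simp
 then show ?thesis unfolding stm_iterated(1)[OF di] by simp
qed

text \<open>The derivative of the entropy at \<open>w\<close> is bounded but not smooth; it is replaced by its smoothing. The error is small in \<open>L\<^sup>1\<close>
but multiplies an unbounded factor, so it is split at a level \<open>R\<close> chosen first.\<close>
lemma entropy_pairing: "(%k. LINT q|stm T. ent1 1 (w q) * (WK k q - w q)) ----> 0"
proof (rule LIMSEQ_I)
 fix e :: real assume e: "e > 0"
 let ?h = "%q. ent1 1 (w q)"
 let ?S = "%n q. smoothing n (%x. ?h (fst q, x)) (snd q)"
 have h: "?h \<in> Borel" "!!q. \<bar>?h q\<bar> <= 1"
  using measurable_compose[OF w_borel cont_Borel[OF ent_continuous(2)[of 1]]] ent_bounds(3)[of 1] by simp_all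
 have SR: "\<bar>?S n q\<bar> <= 1" for n q
  by (rule smoothing_bounded[OF torus_measurable_borel[OF borel_section[OF h(1)]] h(2)])
 note Sb = smoothing_borel(1)[OF h(1)]
 have di: "integrable (stm T) (%q. \<bar>?h q - ?S n q\<bar>)" for n
 proof (rule stm_bounded_integrable[OF stm_borel[OF borel_measurable_abs[OF borel_measurable_diff[OF h(1) Sb]]], where C=2])
  fix t x show "norm \<bar>?h (t, x) - ?S n (t, x)\<bar> <= 2" using h(2)[of "(t, x)"] SR[of n "(t, x)"] unfolding real_norm_def by linarith
 qed
 have Kp0: "Kp >= 0" using order_trans[OF integral_nonneg wi_p(2)] by simp
 obtain R where R: "R > 0" "8 * T * Kp * R powr (1 - p) < e" by (rule small_tail[OF p e])
 have "(%n. 8 * R * (LINT q|stm T. \<bar>?h q - ?S n q\<bar>)) ----> 8 * R * 0"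
  by (intro tendsto_intros stm_smoothing_tendsto[OF h])
 then have "\<forall>\<^sub>F n in sequentially. 8 * R * (LINT q|stm T. \<bar>?h q - ?S n q\<bar>) < e" using e by (intro order_tendstoD(2)) auto
 then obtain n where n: "8 * R * (LINT q|stm T. \<bar>?h q - ?S n q\<bar>) < e"
  using eventually_happens'[OF sequentially_bot] by blast
 obtain k0 where k0: "!!k. k >= k0 ==> \<bar>LINT q|stm T. ?S n q * (WK k q - w q)\<bar> < e / 4"
  using LIMSEQ_D[OF smoothing_weak[OF h, of n], of "e / 4"] e by auto
 show "\<exists>no. \<forall>k\<ge>no. norm ((LINT q|stm T. ?h q * (WK k q - w q)) - 0) < e"
 proof (intro exI[of _ k0] allI impI)
  fix k assume k: "k >= k0"
  have i1: "integrable (stm T) (%q. ?S n q * (WK k q - w q))" and i2: "integrable (stm T) (%q. (?h q - ?S n q) * (WK k q - w q))"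
  proof -
   show "integrable (stm T) (%q. ?S n q * (WK k q - w q))"
    by (rule integrable_bounded_mult[OF WKw_stm stm_borel[OF Sb]]) (rule SR)
   show "integrable (stm T) (%q. (?h q - ?S n q) * (WK k q - w q))"
   proof (rule integrable_bounded_mult[OF WKw_stm stm_borel[OF borel_measurable_diff[OF h(1) Sb]]])
    fix q show "\<bar>?h q - ?S n q\<bar> <= 2" using h(2)[of q] SR[of n q] by linarith
   qed
  qed
  have bi: "integrable (stm T) (%q. 2 * R * \<bar>?h q - ?S n q\<bar> + 2 * R powr (1 - p) * tails k q)"
   by (intro integrable_add integrable_mult_right di tails_integral)
  have pt: "\<bar>(?h q - ?S n q) * (WK k q - w q)\<bar> <= 2 * R * \<bar>?h q - ?S n q\<bar> + 2 * R powr (1 - p) * tails k q" for q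
  proof -
   let ?d = "\<bar>?h q - ?S n q\<bar>"
   have d: "?d <= 2" using h(2)[of q] SR[of n q] by linarith
   have "\<bar>WK k q - w q\<bar> <= 2 * R + R powr (1 - p) * tails k q"
    using powr_tail(2)[OF p R(1), of "WK k q"] powr_tail(2)[OF p R(1), of "w q"] by (simp add: tails_def distrib_left)
   then have "?d * \<bar>WK k q - w q\<bar> <= ?d * (2 * R + R powr (1 - p) * tails k q)" by (rule mult_left_mono) simp
   also have "... = 2 * R * ?d + ?d * (R powr (1 - p) * tails k q)" by (simp add: distrib_left)
   also have "?d * (R powr (1 - p) * tails k q) <= 2 * (R powr (1 - p) * tails k q)" by (rule mult_right_mono[OF d]) (simp add: tails_def)
   finally show ?thesis by (simp add: abs_mult)
  qed
  have "(LINT q|stm T. ?h q * (WK k q - w q)) = (LINT q|stm T. ?S n q * (WK k q - w q)) + (LINT q|stm T. (?h q - ?S n q) * (WK k q - w q))"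
   unfolding integral_add[OF i1 i2, symmetric] by (rule integral_cong) (simp_all add: left_diff_distrib)
  moreover have "\<bar>LINT q|stm T. (?h q - ?S n q) * (WK k q - w q)\<bar> <= (LINT q|stm T. 2 * R * \<bar>?h q - ?S n q\<bar> + 2 * R powr (1 - p) * tails k q)"
   by (rule LINT_abs_le[OF bi pt])
  moreover have "... = 2 * R * (LINT q|stm T. \<bar>?h q - ?S n q\<bar>) + 2 * R powr (1 - p) * (LINT q|stm T. tails k q)"
   by (subst integral_add) (intro integrable_mult_right di tails_integral | simp)+
  moreover have "2 * R powr (1 - p) * (LINT q|stm T. tails k q) <= 2 * R powr (1 - p) * (2 * T * Kp)"
   by (rule mult_left_mono[OF tails_integral(2)]) simp
  moreover have "2 * R powr (1 - p) * (2 * T * Kp) = (8 * T * Kp * R powr (1 - p)) / 2" by simp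
  ultimately show "norm ((LINT q|stm T. ?h q * (WK k q - w q)) - 0) < e"
   using k0[OF k] n R(2) unfolding real_norm_def diff_zero by linarith
 qed
qed

text \<open>The integrated Bregman divergence is at most the entropy that the initial data have in excess of the limit plus a pairing that
vanishes by weak convergence.\<close>
lemma vorticity_L1: "(%k. LINT q|stm T. \<bar>WK k q - w q\<bar>) ----> 0"
proof -
 have hb: "(%q. ent1 1 (w q)) \<in> Borel"
  using measurable_compose[OF w_borel cont_Borel[OF ent_continuous(2)[of 1]]] by simp
 have hi: "integrable (stm T) (%q. ent1 1 (w q) * (WK k q - w q))" for k
  by (rule integrable_bounded_mult[OF WKw_stm stm_borel[OF hb], where C=1]) (use ent_bounds(3)[of 1] in simp)
 have ec: "cont (ent 1)" by (rule ent_continuous(1)) simp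
 have e0i: "L1 (%x. ent 1 (wi x))"
 proof (rule integrable_bound[OF integrable_add[OF torus.integrable_const[of "1::real"] integrable_abs[OF wi_integrable]]])
  show "(%x. ent 1 (wi x)) \<in> TBorel"
   by (rule measurable_compose[OF wi_measurable cont_Borel[OF ec]])
  show "AE x in TM. norm (ent 1 (wi x)) <= norm (1 + \<bar>wi x\<bar>)"
   using ent_bounds(1,2)[of 1] by (intro AE_I2) (smt (verit) real_norm_def real_sqrt_one zero_less_one)
 qed
 note ew = w_integrable[OF cont_Borel[OF ec] e0i]
 note eW = WK_integrable(1)[OF ec]
 have e0k: "L1 (%x. ent 1 (w0 k x))" for k
  by (rule cont_L1[OF cont_compose[OF ec smooth_cont[OF w0_smooth]]])
 define X where "X k = (LINT q|stm T. ent1 1 (w q) * (WK k q - w q))" for k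
 define Y where "Y k = T * (AV x. \<bar>w0 k x - wi x\<bar>) + \<bar>X k\<bar>" for k
 have bi: "integrable (stm T) (%q. breg (WK k q) (w q))" for k
  unfolding breg_def by (intro integrable_diff eW ew hi)
 have breg_le: "(LINT q|stm T. breg (WK k q) (w q)) <= Y k" for k
 proof -
  have "(LINT q|stm T. breg (WK k q) (w q)) = (LINT q|stm T. ent 1 (WK k q)) - T * (AV x. ent 1 (wi x)) - X k"
   unfolding breg_def X_def ew(2)[symmetric]
   by (simp only: integral_diff[OF integrable_diff[OF eW ew(1)] hi] integral_diff[OF eW ew(1)])
  moreover have "(LINT q|stm T. ent 1 (WK k q)) <= T * (AV x. ent 1 (w0 k x))"
  proof (rule WK_decreasing[OF ec])
   fix t assume "t \<in> {0..T}"
   then show "(AV x. ent 1 (wn k t x)) <= (AV x. ent 1 (w0 k x))"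
    using NS.entropy_decreasing[OF ent_C2_fun(1)[of 1], of 0 t k] ent_bounds(4)[of 1] by (simp add: NS.initial less_imp_le)
  qed
  moreover have "(AV x. ent 1 (w0 k x)) - (AV x. ent 1 (wi x)) <= (AV x. \<bar>w0 k x - wi x\<bar>)"
   using LINT_abs_le[OF integrable_abs[OF integrable_diff[OF smooth_L1[OF w0_smooth] wi_integrable]], of "%x. ent 1 (w0 k x) - ent 1 (wi x)" k] ent_lipschitz
   by (simp add: integral_diff[OF e0k e0i])
  then have "T * (AV x. ent 1 (w0 k x)) - T * (AV x. ent 1 (wi x)) <= T * (AV x. \<bar>w0 k x - wi x\<bar>)"
   unfolding right_diff_distrib[symmetric] using T by (intro mult_left_mono) auto
  ultimately show ?thesis unfolding Y_def by linarith
 qed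
 have "(%k. T * (AV x. \<bar>w0 k x - wi x\<bar>) + \<bar>X k\<bar>) ----> T * 0 + \<bar>0\<bar>"
  unfolding X_def by (intro tendsto_intros w0_L1 entropy_pairing)
 then have Y: "Y ----> 0" unfolding Y_def[abs_def] by simp
 have main: "(LINT q|stm T. \<bar>WK k q - w q\<bar>) <= T * \<epsilon> + 2 * (1 + R^2)^2 / \<epsilon> * Y k + 2 * R powr (1 - p) * (2 * T * Kp)"
  if R: "R > 0" and \<epsilon>: "\<epsilon> > 0" for k R \<epsilon>
 proof -
  let ?c = "2 * (1 + R^2)^2 / \<epsilon>"
  have ci: "integrable (stm T) (%q. \<epsilon>)" by (rule finite_measure.integrable_const[OF finite_stm])
  note I = ci integrable_mult_right[OF bi, of ?c k] integrable_mult_right[OF tails_integral(1), of "2 * R powr (1 - p)" k]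
  have "(LINT q|stm T. \<bar>WK k q - w q\<bar>) <= (LINT q|stm T. \<epsilon> + ?c * breg (WK k q) (w q) + 2 * R powr (1 - p) * tails k q)"
  proof (rule integral_mono)
   show "integrable (stm T) (%q. \<bar>WK k q - w q\<bar>)" by (rule integrable_abs[OF WKw_stm])
   show "integrable (stm T) (%q. \<epsilon> + ?c * breg (WK k q) (w q) + 2 * R powr (1 - p) * tails k q)"
    by (intro integrable_add I)
  qed (use breg_controls_abs[OF p R \<epsilon>] in "simp add: tails_def")
  also have "... = T * \<epsilon> + ?c * (LINT q|stm T. breg (WK k q) (w q)) + 2 * R powr (1 - p) * (LINT q|stm T. tails k q)"
   by (simp only: integral_add[OF integrable_add[OF I(1,2)] I(3)] integral_add[OF I(1,2)]
     integral_mult_right_zero stm_const[OF T])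
  also have "... <= T * \<epsilon> + ?c * Y k + 2 * R powr (1 - p) * (2 * T * Kp)"
   using \<epsilon> T by (intro add_mono mult_left_mono breg_le tails_integral(2)) auto
  finally show ?thesis .
 qed
 show ?thesis
 proof (rule LIMSEQ_I)
  fix e :: real assume e: "e > 0"
  have "e / 3 > 0" using e by simp
  from small_tail[OF p this, of "4 * T * Kp"]
  obtain R where R: "R > 0" "2 * R powr (1 - p) * (2 * T * Kp) < e / 3" by (auto simp: mult_ac)
  define \<epsilon> where "\<epsilon> = e / (3 * T)"
  have \<epsilon>: "\<epsilon> > 0" "T * \<epsilon> = e / 3" using e T by (simp_all add: \<epsilon>_def)
  have "(%k. 2 * (1 + R^2)^2 / \<epsilon> * Y k) ----> 2 * (1 + R^2)^2 / \<epsilon> * 0" by (intro tendsto_mult_left Y)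
  then have "\<forall>\<^sub>F k in sequentially. 2 * (1 + R^2)^2 / \<epsilon> * Y k < e / 3" using e by (intro order_tendstoD(2)) auto
  then obtain k0 where k0: "!!k. k >= k0 ==> 2 * (1 + R^2)^2 / \<epsilon> * Y k < e / 3" unfolding eventually_sequentially by blast
  show "\<exists>no. \<forall>k\<ge>no. norm ((LINT q|stm T. \<bar>WK k q - w q\<bar>) - 0) < e"
  proof (intro exI[of _ k0] allI impI)
   fix k assume "k >= k0"
   have "0 <= (LINT q|stm T. \<bar>WK k q - w q\<bar>)" by (rule integral_nonneg) simp
   then show "norm ((LINT q|stm T. \<bar>WK k q - w q\<bar>) - 0) < e"
    using main[OF R(1) \<epsilon>(1), of k] k0[OF \<open>k >= k0\<close>] R(2) \<epsilon>(2) by simp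
  qed
 qed
qed

end

section \<open>The energy of the smoothed vorticity in time\<close>

lemma ent_lipschitz': "c > 0 ==> \<bar>ent c a - ent c b\<bar> <= \<bar>a - b\<bar>"
 using lipschitz_of_deriv[of "ent c" "ent1 c" 1 a b] ent_deriv(1) ent_bounds(3) by simp

definition trunc :: "real => real => real" where "trunc c z = sqrt c * ent1 c z"

lemma trunc_bounded: "c > 0 ==> \<bar>trunc c z\<bar> <= sqrt c"
proof -
 assume c: "c > 0"
 have "sqrt c * \<bar>ent1 c z\<bar> <= sqrt c * 1" by (rule mult_left_mono[OF ent_bounds(3)[OF c]]) (use c in simp)
 then show ?thesis using c by (simp add: trunc_def abs_mult)
qed

lemma trunc_lipschitz': "c > 0 ==> \<bar>trunc c a - trunc c b\<bar> <= \<bar>a - b\<bar>" unfolding trunc_def by (rule trunc_lipschitz)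

lemma trunc_continuous: "c > 0 ==> cont (trunc c)"
 unfolding trunc_def[abs_def] by (intro continuous_intros ent_continuous(2))

lemma trunc_borel: "c > 0 ==> trunc c \<in> Borel" by (rule cont_Borel[OF trunc_continuous])

lemma trunc_smooth: "c > 0 ==> torus_smooth f ==> torus_smooth (%x. trunc c (f x))"
 unfolding trunc_def by (rule C2_fun.smooth(1)[OF ent_C2_fun(2)])

lemma coef_diff:
 assumes f: "L1 f" and g: "L1 g" and j: "j < nmodes n"
  and E: "!!x. \<bar>mode n j x\<bar> <= E"
 shows "\<bar>coef n f j - coef n g j\<bar> <= E * (AV x. \<bar>f x - g x\<bar>)"
proof -
 have "coef n f j - coef n g j = coef n (%x. f x - g x) j"
  unfolding coef_def left_diff_distrib by (rule integral_diff[OF integrable_mode(2)[OF f j] integrable_mode(2)[OF g j], symmetric])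
 then show ?thesis using coef_bound[OF integrable_diff[OF f g] j E] by simp
qed

text \<open>For fixed \<open>n\<close> the energy is a continuous function of finitely many coefficients.\<close>
lemma energy_tendsto_L1:
 assumes f: "!!k. L1 (f k)" and g: "L1 g"
  and lim: "(%k. AV x. \<bar>f k x - g x\<bar>) ----> 0"
 shows "(%k. energy n (f k)) ----> energy n g"
 unfolding energy_def
proof (intro tendsto_sum tendsto_power)
 fix j assume "j \<in> {..<nmodes n}"
 then have j: "j < nmodes n" by simp
 obtain E where E: "!!x. \<bar>mode n j x\<bar> <= E" using torus_smooth_bound[OF mode_smooth[OF j]] by blast
 show "(%k. coef n (f k) j) ----> coef n g j"
 proof (rule LIM_zero_cancel, rule Lim_null_comparison)
  show "\<forall>\<^sub>F k in sequentially. norm (coef n (f k) j - coef n g j) <= E * (AV x. \<bar>f k x - g x\<bar>)"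
   using coef_diff[OF f g j E] by simp
  show "(%k. E * (AV x. \<bar>f k x - g x\<bar>)) ----> 0"
   using tendsto_mult_left[OF lim, of E] by simp
 qed
qed

lemma torus_LINT_L2_L1:
 fixes f :: "real^2 => real"
 assumes f: "f \<in> TBorel" "!!x. x \<in> torus ==> \<bar>f x\<bar> <= C" and r: "r > 0"
 shows "(AV x. \<bar>f x\<bar>) <= (r + (AV x. (f x)^2) / r) / 2"
proof -
 have i: "L1 f" by (rule bounded_L1[OF f(1), where C=C]) (simp add: f(2))
 have "\<bar>(f x)^2\<bar> <= C^2" if "x \<in> torus" for x using power_mono[OF f(2)[OF that], of 2] by simp
 then have i2: "L1 (%x. (f x)^2)"
  by (intro bounded_L1[where C="C^2"] borel_measurable_power f(1)) simp
 have pt: "\<bar>f x\<bar> <= r / 2 + (1 / (2 * r)) * (f x)^2" for x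
 proof -
  have "0 <= (r - \<bar>f x\<bar>)^2" by simp
  then have "2 * r * \<bar>f x\<bar> <= r^2 + (f x)^2" by (simp add: power2_diff)
  then show ?thesis using r by (simp add: field_simps power2_eq_square)
 qed
 have "(AV x. \<bar>f x\<bar>) <= (AV x. r / 2 + (1 / (2 * r)) * (f x)^2)"
  by (rule integral_mono[OF integrable_abs[OF i] integrable_add[OF torus.integrable_const integrable_mult_right[OF i2]] pt])
 also have "... = r / 2 + (1 / (2 * r)) * (AV x. (f x)^2)"
  by (subst integral_add[OF torus.integrable_const integrable_mult_right[OF i2]]) simp
 finally show ?thesis by (simp add: add_divide_distrib)
qed

context inviscid
begin

lemma wn_integrable: "t \<in> {0..T} ==> L1 (wn k t)"
 by (rule smooth_L1[OF NS.w_smooth])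

lemma good_subsequence:
 "\<exists>r::nat => nat. strict_mono r & (AE t in time_on T. (%k. AV x. \<bar>WK (r k) (t, x) - w (t, x)\<bar>) ----> 0)"
proof -
 have nn: "norm (AV x. \<bar>WK k (t, x) - w (t, x)\<bar>) = (AV x. \<bar>WK k (t, x) - w (t, x)\<bar>)" for k t
  unfolding real_norm_def by (rule abs_of_nonneg) (rule integral_nonneg, simp)
 show ?thesis
  by (rule tendsto_L1_AE_subseq[OF stm_iterated(3)[OF WKw_abs_stm]])
   (unfold nn stm_iterated(1)[OF WKw_abs_stm, symmetric], rule vorticity_L1)
qed

text \<open>Along this subsequence the vorticities converge at almost every time. It serves only to derive properties of the limit.\<close>
definition "\<rho> = (SOME r::nat => nat. strict_mono r & (AE t in time_on T. (%k. AV x. \<bar>WK (r k) (t, x) - w (t, x)\<bar>) ----> 0))"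

lemma \<rho>: "strict_mono \<rho>" "AE t in time_on T. (%k. AV x. \<bar>WK (\<rho> k) (t, x) - w (t, x)\<bar>) ----> 0"
 using someI_ex[OF good_subsequence] unfolding \<rho>_def[symmetric] by simp_all

text \<open>The limit at time \<open>s\<close>, with its initial value in place of the meaningless value of \<open>w\<close> at time zero.\<close>
definition rep :: "real => real^2 => real" where "rep s x = (if s = 0 then wi x else w (s, x))"

text \<open>The times at which the limit inherits everything from the approximations; almost all times and time zero.\<close>
definition Good :: "real => bool" where
 "Good s \<longleftrightarrow> 0 <= s & s < T & distr TM borel (rep s) = distr TM borel wi &
   (%k. AV x. \<bar>wn (\<rho> k) s x - rep s x\<bar>) ----> 0"

lemma Good_AE: "AE t in time_on T. Good t"
 using \<rho>(2) equi AE_space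
proof eventually_elim
 fix t assume t: "t \<in> space (time_on T)"
 then have e: "rep t = (%x. w (t, x))" "t \<in> {0..T}" by (auto simp: rep_def)
 assume "(%k. AV x. \<bar>WK (\<rho> k) (t, x) - w (t, x)\<bar>) ----> 0" "distr TM borel (%x. w (t, x)) = distr TM borel wi"
 then show "Good t" using t unfolding Good_def by (simp add: e(1) cut_eq[OF e(2)])
qed

lemma Good_0: "Good 0"
proof -
 have "(%k. AV x. \<bar>w0 (\<rho> k) x - wi x\<bar>) ----> 0"
  using LIMSEQ_subseq_LIMSEQ[OF w0_L1 \<rho>(1)] by (simp add: o_def)
 then show ?thesis using T unfolding Good_def rep_def by (simp add: NS.initial)
qed

lemma Good_range: "Good s ==> s \<in> {0..T}" by (simp add: Good_def)

lemma rep_measurable: "rep s \<in> TBorel"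
 using wi_measurable w_section[of s] unfolding rep_def[abs_def] by (cases "s = 0") simp_all

lemma rep_LINT:
 assumes s: "Good s" and B: "B \<in> Borel"
 shows "(AV x. B (rep s x) :: real) = (AV x. B (wi x))"
  and "L1 (%x. B (rep s x)) \<longleftrightarrow> L1 (%x. B (wi x))"
 using equidistributed_LINT[OF _ rep_measurable wi_measurable B, of s] s by (simp_all add: Good_def)

lemma rep_integrable: "Good s ==> L1 (rep s)"
 using rep_LINT(2)[of s "%z. z"] wi_integrable by simp

lemma velocity_diff_bound:
 obtains K where "!!k. integrable (stm T) (%q. (norm (UK k q - u q))^2)" "!!k. (LINT q|stm T. (norm (UK k q - u q))^2) <= K"
proof -
 obtain K where K: "!!k. (LINT q|stm T. (norm (UK k q))^2) <= K" using velocity_bound by blast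
 have bi: "integrable (stm T) (%q. 2 * (norm (UK k q))^2 + 2 * (norm (u q))^2)" for k
  by (intro integrable_add integrable_mult_right UK_L2 u_L2)
 have pt: "(norm (a - b))^2 <= 2 * (norm a)^2 + 2 * (norm b)^2" for a b :: "real^2"
 proof -
  have "(norm (a - b))^2 <= (norm a + norm b)^2" by (rule power_mono[OF norm_triangle_ineq4 norm_ge_zero])
  moreover have "0 <= (norm a - norm b)^2" by simp
  ultimately show ?thesis unfolding power2_sum power2_diff by linarith
 qed
 have m: "(%q. (norm (UK k q - u q))^2) \<in> borel_measurable (stm T)" for k
  by (rule stm_borel, rule borel_measurable_power, rule measurable_compose[OF borel_measurable_diff[OF UK_borel u_borel] borel_measurable_norm])
 have i: "integrable (stm T) (%q. (norm (UK k q - u q))^2)" for k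
  by (rule integrable_bound[OF bi[of k] m], rule AE_I2) (simp add: pt)
 have "(LINT q|stm T. (norm (UK k q - u q))^2) <= 2 * K + 2 * (LINT q|stm T. (norm (u q))^2)" for k
 proof -
  have "(LINT q|stm T. (norm (UK k q - u q))^2) <= (LINT q|stm T. 2 * (norm (UK k q))^2 + 2 * (norm (u q))^2)"
   by (rule integral_mono[OF i bi pt])
  also have "... = 2 * (LINT q|stm T. (norm (UK k q))^2) + 2 * (LINT q|stm T. (norm (u q))^2)"
   by (subst integral_add) (intro integrable_mult_right UK_L2 u_L2 | simp)+
  finally show ?thesis using K[of k] by linarith
 qed
 with i show ?thesis by (rule that)
qed

context
 fixes c s s' :: real and n :: nat
 assumes c: "c > 0" and n: "n >= 1" and ss: "0 <= s" "s <= s'" "s' <= T"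
begin

abbreviation "\<theta> \<equiv> trunc c"

lemmas \<theta>_bounded = trunc_bounded[OF c] and \<theta>_lipschitz = trunc_lipschitz'[OF c] and \<theta>_continuous = trunc_continuous[OF c]
 and \<theta>_borel = trunc_borel[OF c] and \<theta>_smooth = trunc_smooth[OF c]

abbreviation "hk k q \<equiv> \<theta> (WK k q)"
abbreviation "hh q \<equiv> \<theta> (w q)"
abbreviation "win q \<equiv> indicator {s..s'} (fst q :: real) :: real"

lemma hb: "hk k \<in> Borel" "hh \<in> Borel"
 by (rule measurable_compose[OF WK_borel \<theta>_borel], rule measurable_compose[OF w_borel \<theta>_borel])

lemma windowed_field:
 assumes h: "h \<in> Borel" "!!q. \<bar>h q\<bar> <= sqrt c"
 shows "(%q. win q *\<^sub>R mfield n h q) \<in> Borel"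
  and "integrable (stm T) (%q. (norm (win q *\<^sub>R mfield n h q))^2)"
proof -
 have wb: "(%q::spacetime. win q) \<in> Borel" by (rule fst_snd_borel(1)) simp
 show b: "(%q. win q *\<^sub>R mfield n h q) \<in> Borel"
  by (rule borel_measurable_scaleR[OF wb mfield_borel[OF h(1)]])
 obtain L where L: "L > 0" "!!f x. L1 f ==> norm (grad (smoothing n f) x) <= L * (AV x. \<bar>f x\<bar>)"
  by (rule smoothing_derivative_bounds[of n]) (rule that)
 have le: "norm (win q *\<^sub>R mfield n h q) <= L * (sqrt c)^2" for q
  using mfield_diff(1)[OF h h L(2,1), of q] L(1) c by (simp add: indicator_def)
 show "integrable (stm T) (%q. (norm (win q *\<^sub>R mfield n h q))^2)"
 proof (rule stm_bounded_integrable)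
  show "(%q. (norm (win q *\<^sub>R mfield n h q))^2) \<in> borel_measurable (stm T)"
   by (rule stm_borel, rule borel_measurable_power, rule measurable_compose[OF b borel_measurable_norm])
  show "norm ((norm (win (t, x) *\<^sub>R mfield n h (t, x)))^2) <= (L * (sqrt c)^2)^2" for t x
   unfolding real_norm_def abs_power2 by (rule power_mono[OF le norm_ge_zero])
 qed
qed

text \<open>The velocities converge weakly, the truncated vorticities strongly.\<close>
lemma convection_defect: "(%k. LINT q|stm T. (UK k q - u q) \<bullet> (win q *\<^sub>R mfield n (hk k) q)) ----> 0"
proof -
 obtain K where K: "!!k. integrable (stm T) (%q. (norm (UK k q - u q))^2)" "!!k. (LINT q|stm T. (norm (UK k q - u q))^2) <= K"
  by (rule velocity_diff_bound) (rule that)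
 obtain L where L: "L > 0" "!!f x. L1 f ==> norm (grad (smoothing n f) x) <= L * (AV x. \<bar>f x\<bar>)"
  by (rule smoothing_derivative_bounds[of n]) (rule that)
 note F = windowed_field[OF hb(1) \<theta>_bounded] and F' = windowed_field[OF hb(2) \<theta>_bounded]
 let ?\<phi> = "%k q. win q *\<^sub>R mfield n (hk k) q" and ?\<phi>' = "%q. win q *\<^sub>R mfield n hh q"
 have mb: "(%q. mfield n (hk k) q - mfield n hh q) \<in> Borel" for k
  by (rule borel_measurable_diff[OF mfield_borel[OF hb(1)] mfield_borel[OF hb(2)]])
 have le1: "norm (mfield n (hk k) q - mfield n hh q) <= 2 * (L * (sqrt c)^2)" for k q
  using norm_triangle_ineq4[of "mfield n (hk k) q" "mfield n hh q"]
   mfield_diff(1)[OF hb(1)[of k] \<theta>_bounded hb(1)[of k] \<theta>_bounded L(2,1), of q] mfield_diff(1)[OF hb(2) \<theta>_bounded hb(2) \<theta>_bounded L(2,1), of q] by linarith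
 have mi: "integrable (stm T) (%q. (norm (mfield n (hk k) q - mfield n hh q))^2)" for k
 proof (rule stm_bounded_integrable)
  show "(%q. (norm (mfield n (hk k) q - mfield n hh q))^2) \<in> borel_measurable (stm T)"
   by (rule stm_borel, rule borel_measurable_power, rule measurable_compose[OF mb borel_measurable_norm])
  show "norm ((norm (mfield n (hk k) (t, x) - mfield n hh (t, x)))^2) <= (2 * (L * (sqrt c)^2))^2" for t x
   unfolding real_norm_def abs_power2 by (rule power_mono[OF le1 norm_ge_zero])
 qed
 have dle: "(norm (?\<phi> k q - ?\<phi>' q))^2 <= (norm (mfield n (hk k) q - mfield n hh q))^2" for k q
  by (simp add: indicator_def)
 have dm: "(%q. (norm (?\<phi> k q - ?\<phi>' q))^2) \<in> borel_measurable (stm T)" for k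
  by (rule stm_borel, rule borel_measurable_power, rule measurable_compose[OF borel_measurable_diff[OF F(1) F'(1)] borel_measurable_norm])
 have di: "integrable (stm T) (%q. (norm (?\<phi> k q - ?\<phi>' q))^2)" for k
  by (rule integrable_bound[OF mi[of k] dm], rule AE_I2) (simp only: real_norm_def abs_power2 dle)
 have dlim: "(%k. LINT q|stm T. (norm (?\<phi> k q - ?\<phi>' q))^2) ----> 0"
 proof (rule Lim_null_comparison)
  have "(LINT q|stm T. (norm (?\<phi> k q - ?\<phi>' q))^2) <= 4 * L^2 * (sqrt c)^3 * (LINT q|stm T. \<bar>WK k q - w q\<bar>)" for k
  proof -
   have "(LINT q|stm T. (norm (?\<phi> k q - ?\<phi>' q))^2) <= (LINT q|stm T. (norm (mfield n (hk k) q - mfield n hh q))^2)"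
    by (rule integral_mono[OF di mi dle])
   also have "... <= 4 * L^2 * (sqrt c)^3 * (LINT q|stm T. \<bar>hk k q - hh q\<bar>)"
    by (rule mfield_L2[OF hb(1) \<theta>_bounded hb(2) \<theta>_bounded L(2,1)])
   also have "(LINT q|stm T. \<bar>hk k q - hh q\<bar>) <= (LINT q|stm T. \<bar>WK k q - w q\<bar>)"
    by (rule integral_mono_AE'[OF WKw_abs_stm]) (auto intro!: AE_I2 \<theta>_lipschitz)
   finally show ?thesis using L(1) c by (simp add: mult_left_mono)
  qed
  then show "\<forall>\<^sub>F k in sequentially. norm (LINT q|stm T. (norm (?\<phi> k q - ?\<phi>' q))^2) <= 4 * L^2 * (sqrt c)^3 * (LINT q|stm T. \<bar>WK k q - w q\<bar>)"
   by (intro always_eventually allI) (simp only: real_norm_def abs_of_nonneg[OF integral_nonneg[OF zero_le_power2]])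
  show "(%k. 4 * L^2 * (sqrt c)^3 * (LINT q|stm T. \<bar>WK k q - w q\<bar>)) ----> 0"
   using tendsto_mult_left[OF vorticity_L1] by simp
 qed
 have weak': "(%k. LINT q|stm T. (UK k q - u q) \<bullet> ?\<phi>' q) ----> 0"
 proof -
  have "(LINT q|stm T. (UK k q - u q) \<bullet> ?\<phi>' q) = (LINT q|stm T. UK k q \<bullet> ?\<phi>' q) - (LINT q|stm T. u q \<bullet> ?\<phi>' q)" for k
   unfolding inner_diff_left
   by (rule integral_diff[OF integrable_inner_L2(2)[OF stm_borel[OF UK_borel] UK_L2 stm_borel[OF F'(1)] F'(2)]
      integrable_inner_L2(2)[OF stm_borel[OF u_borel] u_L2 stm_borel[OF F'(1)] F'(2)]])
  then show ?thesis using tendsto_diff[OF weak[OF F'] tendsto_const, of "LINT q|stm T. u q \<bullet> ?\<phi>' q"] by simp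
 qed
 show ?thesis
  by (rule weak_strong[where \<phi>'="?\<phi>'", OF stm_borel[OF borel_measurable_diff[OF UK_borel u_borel]] K stm_borel[OF F(1)] F(2) stm_borel[OF F'(1)] F'(2) di dlim weak'])
qed

text \<open>The limit velocity is paired with the smooth truncated vorticity of the approximation, so the commutator estimate applies
without smoothness of \<open>w\<close>.\<close>
lemma convection_commutator: "\<bar>LINT q|stm T. u q \<bullet> (win q *\<^sub>R mfield n (hk k) q)\<bar> <= 4 * pi * G * c * (s' - s)"
proof -
 note F = windowed_field[OF hb(1)[of k] \<theta>_bounded]
 have i: "integrable (stm T) (%q. u q \<bullet> (win q *\<^sub>R mfield n (hk k) q))"
  by (rule integrable_inner_L2(2)[OF stm_borel[OF u_borel] u_L2 stm_borel[OF F(1)] F(2)])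
 note tl = time_LINT[of T "%_. 4 * pi * G * c", OF continuous_on_const ss(1,3)]
 have ae: "AE t in time_on T. \<bar>AV x. u (t, x) \<bullet> (win (t, x) *\<^sub>R mfield n (hk k) (t, x))\<bar> <= indicator {s..s'} t * (4 * pi * G * c)"
  using sob AE_space
 proof eventually_elim
  fix t assume W: "W11_bounded G (%x. u (t, x))" and "t \<in> space (time_on T)"
  then have t: "t \<in> {0..T}" by simp
  have "\<bar>AV x. \<theta> (wn k t x) * (u (t, x) \<bullet> grad (smoothing n (%x. \<theta> (wn k t x))) x)\<bar> <= 4 * pi * G * (sqrt c)^2"
   by (rule commutator[OF W \<theta>_smooth[OF NS.w_smooth[OF t]] \<theta>_bounded n])
  then show "\<bar>AV x. u (t, x) \<bullet> (win (t, x) *\<^sub>R mfield n (hk k) (t, x))\<bar> <= indicator {s..s'} t * (4 * pi * G * c)"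
   using c by (cases "t \<in> {s..s'}") (simp_all add: mfield_def cut_eq[OF t])
 qed
 have "\<bar>LINT t|time_on T. AV x. u (t, x) \<bullet> (win (t, x) *\<^sub>R mfield n (hk k) (t, x))\<bar>
  <= (LINT t|time_on T. \<bar>AV x. u (t, x) \<bullet> (win (t, x) *\<^sub>R mfield n (hk k) (t, x))\<bar>)" by (rule integral_abs_bound)
 also have "... <= (LINT t|time_on T. indicator {s..s'} t * (4 * pi * G * c))"
  by (rule integral_mono_AE[OF integrable_abs[OF stm_iterated(3)[OF i]] tl(2) ae])
 also have "... = 4 * pi * G * c * (s' - s)" unfolding tl(1) using ss by simp
 finally show ?thesis unfolding stm_iterated(1)[OF i] .
qed

lemma approximate_energy:
 obtains E where "!!k. energy n (%x. \<theta> (wn k s x)) + 2 * (LINT q|stm T. UK k q \<bullet> (win q *\<^sub>R mfield n (hk k) q))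
   - E * (\<nu> k + ((AV x. ent c (wn k s x)) - (AV x. ent c (wn k s' x))))
  <= energy n (%x. \<theta> (wn k s' x))"
proof -
 obtain E where E: "E > 0" "!!j x. j < nmodes n ==> \<bar>mode n j x\<bar> <= E" "!!j x. j < nmodes n ==> \<bar>laplacian (mode n j) x\<bar> <= E"
  "!!j x i. j < nmodes n ==> \<bar>partial i (mode n j) x\<bar> <= E"
  "!!j x. j < nmodes n ==> norm (grad (mode n j) x) <= E"
  by (rule mode_bounds[of n]) (rule that)
 define a where "a k j \<tau> = (AV x. \<theta> (wn k \<tau> x) * mode n j x)" for k j \<tau>
 define b where "b k j \<tau> = (AV x. \<theta> (wn k \<tau> x) * (un k \<tau> x \<bullet> grad (mode n j) x))" for k j \<tau>
 let ?dS = "%k. (AV x. ent c (wn k s x)) - (AV x. ent c (wn k s' x))"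
 define E1 where "E1 = 2 * sqrt c * E * (sqrt c * E * T + 3 / 2 * E)"
 have \<nu>: "\<nu> k > 0" for k by (rule NS.\<nu>)
 have dS: "?dS k >= 0" for k using NS.entropy_decreasing[OF ent_C2_fun(1)[OF c], of s s' k] ent_bounds(4)[OF c] ss by (simp add: less_imp_le)
 have T0: "T >= 0" using T by simp
 have step: "(a k j s')^2 - (a k j s)^2 >= integral {s..s'} (%\<tau>. 2 * a k j \<tau> * b k j \<tau>) - E1 * (\<nu> k + ?dS k)"
  and ac: "continuous_on {0..T} (a k j)" and bc: "continuous_on {0..T} (b k j)" if j: "j < nmodes n" for k j
 proof -
  note ev = NS.truncated_mode_evolution[OF c mode_smooth[OF j] E(2,3)[OF j] ss, of k, folded trunc_def, folded a_def b_def]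
  show "continuous_on {0..T} (a k j)" using ev(2) unfolding a_def[abs_def] .
  show "continuous_on {0..T} (b k j)" using ev(3) unfolding b_def[abs_def] .
  have "\<nu> k * (sqrt c * E) * (s' - s) <= \<nu> k * (sqrt c * E) * T"
   using \<nu>[of k] E(1) c ss by (intro mult_left_mono) auto
  also have "... = (sqrt c * E * T) * \<nu> k" by simp
  also have "... <= (sqrt c * E * T) * (\<nu> k + ?dS k)" using dS[of k] E(1) c T0 by (intro mult_left_mono) auto
  finally have 1: "\<nu> k * (sqrt c * E) * (s' - s) <= (sqrt c * E * T) * (\<nu> k + ?dS k)" .
  have 2: "3 / 2 * E * ?dS k <= 3 / 2 * E * (\<nu> k + ?dS k)" using \<nu>[of k] E(1) by (intro mult_left_mono) auto
  have "2 * sqrt c * E * (\<nu> k * (sqrt c * E) * (s' - s) + 3 / 2 * E * ?dS k) <= 2 * sqrt c * E * ((sqrt c * E * T) * (\<nu> k + ?dS k) + 3 / 2 * E * (\<nu> k + ?dS k))"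
   using E(1) c by (intro mult_left_mono add_mono 1 2) auto
  also have "... = E1 * (\<nu> k + ?dS k)" unfolding E1_def by (simp only: distrib_left distrib_right mult.assoc)
  finally show "(a k j s')^2 - (a k j s)^2 >= integral {s..s'} (%\<tau>. 2 * a k j \<tau> * b k j \<tau>) - E1 * (\<nu> k + ?dS k)"
   using ev(1) by linarith
 qed
 have conv: "(LINT q|stm T. UK k q \<bullet> (win q *\<^sub>R mfield n (hk k) q)) = integral {s..s'} (%\<tau>. \<Sum>j<nmodes n. a k j \<tau> * b k j \<tau>)" for k
 proof -
  note F = windowed_field[OF hb(1)[of k] \<theta>_bounded]
  have i: "integrable (stm T) (%q. UK k q \<bullet> (win q *\<^sub>R mfield n (hk k) q))"
   by (rule integrable_inner_L2(2)[OF stm_borel[OF UK_borel] UK_L2 stm_borel[OF F(1)] F(2)])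
  have "(LINT q|stm T. UK k q \<bullet> (win q *\<^sub>R mfield n (hk k) q)) = (LINT t|time_on T. indicator {s..s'} t * (\<Sum>j<nmodes n. a k j t * b k j t))"
   unfolding stm_iterated(1)[OF i]
  proof (rule integral_cong[OF refl])
   fix t assume "t \<in> space (time_on T)"
   then have t: "t \<in> {0..T}" by simp
   have g: "grad (smoothing n f) x = (\<Sum>j<nmodes n. coef n f j *\<^sub>R grad (mode n j) x)" for f x
    by (simp add: grad_def vec_eq_iff partial_smoothing)
   have uc: "cont (un k t)" and wc: "cont (wn k t)"
    using slab_slice_continuous[OF NS.u_continuous t] smooth_cont[OF NS.w_smooth[OF t]] by blast+
   have ij: "L1 (%x. a k j t * (\<theta> (wn k t x) * (un k t x \<bullet> grad (mode n j) x)))" if "j < nmodes n" for j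
    by (intro integrable_mult_right cont_L1 continuous_intros cont_compose[OF \<theta>_continuous wc] uc continuous_grad mode_smooth that)
   have "(AV x. un k t x \<bullet> mfield n (hk k) (t, x)) = (AV x. (\<Sum>j<nmodes n. a k j t * (\<theta> (wn k t x) * (un k t x \<bullet> grad (mode n j) x))))"
    by (rule integral_cong[OF refl])
     (simp add: mfield_def g cut_eq[OF t] inner_sum_right sum_distrib_left coef_def a_def mult.left_commute)
   also have "... = (\<Sum>j<nmodes n. a k j t * b k j t)"
   proof -
    have "(AV x. (\<Sum>j<nmodes n. a k j t * (\<theta> (wn k t x) * (un k t x \<bullet> grad (mode n j) x))))
     = (\<Sum>j<nmodes n. AV x. a k j t * (\<theta> (wn k t x) * (un k t x \<bullet> grad (mode n j) x)))"
     by (rule integral_sum) (rule ij, simp)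
    then show ?thesis by (simp add: b_def)
   qed
   finally show "(AV x. UK k (t, x) \<bullet> (win (t, x) *\<^sub>R mfield n (hk k) (t, x))) = indicator {s..s'} t * (\<Sum>j<nmodes n. a k j t * b k j t)"
    by (simp add: cut_eq[OF t])
  qed
  also have "... = integral {s..s'} (%\<tau>. \<Sum>j<nmodes n. a k j \<tau> * b k j \<tau>)"
   by (rule time_LINT(1)[OF _ ss(1,3)]) (auto intro!: continuous_intros ac bc)
  finally show ?thesis .
 qed
 show ?thesis
 proof (rule that[of "real (nmodes n) * E1"])
  fix k
  have ii: "(%\<tau>. 2 * a k j \<tau> * b k j \<tau>) integrable_on {s..s'}" if "j < nmodes n" for j
   by (rule integrable_continuous_real, rule continuous_on_subset[of "{0..T}"]) (use that ss in "auto intro!: continuous_intros ac bc")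
  have "(\<Sum>j<nmodes n. integral {s..s'} (%\<tau>. 2 * a k j \<tau> * b k j \<tau>)) = integral {s..s'} (%\<tau>. \<Sum>j<nmodes n. 2 * a k j \<tau> * b k j \<tau>)"
   by (rule Henstock_Kurzweil_Integration.integral_sum[symmetric]) (auto simp: ii)
  also have "... = integral {s..s'} (%\<tau>. 2 * (\<Sum>j<nmodes n. a k j \<tau> * b k j \<tau>))" by (simp add: sum_distrib_left mult.assoc)
  also have "... = 2 * integral {s..s'} (%\<tau>. \<Sum>j<nmodes n. a k j \<tau> * b k j \<tau>)" by simp
  finally have S: "(\<Sum>j<nmodes n. integral {s..s'} (%\<tau>. 2 * a k j \<tau> * b k j \<tau>)) = 2 * (LINT q|stm T. UK k q \<bullet> (win q *\<^sub>R mfield n (hk k) q))"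
   unfolding conv .
  have "(\<Sum>j<nmodes n. integral {s..s'} (%\<tau>. 2 * a k j \<tau> * b k j \<tau>) - E1 * (\<nu> k + ?dS k)) <= (\<Sum>j<nmodes n. (a k j s')^2 - (a k j s)^2)"
   by (rule sum_mono) (simp add: step)
  then show "energy n (%x. \<theta> (wn k s x)) + 2 * (LINT q|stm T. UK k q \<bullet> (win q *\<^sub>R mfield n (hk k) q)) - real (nmodes n) * E1 * (\<nu> k + ?dS k)
   <= energy n (%x. \<theta> (wn k s' x))"
   unfolding sum_subtractf S energy_def coef_def a_def[symmetric] by (simp add: mult.assoc)
 qed
qed

text \<open>The entropy lost between two good times tends to zero, since the entropies at both times converge to that of the initial datum. The constant is
independent of \<open>n\<close>.\<close>
lemma good_energy:
 assumes g: "Good s" "Good s'"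
 shows "energy n (%x. \<theta> (rep s x)) - 8 * pi * G * c * (s' - s) <= energy n (%x. \<theta> (rep s' x))"
proof -
 obtain E where E: "!!k. energy n (%x. \<theta> (wn k s x)) + 2 * (LINT q|stm T. UK k q \<bullet> (win q *\<^sub>R mfield n (hk k) q))
   - E * (\<nu> k + ((AV x. ent c (wn k s x)) - (AV x. ent c (wn k s' x))))
  <= energy n (%x. \<theta> (wn k s' x))" by (rule approximate_energy) (rule that)
 let ?X = "%k. LINT q|stm T. (UK k q - u q) \<bullet> (win q *\<^sub>R mfield n (hk k) q)"
 let ?dS = "%k. (AV x. ent c (wn k s x)) - (AV x. ent c (wn k s' x))"
 have sub: "strict_mono \<rho>" by (rule \<rho>)
 have ec: "cont (ent c)" by (rule ent_continuous(1)[OF c])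
 have lim: "(%k. energy n (%x. \<theta> (wn (\<rho> k) \<sigma> x))) ----> energy n (%x. \<theta> (rep \<sigma> x))"
  "(%k. AV x. ent c (wn (\<rho> k) \<sigma> x)) ----> (AV x. ent c (wi x))" if \<sigma>: "Good \<sigma>" for \<sigma>
 proof -
  have t: "\<sigma> \<in> {0..T}" by (rule Good_range[OF \<sigma>])
  have L: "(%k. AV x. \<bar>wn (\<rho> k) \<sigma> x - rep \<sigma> x\<bar>) ----> 0" using \<sigma> by (simp add: Good_def)
  note wi = wn_integrable[OF t] and ri = rep_integrable[OF \<sigma>]
  have ti: "L1 (%x. \<theta> (wn k \<sigma> x))" for k
   by (rule smooth_L1[OF \<theta>_smooth[OF NS.w_smooth[OF t]]])
  have tri: "L1 (%x. \<theta> (rep \<sigma> x))"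
   by (rule bounded_L1[OF measurable_compose[OF rep_measurable \<theta>_borel], where C="sqrt c"]) (simp add: \<theta>_bounded)
  have nn: "norm (AV x. \<bar>f x\<bar>) = (AV x. \<bar>f x\<bar>)" for f :: "real^2 => real"
   unfolding real_norm_def by (rule abs_of_nonneg) (rule integral_nonneg, simp)
  have "(%k. AV x. \<bar>\<theta> (wn (\<rho> k) \<sigma> x) - \<theta> (rep \<sigma> x)\<bar>) ----> 0"
  proof (rule Lim_null_comparison[OF always_eventually L], rule allI)
   show "norm (AV x. \<bar>\<theta> (wn (\<rho> k) \<sigma> x) - \<theta> (rep \<sigma> x)\<bar>) <= (AV x. \<bar>wn (\<rho> k) \<sigma> x - rep \<sigma> x\<bar>)" for k
    unfolding nn by (rule integral_mono[OF integrable_abs[OF integrable_diff[OF ti tri]] integrable_abs[OF integrable_diff[OF wi ri]] \<theta>_lipschitz])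
  qed
  then show "(%k. energy n (%x. \<theta> (wn (\<rho> k) \<sigma> x))) ----> energy n (%x. \<theta> (rep \<sigma> x))" by (rule energy_tendsto_L1[OF ti tri])
  have ei: "L1 (%x. ent c (wn k \<sigma> x))" for k
   by (rule cont_L1[OF cont_compose[OF ec smooth_cont[OF NS.w_smooth[OF t]]]])
  have eri: "L1 (%x. ent c (rep \<sigma> x))"
  proof (rule integrable_bound[OF integrable_add[OF torus.integrable_const[of "sqrt c"] integrable_abs[OF ri]]])
   show "(%x. ent c (rep \<sigma> x)) \<in> TBorel"
    by (rule measurable_compose[OF rep_measurable cont_Borel[OF ec]])
   show "AE x in TM. norm (ent c (rep \<sigma> x)) <= norm (sqrt c + \<bar>rep \<sigma> x\<bar>)"
   proof (rule AE_I2)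
    fix x show "norm (ent c (rep \<sigma> x)) <= norm (sqrt c + \<bar>rep \<sigma> x\<bar>)"
     using ent_bounds(1,2)[OF c, of "rep \<sigma> x"] by simp
   qed
  qed
  have "(%k. AV x. ent c (wn (\<rho> k) \<sigma> x)) ----> (AV x. ent c (rep \<sigma> x))"
  proof (rule LIM_zero_cancel, rule Lim_null_comparison[OF always_eventually L], rule allI)
   fix k
   show "norm ((AV x. ent c (wn (\<rho> k) \<sigma> x)) - (AV x. ent c (rep \<sigma> x))) <= (AV x. \<bar>wn (\<rho> k) \<sigma> x - rep \<sigma> x\<bar>)"
    unfolding integral_diff[OF ei eri, symmetric] real_norm_def
    by (rule LINT_abs_le[OF integrable_abs[OF integrable_diff[OF wi ri]] ent_lipschitz'[OF c]])
  qed
  then show "(%k. AV x. ent c (wn (\<rho> k) \<sigma> x)) ----> (AV x. ent c (wi x))"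
   using rep_LINT(1)[OF \<sigma> cont_Borel[OF ec]] by simp
 qed
 have X: "(%k. ?X (\<rho> k)) ----> 0" using LIMSEQ_subseq_LIMSEQ[OF convection_defect sub] by (simp add: o_def)
 have \<nu>': "(%k. \<nu> (\<rho> k)) ----> 0" using LIMSEQ_subseq_LIMSEQ[OF \<nu>0 sub] by (simp add: o_def)
 have lower: "energy n (%x. \<theta> (wn k s x)) + 2 * (?X k - 4 * pi * G * c * (s' - s)) - E * (\<nu> k + ?dS k) <= energy n (%x. \<theta> (wn k s' x))" for k
 proof -
  note F = windowed_field[OF hb(1)[of k] \<theta>_bounded]
  have "(LINT q|stm T. UK k q \<bullet> (win q *\<^sub>R mfield n (hk k) q)) = ?X k + (LINT q|stm T. u q \<bullet> (win q *\<^sub>R mfield n (hk k) q))"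
   unfolding inner_diff_left
   using integral_diff[OF integrable_inner_L2(2)[OF stm_borel[OF UK_borel[of k]] UK_L2 stm_borel[OF F(1)] F(2)]
      integrable_inner_L2(2)[OF stm_borel[OF u_borel] u_L2 stm_borel[OF F(1)] F(2)]] by linarith
  moreover have "e + 2 * (X - P) - D <= e'" if "Y = X + Z" "\<bar>Z\<bar> <= P" "e + 2 * Y - D <= e'" for e e' X P D Y Z :: real
   using that by (simp add: abs_le_iff)
  ultimately show ?thesis using convection_commutator[of k] E[of k] by blast
 qed
 have "(%k. energy n (%x. \<theta> (wn (\<rho> k) s x)) + 2 * (?X (\<rho> k) - 4 * pi * G * c * (s' - s)) - E * (\<nu> (\<rho> k) + ?dS (\<rho> k)))
  ----> energy n (%x. \<theta> (rep s x)) + 2 * (0 - 4 * pi * G * c * (s' - s)) - E * (0 + ((AV x. ent c (wi x)) - (AV x. ent c (wi x))))"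
  by (intro tendsto_intros lim g X \<nu>')
 from LIMSEQ_le[OF this lim(1)[OF g(2)]] lower
 have "energy n (%x. \<theta> (rep s x)) + 2 * (0 - 4 * pi * G * c * (s' - s)) - E * (0 + ((AV x. ent c (wi x)) - (AV x. ent c (wi x)))) <= energy n (%x. \<theta> (rep s' x))"
  by blast
 then show ?thesis by (simp add: mult.assoc)
qed

end

end

section \<open>Uniform convergence in time\<close>

lemma trunc_error:
 assumes c: "c > 0"
 shows "\<bar>z - trunc c z\<bar> <= \<bar>z\<bar>" "\<bar>z - trunc c z\<bar> <= \<bar>z\<bar> ^ 3 / c"
proof -
 define r where "r = sqrt c / sqrt (c + z^2)"
 have pos: "c + z^2 > 0" by (rule sq_pos[OF c])
 have r: "0 <= r" "r <= 1" "r^2 = c / (c + z^2)" using c pos unfolding r_def by (simp_all add: power_divide)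
 have e: "\<bar>z - trunc c z\<bar> = \<bar>z\<bar> * (1 - r)"
 proof -
  have "z - trunc c z = z * (1 - r)" unfolding trunc_def ent1_eq[OF c] r_def by (simp add: algebra_simps)
  then show ?thesis using r by (simp add: abs_mult)
 qed
 show "\<bar>z - trunc c z\<bar> <= \<bar>z\<bar>" unfolding e using r by (simp add: mult_left_le)
 have "r^2 <= r" using r mult_left_mono[OF r(2) r(1)] by (simp add: power2_eq_square)
 then have "1 - r <= 1 - c / (c + z^2)" unfolding r(3)[symmetric] by simp
 also have "... = z^2 / (c + z^2)" using pos by (simp add: field_simps)
 also have "... <= z^2 / c" by (rule divide_left_mono) (use c pos in auto)
 finally have "\<bar>z\<bar> * (1 - r) <= \<bar>z\<bar> * (z^2 / c)" by (rule mult_left_mono) simp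
 then show "\<bar>z - trunc c z\<bar> <= \<bar>z\<bar> ^ 3 / c" unfolding e by (simp add: power3_eq_cube power2_eq_square)
qed

lemma trunc_L1_tendsto:
 fixes f :: "real^2 => real"
 assumes f: "L1 f"
 shows "(%m. AV x. \<bar>f x - trunc (real (Suc m)) (f x)\<bar>) ----> 0"
proof -
 have "(%m. AV x. \<bar>f x - trunc (real (Suc m)) (f x)\<bar>) ----> (AV x. 0)"
 proof (rule integral_dominated_convergence[where w="%x. \<bar>f x\<bar>"])
  show "(%x. \<bar>f x - trunc (real (Suc m)) (f x)\<bar>) \<in> TBorel" for m
   by (rule borel_measurable_abs, rule borel_measurable_diff[OF integrable_measurable[OF f]],
     rule measurable_compose[OF integrable_measurable[OF f] trunc_borel]) simp
  show "L1 (%x. \<bar>f x\<bar>)" by (rule integrable_abs[OF f])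
  show "AE x in TM. (%m. \<bar>f x - trunc (real (Suc m)) (f x)\<bar>) ----> 0"
  proof (rule AE_I2, rule Lim_null_comparison, rule always_eventually, rule allI)
   fix x and m
   show "norm \<bar>f x - trunc (real (Suc m)) (f x)\<bar> <= \<bar>f x\<bar> ^ 3 / real (Suc m)"
    unfolding real_norm_def abs_abs by (rule trunc_error(2)) simp
  next
   fix x show "(%m. \<bar>f x\<bar> ^ 3 / real (Suc m)) ----> 0"
    using tendsto_mult_right_zero[OF LIMSEQ_inverse_real_of_nat, of "\<bar>f x\<bar> ^ 3"] by (simp add: divide_inverse)
  qed
  show "AE x in TM. norm \<bar>f x - trunc (real (Suc m)) (f x)\<bar> <= \<bar>f x\<bar>" for m
   by (rule AE_I2) (simp only: real_norm_def abs_abs, rule trunc_error(1), simp)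
 qed simp
 then show ?thesis by simp
qed

context inviscid
begin

text \<open>Good times have full measure, so otherwise the integral over the interval alone would be too large.\<close>
lemma good_time_in:
 fixes f :: "real => real"
 assumes f: "integrable (time_on T) f" "!!t. 0 <= f t" and d: "integral\<^sup>L (time_on T) f < \<delta>"
  and ab: "0 <= a" "a < b" "b <= T"
 obtains s where "a <= s" "s <= b" "Good s" "f s <= \<delta> / (b - a)"
proof -
 have "\<exists>s. a <= s & s <= b & Good s & f s <= \<delta> / (b - a)"
 proof (rule ccontr)
  assume n: "~ ?thesis"
  note tl = time_LINT[of T "%_. \<delta> / (b - a)", OF continuous_on_const ab(1,3)]
  have "AE t in time_on T. indicator {a..b} t * (\<delta> / (b - a)) <= f t"
   using Good_AE
  proof eventually_elim
   fix t assume "Good t"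
   with n have "a <= t ==> t <= b ==> \<delta> / (b - a) <= f t" by (meson linear)
   then show "indicator {a..b} t * (\<delta> / (b - a)) <= f t" using f(2)[of t] by (simp add: indicator_def)
  qed
  from integral_mono_AE[OF tl(2) f(1) this] have "\<delta> <= integral\<^sup>L (time_on T) f" unfolding tl(1) using ab by simp
  then show False using d by simp
 qed
 then show ?thesis using that by blast
qed

text \<open>A net of good times with spacing determined by the Lipschitz bound; as this bound does not depend on \<open>n\<close>, the index \<open>n\<close> can be
chosen after the net. Each good time is then compared with a preceding point of the net.\<close>
lemma uniform_smoothing:
 assumes e: "e > 0"
 obtains n where "!!s. Good s ==> (AV x. \<bar>rep s x - smoothing n (rep s) x\<bar>) <= e"
proof -
 have "\<forall>\<^sub>F m in sequentially. (AV x. \<bar>wi x - trunc (real (Suc m)) (wi x)\<bar>) < e / 4"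
  using e by (intro order_tendstoD(2)[OF trunc_L1_tendsto[OF wi_integrable]]) simp
 then obtain m0 where m0: "(AV x. \<bar>wi x - trunc (real (Suc m0)) (wi x)\<bar>) < e / 4"
  using eventually_happens'[OF sequentially_bot] by blast
 define c where "c = real (Suc m0)"
 have c: "c > 0" and cL: "(AV x. \<bar>wi x - trunc c (wi x)\<bar>) < e / 4" using m0 by (simp_all add: c_def)
 define Q where "Q = (AV x. (trunc c (wi x))^2)"
 define r where "r = e / 2"
 \<comment> \<open>\<open>2 * \<eta> = r\<^sup>2\<close> makes the square of the defect and its weight \<open>1 / r\<close> balance to \<open>r = e / 2\<close>\<close>
 define \<eta> where "\<eta> = r^2 / 2"
 have r: "r > 0" and \<eta>: "\<eta> > 0" using e by (simp_all add: r_def \<eta>_def)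
 define M where "M = 8 * pi * \<bar>G\<bar> * c"
 have M0: "M >= 0" using c by (simp add: M_def)
 obtain m :: nat where m: "4 * M * T / \<eta> < real m" using reals_Archimedean2 by blast
 have "0 <= 4 * M * T / \<eta>" using M0 T \<eta> by simp
 then have mp: "real m > 0" using m by linarith
 \<comment> \<open>a good time of the net lies within \<open>2 * d\<close> before every time, and this costs at most \<open>\<eta> / 2\<close>\<close>
 define d where "d = T / real m"
 have d: "d > 0" "real m * d = T" using T mp by (simp_all add: d_def)
 have Md: "M * (2 * d) <= \<eta> / 2"
 proof -
  have "4 * M * T < real m * \<eta>" using m \<eta> by (simp add: divide_less_eq)
  then show ?thesis using mp by (simp add: d_def field_simps)
 qed
 have bor2: "(%z. (trunc c z)^2) \<in> Borel" by (rule borel_measurable_power[OF trunc_borel[OF c]])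
 have tm: "(%x. trunc c (rep s x)) \<in> TBorel" for s by (rule measurable_compose[OF rep_measurable trunc_borel[OF c]])
 have "\<exists>s. Good s & s <= real i * d & real i * d - d <= s" if "i < m" for i
 proof (cases i)
  case 0 then show ?thesis using Good_0 d by (intro exI[of _ 0]) simp
 next
  case (Suc i')
  have z: "integrable (time_on T) (%t. 0)" "integral\<^sup>L (time_on T) (%t. 0) < (1::real)" by simp_all
  have i: "real i * d <= real m * d" by (rule mult_right_mono) (use that d in auto)
  have "0 <= real i' * d" "real i' * d < real i * d" "real i * d <= T" using d i Suc by (simp_all add: distrib_right)
  from good_time_in[OF z(1) _ z(2) this] obtain s where "real i' * d <= s" "s <= real i * d" "Good s" by auto
  then show ?thesis using Suc by (intro exI[of _ s]) (simp add: algebra_simps)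
 qed
 then obtain g where g: "!!i. i < m ==> Good (g i)" "!!i. i < m ==> g i <= real i * d" "!!i. i < m ==> real i * d - d <= g i"
  by metis
 have "\<forall>\<^sub>F n in sequentially. \<forall>i\<in>{..<m}. Q - \<eta> / 2 < energy n (%x. trunc c (rep (g i) x))"
 proof (rule eventually_ball_finite, simp, rule ballI)
  fix i assume "i \<in> {..<m}"
  then have i: "Good (g i)" using g by simp
  have "(%n. energy n (%x. trunc c (rep (g i) x))) ----> Q"
   using energy_tendsto[OF tm[of "g i"] trunc_bounded[OF c]] rep_LINT(1)[OF i bor2] unfolding Q_def by simp
  then show "\<forall>\<^sub>F n in sequentially. Q - \<eta> / 2 < energy n (%x. trunc c (rep (g i) x))"
   by (rule order_tendstoD(1)) (use \<eta> in simp)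
 qed
 from eventually_conj[OF this eventually_ge_at_top[of 1]]
 obtain n where "(\<forall>i\<in>{..<m}. Q - \<eta> / 2 < energy n (%x. trunc c (rep (g i) x))) & 1 <= n"
  using eventually_happens'[OF sequentially_bot] by blast
 then have n: "n >= 1" "!!i. i < m ==> Q - \<eta> / 2 < energy n (%x. trunc c (rep (g i) x))" by auto
 show ?thesis
 proof (rule that[of n])
  fix s assume s: "Good s"
  let ?f = "%x. trunc c (rep s x)"
  have s0: "0 <= s" "s < T" using s by (simp_all add: Good_def)
  define i where "i = nat \<lfloor>s / d\<rfloor>"
  have i0: "real i = of_int \<lfloor>s / d\<rfloor>" using s0 d by (simp add: i_def)
  have i1: "real i * d <= s" using of_int_floor_le[of "s / d"] d(1) unfolding i0[symmetric] by (simp add: pos_le_divide_eq)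
  have i2: "s < (real i + 1) * d"
 proof -
   have "s / d < real i + 1" unfolding i0 by linarith
   then show ?thesis using d(1) by (simp only: pos_divide_less_eq)
  qed
  have "real i * d < real m * d" using i1 s0 d(2) by linarith
  then have im: "i < m" using d(1) by simp
  note gi = g[OF im]
  have dist: "s - g i <= 2 * d" "g i <= s" using i1 i2 gi(2,3) by (simp_all add: distrib_right)
  have "energy n (%x. trunc c (rep (g i) x)) - 8 * pi * G * c * (s - g i) <= energy n ?f"
   by (rule good_energy[OF c n(1) _ dist(2) _ gi(1) s]) (use gi(1) s0 in "simp_all add: Good_def")
  moreover have "8 * pi * G * c * (s - g i) <= M * (2 * d)"
   unfolding M_def by (rule mult_mono[OF _ dist(1)]) (use c dist in "auto intro!: mult_right_mono")
  ultimately have en: "Q - energy n ?f <= \<eta>" using n(2)[OF im] Md by linarith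
  have bd: "\<bar>?f x - smoothing n ?f x\<bar> <= 2 * sqrt c" for x
   using smoothing_bounded[OF tm[of s] trunc_bounded[OF c], of n x] trunc_bounded[OF c, of "rep s x"] by linarith
  have fi: "L1 ?f"
   by (rule bounded_L1[OF tm, where C="sqrt c"]) (simp add: trunc_bounded[OF c])
  note ri = rep_integrable[OF s]
  note sm = integrable_measurable[OF smoothing_integrable]
  have "(AV x. (?f x - smoothing n ?f x)^2) <= 2 * \<eta>"
   using smoothing_defect[OF tm[of s] trunc_bounded[OF c], of n] en rep_LINT(1)[OF s bor2] unfolding Q_def by simp
  then have "(AV x. (?f x - smoothing n ?f x)^2) / r <= r"
   using r by (simp add: \<eta>_def divide_le_eq power2_eq_square)
  then have 1: "(AV x. \<bar>?f x - smoothing n ?f x\<bar>) <= e / 2"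
   using torus_LINT_L2_L1[OF borel_measurable_diff[OF tm[of s] sm[of n ?f]] bd r] unfolding r_def by simp
  have tb: "(%z. \<bar>z - trunc c z\<bar>) \<in> Borel"
   by (rule cont_Borel) (intro continuous_intros trunc_continuous[OF c])
  have 2: "(AV x. \<bar>rep s x - ?f x\<bar>) < e / 4"
   using rep_LINT(1)[OF s tb] cL by simp
  have 3: "(AV x. \<bar>smoothing n ?f x - smoothing n (rep s) x\<bar>) <= (AV x. \<bar>rep s x - ?f x\<bar>)"
   using smoothing_L1[OF integrable_diff[OF fi ri], of n] smoothing_diff[OF fi ri, of n]
   by (simp add: abs_minus_commute)
  have "(AV x. \<bar>rep s x - smoothing n (rep s) x\<bar>) <= (AV x. \<bar>rep s x - ?f x\<bar>)
   + (AV x. \<bar>?f x - smoothing n (rep s) x\<bar>)" by (rule L1_triangle[OF ri fi smoothing_integrable])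
  moreover have "(AV x. \<bar>?f x - smoothing n (rep s) x\<bar>) <= (AV x. \<bar>?f x - smoothing n ?f x\<bar>)
   + (AV x. \<bar>smoothing n ?f x - smoothing n (rep s) x\<bar>)" by (rule L1_triangle[OF fi smoothing_integrable smoothing_integrable])
  ultimately show "(AV x. \<bar>rep s x - smoothing n (rep s) x\<bar>) <= e" using 1 2 3 by linarith
 qed
qed

text \<open>Young's inequality with a free parameter: on short intervals the displacement is small uniformly in the viscosity.\<close>
lemma speed_bound:
 assumes K: "(LINT q|stm T. (norm (UK k q))^2) <= K" and st: "0 <= s" "s <= t" "t <= T" and r: "r > 0"
 shows "integral {s..t} (NS.speed k) <= (r * (t - s) + K / r) / 2"
proof -
 note a = time_LINT[OF NS.speed_continuous[of k] st(1,3)]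
 note b = time_LINT[of T "%_. r / 2", OF continuous_on_const st(1,3)]
 note U = stm_iterated[OF UK_L2[of k]]
 have "integral {s..t} (NS.speed k) = (LINT \<tau>|time_on T. indicator {s..t} \<tau> * NS.speed k \<tau>)" by (rule a(1)[symmetric])
 also have "... <= (LINT \<tau>|time_on T. indicator {s..t} \<tau> * (r / 2) + (1 / (2 * r)) * (AV x. (norm (UK k (\<tau>, x)))^2))"
 proof (rule integral_mono[OF a(2) integrable_add[OF b(2) integrable_mult_right[OF U(3)]]])
  fix \<tau> assume "\<tau> \<in> space (time_on T)"
  then have \<tau>: "\<tau> \<in> {0..T}" by simp
  have uc: "cont (un k \<tau>)" by (rule slab_slice_continuous[OF NS.u_continuous \<tau>])
  have i2: "L1 (%x. (norm (un k \<tau> x))^2)" by (rule cont_L1) (intro continuous_intros uc)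
  have i1: "L1 (%x. norm (un k \<tau> x))" by (rule cont_L1) (intro continuous_intros uc)
  have pt: "y <= r / 2 + (1 / (2 * r)) * y^2" for y
  proof -
   have "0 <= (r - y)^2" by simp
   then have "2 * r * y <= r^2 + y^2" by (simp add: power2_diff)
   then show ?thesis using r by (simp add: field_simps power2_eq_square)
  qed
  have "NS.speed k \<tau> <= (AV x. r / 2 + (1 / (2 * r)) * (norm (un k \<tau> x))^2)"
   unfolding NS.speed_def by (rule integral_mono[OF i1 integrable_add[OF torus.integrable_const integrable_mult_right[OF i2]] pt])
  also have "... = r / 2 + (1 / (2 * r)) * (AV x. (norm (un k \<tau> x))^2)"
   by (subst integral_add[OF torus.integrable_const integrable_mult_right[OF i2]]) simp
  finally have le: "NS.speed k \<tau> <= r / 2 + (1 / (2 * r)) * (AV x. (norm (un k \<tau> x))^2)" .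
  have nn: "0 <= (1 / (2 * r)) * (AV x. (norm (un k \<tau> x))^2)"
   using r by (intro mult_nonneg_nonneg integral_nonneg) auto
  show "indicator {s..t} \<tau> * NS.speed k \<tau> <= indicator {s..t} \<tau> * (r / 2) + (1 / (2 * r)) * (AV x. (norm (UK k (\<tau>, x)))^2)"
   unfolding cut_eq[OF \<tau>] using le nn by (cases "\<tau> \<in> {s..t}") (simp_all only: indicator_simps, simp_all)
 qed
 also have "... = (t - s) * (r / 2) + (1 / (2 * r)) * (LINT q|stm T. (norm (UK k q))^2)"
  unfolding integral_add[OF b(2) integrable_mult_right[OF U(3)]] b(1) integral_mult_right_zero U(1) using st by simp
 also have "... <= (t - s) * (r / 2) + (1 / (2 * r)) * K" using r K by (intro add_left_mono mult_left_mono) auto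
 finally show ?thesis by (simp add: add_divide_distrib mult.commute)
qed

lemma rep_L1: "Good s ==> (AV x. \<bar>rep s x\<bar>) = (AV x. \<bar>wi x\<bar>)"
 by (rule rep_LINT(1)) simp_all

text \<open>The order of choices: \<open>n\<close> from the accuracy, which fixes the Lipschitz constant \<open>\<Lambda>\<close> of the smoothed vorticities; then \<open>r\<close> and the
length \<open>h\<close> of the look-back interval; and last the index beyond which the vorticities are close in space-time. For \<open>t \<le> 2 * h\<close> the comparison starts from the initial datum.\<close>
lemma uniformly_Cauchy:
 assumes e: "e > 0"
 shows "\<exists>N. \<forall>k\<ge>N. \<forall>l\<ge>N. \<forall>t\<in>{0..T}. (AV x. \<bar>wn k t x - wn l t x\<bar>) <= e"
proof -
 have e16: "e / 16 > 0" using e by simp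
 obtain n where n: "!!s. Good s ==> (AV x. \<bar>rep s x - smoothing n (rep s) x\<bar>) <= e / 16" by (rule uniform_smoothing[OF e16]) (rule that)
 obtain L where L: "L > 0" "!!f x. L1 f ==> norm (grad (smoothing n f) x) <= L * (AV x. \<bar>f x\<bar>)"
  "!!f x. L1 f ==> \<bar>laplacian (smoothing n f) x\<bar> <= L * (AV x. \<bar>f x\<bar>)"
  by (rule smoothing_derivative_bounds[of n]) (rule that)
 define \<Lambda> where "\<Lambda> = L * (AV x. \<bar>wi x\<bar>)"
 have \<Lambda>0: "\<Lambda> >= 0" unfolding \<Lambda>_def using L(1) by (intro mult_nonneg_nonneg integral_nonneg) auto
 obtain K where K: "!!k. (LINT q|stm T. (norm (UK k q))^2) <= K" using velocity_bound by blast
 have K0: "K >= 0" using order_trans[OF integral_nonneg K[of 0]] by simp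
 \<comment> \<open>the summand 1 keeps \<open>r\<close> positive when \<open>\<Lambda>\<close> or \<open>K\<close> vanishes\<close>
 define r where "r = 8 * \<Lambda> * K / e + 1"
 have r: "r > 0" using \<Lambda>0 K0 e by (simp add: r_def add_nonneg_pos)
 have rK: "\<Lambda> * (K / r) <= e / 8"
 proof -
  have "8 * (\<Lambda> * K) = e * (r - 1)" using e by (simp add: r_def)
  also have "... <= e * r" using e by simp
  finally show ?thesis using r by (simp add: field_simps)
 qed
 define h where "h = e / (16 * (\<Lambda> * r + 1))"
 have \<Lambda>r: "\<Lambda> * r >= 0" using \<Lambda>0 r by simp
 have h: "h > 0" using e \<Lambda>r unfolding h_def by (intro divide_pos_pos mult_pos_pos) linarith+
 have hr: "\<Lambda> * (r * h) <= e / 16"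
 proof -
  have "e / (16 * D) * D = e / 16" if "D > 0" for D using that by simp
  then have "h * (\<Lambda> * r + 1) = e / 16" unfolding h_def using \<Lambda>r by (simp only: add_nonneg_pos[OF _ zero_less_one])
  moreover have "h * (\<Lambda> * r) <= h * (\<Lambda> * r + 1)" using h by (intro mult_left_mono) auto
  ultimately have "h * (\<Lambda> * r) <= e / 16" by linarith
  then show ?thesis by (simp only: mult.commute mult.left_commute)
 qed
 have cmp: "(AV x. \<bar>wn k t x - smoothing n (rep s) x\<bar>) <= (AV x. \<bar>wn k s x - rep s x\<bar>) + e / 16 + e / 8 + \<nu> k * \<Lambda> * T"
  if s: "Good s" and st: "s <= t" "t <= T" "t - s <= 2 * h" for k s t
 proof -
  have s0: "0 <= s" "s \<in> {0..T}" using s by (simp_all add: Good_def)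
  note ri = rep_integrable[OF s]
  have b: "norm (grad (smoothing n (rep s)) x) <= \<Lambda>" "\<bar>laplacian (smoothing n (rep s)) x\<bar> <= \<Lambda>" for x
   using L(2,3)[OF ri, of x] unfolding rep_L1[OF s] \<Lambda>_def by simp_all
  have "(AV x. \<bar>wn k t x - smoothing n (rep s) x\<bar>) <= (AV x. \<bar>wn k s x - smoothing n (rep s) x\<bar>)
    + \<Lambda> * integral {s..t} (NS.speed k) + \<nu> k * \<Lambda> * (t - s)"
   by (rule NS.L1_stability[OF smoothing_smooth b s0(1) st(1,2)])
  moreover have "(AV x. \<bar>wn k s x - smoothing n (rep s) x\<bar>) <= (AV x. \<bar>wn k s x - rep s x\<bar>) + (AV x. \<bar>rep s x - smoothing n (rep s) x\<bar>)"
   by (rule L1_triangle[OF wn_integrable[OF s0(2)] ri smoothing_integrable])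
  moreover have "\<Lambda> * integral {s..t} (NS.speed k) <= e / 8"
  proof -
   have "integral {s..t} (NS.speed k) <= (r * (t - s) + K / r) / 2" by (rule speed_bound[OF K s0(1) st(1,2) r])
   also have "... <= r * h + (K / r) / 2" using mult_left_mono[OF st(3), of r] r by simp
   finally have "\<Lambda> * integral {s..t} (NS.speed k) <= \<Lambda> * (r * h + (K / r) / 2)" by (rule mult_left_mono[OF _ \<Lambda>0])
   also have "... = \<Lambda> * (r * h) + \<Lambda> * (K / r) / 2" by (simp add: distrib_left)
   also have "... <= e / 16 + e / 8 / 2" by (rule add_mono[OF hr divide_right_mono[OF rK]]) simp
   also have "... = e / 8" by simp
   finally show ?thesis .
  qed
  moreover have "\<nu> k * \<Lambda> * (t - s) <= \<nu> k * \<Lambda> * T"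
   using NS.\<nu>[of k] \<Lambda>0 st s0 by (intro mult_left_mono) auto
  ultimately show ?thesis using n[OF s] by linarith
 qed
 have "(%k. \<nu> k * \<Lambda> * T) ----> 0 * \<Lambda> * T" by (intro tendsto_intros \<nu>0)
 then have "\<forall>\<^sub>F k in sequentially. \<nu> k * \<Lambda> * T < e / 16" using e by (intro order_tendstoD(2)) auto
 moreover have "\<forall>\<^sub>F k in sequentially. (AV x. \<bar>w0 k x - wi x\<bar>) < e / 16" by (rule order_tendstoD(2)[OF w0_L1 e16])
 moreover have "\<forall>\<^sub>F k in sequentially. (LINT q|stm T. \<bar>WK k q - w q\<bar>) < h * (e / 16)"
  by (rule order_tendstoD(2)[OF vorticity_L1]) (use h e in simp)
 ultimately have "\<forall>\<^sub>F k in sequentially. \<nu> k * \<Lambda> * T < e / 16 & (AV x. \<bar>w0 k x - wi x\<bar>) < e / 16 & (LINT q|stm T. \<bar>WK k q - w q\<bar>) < h * (e / 16)"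
  by eventually_elim simp
 then obtain N where N: "!!k. k >= N ==> \<nu> k * \<Lambda> * T < e / 16" "!!k. k >= N ==> (AV x. \<bar>w0 k x - wi x\<bar>) < e / 16"
  "!!k. k >= N ==> (LINT q|stm T. \<bar>WK k q - w q\<bar>) < h * (e / 16)" unfolding eventually_sequentially by blast
 show ?thesis
 proof (intro exI[of _ N] allI impI ballI)
  fix k l t assume kl: "k >= N" "l >= N" and t: "t \<in> {0..T}"
  have "\<exists>s. Good s & s <= t & t - s <= 2 * h & (AV x. \<bar>wn k s x - rep s x\<bar>) <= e / 16 & (AV x. \<bar>wn l s x - rep s x\<bar>) <= e / 16"
  proof (cases "t <= 2 * h")
   case True
   then show ?thesis using Good_0 t N(2)[OF kl(1)] N(2)[OF kl(2)]
    by (intro exI[of _ 0]) (simp add: NS.initial rep_def)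
  next
   case False
   let ?f = "%j s. AV x. \<bar>WK j (s, x) - w (s, x)\<bar>"
   have nn: "0 <= ?f j s" for j s by (rule integral_nonneg) simp
   have i: "integrable (time_on T) (%s. ?f k s + ?f l s)"
    by (intro integrable_add stm_iterated(3)[OF WKw_abs_stm])
   have I: "(LINT s|time_on T. ?f k s + ?f l s) < 2 * h * (e / 16)"
    unfolding integral_add[OF stm_iterated(3)[OF WKw_abs_stm] stm_iterated(3)[OF WKw_abs_stm]] stm_iterated(1)[OF WKw_abs_stm, symmetric]
    using N(3)[OF kl(1)] N(3)[OF kl(2)] by linarith
   obtain s where s: "t - 2 * h <= s" "s <= t" "Good s" "?f k s + ?f l s <= 2 * h * (e / 16) / (t - (t - 2 * h))"
    by (rule good_time_in[OF i _ I, of "t - 2 * h" t]) (use False h t nn in "auto intro: add_nonneg_nonneg")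
   have sp: "s ~= 0" using s(1) False by linarith
   have sT: "s \<in> {0..T}" using s(3) by (simp add: Good_def)
   have q: "2 * h * (e / 16) / (t - (t - 2 * h)) = e / 16" using h by simp
   have "?f k s <= e / 16" "?f l s <= e / 16" using s(4) nn[of k s] nn[of l s] unfolding q by linarith+
   then show ?thesis using s(1-3) sp by (intro exI[of _ s]) (simp add: cut_eq[OF sT] rep_def)
  qed
  then obtain s where s: "Good s" "s <= t" "t - s <= 2 * h" "(AV x. \<bar>wn k s x - rep s x\<bar>) <= e / 16" "(AV x. \<bar>wn l s x - rep s x\<bar>) <= e / 16" by blast
  have tT: "t <= T" using t by simp
  have "(AV x. \<bar>wn k t x - wn l t x\<bar>) <= (AV x. \<bar>wn k t x - smoothing n (rep s) x\<bar>) + (AV x. \<bar>smoothing n (rep s) x - wn l t x\<bar>)"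
   by (rule L1_triangle[OF wn_integrable[OF t] smoothing_integrable wn_integrable[OF t]])
  moreover have "(AV x. \<bar>smoothing n (rep s) x - wn l t x\<bar>) = (AV x. \<bar>wn l t x - smoothing n (rep s) x\<bar>)"
   by (simp add: abs_minus_commute)
  ultimately show "(AV x. \<bar>wn k t x - wn l t x\<bar>) <= e"
   using cmp[OF s(1,2) tT s(3), of k] cmp[OF s(1,2) tT s(3), of l] s(4,5) N(1)[OF kl(1)] N(1)[OF kl(2)] e by linarith
 qed
qed

end

section \<open>From integrable to p-integrable convergence\<close>

lemma Fatou_bound:
 fixes g :: "nat => 'a => real"
 assumes g: "!!i. integrable M (g i)" "!!i x. 0 <= g i x" and h: "h \<in> borel_measurable M" "!!x. 0 <= h x"
  and C: "!!i. i >= N ==> integral\<^sup>L M (g i) <= C" and lim: "AE x in M. (%i. g i x) ----> h x"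
 shows "integrable M h" "integral\<^sup>L M h <= C"
proof -
 have C0: "0 <= C" using order_trans[OF integral_nonneg C[of N]] g by simp
 have "(\<integral>\<^sup>+x. ennreal (h x) \<partial>M) = (\<integral>\<^sup>+x. liminf (%i. ennreal (g i x)) \<partial>M)"
 proof (rule nn_integral_cong_AE)
  show "AE x in M. ennreal (h x) = liminf (%i. ennreal (g i x))" using lim
  proof eventually_elim
   fix x assume "(%i. g i x) ----> h x"
   then have "(%i. ennreal (g i x)) ----> ennreal (h x)" by (rule tendsto_ennrealI)
   then show "ennreal (h x) = liminf (%i. ennreal (g i x))" using lim_imp_Liminf[OF sequentially_bot] by metis
  qed
 qed
 also have "... <= liminf (%i. \<integral>\<^sup>+x. ennreal (g i x) \<partial>M)"
  by (rule nn_integral_liminf) (rule measurable_compose[OF integrable_measurable[OF g(1)] measurable_ennreal])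
 also have "... <= liminf (%i. ennreal C)"
 proof (rule Liminf_mono)
  show "\<forall>\<^sub>F i in sequentially. (\<integral>\<^sup>+x. ennreal (g i x) \<partial>M) <= ennreal C"
   using eventually_ge_at_top[of N]
  proof eventually_elim
   fix i assume "N <= i"
   have "(\<integral>\<^sup>+x. ennreal (g i x) \<partial>M) = ennreal (integral\<^sup>L M (g i))" by (rule nn_integral_eq_integral[OF g(1)]) (simp add: g)
   then show "(\<integral>\<^sup>+x. ennreal (g i x) \<partial>M) <= ennreal C" using C[OF \<open>N <= i\<close>] by (simp add: ennreal_leI)
  qed
 qed
 also have "... = ennreal C" by (simp add: Liminf_const)
 finally have le: "(\<integral>\<^sup>+x. ennreal (h x) \<partial>M) <= ennreal C" .
 show i: "integrable M h"
 proof (rule integrableI_nonneg[OF h(1)])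
  show "AE x in M. 0 <= h x" using h by simp
  show "(\<integral>\<^sup>+x. ennreal (h x) \<partial>M) < \<infinity>" using le_less_trans[OF le ennreal_less_top] by simp
 qed
 have "ennreal (integral\<^sup>L M h) <= ennreal C" using le nn_integral_eq_integral[OF i] h by simp
 then show "integral\<^sup>L M h <= C" using C0 by (simp add: ennreal_le_iff)
qed

text \<open>Completeness of \<open>L\<^sup>1\<close>: a subsequence converges almost everywhere, and Fatou's lemma identifies its limit.\<close>
lemma L1_complete:
 fixes s :: "nat => 'a => real"
 assumes s: "!!k. integrable M (s k)"
  and cauchy: "!!e. e > 0 ==> \<exists>N. \<forall>k\<ge>N. \<forall>l\<ge>N. (LINT x|M. \<bar>s k x - s l x\<bar>) <= e"
 obtains f where "integrable M f" "(%k. LINT x|M. \<bar>s k x - f x\<bar>) ----> 0"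
proof -
 have c: "\<exists>N. \<forall>i\<ge>N. \<forall>j\<ge>N. (LINT x|M. norm (s i x - s j x)) < e" if e: "e > 0" for e
 proof -
  obtain N where N: "\<forall>k\<ge>N. \<forall>l\<ge>N. (LINT x|M. \<bar>s k x - s l x\<bar>) <= e / 2" using cauchy[of "e / 2"] e by auto
  show ?thesis
  proof (intro exI[of _ N] allI impI)
   fix i j assume "N <= i" "N <= j"
   then have "(LINT x|M. \<bar>s i x - s j x\<bar>) <= e / 2" using N by blast
   then show "(LINT x|M. norm (s i x - s j x)) < e" using e by simp
  qed
 qed
 obtain r where r: "strict_mono r" "AE x in M. Cauchy (%i. s (r i) x)" by (rule cauchy_L1_AE_cauchy_subseq[OF s c])
 define f where "f x = lim (%i. s (r i) x)" for x
 have fm: "f \<in> borel_measurable M" unfolding f_def[abs_def] by (rule borel_measurable_lim_metric) (rule integrable_measurable[OF s])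
 have lim: "AE x in M. (%i. s (r i) x) ----> f x" using r(2)
  by eventually_elim (simp add: f_def Cauchy_convergent_iff convergent_LIMSEQ_iff)
 have bound: "integrable M (%x. \<bar>s k x - f x\<bar>)" "(LINT x|M. \<bar>s k x - f x\<bar>) <= e"
  if N: "!!l. l >= N ==> (LINT x|M. \<bar>s k x - s l x\<bar>) <= e" for k e N
 proof -
  have g: "integrable M (%x. \<bar>s k x - s (r i) x\<bar>)" for i by (rule integrable_abs[OF integrable_diff[OF s s]])
  have m: "(%x. \<bar>s k x - f x\<bar>) \<in> borel_measurable M" by (rule borel_measurable_abs[OF borel_measurable_diff[OF integrable_measurable[OF s] fm]])
  have C: "(LINT x|M. \<bar>s k x - s (r i) x\<bar>) <= e" if "i >= N" for i
   using N[of "r i"] seq_suble[OF r(1), of i] that by linarith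
  have l: "AE x in M. (%i. \<bar>s k x - s (r i) x\<bar>) ----> \<bar>s k x - f x\<bar>" using lim by eventually_elim (intro tendsto_intros)
  show "integrable M (%x. \<bar>s k x - f x\<bar>)" "(LINT x|M. \<bar>s k x - f x\<bar>) <= e"
   by (rule Fatou_bound[OF g _ m _ C l]; simp)+
 qed
 have di: "(%x. s k x - f x) \<in> borel_measurable M" for k by (rule borel_measurable_diff[OF integrable_measurable[OF s] fm])
 show ?thesis
 proof (rule that[of f])
  obtain N where N: "\<forall>k\<ge>N. \<forall>l\<ge>N. (LINT x|M. \<bar>s k x - s l x\<bar>) <= 1" using cauchy[of 1] by auto
  have "integrable M (%x. \<bar>s N x - f x\<bar>)" by (rule bound(1)[of N]) (use N in auto)
  then have "integrable M (%x. s N x - f x)" using integrable_abs_iff[OF di] by blast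
  then have "integrable M (%x. s N x - (s N x - f x))" by (rule integrable_diff[OF s])
  then show "integrable M f" by simp
  show "(%k. LINT x|M. \<bar>s k x - f x\<bar>) ----> 0"
  proof (rule LIMSEQ_I)
   fix e :: real assume e: "e > 0"
   obtain N where N: "\<forall>k\<ge>N. \<forall>l\<ge>N. (LINT x|M. \<bar>s k x - s l x\<bar>) <= e / 2" using cauchy[of "e / 2"] e by auto
   show "\<exists>no. \<forall>k\<ge>no. norm ((LINT x|M. \<bar>s k x - f x\<bar>) - 0) < e"
   proof (intro exI[of _ N] allI impI)
    fix k assume "N <= k"
    then have "(LINT x|M. \<bar>s k x - f x\<bar>) <= e / 2" by (intro bound(2)[of N]) (use N in auto)
    moreover have "0 <= (LINT x|M. \<bar>s k x - f x\<bar>)" by (rule integral_nonneg) simp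
    ultimately show "norm ((LINT x|M. \<bar>s k x - f x\<bar>) - 0) < e" using e by simp
   qed
  qed
 qed
qed

text \<open>The \<open>p\<close>-th power capped at level \<open>R\<close>: bounded and Lipschitz, so its integral is continuous in \<open>L\<^sup>1\<close>. The excess
\<open>\<bar>z\<bar> powr p - capp p R z\<close> measures the tail.\<close>
definition capp :: "real => real => real => real" where "capp p R z = min \<bar>z\<bar> R powr p"

lemma capp_lipschitz:
 assumes p: "p > 1" and R: "R >= 0"
 shows "\<bar>capp p R a - capp p R b\<bar> <= p * R powr (p - 1) * \<bar>a - b\<bar>"
proof -
 have main: "x powr p - y powr p <= p * R powr (p - 1) * (x - y)" if xy: "0 <= y" "y <= x" "x <= R" for x y
 proof -
  consider "y = x" | "y = 0" "0 < x" | "0 < y" "y < x" using xy by linarith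
  then show ?thesis
  proof cases
   case 2
   have "x powr p = x powr (p - 1) * x" using powr_mult_base[of x "p - 1"] 2 by (simp add: mult.commute)
   also have "... <= (p * R powr (p - 1)) * x"
    using powr_mono2[of "p - 1" x R] p xy 2 mult_mono[of 1 p "x powr (p - 1)" "R powr (p - 1)"] by (intro mult_right_mono) auto
   finally show ?thesis using 2 p by simp
  next
   case 3
   have "\<exists>z>y. z < x & x powr p - y powr p = (x - y) * (p * z powr (p - 1))"
   proof (rule MVT2[OF 3(2)])
    fix z assume "y <= z" "z <= x"
    then show "((%z. z powr p) has_real_derivative p * z powr (p - 1)) (at z)" using 3 by (auto intro!: derivative_eq_intros has_real_derivative_powr)
   qed
   then obtain z where z: "y < z" "z < x" "x powr p - y powr p = (x - y) * (p * z powr (p - 1))" by blast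
   have "z powr (p - 1) <= R powr (p - 1)" by (rule powr_mono2) (use z xy 3 p in auto)
   then have "(x - y) * (p * z powr (p - 1)) <= (x - y) * (p * R powr (p - 1))" using p 3 by (intro mult_left_mono) auto
   then show ?thesis using z(3) by (simp add: mult.commute)
  qed (use p in simp)
 qed
 let ?a = "min \<bar>a\<bar> R" and ?b = "min \<bar>b\<bar> R"
 have d: "\<bar>?a - ?b\<bar> <= \<bar>a - b\<bar>" by linarith
 have sym: "\<bar>x powr p - y powr p\<bar> <= p * R powr (p - 1) * \<bar>x - y\<bar>" if xy: "0 <= y" "y <= x" "x <= R" for x y
 proof -
  have "y powr p <= x powr p" by (rule powr_mono2) (use xy p in auto)
  then have "\<bar>x powr p - y powr p\<bar> = x powr p - y powr p" "\<bar>x - y\<bar> = x - y" using xy by linarith+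
  then show ?thesis using main[OF xy] by simp
 qed
 have "\<bar>?a powr p - ?b powr p\<bar> <= p * R powr (p - 1) * \<bar>?a - ?b\<bar>"
 proof (cases "?b <= ?a")
  case True
  show ?thesis by (rule sym[OF _ True]) (use R in auto)
 next
  case False
  then have le: "?a <= ?b" by linarith
  have "\<bar>?b powr p - ?a powr p\<bar> <= p * R powr (p - 1) * \<bar>?b - ?a\<bar>" by (rule sym[OF _ le]) (use R in auto)
  then show ?thesis by (simp only: abs_minus_commute)
 qed
 also have "... <= p * R powr (p - 1) * \<bar>a - b\<bar>" using p by (intro mult_left_mono d) auto
 finally show ?thesis by (simp add: capp_def)
qed

lemma capp_continuous: "p > 1 ==> R >= 0 ==> cont (capp p R)"
 unfolding capp_def[abs_def] by (intro continuous_on_powr' continuous_intros) auto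

lemma capp_props:
 assumes p: "p > 1" and R: "R >= 0"
 shows "0 <= capp p R z" "capp p R z <= R powr p" "capp p R z <= \<bar>z\<bar> powr p" "2 * R < \<bar>z\<bar> ==> \<bar>z\<bar> powr p <= 2 * (\<bar>z\<bar> powr p - capp p R z)"
proof -
 show "0 <= capp p R z" by (simp add: capp_def)
 show "capp p R z <= R powr p" "capp p R z <= \<bar>z\<bar> powr p" unfolding capp_def by (rule powr_mono2; use p R in auto)+
 assume z: "2 * R < \<bar>z\<bar>"
 have "capp p R z <= (\<bar>z\<bar> / 2) powr p" unfolding capp_def by (rule powr_mono2) (use p R z in auto)
 also have "... = \<bar>z\<bar> powr p / 2 powr p" by (rule powr_divide)
 also have "... <= \<bar>z\<bar> powr p / 2 powr 1" by (rule divide_left_mono[OF powr_mono]) (use p in auto)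
 finally show "\<bar>z\<bar> powr p <= 2 * (\<bar>z\<bar> powr p - capp p R z)" by simp
qed

lemma powr_add_le:
 fixes a b p :: real assumes p: "p > 1" shows "\<bar>a + b\<bar> powr p <= 2 powr p * (\<bar>a\<bar> powr p + \<bar>b\<bar> powr p)"
proof -
 let ?m = "max \<bar>a\<bar> \<bar>b\<bar>"
 have "\<bar>a + b\<bar> powr p <= (2 * ?m) powr p" by (rule powr_mono2) (use p in auto)
 also have "... = 2 powr p * ?m powr p" by (rule powr_mult)
 also have "?m powr p <= \<bar>a\<bar> powr p + \<bar>b\<bar> powr p" by (simp add: max_def)
 finally show ?thesis by simp
qed

text \<open>Below level \<open>2 * R\<close> the \<open>p\<close>-th power is controlled by the first power, above it by the excess.\<close>
lemma powr_diff_tail: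
 assumes p: "p > 1" and R: "R > 0"
 shows "\<bar>a - b\<bar> powr p <= (4 * R) powr (p - 1) * \<bar>a - b\<bar> + 2 * 2 powr p * ((\<bar>a\<bar> powr p - capp p R a) + (\<bar>b\<bar> powr p - capp p R b))"
proof -
 let ?t = "%z. \<bar>z\<bar> powr p - capp p R z"
 have nn: "0 <= ?t a" "0 <= ?t b" using capp_props(3)[OF p less_imp_le[OF R]] by (simp_all add: diff_ge_0_iff_ge)
 have nn3: "0 <= (4 * R) powr (p - 1) * \<bar>a - b\<bar>" by simp
 have big: "\<bar>a - b\<bar> powr p <= 2 * 2 powr p * (?t a + ?t b)" if z: "2 * R < \<bar>z\<bar>" "\<bar>a - b\<bar> <= 2 * \<bar>z\<bar>" "?t z <= ?t a + ?t b" for z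
 proof -
  have "\<bar>a - b\<bar> powr p <= (2 * \<bar>z\<bar>) powr p" by (rule powr_mono2) (use p z in auto)
  also have "... = 2 powr p * \<bar>z\<bar> powr p" by (rule powr_mult)
  also have "... <= 2 powr p * (2 * (?t a + ?t b))" using capp_props(4)[OF p _ z(1)] R z(3) by (intro mult_left_mono) auto
  finally show ?thesis by (simp only: mult.assoc mult.left_commute[of "2 powr p" 2])
 qed
 consider "\<bar>a\<bar> <= 2 * R" "\<bar>b\<bar> <= 2 * R" | "2 * R < \<bar>a\<bar>" "\<bar>b\<bar> <= \<bar>a\<bar>" | "2 * R < \<bar>b\<bar>" "\<bar>a\<bar> <= \<bar>b\<bar>" by linarith
 then show ?thesis
 proof cases
  case 1
  have "\<bar>a - b\<bar> powr p = \<bar>a - b\<bar> powr (p - 1) * \<bar>a - b\<bar>" by (cases "a = b") (simp_all add: powr_diff)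
  also have "... <= (4 * R) powr (p - 1) * \<bar>a - b\<bar>" by (rule mult_right_mono[OF powr_mono2]) (use 1 p in auto)
  finally show ?thesis using nn by (simp add: add_increasing2)
 next
  case 2
  then show ?thesis using big[of a] nn nn3 by (smt (verit))
 next
  case 3
  then show ?thesis using big[of b] nn nn3 by (smt (verit))
 qed
qed

lemma capp_L1_tendsto:
 fixes f :: "real^2 => real"
 assumes f: "f \<in> TBorel" "L1 (%x. \<bar>f x\<bar> powr p)" and p: "p > 1"
 shows "(%n. AV x. capp p (real n) (f x)) ----> (AV x. \<bar>f x\<bar> powr p)"
proof (rule integral_dominated_convergence[where w="%x. \<bar>f x\<bar> powr p"])
 show "(%x. \<bar>f x\<bar> powr p) \<in> TBorel" by (rule integrable_measurable[OF f(2)])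
 show "(%x. capp p (real n) (f x)) \<in> TBorel" for n
  by (rule measurable_compose[OF f(1) cont_Borel[OF capp_continuous[OF p]]]) simp
 show "AE x in TM. (%n. capp p (real n) (f x)) ----> \<bar>f x\<bar> powr p"
 proof (rule AE_I2)
  fix x
  obtain N :: nat where N: "\<bar>f x\<bar> <= real N" using real_arch_simple by blast
  have "\<forall>\<^sub>F n in sequentially. capp p (real n) (f x) = \<bar>f x\<bar> powr p"
   using eventually_ge_at_top[of N] by eventually_elim (use N in "simp add: capp_def min_def")
  then show "(%n. capp p (real n) (f x)) ----> \<bar>f x\<bar> powr p" by (rule tendsto_eventually)
 qed
 show "AE x in TM. norm (capp p (real n) (f x)) <= \<bar>f x\<bar> powr p" for n
  using capp_props[OF p, of "real n"] by (intro AE_I2) simp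
qed (rule f(2))

context inviscid
begin

lemma L1_limit:
 assumes t: "t \<in> {0..T}"
 obtains f where "L1 f" "(%k. AV x. \<bar>wn k t x - f x\<bar>) ----> 0"
proof -
 have c: "\<exists>N. \<forall>k\<ge>N. \<forall>l\<ge>N. (AV x. \<bar>wn k t x - wn l t x\<bar>) <= e" if "e > 0" for e
  using uniformly_Cauchy[OF that] t by blast
 show ?thesis by (rule L1_complete[OF wn_integrable[OF t] c]) (use that in blast)+
qed

lemma Good_L1_limit:
 assumes s: "Good s"
 shows "(%k. AV x. \<bar>wn k s x - rep s x\<bar>) ----> 0"
proof (rule LIMSEQ_I)
 fix e :: real assume e: "e > 0"
 have sT: "s \<in> {0..T}" by (rule Good_range[OF s])
 have "e / 3 > 0" using e by simp
 from uniformly_Cauchy[OF this] obtain N where N: "!!k l. k >= N ==> l >= N ==> (AV x. \<bar>wn k s x - wn l s x\<bar>) <= e / 3" using sT by blast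
 have "(%k. AV x. \<bar>wn (\<rho> k) s x - rep s x\<bar>) ----> 0" using s by (simp add: Good_def)
 from order_tendstoD(2)[OF this \<open>e / 3 > 0\<close>] obtain M where M: "!!k. k >= M ==> (AV x. \<bar>wn (\<rho> k) s x - rep s x\<bar>) < e / 3"
  unfolding eventually_sequentially by blast
 show "\<exists>no. \<forall>k\<ge>no. norm ((AV x. \<bar>wn k s x - rep s x\<bar>) - 0) < e"
 proof (intro exI[of _ N] allI impI)
  fix k assume k: "k >= N"
  let ?l = "\<rho> (max M N)"
  have l: "?l >= N" using seq_suble[OF \<rho>(1), of "max M N"] by linarith
  have "(AV x. \<bar>wn k s x - rep s x\<bar>) <= (AV x. \<bar>wn k s x - wn ?l s x\<bar>) + (AV x. \<bar>wn ?l s x - rep s x\<bar>)"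
   by (rule L1_triangle[OF wn_integrable[OF sT] wn_integrable[OF sT] rep_integrable[OF s]])
  then have "(AV x. \<bar>wn k s x - rep s x\<bar>) < e" using N[OF k l] M[of "max M N"] e by simp
  moreover have "0 <= (AV x. \<bar>wn k s x - rep s x\<bar>)" by (rule integral_nonneg) simp
  ultimately show "norm ((AV x. \<bar>wn k s x - rep s x\<bar>) - 0) < e" by simp
 qed
qed

lemma wn_continuous_Lq:
 assumes q: "q >= 1" and t: "t \<in> {0..T}"
 shows "((%s. AV x. \<bar>wn k s x - wn k t x\<bar> powr q) \<longlongrightarrow> 0) (at t within {0..T})"
proof -
 have wc: "cont (wn k t)" by (rule smooth_cont[OF NS.w_smooth[OF t]])
 have "continuous_on ({0..T} \<times> UNIV) (%p. \<bar>wn k (fst p) (snd p) - wn k t (snd p)\<bar> powr q)"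
  using q by (intro continuous_on_powr' continuous_intros NS.w_continuous NS.continuous_snd_slab[OF wc]) auto
 from slab_LINT_continuous[OF this]
 have "((%s. AV x. \<bar>wn k s x - wn k t x\<bar> powr q) \<longlongrightarrow> (AV x. \<bar>wn k t x - wn k t x\<bar> powr q)) (at t within {0..T})"
  unfolding continuous_on_def using t by blast
 then show ?thesis by simp
qed

context
 fixes wc :: "real => real^2 => real"
 assumes wc_int: "!!t. t \<in> {0..T} ==> L1 (wc t)"
  and wc_lim: "!!t. t \<in> {0..T} ==> (%k. AV x. \<bar>wn k t x - wc t x\<bar>) ----> 0"
  and w0_norm: "!!\<delta>. \<delta> > 0 ==> \<forall>\<^sub>F k in sequentially. (AV x. \<bar>w0 k x\<bar> powr p) < (AV x. \<bar>wi x\<bar> powr p) + \<delta>"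
begin

lemma uniform_L1:
 assumes e: "e > 0"
 obtains N where "!!k t. k >= N ==> t \<in> {0..T} ==> (AV x. \<bar>wn k t x - wc t x\<bar>) <= e"
proof -
 obtain N where N: "!!k l t. k >= N ==> l >= N ==> t \<in> {0..T} ==> (AV x. \<bar>wn k t x - wn l t x\<bar>) <= e"
  using uniformly_Cauchy[OF e] by blast
 show ?thesis
 proof (rule that[of N])
  fix k t assume k: "k >= N" and t: "t \<in> {0..T}"
  have "(%l. e + (AV x. \<bar>wn l t x - wc t x\<bar>)) ----> e + 0" by (intro tendsto_intros wc_lim[OF t])
  then have "(AV x. \<bar>wn k t x - wc t x\<bar>) <= e + 0"
  proof (rule tendsto_lowerbound[OF _ _ sequentially_bot])
   show "\<forall>\<^sub>F l in sequentially. (AV x. \<bar>wn k t x - wc t x\<bar>) <= e + (AV x. \<bar>wn l t x - wc t x\<bar>)"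
    using eventually_ge_at_top[of N]
   proof eventually_elim
    fix l assume "N <= l"
    then show "(AV x. \<bar>wn k t x - wc t x\<bar>) <= e + (AV x. \<bar>wn l t x - wc t x\<bar>)"
     using L1_triangle[OF wn_integrable[OF t] wn_integrable[OF t] wc_int[OF t], of k l] N[OF k _ t, of l] by linarith
   qed
  qed
  then show "(AV x. \<bar>wn k t x - wc t x\<bar>) <= e" by simp
 qed
qed

lemma wc_L1_continuous:
 assumes t: "t \<in> {0..T}" and e: "e > 0"
 shows "\<forall>\<^sub>F s in at t within {0..T}. (AV x. \<bar>wc s x - wc t x\<bar>) < e"
proof -
 have "e / 4 > 0" using e by simp
 from uniform_L1[OF this] obtain N where N: "!!k t. k >= N ==> t \<in> {0..T} ==> (AV x. \<bar>wn k t x - wc t x\<bar>) <= e / 4" by blast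
 have "\<forall>\<^sub>F s in at t within {0..T}. (AV x. \<bar>wn N s x - wn N t x\<bar>) < e / 4"
  using order_tendstoD(2)[OF wn_continuous_Lq[OF _ t, of 1 N] \<open>e / 4 > 0\<close>] by simp
 moreover have "\<forall>\<^sub>F s in at t within {0..T}. s \<in> {0..T}" by (simp add: eventually_at_filter)
 ultimately show ?thesis
 proof eventually_elim
  fix s assume *: "(AV x. \<bar>wn N s x - wn N t x\<bar>) < e / 4" and s: "s \<in> {0..T}"
  have "(AV x. \<bar>wc s x - wc t x\<bar>) <= (AV x. \<bar>wc s x - wn N s x\<bar>) + (AV x. \<bar>wn N s x - wc t x\<bar>)"
   by (rule L1_triangle[OF wc_int[OF s] wn_integrable[OF s] wc_int[OF t]])
  moreover have "(AV x. \<bar>wn N s x - wc t x\<bar>) <= (AV x. \<bar>wn N s x - wn N t x\<bar>) + (AV x. \<bar>wn N t x - wc t x\<bar>)"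
   by (rule L1_triangle[OF wn_integrable[OF s] wn_integrable[OF t] wc_int[OF t]])
  moreover have "(AV x. \<bar>wc s x - wn N s x\<bar>) = (AV x. \<bar>wn N s x - wc s x\<bar>)" by (simp add: abs_minus_commute)
  ultimately show "(AV x. \<bar>wc s x - wc t x\<bar>) < e" using * N[of N s] N[of N t] s t e by linarith
 qed
qed

lemma wc_rep: "Good s ==> AE x in TM. wc s x = rep s x"
proof -
 assume s: "Good s"
 have sT: "s \<in> {0..T}" by (rule Good_range[OF s])
 note di = integrable_diff[OF wc_int[OF sT] rep_integrable[OF s]]
 have "(AV x. \<bar>wc s x - rep s x\<bar>) <= 0"
 proof (rule tendsto_lowerbound[OF _ _ sequentially_bot])
  show "(%k. (AV x. \<bar>wn k s x - wc s x\<bar>) + (AV x. \<bar>wn k s x - rep s x\<bar>)) ----> 0"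
   using tendsto_add[OF wc_lim[OF sT] Good_L1_limit[OF s]] by simp
  show "\<forall>\<^sub>F k in sequentially. (AV x. \<bar>wc s x - rep s x\<bar>) <= (AV x. \<bar>wn k s x - wc s x\<bar>) + (AV x. \<bar>wn k s x - rep s x\<bar>)"
   using L1_triangle[OF wc_int[OF sT] wn_integrable[OF sT] rep_integrable[OF s]]
   by (simp add: abs_minus_commute[of "wc s _" "wn _ s _"])
 qed
 moreover have "0 <= (AV x. \<bar>wc s x - rep s x\<bar>)" by (rule integral_nonneg) simp
 ultimately have "(AV x. \<bar>wc s x - rep s x\<bar>) = 0" by linarith
 then have "AE x in TM. \<bar>wc s x - rep s x\<bar> = 0"
  using integral_nonneg_eq_0_iff_AE[OF integrable_abs[OF di]] by simp
 then show ?thesis by eventually_elim simp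
qed

text \<open>True at good times, which are dense, and continuous in time.\<close>
lemma equidistributed:
 assumes t: "t \<in> {0..T}" and R: "R >= 0"
 shows "(AV x. capp p R (wc t x)) = (AV x. capp p R (wi x))"
proof -
 define L where "L = p * R powr (p - 1) + 1"
 have L: "L > 0" using p by (simp add: L_def add_nonneg_pos)
 have lip: "\<bar>capp p R a - capp p R b\<bar> <= L * \<bar>a - b\<bar>" for a b
  unfolding L_def distrib_right by (rule add_increasing2[OF _ capp_lipschitz[OF p R]]) simp
 have cb: "capp p R \<in> Borel" by (rule cont_Borel[OF capp_continuous[OF p R]])
 have ci: "L1 (%x. capp p R (f x))" if "L1 f" for f
  by (rule bounded_L1[OF measurable_compose[OF integrable_measurable[OF that] cb], where C="R powr p"])
   (use capp_props[OF p R] in simp)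
 show ?thesis
 proof (rule ccontr)
  assume ne: "~ ?thesis"
  define e where "e = \<bar>(AV x. capp p R (wc t x)) - (AV x. capp p R (wi x))\<bar> / L"
  have e: "e > 0" using ne L by (simp add: e_def)
  from wc_L1_continuous[OF t e] obtain d where d: "d > 0" "!!s. s \<in> {0..T} ==> s ~= t ==> dist s t < d ==> (AV x. \<bar>wc s x - wc t x\<bar>) < e"
   unfolding eventually_at by blast
  have d': "(AV x. \<bar>wc s x - wc t x\<bar>) < e" if "s \<in> {0..T}" "dist s t < d" for s
   using d(2)[OF that(1) _ that(2)] e by (cases "s = t") auto
  have z: "integrable (time_on T) (%t. 0)" "integral\<^sup>L (time_on T) (%t. 0) < (1::real)" by simp_all
  define a b where "a = max 0 (t - d / 2)" and "b = min T (t + d / 2)"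
  have ab: "0 <= a" "a < b" "b <= T" using t d(1) T by (auto simp: a_def b_def)
  obtain s where s: "a <= s" "s <= b" "Good s" by (rule good_time_in[OF z(1) _ z(2) ab]) auto
  have sT: "s \<in> {0..T}" by (rule Good_range[OF s(3)])
  have sd: "dist s t < d" using s(1,2) d(1) by (auto simp: a_def b_def dist_real_def)
  have "(AV x. capp p R (wc s x)) = (AV x. capp p R (rep s x))"
   by (rule integral_cong_AE)
    (use wc_rep[OF s(3)] integrable_measurable[OF ci[OF wc_int[OF sT]]] integrable_measurable[OF ci[OF rep_integrable[OF s(3)]]] in auto)
  also have "... = (AV x. capp p R (wi x))" by (rule rep_LINT(1)[OF s(3) cb])
  finally have eq: "(AV x. capp p R (wc s x)) = (AV x. capp p R (wi x))" .
  have "\<bar>(AV x. capp p R (wc t x)) - (AV x. capp p R (wc s x))\<bar> <= (AV x. L * \<bar>wc s x - wc t x\<bar>)"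
   unfolding integral_diff[OF ci[OF wc_int[OF t]] ci[OF wc_int[OF sT]], symmetric]
   by (rule LINT_abs_le[OF integrable_mult_right[OF integrable_abs[OF integrable_diff[OF wc_int[OF sT] wc_int[OF t]]]]])
    (use lip abs_minus_commute in metis)
  also have "... = L * (AV x. \<bar>wc s x - wc t x\<bar>)" by simp
  also have "... < L * e" using d'[OF sT sd] L by simp
  also have "... = \<bar>(AV x. capp p R (wc t x)) - (AV x. capp p R (wi x))\<bar>" using L by (simp add: e_def)
  finally show False unfolding eq by simp
 qed
qed

text \<open>Remove the cap by letting \<open>R\<close> tend to infinity in \<open>equidistributed\<close>.\<close>
lemma wc_Lp:
 assumes t: "t \<in> {0..T}"
 shows "L1 (%x. \<bar>wc t x\<bar> powr p)" "(AV x. \<bar>wc t x\<bar> powr p) = (AV x. \<bar>wi x\<bar> powr p)"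
proof -
 have m: "wc t \<in> TBorel" by (rule integrable_measurable[OF wc_int[OF t]])
 have gi: "L1 (%x. capp p (real n) (wc t x))" for n
  by (rule bounded_L1[OF measurable_compose[OF m cont_Borel[OF capp_continuous[OF p]]], where C="real n powr p"])
   (use capp_props[OF p, of "real n"] in simp_all)
 have pm: "(%x. \<bar>wc t x\<bar> powr p) \<in> TBorel"
  by (rule measurable_compose[OF m cont_Borel[OF powr_p_continuous]])
 have le: "(AV x. capp p (real n) (wc t x)) <= (AV x. \<bar>wi x\<bar> powr p)" for n
 proof -
  have "(AV x. capp p (real n) (wi x)) <= (AV x. \<bar>wi x\<bar> powr p)"
   by (rule integral_mono_AE'[OF wi_p(1)]) (auto intro!: AE_I2 capp_props[OF p])
  then show ?thesis unfolding equidistributed[OF t, of "real n", simplified] by simp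
 qed
 have lim: "AE x in TM. (%n. capp p (real n) (wc t x)) ----> \<bar>wc t x\<bar> powr p"
 proof (rule AE_I2)
  fix x
  obtain N :: nat where N: "\<bar>wc t x\<bar> <= real N" using real_arch_simple by blast
  have "\<forall>\<^sub>F n in sequentially. capp p (real n) (wc t x) = \<bar>wc t x\<bar> powr p"
   using eventually_ge_at_top[of N] by eventually_elim (use N in "simp add: capp_def min_def")
  then show "(%n. capp p (real n) (wc t x)) ----> \<bar>wc t x\<bar> powr p" by (rule tendsto_eventually)
 qed
 show i: "L1 (%x. \<bar>wc t x\<bar> powr p)"
  by (rule Fatou_bound(1)[OF gi _ pm _ le lim]) (use capp_props(1)[OF p] in simp_all)
 have "(%n. AV x. capp p (real n) (wc t x)) ----> (AV x. \<bar>wc t x\<bar> powr p)"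
  by (rule capp_L1_tendsto[OF m i p])
 moreover have "(%n. AV x. capp p (real n) (wc t x)) ----> (AV x. \<bar>wi x\<bar> powr p)"
  unfolding equidistributed[OF t of_nat_0_le_iff] by (rule capp_L1_tendsto[OF wi_measurable wi_p(1) p])
 ultimately show "(AV x. \<bar>wc t x\<bar> powr p) = (AV x. \<bar>wi x\<bar> powr p)" by (rule LIMSEQ_unique)
qed

lemma wn_Lp: "t \<in> {0..T} ==> L1 (%x. \<bar>wn k t x\<bar> powr p)"
 by (rule cont_L1[OF cont_compose[OF powr_p_continuous smooth_cont[OF NS.w_smooth]]])

lemma diff_Lp:
 assumes "f \<in> TBorel" "L1 (%x. \<bar>f x\<bar> powr p)"
  and "g \<in> TBorel" "L1 (%x. \<bar>g x\<bar> powr p)"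
 shows "L1 (%x. \<bar>f x - g x :: real\<bar> powr p)"
  and "(AV x. \<bar>f x - g x\<bar> powr p) <= 2 powr p * ((AV x. \<bar>f x\<bar> powr p) + (AV x. \<bar>g x\<bar> powr p))"
proof -
 have b: "L1 (%x. 2 powr p * (\<bar>f x\<bar> powr p + \<bar>g x\<bar> powr p))" by (intro integrable_mult_right integrable_add assms)
 have le: "\<bar>f x - g x\<bar> powr p <= 2 powr p * (\<bar>f x\<bar> powr p + \<bar>g x\<bar> powr p)" for x using powr_add_le[OF p, of "f x" "- g x"] by simp
 have m: "(%x. \<bar>f x - g x\<bar> powr p) \<in> TBorel"
  by (rule measurable_compose[OF borel_measurable_diff[OF assms(1,3)] cont_Borel[OF powr_p_continuous]])
 show i: "L1 (%x. \<bar>f x - g x\<bar> powr p)"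
  by (rule integrable_bound[OF b m], rule AE_I2) (use le in simp)
 have "(AV x. \<bar>f x - g x\<bar> powr p) <= (AV x. 2 powr p * (\<bar>f x\<bar> powr p + \<bar>g x\<bar> powr p))" by (rule integral_mono[OF i b le])
 also have "... = 2 powr p * ((AV x. \<bar>f x\<bar> powr p) + (AV x. \<bar>g x\<bar> powr p))"
  by (simp only: integral_mult_right_zero integral_add[OF assms(2,4)])
 finally show "(AV x. \<bar>f x - g x\<bar> powr p) <= 2 powr p * ((AV x. \<bar>f x\<bar> powr p) + (AV x. \<bar>g x\<bar> powr p))" .
qed

text \<open>The excess of \<open>w\<^sup>k(t)\<close> is small: its \<open>p\<close>-th power has an integral at most that of the initial datum, and its capped power is close to that of the
limit, whose distribution is known. The level \<open>R\<close> is chosen for the tail of \<open>wi\<close>, and the closeness in \<open>L\<^sup>1\<close> afterwards.\<close>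
lemma uniform_Lp:
 assumes e: "e > 0"
 obtains N where "!!k t. k >= N ==> t \<in> {0..T} ==> (AV x. \<bar>wn k t x - wc t x\<bar> powr p) <= e"
proof -
 let ?N0 = "AV x. \<bar>wi x\<bar> powr p"
 \<comment> \<open>the factor of the tails in \<open>powr_diff_tail\<close>; the bounds below add up to \<open>4 * e / 5\<close>\<close>
 define A where "A = 2 * 2 powr p"
 have A: "A > 0" by (simp add: A_def)
 define \<delta> where "\<delta> = e / (5 * A)"
 have \<delta>: "\<delta> > 0" "A * \<delta> = e / 5" using e A by (simp_all add: \<delta>_def)
 have "\<forall>\<^sub>F n in sequentially. ?N0 - \<delta> < (AV x. capp p (real n) (wi x))"
  using \<delta> by (intro order_tendstoD(1)[OF capp_L1_tendsto[OF wi_measurable wi_p(1) p]]) simp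
 from eventually_conj[OF this eventually_ge_at_top[of 1]]
 obtain n :: nat where n: "?N0 - \<delta> < (AV x. capp p (real n) (wi x)) & 1 <= n"
  using eventually_happens'[OF sequentially_bot] by blast
 define R where "R = real n"
 have R: "R > 0" "?N0 - (AV x. capp p R (wi x)) < \<delta>" using n by (auto simp: R_def)
 define P where "P = p * R powr (p - 1)"
 define C where "C = (4 * R) powr (p - 1) + A * P"
 have P0: "P >= 0" using p by (simp add: P_def)
 have C0: "C >= 0" using A P0 by (simp add: C_def)
 define \<eta> where "\<eta> = e / (5 * (C + 1))"
 have C1: "C + 1 > 0" using C0 by linarith
 have \<eta>: "\<eta> > 0" using e C1 by (simp add: \<eta>_def)
 have C\<eta>: "C * \<eta> <= e / 5"
 proof -
  have "C * \<eta> <= (C + 1) * \<eta>" using \<eta> by (intro mult_right_mono) auto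
  also have "... = e / 5" using C1 by (simp add: \<eta>_def field_simps)
  finally show ?thesis .
 qed
 obtain N1 where N1: "!!k t. k >= N1 ==> t \<in> {0..T} ==> (AV x. \<bar>wn k t x - wc t x\<bar>) <= \<eta>" using uniform_L1[OF \<eta>] by blast
 have "\<forall>\<^sub>F k in sequentially. (AV x. \<bar>w0 k x\<bar> powr p) < ?N0 + \<delta>"
  by (rule w0_norm[OF \<delta>(1)])
 then obtain N2 where N2: "!!k. k >= N2 ==> (AV x. \<bar>w0 k x\<bar> powr p) < ?N0 + \<delta>" unfolding eventually_sequentially by blast
 show ?thesis
 proof (rule that[of "max N1 N2"])
  fix k t assume "k >= max N1 N2" and t: "t \<in> {0..T}"
  then have k: "k >= N1" "k >= N2" by simp_all
  have R0: "R >= 0" using R by simp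
  have cb: "capp p R \<in> Borel" by (rule cont_Borel[OF capp_continuous[OF p R0]])
  have ci: "L1 (%x. capp p R (f x))" if "L1 f" for f
   by (rule bounded_L1[OF measurable_compose[OF integrable_measurable[OF that] cb], where C="R powr p"])
    (use capp_props[OF p R0] in simp)
  note wni = wn_integrable[OF t, of k] and wci = wc_int[OF t]
  note di = integrable_abs[OF integrable_diff[OF wni wci]]
  note ta = integrable_diff[OF wn_Lp[OF t, of k] ci[OF wni]] and tb = integrable_diff[OF wc_Lp(1)[OF t] ci[OF wci]]
  have Ta: "(AV x. \<bar>wn k t x\<bar> powr p - capp p R (wn k t x)) <= 2 * \<delta> + P * \<eta>"
  proof -
   have "(AV x. capp p R (wc t x)) - (AV x. capp p R (wn k t x)) <= (AV x. P * \<bar>wn k t x - wc t x\<bar>)"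
    unfolding integral_diff[OF ci[OF wci] ci[OF wni], symmetric]
    by (rule order_trans[OF abs_ge_self LINT_abs_le[OF integrable_mult_right[OF di]]])
     (use capp_lipschitz[OF p R0] abs_minus_commute in "metis P_def")
   also have "... <= P * \<eta>" using N1[OF k(1) t] P0 by (simp add: mult_left_mono)
   finally have 1: "(AV x. capp p R (wi x)) - (AV x. capp p R (wn k t x)) <= P * \<eta>"
    unfolding equidistributed[OF t R0] .
   have 2: "(AV x. \<bar>wn k t x\<bar> powr p) <= (AV x. \<bar>w0 k x\<bar> powr p)"
    by (rule NS.Lp_contraction[OF _ t]) (use p in simp)
   show ?thesis unfolding integral_diff[OF wn_Lp[OF t, of k] ci[OF wni]]
    using 1 2 N2[OF k(2)] R(2) by linarith
  qed
  have Tb: "(AV x. \<bar>wc t x\<bar> powr p - capp p R (wc t x)) <= \<delta>"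
   unfolding integral_diff[OF wc_Lp(1)[OF t] ci[OF wci]] wc_Lp(2)[OF t] equidistributed[OF t R0] using R(2) by linarith
  have bi: "L1 (%x. (4 * R) powr (p - 1) * \<bar>wn k t x - wc t x\<bar> + A * ((\<bar>wn k t x\<bar> powr p - capp p R (wn k t x)) + (\<bar>wc t x\<bar> powr p - capp p R (wc t x))))"
   by (rule integrable_add[OF integrable_mult_right[OF di] integrable_mult_right[OF integrable_add[OF ta tb]]])
  have "(AV x. \<bar>wn k t x - wc t x\<bar> powr p) <= (AV x. (4 * R) powr (p - 1) * \<bar>wn k t x - wc t x\<bar> + A * ((\<bar>wn k t x\<bar> powr p - capp p R (wn k t x)) + (\<bar>wc t x\<bar> powr p - capp p R (wc t x))))"
   by (rule integral_mono[OF diff_Lp(1)[OF integrable_measurable[OF wni] wn_Lp[OF t] integrable_measurable[OF wci] wc_Lp(1)[OF t]] bi])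
    (use powr_diff_tail[OF p R(1)] in "simp add: A_def")
  also have "... = (4 * R) powr (p - 1) * (AV x. \<bar>wn k t x - wc t x\<bar>) + A * ((AV x. \<bar>wn k t x\<bar> powr p - capp p R (wn k t x)) + (AV x. \<bar>wc t x\<bar> powr p - capp p R (wc t x)))"
   by (simp only: integral_add[OF integrable_mult_right[OF di] integrable_mult_right[OF integrable_add[OF ta tb]]]
     integral_mult_right_zero integral_add[OF ta tb])
  also have "... <= (4 * R) powr (p - 1) * \<eta> + A * ((2 * \<delta> + P * \<eta>) + \<delta>)"
   using A by (intro add_mono mult_left_mono N1[OF k(1) t] Ta Tb) auto
  also have "... = C * \<eta> + 3 * (A * \<delta>)" by (simp add: C_def algebra_simps)
  also have "... <= e" using C\<eta> \<delta>(2) e by linarith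
  finally show "(AV x. \<bar>wn k t x - wc t x\<bar> powr p) <= e" .
 qed
qed

lemma wc_continuous_Lp:
 assumes t: "t \<in> {0..T}"
 shows "((%s. AV x. \<bar>wc s x - wc t x\<bar> powr p) \<longlongrightarrow> 0) (at t within {0..T})"
proof (rule order_tendstoI)
 fix a :: real assume "a < 0"
 moreover have "0 <= (AV x. \<bar>wc s x - wc t x\<bar> powr p)" for s by (rule integral_nonneg) simp
 ultimately show "\<forall>\<^sub>F s in at t within {0..T}. a < (AV x. \<bar>wc s x - wc t x\<bar> powr p)"
  by (intro always_eventually allI) (rule less_le_trans)
next
 fix e :: real assume e: "0 < e"
 define B where "B = 2 powr p + 2 powr p * 2 powr p + 2 powr p * 2 powr p"
 have B: "B > 0" by (simp add: B_def add_pos_pos)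
 define \<delta> where "\<delta> = e / (2 * B)"
 have \<delta>: "\<delta> > 0" "B * \<delta> = e / 2" using e B by (simp_all add: \<delta>_def)
 obtain N where N: "!!k t. k >= N ==> t \<in> {0..T} ==> (AV x. \<bar>wn k t x - wc t x\<bar> powr p) <= \<delta>" using uniform_Lp[OF \<delta>(1)] by blast
 have "\<forall>\<^sub>F s in at t within {0..T}. (AV x. \<bar>wn N s x - wn N t x\<bar> powr p) < \<delta>"
  by (rule order_tendstoD(2)[OF wn_continuous_Lq[OF _ t]]) (use p \<delta> in auto)
 moreover have "\<forall>\<^sub>F s in at t within {0..T}. s \<in> {0..T}" by (simp add: eventually_at_filter)
 ultimately show "\<forall>\<^sub>F s in at t within {0..T}. (AV x. \<bar>wc s x - wc t x\<bar> powr p) < e"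
 proof eventually_elim
  fix s assume *: "(AV x. \<bar>wn N s x - wn N t x\<bar> powr p) < \<delta>" and s: "s \<in> {0..T}"
  note m = integrable_measurable[OF wc_int] and mn = integrable_measurable[OF wn_integrable]
  note d1 = diff_Lp[OF mn[OF s] wn_Lp[OF s] m[OF s] wc_Lp(1)[OF s], of N]
  note d2 = diff_Lp[OF mn[OF t] wn_Lp[OF t] m[OF t] wc_Lp(1)[OF t], of N]
  note d3 = diff_Lp[OF mn[OF s] wn_Lp[OF s] mn[OF t] wn_Lp[OF t], of N N]
  note md = borel_measurable_diff
  have "(AV x. \<bar>wc s x - wc t x\<bar> powr p) = (AV x. \<bar>(wn N s x - wc t x) - (wn N s x - wc s x)\<bar> powr p)" by simp
  also have "... <= 2 powr p * ((AV x. \<bar>wn N s x - wc t x\<bar> powr p) + (AV x. \<bar>wn N s x - wc s x\<bar> powr p))"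
   by (rule diff_Lp(2)[OF md[OF mn[OF s] m[OF t]] diff_Lp(1)[OF mn[OF s] wn_Lp[OF s] m[OF t] wc_Lp(1)[OF t]] md[OF mn[OF s] m[OF s]] d1(1)])
  also have "(AV x. \<bar>wn N s x - wc t x\<bar> powr p) = (AV x. \<bar>(wn N s x - wn N t x) - (wc t x - wn N t x)\<bar> powr p)" by simp
  also have "... <= 2 powr p * ((AV x. \<bar>wn N s x - wn N t x\<bar> powr p) + (AV x. \<bar>wc t x - wn N t x\<bar> powr p))"
   by (rule diff_Lp(2)[OF md[OF mn[OF s] mn[OF t]] d3(1) md[OF m[OF t] mn[OF t]] diff_Lp(1)[OF m[OF t] wc_Lp(1)[OF t] mn[OF t] wn_Lp[OF t]]])
  also have "(AV x. \<bar>wc t x - wn N t x\<bar> powr p) = (AV x. \<bar>wn N t x - wc t x\<bar> powr p)" by (simp only: abs_minus_commute)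
  finally have "(AV x. \<bar>wc s x - wc t x\<bar> powr p) <= 2 powr p * (2 powr p * ((AV x. \<bar>wn N s x - wn N t x\<bar> powr p)
    + (AV x. \<bar>wn N t x - wc t x\<bar> powr p)) + (AV x. \<bar>wn N s x - wc s x\<bar> powr p))" by simp
  also have "... <= 2 powr p * (2 powr p * (\<delta> + \<delta>) + \<delta>)"
   using * N[of N t] N[of N s] s t by (intro mult_left_mono add_mono) auto
  also have "... = B * \<delta>" by (simp add: B_def algebra_simps)
  also have "... < e" using \<delta>(2) e by simp
  finally show "(AV x. \<bar>wc s x - wc t x\<bar> powr p) < e" .
 qed
qed

end

end

section \<open>The convergence theorem\<close>

text \<open>Convexity of the power, with weights \<open>1 - l\<close> and \<open>l\<close>. As \<open>l\<close> tends to zero the first factor tends to one, which gives the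
convergence of norms under convergence in norm.\<close>
lemma powr_add_split:
 fixes x y l p :: real
 assumes p: "p > 1" and l: "0 < l" "l < 1" and x: "x >= 0" "y >= 0"
 shows "(x + y) powr p <= (1 - l) powr (1 - p) * x powr p + l powr (1 - p) * y powr p"
proof -
 have ge1: "1 <= (1 - l) powr (1 - p)" "1 <= l powr (1 - p)"
  using powr_mono2'[of "1 - p" "1 - l" 1] powr_mono2'[of "1 - p" l 1] l p by simp_all
 have e: "c * (z / c) powr p = c powr (1 - p) * z powr p" if "c > 0" for c z
  using that by (simp add: powr_divide powr_diff)
 consider "x = 0" | "y = 0" | "x > 0" "y > 0" using x by linarith
 then show ?thesis
 proof cases
  case 1
  then show ?thesis using ge1(2) p mult_right_mono[OF ge1(2), of "y powr p"] by simp
 next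
  case 2
  then show ?thesis using ge1(1) p mult_right_mono[OF ge1(1), of "x powr p"] by simp
 next
  case 3
  have "((1 - l) *\<^sub>R (x / (1 - l)) + l *\<^sub>R (y / l)) powr p <= (1 - l) * (x / (1 - l)) powr p + l * (y / l) powr p"
   using convex_onD[OF powr_convex[of p], of l "x / (1 - l)" "y / l"] p l 3 by simp
  moreover have "(1 - l) *\<^sub>R (x / (1 - l)) + l *\<^sub>R (y / l) = x + y" using l by simp
  ultimately show ?thesis using e[of "1 - l" x] e[of l y] l by simp
 qed
qed

lemma AE_time_spacetime:
 assumes "AE t in lebesgue_on {0<..<T::real}. Q t"
 shows "AE q in spacetime_measure T. Q (fst q)"
proof -
 have "AE t in lebesgue. t \<in> {0<..<T} --> Q t" using assms by (simp add: AE_restrict_space_iff)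
 then have "AE t in lborel. t \<in> {0<..<T} --> Q t" by (simp add: AE_completion_iff)
 then obtain N where N: "N \<in> null_sets lborel" "{t \<in> space lborel. ~ (t \<in> {0<..<T} --> Q t)} \<subseteq> N" by (rule AE_E3) (auto simp: null_sets_def)
 have "N \<times> (UNIV :: (real^2) set) \<in> null_sets (lborel \<Otimes>\<^sub>M lborel)" by (rule lborel.times_in_null_sets1[OF N(1)]) simp
 then have "N \<times> (UNIV :: (real^2) set) \<in> null_sets lborel" by (simp only: lborel_prod)
 then have "AE q in lborel. q \<notin> N \<times> (UNIV :: (real^2) set)" by (rule AE_not_in)
 then have "AE q in lebesgue. q \<notin> N \<times> (UNIV :: (real^2) set)" by (rule AE_completion)
 then have "AE q in lebesgue. q \<in> {0<..<T} \<times> (torus :: (real^2) set) --> Q (fst q)"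
  by eventually_elim (use N(2) in auto)
 then show ?thesis by (simp add: AE_restrict_space_iff)
qed

lemma Lp_norm_real: "Lp_norm p f = (AV x. \<bar>f x\<bar> powr p) powr (1 / p)" for f :: "real^2 => real"
 by (simp add: Lp_norm_def)

lemma Lp_norm_nonneg: "0 <= Lp_norm p f" by (simp add: Lp_norm_def)

lemma Lp_norm_bound:
 assumes p: "p > 0" and K: "Lp_norm p f <= K"
 shows "(AV x. norm (f x) powr p) <= \<bar>K\<bar> powr p"
proof -
 let ?I = "AV x. norm (f x) powr p"
 have I: "0 <= ?I" by (rule integral_nonneg) simp
 have "?I = (?I powr (1 / p)) powr p" using p I by (simp add: powr_powr)
 also have "... <= \<bar>K\<bar> powr p" by (rule powr_mono2) (use p K in "auto simp: Lp_norm_def")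
 finally show ?thesis .
qed

lemma Lp_norm_le:
 fixes f :: "real^2 => real"
 assumes p: "p > 0" and e: "e >= 0" and le: "(AV x. \<bar>f x\<bar> powr p) <= e powr p"
 shows "Lp_norm p f <= e"
proof -
 have "Lp_norm p f <= (e powr p) powr (1 / p)" unfolding Lp_norm_real
  by (rule powr_mono2[OF _ _ le]) (use p in "auto intro: integral_nonneg")
 also have "... = e" using p e by (simp add: powr_powr)
 finally show ?thesis .
qed

lemma Lp_norm_tendsto:
 fixes f :: "'a => real^2 => real"
 assumes p: "p > 0" and lim: "((%s. AV x. \<bar>f s x\<bar> powr p) \<longlongrightarrow> 0) F"
 shows "((%s. Lp_norm p (f s)) \<longlongrightarrow> 0) F"
 unfolding Lp_norm_real
proof (rule tendsto_zero_powrI[OF lim tendsto_const])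
 show "\<forall>\<^sub>F s in F. 0 <= (AV x. \<bar>f s x\<bar> powr p)" by (intro always_eventually allI integral_nonneg) simp
qed (use p in simp)

text \<open>On a space of finite measure \<open>\<bar>g\<bar> \<le> 1 + \<bar>g\<bar>\<^sup>p\<close>, so the \<open>p\<close>-integrable weak derivatives are bounded in \<open>L\<^sup>1\<close> uniformly in time.\<close>
lemma sobolev_W11:
 assumes u: "u \<in> Linf_W1p T p" and p: "p > 1"
 obtains G where "AE t in time_on T. W11_bounded G (u t)"
proof -
 have "\<forall>l. \<exists>g. g \<in> Linf_Lp T p & (AE t in time_on T. weak_partial l (u t) (g t))"
  using u unfolding Linf_W1p_def mem_Collect_eq Bex_def by (rule conjunct2)
 from choice[OF this] obtain g where g': "\<forall>l. g l \<in> Linf_Lp T p & (AE t in time_on T. weak_partial l (u t) (g l t))" ..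
 have g: "g l \<in> Linf_Lp T p" "AE t in time_on T. weak_partial l (u t) (g l t)" for l
  using spec[OF g', of l] by (rule conjunct1, rule conjunct2)
 have "\<forall>l. \<exists>K. AE t in time_on T. g l t \<in> Lp p & Lp_norm p (g l t) <= K"
  using g(1) unfolding Linf_Lp_def mem_Collect_eq by (intro allI) (rule conjunct2)
 from choice[OF this] obtain K where K': "\<forall>l. AE t in time_on T. g l t \<in> Lp p & Lp_norm p (g l t) <= K l" ..
 note K = spec[OF K']
 define G where "G = 1 + (\<bar>K 1\<bar> powr p + \<bar>K 2\<bar> powr p)"
 have KG: "1 + \<bar>K l\<bar> powr p <= G" for l using exhaust_2[of l] by (auto simp: G_def)
 have G0: "0 <= G" by (simp add: G_def add_nonneg_nonneg)
 have "AE t in time_on T. W11_bounded G (u t)"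
  using g(2)[of 1] g(2)[of 2] K[of 1] K[of 2]
 proof eventually_elim
  fix t assume "weak_partial 1 (u t) (g 1 t)" "weak_partial 2 (u t) (g 2 t)"
   "g 1 t \<in> Lp p & Lp_norm p (g 1 t) <= K 1" "g 2 t \<in> Lp p & Lp_norm p (g 2 t) <= K 2"
  then have wp: "weak_partial l (u t) (g l t)" and gl: "g l t \<in> Lp p" "Lp_norm p (g l t) <= K l" for l
   using exhaust_2[of l] by (elim disjE; simp)+
  have ui: "L1 (u t)" and gi: "L1 (g l t)" for l
   using wp[of l] unfolding weak_partial_def by blast+
  note nth = bounded_linear_vec_nth
  show "W11_bounded G (u t)" unfolding W11_bounded_def
  proof (intro conjI allI impI)
   show "0 <= G" by (rule G0)
   show "L1 (%x. u t x $ i)" for i by (rule integrable_bounded_linear[OF nth ui])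
   fix i l :: 2 and \<phi> :: "real^2 => real" and R :: real
   assume \<phi>: "torus_smooth \<phi>" and R: "\<forall>x. \<bar>\<phi> x\<bar> <= R"
   have R0: "0 <= R" using R[rule_format, of 0] by linarith
   have s: "L1 (%x. \<psi> x *\<^sub>R f x)" if \<psi>: "torus_smooth \<psi>" and f: "L1 f" for \<psi> and f :: "real^2 => real^2"
   proof -
    obtain C where C: "!!x. \<bar>\<psi> x\<bar> <= C" using torus_smooth_bound[OF \<psi>] by blast
    have "L1 (%x. C * norm (f x))" by (intro integrable_mult_right integrable_norm f)
    then show ?thesis
    proof (rule integrable_bound)
     show "(%x. \<psi> x *\<^sub>R f x) \<in> TBorel"
      by (rule borel_measurable_scaleR[OF smooth_measurable[OF \<psi>] integrable_measurable[OF f]])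
     show "AE x in TM. norm (\<psi> x *\<^sub>R f x) <= norm (C * norm (f x))"
     proof (rule AE_I2)
      fix x have "\<bar>\<psi> x\<bar> * norm (f x) <= C * norm (f x)" by (rule mult_right_mono[OF C norm_ge_zero])
      also have "... <= \<bar>C * norm (f x)\<bar>" by (rule abs_ge_self)
      finally show "norm (\<psi> x *\<^sub>R f x) <= norm (C * norm (f x))" by simp
     qed
    qed
   qed
   have e1: "(AV x. partial l \<phi> x * u t x $ i) = (AV x. partial l \<phi> x *\<^sub>R u t x) $ i"
    using integral_bounded_linear[OF nth s[OF smooth_partial[OF \<phi>] ui], of l i] by simp
   have e2: "(AV x. \<phi> x * g l t x $ i) = (AV x. \<phi> x *\<^sub>R g l t x) $ i"
    using integral_bounded_linear[OF nth s[OF \<phi> gi[of l]], of i] by simp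
   have "(AV x. partial l \<phi> x * u t x $ i) = - (AV x. \<phi> x * g l t x $ i)"
    unfolding e1 e2 using wp[of l] \<phi> by (simp add: weak_partial_def)
   then have "\<bar>AV x. partial l \<phi> x * u t x $ i\<bar> = \<bar>AV x. \<phi> x * g l t x $ i\<bar>" by simp
   also have "... <= (AV x. R * (1 + norm (g l t x) powr p))"
   proof (rule LINT_abs_le)
    show "L1 (%x. R * (1 + norm (g l t x) powr p))" using gl(1)[of l] by (simp add: Lp_def)
    fix x
    have "\<bar>g l t x $ i\<bar> <= norm (g l t x)" by (rule component_le_norm_cart)
    also have "... <= 1 + norm (g l t x) powr p" using powr_tail(2)[OF p, of 1 "norm (g l t x)"] by simp
    finally have "\<bar>\<phi> x\<bar> * \<bar>g l t x $ i\<bar> <= R * (1 + norm (g l t x) powr p)" using R R0 by (intro mult_mono) auto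
    then show "\<bar>\<phi> x * g l t x $ i\<bar> <= R * (1 + norm (g l t x) powr p)" by (simp add: abs_mult)
   qed
   also have "... = R * (1 + (AV x. norm (g l t x) powr p))"
    using gl(1)[of l] by (simp add: Lp_def)
   also have "... <= R * (1 + \<bar>K l\<bar> powr p)" using Lp_norm_bound[OF _ gl(2)[of l]] p R0 by (intro mult_left_mono) auto
   also have "... <= R * G" by (rule mult_left_mono[OF KG R0])
   finally show "\<bar>AV x. partial l \<phi> x * u t x $ i\<bar> <= G * R" by (simp only: mult.commute)
  qed
 qed
 then show ?thesis by (rule that)
qed

lemma W11_bounded_cong:
 assumes W: "W11_bounded G u" and ae: "AE x in TM. u x = v x" and v: "v \<in> TBorel"
 shows "W11_bounded G v"
proof -
 have m: "(%x. v x $ i) \<in> TBorel" for i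
  using measurable_compose[OF v cont_Borel[of "%v. v $ i"]] by (simp add: continuous_on_component)
 have aei: "AE x in TM. u x $ i = v x $ i" for i using ae by eventually_elim simp
 have ui: "L1 (%x. u x $ i)" for i using W by (simp add: W11_bounded_def)
 have vi: "L1 (%x. v x $ i)" for i
  using integrable_cong_AE_imp[OF ui m] aei[of i] by (simp add: eq_commute)
 have "(AV x. partial l \<phi> x * v x $ i) = (AV x. partial l \<phi> x * u x $ i)" if "torus_smooth \<phi>" for l i \<phi>
 proof (rule integral_cong_AE)
  show "AE x in TM. partial l \<phi> x * v x $ i = partial l \<phi> x * u x $ i" using aei[of i] by eventually_elim simp
 qed (rule integrable_measurable[OF smooth_L1_mult[OF smooth_partial[OF that] vi]]
   integrable_measurable[OF smooth_L1_mult[OF smooth_partial[OF that] ui]])+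
 then show ?thesis using W vi unfolding W11_bounded_def by simp
qed

lemma velocity_L2:
 assumes u: "u \<in> Linf_Lp T 2" and ub: "v \<in> Borel"
  and ae: "AE t in time_on T. AE x in TM. u t x = v (t, x)"
 shows "integrable (stm T) (%q. (norm (v q :: real^2))^2)"
proof -
 obtain K where K: "AE t in time_on T. u t \<in> Lp 2 & Lp_norm 2 (u t) <= K" using u by (auto simp: Linf_Lp_def)
 have nb: "(%q. (norm (v q))^2) \<in> Borel"
  by (rule borel_measurable_power, rule measurable_compose[OF ub borel_measurable_norm])
 show ?thesis
 proof (rule stm_integrable_curry[OF nb, where C="\<bar>K\<bar> powr 2"])
  show "AE t in time_on T. L1 (%x. (norm (v (t, x)))^2) & (AV x. \<bar>(norm (v (t, x)))^2\<bar>) <= \<bar>K\<bar> powr 2"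
   using K ae
  proof eventually_elim
   fix t assume k: "u t \<in> Lp 2 & Lp_norm 2 (u t) <= K" and a: "AE x in TM. u t x = v (t, x)"
   have i: "L1 (%x. norm (u t x) powr 2)" using k by (simp add: Lp_def)
   have m: "(%x. (norm (v (t, x)))^2) \<in> TBorel" by (rule torus_measurable_borel[OF borel_section[OF nb]])
   have a2: "AE x in TM. norm (u t x) powr 2 = (norm (v (t, x)))^2" using a by eventually_elim simp
   have "L1 (%x. (norm (v (t, x)))^2)" by (rule integrable_cong_AE_imp[OF i m]) (use a2 in "simp add: eq_commute")
   moreover have "(AV x. norm (u t x) powr 2) = (AV x. (norm (v (t, x)))^2)"
    by (rule integral_cong_AE[OF integrable_measurable[OF i] m a2])
   ultimately show "L1 (%x. (norm (v (t, x)))^2) & (AV x. \<bar>(norm (v (t, x)))^2\<bar>) <= \<bar>K\<bar> powr 2"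
    using Lp_norm_bound[of 2 "u t" K] k by simp
  qed
 qed
qed

text \<open>The only use of the Lagrangian representation of the vorticity.\<close>
lemma flow_equidistributed:
 assumes X: "regular_lagrangian_flow T u X" and T: "T > 0" and \<omega>0: "\<omega>0 \<in> TBorel"
  and t: "t \<in> {0..T}" and ae: "AE x in TM. f x = \<omega>0 (X t 0 x)" and f: "f \<in> TBorel"
 shows "distr TM borel f = distr TM borel (\<omega>0 :: real^2 => real)"
proof -
 have mp: "X t 0 \<in> measurable TM TM" "distr TM TM (X t 0) = TM"
  using X t T by (auto simp: regular_lagrangian_flow_def measure_preserving_torus_def)
 have "distr TM borel f = distr TM borel (%x. \<omega>0 (X t 0 x))"
  by (rule distr_cong_AE[OF refl refl ae f measurable_compose[OF mp(1) \<omega>0]])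
 also have "... = distr (distr TM TM (X t 0)) borel \<omega>0"
  using distr_distr[OF \<omega>0 mp(1)] by (simp add: o_def)
 finally show ?thesis by (simp only: mp(2))
qed

lemma curl_cong:
 assumes bs: "biot_savart \<omega> u" and au: "AE x in TM. u x = v x" and aw: "AE x in TM. \<omega> x = w x"
  and v: "v \<in> TBorel" and w: "w \<in> TBorel"
  and m: "avg w = m" and \<phi>: "torus_smooth \<phi>"
 shows "(AV x. v x $ 1 * partial 2 \<phi> x - v x $ 2 * partial 1 \<phi> x) = (AV x. (w x - m) * \<phi> x)"
proof -
 note b = biot_savart_divfree[OF bs \<phi>]
 have vm: "(%x. v x $ i) \<in> TBorel" for i
  using measurable_compose[OF v cont_Borel[of "%v. v $ i"]] by (simp add: continuous_on_component)
 note pm = smooth_measurable[OF smooth_partial[OF \<phi>]] and \<phi>m = smooth_measurable[OF \<phi>]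
 have m': "avg \<omega> = m"
  unfolding m[symmetric] by (rule integral_cong_AE[OF integrable_measurable[OF b(3)] w aw])
 have "(AV x. v x $ 1 * partial 2 \<phi> x - v x $ 2 * partial 1 \<phi> x) = (AV x. u x $ 1 * partial 2 \<phi> x - u x $ 2 * partial 1 \<phi> x)"
 proof (rule integral_cong_AE)
  show "AE x in TM. v x $ 1 * partial 2 \<phi> x - v x $ 2 * partial 1 \<phi> x = u x $ 1 * partial 2 \<phi> x - u x $ 2 * partial 1 \<phi> x"
   using au by eventually_elim simp
 qed (rule borel_measurable_diff borel_measurable_times vm pm integrable_measurable[OF b(4)] integrable_measurable[OF b(5)])+
 also have "... = (AV x. (\<omega> x - m) * \<phi> x)" using b(2) unfolding m' .
 also have "... = (AV x. (w x - m) * \<phi> x)"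
 proof (rule integral_cong_AE)
  show "AE x in TM. (\<omega> x - m) * \<phi> x = (w x - m) * \<phi> x" using aw by eventually_elim simp
 qed (rule borel_measurable_times borel_measurable_diff \<phi>m w borel_measurable_const integrable_measurable[OF b(3)])+
 finally show ?thesis .
qed

text \<open>Convergence uniformly in time along the given sequence. The continuous representative is chosen to coincide with \<open>\<omega> t\<close> itself
at every time at which \<open>\<omega> t\<close> is the limit, so that no measurability in time has to be proved for the chosen values.\<close>
lemma vanishing_viscosity_limit:
 fixes T p :: real and \<omega>0 :: "real^2 => real" and \<nu> :: "nat => real" and w0 :: "nat => real^2 => real"
  and un :: "nat => real => real^2 => real^2" and wn :: "nat => real => real^2 => real"
  and u :: "real => real^2 => real^2" and \<omega> :: "real => real^2 => real"
 assumes T: "T > 0" and p: "p > 1" and \<omega>0: "\<omega>0 \<in> Lp p"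
  and \<nu>: "!!k. \<nu> k > 0" "\<nu> ----> 0" and w0: "!!k. torus_smooth (w0 k)"
  and w0_lim: "(%k. Lp_norm p (%x. w0 k x - \<omega>0 x)) ----> 0"
  and ns: "!!k. navier_stokes_solution T (\<nu> k) (w0 k) (un k) (wn k)"
  and lag: "lagrangian_euler_solution T p \<omega>0 u \<omega>" and ws: "weakstar_Linf_L2 T un u"
 obtains \<omega>c where "AE (t, x) in spacetime_measure T. \<omega>c t x = \<omega> t x"
  and "!!k. wn k \<in> C_Lp T p" and "\<omega>c \<in> C_Lp T p"
  and "!!e. e > 0 ==> \<exists>N. \<forall>k\<ge>N. \<forall>t\<in>{0..T}. Lp_norm p (%x. wn k t x - \<omega>c t x) <= e"
proof -
 have p0: "p > 0" using p by simp
 have NS: "ns_solution T (\<nu> k) (w0 k) (un k) (wn k)" for k by (rule ns_solution.intro[OF ns T \<nu>(1)])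
 have \<omega>0m: "\<omega>0 \<in> TBorel" and \<omega>0p: "L1 (%x. \<bar>\<omega>0 x\<bar> powr p)" using \<omega>0 by (simp_all add: Lp_def)
 have pc: "cont (%z::real. \<bar>z\<bar> powr p)" using p by (intro continuous_intros continuous_on_powr') auto
 have w0c: "cont (w0 k)" for k by (rule smooth_cont[OF w0])
 have w0p: "L1 (%x. \<bar>w0 k x\<bar> powr p)" for k by (rule cont_L1[OF cont_compose[OF pc w0c]])
 have w0m: "w0 k \<in> TBorel" for k by (rule smooth_measurable[OF w0])
 let ?E = "%k. AV x. \<bar>w0 k x - \<omega>0 x\<bar> powr p"
 let ?N = "%k. AV x. \<bar>w0 k x\<bar> powr p" and ?Z = "AV x. \<bar>\<omega>0 x\<bar> powr p"
 have E0: "0 <= ?E k" for k by (rule integral_nonneg) simp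
 have N00: "0 <= ?Z" by (rule integral_nonneg) simp
 have dm: "(%x. w0 k x - \<omega>0 x) \<in> TBorel" for k by (rule borel_measurable_diff[OF w0m \<omega>0m])
 have dp: "L1 (%x. \<bar>w0 k x - \<omega>0 x\<bar> powr p)" for k
 proof (rule integrable_bound)
  show "L1 (%x. 2 powr p * (\<bar>w0 k x\<bar> powr p + \<bar>\<omega>0 x\<bar> powr p))"
   by (intro integrable_mult_right integrable_add w0p \<omega>0p)
  show "(%x. \<bar>w0 k x - \<omega>0 x\<bar> powr p) \<in> TBorel" by (rule measurable_compose[OF dm cont_Borel[OF pc]])
  show "AE x in TM. norm (\<bar>w0 k x - \<omega>0 x\<bar> powr p) <= norm (2 powr p * (\<bar>w0 k x\<bar> powr p + \<bar>\<omega>0 x\<bar> powr p))"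
   by (rule AE_I2) (use powr_add_le[OF p, of "w0 k _" "- \<omega>0 _"] in simp)
 qed
 have Elim: "?E ----> 0"
 proof -
  have "(%k. Lp_norm p (%x. w0 k x - \<omega>0 x) powr p) ----> 0"
   by (rule tendsto_zero_powrI[OF w0_lim tendsto_const]) (use p in "auto simp: Lp_norm_nonneg")
  moreover have "Lp_norm p (%x. w0 k x - \<omega>0 x) powr p = ?E k" for k unfolding Lp_norm_real using p E0[of k] by (simp add: powr_powr)
  ultimately show ?thesis by simp
 qed
 have N_le: "?N k <= (1 - l) powr (1 - p) * ?Z + l powr (1 - p) * ?E k" if l: "0 < l" "l < 1" for k l
 proof -
  have "?N k <= (AV x. (1 - l) powr (1 - p) * \<bar>\<omega>0 x\<bar> powr p + l powr (1 - p) * \<bar>w0 k x - \<omega>0 x\<bar> powr p)"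
  proof (rule integral_mono[OF w0p integrable_add[OF integrable_mult_right[OF \<omega>0p] integrable_mult_right[OF dp]]])
   fix x
   have "\<bar>w0 k x\<bar> powr p <= (\<bar>\<omega>0 x\<bar> + \<bar>w0 k x - \<omega>0 x\<bar>) powr p" by (rule powr_mono2) (use p in auto)
   also have "... <= (1 - l) powr (1 - p) * \<bar>\<omega>0 x\<bar> powr p + l powr (1 - p) * \<bar>w0 k x - \<omega>0 x\<bar> powr p" by (rule powr_add_split[OF p l]) auto
   finally show "\<bar>w0 k x\<bar> powr p <= (1 - l) powr (1 - p) * \<bar>\<omega>0 x\<bar> powr p + l powr (1 - p) * \<bar>w0 k x - \<omega>0 x\<bar> powr p" .
  qed
  then show ?thesis by (simp only: integral_add[OF integrable_mult_right[OF \<omega>0p] integrable_mult_right[OF dp]] integral_mult_right_zero)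
 qed
 have norm_lim: "\<forall>\<^sub>F k in sequentially. ?N k < ?Z + \<delta>" if \<delta>: "\<delta> > 0" for \<delta>
 proof -
  have "((%l. (1 - l) powr (1 - p) * ?Z) \<longlongrightarrow> (1 - 0) powr (1 - p) * ?Z) (at_right 0)"
   by (intro tendsto_intros) auto
  then have "\<forall>\<^sub>F l in at_right 0. (1 - l) powr (1 - p) * ?Z < ?Z + \<delta> / 2" using \<delta> by (intro order_tendstoD(2)) auto
  moreover have "\<forall>\<^sub>F l in at_right (0::real). l \<in> {0<..<1}" by (rule eventually_at_right_real) simp
  ultimately have "\<forall>\<^sub>F l in at_right (0::real). l \<in> {0<..<1} & (1 - l) powr (1 - p) * ?Z < ?Z + \<delta> / 2" by eventually_elim blast
  then obtain l where l: "l \<in> {0<..<1} & (1 - l) powr (1 - p) * ?Z < ?Z + \<delta> / 2" using eventually_happens'[OF trivial_limit_at_right_real] by blast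
  have "(%k. l powr (1 - p) * ?E k) ----> l powr (1 - p) * 0" by (intro tendsto_mult_left Elim)
  then have "\<forall>\<^sub>F k in sequentially. l powr (1 - p) * ?E k < \<delta> / 2" using \<delta> by (intro order_tendstoD(2)) auto
  then show ?thesis
  proof eventually_elim
   fix k assume "l powr (1 - p) * ?E k < \<delta> / 2"
   then show "?N k < ?Z + \<delta>" using N_le[of l k] l by simp
  qed
 qed
 obtain B where B: "!!k. ?E k <= B"
  using convergent_imp_Bseq[OF convergentI[OF Elim]] unfolding Bseq_def by (metis abs_le_D1 real_norm_def)
 define Kp where "Kp = max ?Z ((1 - 1/2) powr (1 - p) * ?Z + (1/2) powr (1 - p) * B)"
 have NKp: "?N k <= Kp" for k

 proof -
  have "?N k <= (1 - 1/2) powr (1 - p) * ?Z + (1/2) powr (1 - p) * ?E k" by (rule N_le) simp_all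
  also have "... <= (1 - 1/2) powr (1 - p) * ?Z + (1/2) powr (1 - p) * B" by (intro add_left_mono mult_left_mono B) simp
  also have "... <= Kp" unfolding Kp_def by (rule max.cobounded2)
  finally show ?thesis .
 qed
 have L1lim: "(%k. AV x. \<bar>w0 k x - \<omega>0 x\<bar>) ----> 0"
 proof (rule LIMSEQ_I)
  fix e :: real assume e: "e > 0"
  define d where "d = e / 2"
  have d: "d > 0" using e by (simp add: d_def)
  have di: "L1 (%x. \<bar>w0 k x - \<omega>0 x\<bar>)" for k
  proof (rule integrable_bound[OF integrable_add[OF torus.integrable_const[of "1::real"] dp[of k]]])
   show "AE x in TM. norm \<bar>w0 k x - \<omega>0 x\<bar> <= norm (1 + \<bar>w0 k x - \<omega>0 x\<bar> powr p)"
    by (rule AE_I2) (use powr_tail(2)[OF p, of 1] in simp)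
  qed (rule borel_measurable_abs[OF dm])
  have le: "(AV x. \<bar>w0 k x - \<omega>0 x\<bar>) <= d + d powr (1 - p) * ?E k" for k
  proof -
   have "(AV x. \<bar>w0 k x - \<omega>0 x\<bar>) <= (AV x. d + d powr (1 - p) * \<bar>w0 k x - \<omega>0 x\<bar> powr p)"
    by (rule integral_mono[OF di integrable_add[OF torus.integrable_const integrable_mult_right[OF dp]] powr_tail(2)[OF p d]])
   also have "... = d + d powr (1 - p) * ?E k"
    by (subst integral_add[OF torus.integrable_const integrable_mult_right[OF dp]]) simp
   finally show ?thesis .
  qed
  have "(%k. d powr (1 - p) * ?E k) ----> d powr (1 - p) * 0" by (intro tendsto_mult_left Elim)
  then have "\<forall>\<^sub>F k in sequentially. d powr (1 - p) * ?E k < e / 2" using e by (intro order_tendstoD(2)) auto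
  then obtain N where N: "!!k. k >= N ==> d powr (1 - p) * ?E k < e / 2" unfolding eventually_sequentially by blast
  show "\<exists>no. \<forall>k\<ge>no. norm ((AV x. \<bar>w0 k x - \<omega>0 x\<bar>) - 0) < e"
  proof (intro exI[of _ N] allI impI)
   fix k assume "N <= k"
   moreover have "0 <= (AV x. \<bar>w0 k x - \<omega>0 x\<bar>)" by (rule integral_nonneg) simp
   ultimately show "norm ((AV x. \<bar>w0 k x - \<omega>0 x\<bar>) - 0) < e" using le[of k] N[of k] by (simp add: d_def)
  qed
 qed
 have uW: "u \<in> Linf_W1p T p" and \<omega>L: "\<omega> \<in> Linf_Lp T p" and bs: "AE t in time_on T. biot_savart (\<omega> t) (u t)"
  using lag by (auto simp: lagrangian_euler_solution_def)
 obtain X where X: "regular_lagrangian_flow T u X" "AE (t, x) in spacetime_measure T. \<omega> t x = \<omega>0 (X t 0 x)"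
  using lag unfolding lagrangian_euler_solution_def by blast
 have um: "(%q. u (fst q) (snd q)) \<in> borel_measurable (spacetime_measure T)" and wm: "(%q. \<omega> (fst q) (snd q)) \<in> borel_measurable (spacetime_measure T)"
  using uW \<omega>L by (simp_all add: Linf_W1p_def Linf_Lp_def jointly_measurable_def case_prod_unfold)
 obtain v where v: "v \<in> Borel" "AE q in spacetime_measure T. u (fst q) (snd q) = v q" by (rule borel_version_vec[OF um spacetime_set_lebesgue])
 obtain w where w: "w \<in> Borel" "AE q in spacetime_measure T. \<omega> (fst q) (snd q) = w q" by (rule borel_version_real[OF wm spacetime_set_lebesgue])
 have uv: "AE t in time_on T. AE x in TM. u t x = v (t, x)" using spacetime_AE[OF v(2)] by simp
 have \<omega>w: "AE t in time_on T. AE x in TM. \<omega> t x = w (t, x)" using spacetime_AE[OF w(2)] by simp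
 have vs: "(%x. v (t, x)) \<in> TBorel" and wsec: "(%x. w (t, x)) \<in> TBorel" for t
  by (rule torus_measurable_borel[OF borel_section[OF v(1)]], rule torus_measurable_borel[OF borel_section[OF w(1)]])
 have "AE q in spacetime_measure T. \<omega> (fst q) (snd q) = \<omega>0 (X (fst q) 0 (snd q))" using X(2) by (simp add: case_prod_unfold)
 from spacetime_AE[OF this] have flow: "AE t in time_on T. AE x in TM. \<omega> t x = \<omega>0 (X t 0 x)" by simp
 have equi: "AE t in time_on T. distr TM borel (%x. w (t, x)) = distr TM borel \<omega>0"
  using flow \<omega>w AE_space
 proof eventually_elim
  fix t assume a: "AE x in TM. \<omega> t x = \<omega>0 (X t 0 x)" "AE x in TM. \<omega> t x = w (t, x)" and "t \<in> space (time_on T)"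
  then have t: "t \<in> {0..T}" by simp
  have "AE x in TM. w (t, x) = \<omega>0 (X t 0 x)" using a by eventually_elim simp
  then show "distr TM borel (%x. w (t, x)) = distr TM borel \<omega>0" by (rule flow_equidistributed[OF X(1) T \<omega>0m t _ wsec])
 qed
 have curl: "AE t in time_on T. \<forall>\<phi>. torus_smooth \<phi> -->
   (AV x. v (t, x) $ 1 * partial 2 \<phi> x - v (t, x) $ 2 * partial 1 \<phi> x) = (AV x. (w (t, x) - avg \<omega>0) * \<phi> x)"
  using bs uv \<omega>w equi
 proof eventually_elim
  fix t assume b: "biot_savart (\<omega> t) (u t)" and a: "AE x in TM. u t x = v (t, x)" "AE x in TM. \<omega> t x = w (t, x)"
   and d: "distr TM borel (%x. w (t, x)) = distr TM borel \<omega>0"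
  have m: "(AV x. w (t, x)) = avg \<omega>0"
   using equidistributed_LINT(1)[OF d wsec \<omega>0m, of "%z. z"] by simp
  show "\<forall>\<phi>. torus_smooth \<phi> -->
   (AV x. v (t, x) $ 1 * partial 2 \<phi> x - v (t, x) $ 2 * partial 1 \<phi> x) = (AV x. (w (t, x) - avg \<omega>0) * \<phi> x)"
   by (intro allI impI curl_cong[OF b a vs wsec m])
 qed
 obtain G where G: "AE t in time_on T. W11_bounded G (u t)" by (rule sobolev_W11[OF uW p])
 have sob: "AE t in time_on T. W11_bounded G (%x. v (t, x))"
  using G uv by eventually_elim (rule W11_bounded_cong[OF _ _ vs])
 have v2: "integrable (stm T) (%q. (norm (v q))^2)"
  by (rule velocity_L2[OF _ v(1) uv]) (use ws in "simp add: weakstar_Linf_L2_def")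
 have weak: "(%k. LINT q|stm T. cut T (un k) q \<bullet> \<phi> q) ----> (LINT q|stm T. v q \<bullet> \<phi> q)"
  if "\<phi> \<in> Borel" "integrable (stm T) (%q. (norm (\<phi> q))^2)" for \<phi>
  by (rule weakstar_test[OF ws ns_solution.u_continuous[OF NS] v that])
 have ZKp: "?Z <= Kp" by (simp add: Kp_def)
 interpret inviscid T p Kp G \<omega>0 \<nu> w0 un wn v w
  by (rule inviscid.intro[OF T p NS \<nu>(2) \<omega>0m \<omega>0p ZKp NKp L1lim v(1) w(1) v2 weak curl equi sob])
 define lim where "lim t f \<longleftrightarrow> L1 f & (%k. AV x. \<bar>wn k t x - f x\<bar>) ----> 0" for t f
 \<comment> \<open>the given representative wherever it is the limit\<close>
 define \<omega>c where "\<omega>c t = (if lim t (\<omega> t) then \<omega> t else (SOME f. lim t f))" for t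
 have wc: "lim t (\<omega>c t)" if "t \<in> {0..T}" for t
 proof -
  have "\<exists>f. lim t f" using L1_limit[OF that] unfolding lim_def by blast
  from someI_ex[OF this] show ?thesis unfolding \<omega>c_def by simp
 qed
 have wc1: "L1 (\<omega>c t)" and wc2: "(%k. AV x. \<bar>wn k t x - \<omega>c t x\<bar>) ----> 0" if "t \<in> {0..T}" for t
  using wc[OF that] by (simp_all add: lim_def)
 note W = wc1 wc2 norm_lim
 obtain K\<omega> where K\<omega>: "AE t in time_on T. \<omega> t \<in> Lp p & Lp_norm p (\<omega> t) <= K\<omega>" using \<omega>L by (auto simp: Linf_Lp_def)
 have "AE t in time_on T. \<omega>c t = \<omega> t"
  using Good_AE \<omega>w K\<omega> AE_space
 proof eventually_elim
  fix t assume g: "Good t" and a: "AE x in TM. \<omega> t x = w (t, x)" and k: "\<omega> t \<in> Lp p & Lp_norm p (\<omega> t) <= K\<omega>" and t: "t \<in> space (time_on T)"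
  have r: "rep t = (%x. w (t, x))" using t by (auto simp: rep_def)
  have tT: "t \<in> {0..T}" using t by simp
  have m: "\<omega> t \<in> TBorel" using k by (simp add: Lp_def)
  have a': "AE x in TM. w (t, x) = \<omega> t x" using a by eventually_elim simp
  have wi: "L1 (%x. w (t, x))" using rep_integrable[OF g] by (simp add: r)
  have i: "L1 (\<omega> t)" by (rule integrable_cong_AE_imp[OF wi m a'])
  have "(AV x. \<bar>wn k t x - \<omega> t x\<bar>) = (AV x. \<bar>wn k t x - w (t, x)\<bar>)" for k
  proof (rule integral_cong_AE)
   show "AE x in TM. \<bar>wn k t x - \<omega> t x\<bar> = \<bar>wn k t x - w (t, x)\<bar>" using a by eventually_elim simp
  qed (rule borel_measurable_abs borel_measurable_diff integrable_measurable[OF wn_integrable[OF tT]] m wsec)+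
  then have "lim t (\<omega> t)" using Good_L1_limit[OF g] i unfolding lim_def r by simp
  then show "\<omega>c t = \<omega> t" by (simp add: \<omega>c_def)
 qed
 from AE_time_spacetime[OF this] have 1: "AE (t, x) in spacetime_measure T. \<omega>c t x = \<omega> t x"
  by eventually_elim (simp add: case_prod_unfold)
 have wnm: "wn k t \<in> TBorel" if "t \<in> {0..T}" for k t by (rule integrable_measurable[OF wn_integrable[OF that]])
 have 2: "wn k \<in> C_Lp T p" for k
 proof -
  have "wn k t \<in> Lp p" if "t \<in> {0..T}" for t using wnm[OF that] wn_Lp[OF W that] by (simp add: Lp_def)
  moreover have "((%s. Lp_norm p (%x. wn k s x - wn k t x)) \<longlongrightarrow> 0) (at t within {0..T})" if "t \<in> {0..T}" for t
   by (rule Lp_norm_tendsto[OF p0 wn_continuous_Lq[OF _ that]]) (use p in simp)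
  ultimately show ?thesis by (simp add: C_Lp_def)
 qed
 have 3: "\<omega>c \<in> C_Lp T p"
 proof -
  have "\<omega>c t \<in> Lp p" if "t \<in> {0..T}" for t using integrable_measurable[OF wc1[OF that]] wc_Lp(1)[OF W that] by (simp add: Lp_def)
  moreover have "((%s. Lp_norm p (%x. \<omega>c s x - \<omega>c t x)) \<longlongrightarrow> 0) (at t within {0..T})" if "t \<in> {0..T}" for t
   by (rule Lp_norm_tendsto[OF p0 wc_continuous_Lp[OF W that]])
  ultimately show ?thesis by (simp add: C_Lp_def)
 qed
 have 4: "\<exists>N. \<forall>k\<ge>N. \<forall>t\<in>{0..T}. Lp_norm p (%x. wn k t x - \<omega>c t x) <= e" if e: "e > 0" for e
 proof -
  have "e powr p > 0" using e by simp
  then obtain N where N: "!!k t. k >= N ==> t \<in> {0..T} ==> (AV x. \<bar>wn k t x - \<omega>c t x\<bar> powr p) <= e powr p"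
   using uniform_Lp[OF W] by blast
  show ?thesis by (intro exI[of _ N] allI impI ballI Lp_norm_le[OF p0 less_imp_le[OF e] N])
 qed
 show ?thesis by (rule that[OF 1 2 3 4])
qed

theorem theorem2p3:
  fixes T p :: real and \<omega>0 :: "real^2 \<Rightarrow> real"
  assumes "T > 0" and "p > 1" and "\<omega>0 \<in> Lp p"
  shows
    "\<exists>C :: real \<Rightarrow> real. (\<forall>\<delta>>0. C \<delta> > 0) \<and>
      (\<forall>(\<nu> :: nat \<Rightarrow> real) (\<omega>0n :: nat \<Rightarrow> real^2 \<Rightarrow> real)
         (un :: nat \<Rightarrow> real \<Rightarrow> real^2 \<Rightarrow> real^2) (\<omega>n :: nat \<Rightarrow> real \<Rightarrow> real^2 \<Rightarrow> real)
         (u :: real \<Rightarrow> real^2 \<Rightarrow> real^2) (\<omega> :: real \<Rightarrow> real^2 \<Rightarrow> real) (r :: nat \<Rightarrow> nat).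
         (\<forall>n. \<nu> n > 0) \<and> \<nu> \<longlonglongrightarrow> 0 \<and>
         (\<forall>n. torus_smooth (\<omega>0n n) \<and> \<omega>0n n \<in> Lp p) \<and>
         (\<lambda>n. Lp_norm p (\<lambda>x. \<omega>0n n x - \<omega>0 x)) \<longlonglongrightarrow> 0 \<and>
         (\<forall>n. navier_stokes_solution T (\<nu> n) (\<omega>0n n) (un n) (\<omega>n n)) \<and>
         lagrangian_euler_solution T p \<omega>0 u \<omega> \<and>
         strict_mono r \<and>
         weakstar_Linf_L2 T (\<lambda>k. un (r k)) u
         \<longrightarrow>
         (\<exists>\<omega>c. (AE (t, x) in spacetime_measure T. \<omega>c t x = \<omega> t x) \<and>
            converges_C_Lp T p (\<lambda>k. \<omega>n (r k)) \<omega>c \<and>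
            (\<forall>\<delta>>0. \<exists>\<nu>0>0. \<forall>k. \<nu> (r k) < \<nu>0 \<longrightarrow>
               (SUP t\<in>{0<..<T}. Lp_norm p (\<lambda>x. \<omega>n (r k) t x - \<omega>c t x))
               \<le> \<delta>
                 + C \<delta> / \<bar>ln (max (sqrt (\<nu> (r k)))
                                   (L1_Lp_norm T 1 (\<lambda>t x. un (r k) t x - u t x)))\<bar>
                 + Lp_norm p (\<lambda>x. \<omega>0n (r k) x - \<omega>0 x))))"
 apply (rule exI[of _ "%_. 1"], intro conjI allI impI, simp, elim conjE)
 subgoal premises A for \<nu> \<omega>0n un \<omega>n u \<omega> r
 proof -
  have \<nu>r: "(%k. \<nu> (r k)) ----> 0" and limr: "(%k. Lp_norm p (%x. \<omega>0n (r k) x - \<omega>0 x)) ----> 0"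
   using LIMSEQ_subseq_LIMSEQ[OF A(2) A(7)] LIMSEQ_subseq_LIMSEQ[OF A(4) A(7)] by (simp_all add: o_def)
  obtain \<omega>c where ae: "AE (t, x) in spacetime_measure T. \<omega>c t x = \<omega> t x"
   and C: "!!k. \<omega>n (r k) \<in> C_Lp T p" "\<omega>c \<in> C_Lp T p"
   and unif: "!!e. e > 0 ==> \<exists>N. \<forall>k\<ge>N. \<forall>t\<in>{0..T}. Lp_norm p (%x. \<omega>n (r k) t x - \<omega>c t x) <= e"
   by (rule vanishing_viscosity_limit[OF assms spec[OF A(1)] \<nu>r conjunct1[OF spec[OF A(3)]] limr spec[OF A(5)] A(6) A(8)]) (rule that)
  let ?E = "%k t. Lp_norm p (%x. \<omega>n (r k) t x - \<omega>c t x)"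
  have sup: "(SUP t\<in>I. ?E k t) <= e" if "\<forall>t\<in>{0..T}. ?E k t <= e" "I \<subseteq> {0..T}" "I ~= {}" for I k e
   by (rule cSUP_least[OF that(3)]) (use that in blast)
  have conv: "(%k. SUP t\<in>{0..T}. ?E k t) ----> 0"
  proof (rule LIMSEQ_I)
   fix e :: real assume e: "e > 0"
   obtain N where N: "\<forall>k\<ge>N. \<forall>t\<in>{0..T}. ?E k t <= e / 2" using unif[of "e / 2"] e by auto
   show "\<exists>no. \<forall>k\<ge>no. norm ((SUP t\<in>{0..T}. ?E k t) - 0) < e"
   proof (intro exI[of _ N] allI impI)
    fix k assume "N <= k"
    with N have b: "\<forall>t\<in>{0..T}. ?E k t <= e / 2" by blast
    have le: "(SUP t\<in>{0..T}. ?E k t) <= e / 2" by (rule sup[OF b]) (use assms(1) in auto)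
    have "0 <= ?E k 0" by (rule Lp_norm_nonneg)
    also have "... <= (SUP t\<in>{0..T}. ?E k t)"
     by (rule cSUP_upper[OF _ bdd_aboveI2[where M="e / 2"]]) (use assms(1) b in auto)
    finally show "norm ((SUP t\<in>{0..T}. ?E k t) - 0) < e" using le e by simp
   qed
  qed
  have rate: "\<exists>\<nu>0>0. \<forall>k. \<nu> (r k) < \<nu>0 --> (SUP t\<in>{0<..<T}. ?E k t) <= \<delta>" if \<delta>: "\<delta> > 0" for \<delta>
  proof -
   obtain N where N: "\<forall>k\<ge>N. \<forall>t\<in>{0..T}. ?E k t <= \<delta>" using unif[OF \<delta>] by blast
   \<comment> \<open>finitely many positive viscosities precede the index N, so a smaller viscosity comes after it\<close>
   define \<nu>0 where "\<nu>0 = Min (insert 1 ((%k. \<nu> (r k)) ` {..<N}))"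
   show ?thesis
   proof (intro exI[of _ \<nu>0] conjI allI impI)
    show "\<nu>0 > 0" unfolding \<nu>0_def using A(1) by (subst Min_gr_iff) auto
    fix k assume k: "\<nu> (r k) < \<nu>0"
    have "\<nu>0 <= \<nu> (r k)" if "k < N" unfolding \<nu>0_def using that by (intro Min_le) auto
    then have "k >= N" using k by (meson not_le)
    then show "(SUP t\<in>{0<..<T}. ?E k t) <= \<delta>" using N assms(1) by (intro sup) auto
   qed
  qed
  have weaken: "a <= \<delta> + 1 / \<bar>l\<bar> + Lp_norm p f" if "a <= \<delta>" for a \<delta> l :: real and f :: "real^2 => real"
   using that Lp_norm_nonneg[of p f] by (simp add: add_increasing2)
  show ?thesis
  proof (intro exI[of _ \<omega>c] conjI allI impI)
   show "converges_C_Lp T p (%k. \<omega>n (r k)) \<omega>c" using C conv by (simp add: converges_C_Lp_def)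
  qed (use ae in blast, use rate weaken in meson)
 qed
 done

end
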